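(* Let $n\ge 2$, $1<p<n$, $p^*=\frac{np}{n-p}$, and let $\Omega\subset\mathbb{R}^n$ be a bounded open set with smooth boundary (e.g. of class $C^{2,\alpha}$). For $q\in[1,p^*]$ let $\mu^{\mathcal A}_{p,q}=\mu^{\mathcal A}_{p,q}(\Omega)$ be the optimal (largest) constant in the affine $L^q$ Poincaré–Sobolev inequality $$\mu^{\mathcal A}_{p,q}\,\|u\|_{L^q(\Omega)}\le\mathcal{E}_{p,\Omega}(u)\qquad\text{for all }u\in W^{1,p}_0(\Omega).$$ Then this sharp inequality admits an extremal function if and only if $1\le q<p^*$.
   Context: Notation. $\mathbb{S}^{n-1}$ is the unit sphere of $\mathbb{R}^n$ with surface measure $\sigma$; $\omega_s=\pi^{s/2}/\Gamma(\frac s2+1)$ (the volume of the unit ball of $\mathbb{R}^s$ for integer $s$). $W^{1,p}_0(\Omega)$ is the completion of $C_0^\infty(\Omega)$ in the norm $\|\nabla u\|_{L^p(\Omega)}$. For $\xi\in\mathbb{S}^{n-1}$, $\nabla_\xi u=\nabla u\cdot\xi$. Affine $L^p$ energy: for $u\in W^{1,p}_0(\Omega)$, $$\mathcal{E}_{p,\Omega}(u)=\alpha_{n,p}\left(\int_{\mathbb{S}^{n-1}}\left(\int_\Omega|\nabla_\xi u|^p\,dx\right)^{-\frac np}d\sigma(\xi)\right)^{-\frac1n},\quad \alpha_{n,p}=(2\omega_{n+p-2})^{-\frac1p}(n\omega_n\omega_{p-1})^{\frac1p}(n\omega_n)^{\frac1n},$$ with the convention $0^{-n/p}=\infty$, $\infty^{-1/n}=0$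 (so $\mathcal{E}_{p,\Omega}(0)=0$). An extremal function is a nonzero $u_0\in W^{1,p}_0(\Omega)$ for which the inequality is an equality. *)

theory Defs
  imports "HOL-Analysis.Analysis"
begin

section \<open>Powers and $L^q$ norms with values in $[0,\infty]$\<close>

text \<open>Real powers on $[0,\infty]$ with $0^s = \infty$ and $\infty^s = 0$ for $s < 0$.\<close>

definition ennreal_powr :: "ennreal \<Rightarrow> real \<Rightarrow> ennreal" where
  "ennreal_powr x s =
     (if s = 0 then 1
      else if x = 0 then (if s < 0 then \<infinity> else 0)
      else if x = \<infinity> then (if s < 0 then 0 else \<infinity>)
      else ennreal (enn2real x powr s))"

definition Lp_norm :: "real \<Rightarrow> (real^'n) set \<Rightarrow> (real^'n \<Rightarrow> 'b::real_normed_vector) \<Rightarrow> ennreal" where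
  "Lp_norm q \<Omega> u = ennreal_powr (\<integral>\<^sup>+x\<in>\<Omega>. ennreal (norm (u x) powr q) \<partial>lebesgue) (1 / q)"

section \<open>Test functions, weak gradients and $W^{1,p}_0(\Omega)$\<close>

definition partial_deriv :: "'n \<Rightarrow> (real^'n \<Rightarrow> real) \<Rightarrow> real^'n \<Rightarrow> real" where
  "partial_deriv i f x = frechet_derivative f (at x) (axis i 1)"

definition gradient :: "(real^'n \<Rightarrow> real) \<Rightarrow> real^'n \<Rightarrow> real^'n" where
  "gradient f x = (\<chi> i. partial_deriv i f x)"

primrec C_k :: "nat \<Rightarrow> (real^'n \<Rightarrow> real) \<Rightarrow> bool" where
  "C_k 0 f \<longleftrightarrow> continuous_on UNIV f"
| "C_k (Suc k) f \<longleftrightarrow> (\<forall>x. f differentiable (at x)) \<and> (\<forall>i. C_k k (partial_deriv i f))"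

text \<open>Elements of $C_0^\infty(\Omega)$ are represented by their extension by zero.\<close>

definition test_functions :: "(real^'n) set \<Rightarrow> (real^'n \<Rightarrow> real) set" where
  "test_functions \<Omega> =
     {\<phi>. (\<forall>k. C_k k \<phi>) \<and> compact (closure {x. \<phi> x \<noteq> 0}) \<and> closure {x. \<phi> x \<noteq> 0} \<subseteq> \<Omega>}"

definition locally_integrable_on ::
    "(real^'n \<Rightarrow> 'b::euclidean_space) \<Rightarrow> (real^'n) set \<Rightarrow> bool" where
  "locally_integrable_on f \<Omega> \<longleftrightarrow>
     (\<forall>K. compact K \<and> K \<subseteq> \<Omega> \<longrightarrow> f absolutely_integrable_on K)"

definition has_weak_gradient ::
    "(real^'n) set \<Rightarrow> (real^'n \<Rightarrow> real) \<Rightarrow> (real^'n \<Rightarrow> real^'n) \<Rightarrow> bool" where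
  "has_weak_gradient \<Omega> u g \<longleftrightarrow>
     locally_integrable_on u \<Omega> \<and> locally_integrable_on g \<Omega> \<and>
     (\<forall>\<phi>\<in>test_functions \<Omega>. \<forall>i.
        (LINT x:\<Omega>|lebesgue. u x * partial_deriv i \<phi> x) = - (LINT x:\<Omega>|lebesgue. g x $ i * \<phi> x))"

text \<open>The weak gradient is unique only up to null sets; a representative is chosen.\<close>

definition weak_gradient :: "(real^'n) set \<Rightarrow> (real^'n \<Rightarrow> real) \<Rightarrow> real^'n \<Rightarrow> real^'n" where
  "weak_gradient \<Omega> u = (SOME g. has_weak_gradient \<Omega> u g)"

text \<open>
  The completion of $C_0^\infty(\Omega)$ in the norm $\|\nabla u\|_{L^p(\Omega)}$, realised as a space
  of functions: for bounded $\Omega$, Poincare's inequality turns a sequence that is Cauchy in this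
  norm into one that also converges in $L^p(\Omega)$. Members are functions on the whole space of
  which only the values on $\Omega$ matter, and equality is equality almost everywhere on $\Omega$.
\<close>

definition W01p :: "real \<Rightarrow> (real^'n) set \<Rightarrow> (real^'n \<Rightarrow> real) set" where
  "W01p p \<Omega> =
     {u. \<exists>g. has_weak_gradient \<Omega> u g \<and>
         (\<exists>\<phi>::nat \<Rightarrow> real^'n \<Rightarrow> real. (\<forall>k. \<phi> k \<in> test_functions \<Omega>) \<and>
            (\<lambda>k. Lp_norm p \<Omega> (\<lambda>x. \<phi> k x - u x)) \<longlonglongrightarrow> 0 \<and>
            (\<lambda>k. Lp_norm p \<Omega> (\<lambda>x. gradient (\<phi> k) x - g x)) \<longlonglongrightarrow> 0)}"

section \<open>Domains with $C^{2,\alpha}$ boundary\<close>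

definition C2_Holder :: "real \<Rightarrow> (real^'n \<Rightarrow> real) \<Rightarrow> bool" where
  "C2_Holder \<alpha> f \<longleftrightarrow>
     (\<exists>(G :: real^'n \<Rightarrow> real^'n) (H :: real^'n \<Rightarrow> real^'n^'n).
        (\<forall>x. (f has_derivative (\<lambda>h. G x \<bullet> h)) (at x)) \<and>
        (\<forall>x. (G has_derivative (\<lambda>h. H x *v h)) (at x)) \<and>
        (\<forall>K. compact K \<longrightarrow> (\<exists>C. \<forall>x\<in>K. \<forall>y\<in>K. norm (H x - H y) \<le> C * dist x y powr \<alpha>)))"

text \<open>
  Near every boundary point, $\Omega$ is the part of space above the graph of a $C^{2,\alpha}$
  function in suitable orthonormal coordinates. The vector $\nu$ is the vertical direction, and
  $\gamma$ is only evaluated on the hyperplane orthogonal to $\nu$, which plays the role of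
  the $(n-1)$-dimensional parameter space.
\<close>

definition C2_Holder_boundary :: "real \<Rightarrow> (real^'n) set \<Rightarrow> bool" where
  "C2_Holder_boundary \<alpha> \<Omega> \<longleftrightarrow>
     (\<forall>x0\<in>frontier \<Omega>. \<exists>r>0. \<exists>\<nu> \<gamma>. norm \<nu> = 1 \<and> C2_Holder \<alpha> \<gamma> \<and>
        \<Omega> \<inter> ball x0 r = {x \<in> ball x0 r. \<gamma> (x - (x \<bullet> \<nu>) *\<^sub>R \<nu>) < x \<bullet> \<nu>})"

section \<open>The affine energy and the affine Poincare-Sobolev inequality\<close>

text \<open>
  Surface measure on the unit sphere: $\sigma(A)$ is $n$ times the volume of the cone
  $\{r \xi : \xi \in A, 0 < r < 1\}$, which is the measure appearing in integration in
  polar coordinates.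
\<close>

definition surface_measure :: "(real^'n) measure" where
  "surface_measure =
     scale_measure (of_nat CARD('n))
       (distr (restrict_space lborel (ball 0 1 - {0})) (restrict_space borel (sphere 0 1))
          (\<lambda>x. x /\<^sub>R norm x))"

definition affine_const :: "real \<Rightarrow> real \<Rightarrow> real" where
  "affine_const n p =
     (2 * unit_ball_vol (n + p - 2)) powr (- 1 / p) *
     (n * unit_ball_vol n * unit_ball_vol (p - 1)) powr (1 / p) *
     (n * unit_ball_vol n) powr (1 / n)"

definition affine_energy :: "real \<Rightarrow> (real^'n) set \<Rightarrow> (real^'n \<Rightarrow> real) \<Rightarrow> ennreal" where
  "affine_energy p \<Omega> u =
     ennreal (affine_const (real CARD('n)) p) *
     ennreal_powr
       (\<integral>\<^sup>+\<xi>. ennreal_powr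
                (\<integral>\<^sup>+x\<in>\<Omega>. ennreal (\<bar>weak_gradient \<Omega> u x \<bullet> \<xi>\<bar> powr p) \<partial>lebesgue)
                (- real CARD('n) / p)
          \<partial>surface_measure)
       (- 1 / real CARD('n))"

definition critical_exponent :: "real \<Rightarrow> real \<Rightarrow> real" where
  "critical_exponent n p = n * p / (n - p)"

definition affine_mu :: "real \<Rightarrow> real \<Rightarrow> (real^'n) set \<Rightarrow> ennreal" where
  "affine_mu p q \<Omega> =
     Sup {\<mu>. \<forall>u\<in>W01p p \<Omega>. \<mu> * Lp_norm q \<Omega> u \<le> affine_energy p \<Omega> u}"

definition affine_extremal :: "real \<Rightarrow> real \<Rightarrow> (real^'n) set \<Rightarrow> (real^'n \<Rightarrow> real) \<Rightarrow> bool" where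
  "affine_extremal p q \<Omega> u \<longleftrightarrow>
     u \<in> W01p p \<Omega> \<and> \<not> (AE x in lebesgue_on \<Omega>. u x = 0) \<and>
     affine_mu p q \<Omega> * Lp_norm q \<Omega> u = affine_energy p \<Omega> u"

end

theory Submission
  imports Defs "HOL-Library.Diagonal_Subsequence" "HOL-Complex_Analysis.Great_Picard"
begin

text \<open>
  For a nonzero test function \<open>f\<close> the numbers \<open>dnorm p f \<xi>\<close>, the \<open>p\<close>-norms of the directional
  derivatives, form a norm in \<open>\<xi>\<close>, and the affine energy is a monotone, homogeneous
  functional \<open>energy_of\<close> of it: up to a constant, the power \<open>-1/n\<close> of the volume of its unit
  ball \<open>K\<close> (\<open>polar_volume\<close>, in polar coordinates). The inequality and its sharp constant are
  determined by test functions, since the directional norms of a nonzero Sobolev function are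
  bounded away from zero by a Poincare inequality in a single direction
  (\<open>directional_Poincare\<close>), so that the energy is continuous along approximating sequences.

  \<^bold>\<open>At the critical exponent there is no extremal function.\<close> Both sides of the inequality scale in
  the same way, so the sharp inequality on \<open>\<Omega>\<close> holds with the same constant for test functions on the
  whole space (\<open>critical_scaling\<close>). Let \<open>u\<close> be extremal and \<open>\<eta>\<close> a cutoff equal to one on a ball
  containing \<open>\<Omega>\<close>. Test the inequality with \<open>|u| + t \<eta>\<close>. The gradients of the two summands live
  on disjoint sets, so the \<open>p\<close>-th powers of the directional norms add and the energy grows only
  by a term of order \<open>t\<^sup>p\<close>, whereas the norm of \<open>|u| + t\<close> on \<open>\<Omega>\<close> grows at least linearly
  in \<open>t\<close>. For small \<open>t\<close> this is impossible as \<open>p > 1\<close> (\<open>no_linear_growth\<close>).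

  \<^bold>\<open>Below the critical exponent a minimizing sequence converges.\<close> The energy is invariant under
  volume preserving linear maps, hence a bound on it does not by itself bound the gradient. It does
  bound the volume of \<open>K\<close> from below. Averaging the fundamental theorem of calculus over \<open>K\<close>,
  instead of a Euclidean ball, gives a subcritical Sobolev inequality that involves only the volume
  of \<open>K\<close> (\<open>affine_Sobolev\<close>). For functions normalized in \<open>L\<^sup>q\<close> it keeps the \<open>L\<^sup>p\<close> norm away from
  zero, so by the directional Poincare inequality \<open>K\<close> lies in a fixed ball; a symmetric convex body of
  bounded diameter and volume bounded below is not thin in any direction, and this bounds all
  directional norms from above (\<open>bounded_energy_imp_dnorm_bounds\<close>). Ascoli's theorem makes the
  directional norms converge uniformly on the sphere, and the Rellich argument makes the functions
  converge in \<open>L\<^sup>r\<close> for some \<open>r\<close> that is at least \<open>q\<close> and larger than \<open>p\<close>. The energy is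
  a concave functional of the directional norms and gives no convexity, but each directional norm is convex: among
  the test functions that satisfy the limiting upper bounds on them asymptotically, those with nearly minimal \<open>p\<close>-norm of the gradient have
  gradients that form a Cauchy sequence, by uniform convexity
  (\<open>convex_minimizing_sequence\<close>). The limit belongs to the Sobolev space and is extremal.
\<close>

section \<open>Convexity of powers\<close>

lemma powr_minus_one_mult: "0 < (c::real) \<Longrightarrow> c powr (p - 1) * c = c powr p"
  by (simp add: powr_diff)

text \<open>
  The tangent line of \<open>t powr p\<close> at a mean value is behind every convexity argument below: averaging it
  yields Jensen's inequality, and its strictness for \<open>p > 1\<close> yields uniform convexity.
\<close>

lemma powr_above_tangent_strict:
  fixes p c t :: real
  assumes "1 < p" "0 < c" "0 \<le> t" "t \<noteq> c"
  shows "c powr p + p * c powr (p - 1) * (t - c) < t powr p"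
proof -
  have cp: "c powr p = c powr (p - 1) * c"
    using assms by (simp add: powr_minus_one_mult)
  consider "t = 0" | "0 < t" "t < c" | "c < t" using assms by linarith
  then show ?thesis
  proof cases
    case 1
    then show ?thesis using assms by (simp add: cp algebra_simps)
  next
    case 2
    have "\<exists>z. t < z \<and> z < c \<and> c powr p - t powr p = (c - t) * (p * z powr (p - 1))"
      by (rule MVT2) (use 2 in \<open>auto intro!: derivative_eq_intros\<close>)
    then obtain z where z: "t < z" "z < c" "c powr p - t powr p = (c - t) * (p * z powr (p - 1))" by blast
    have "z powr (p - 1) < c powr (p - 1)" using z 2 assms by (intro powr_less_mono2) auto
    then have "(c - t) * (p * z powr (p - 1)) < (c - t) * (p * c powr (p - 1))"
      using 2 assms by simp
    then show ?thesis using z by (simp add: algebra_simps)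
  next
    case 3
    have "\<exists>z. c < z \<and> z < t \<and> t powr p - c powr p = (t - c) * (p * z powr (p - 1))"
      by (rule MVT2) (use 3 assms in \<open>auto intro!: derivative_eq_intros\<close>)
    then obtain z where z: "c < z" "z < t" "t powr p - c powr p = (t - c) * (p * z powr (p - 1))" by blast
    have "c powr (p - 1) < z powr (p - 1)" using z 3 assms by (intro powr_less_mono2) auto
    then have "(t - c) * (p * c powr (p - 1)) < (t - c) * (p * z powr (p - 1))"
      using 3 assms by simp
    then show ?thesis using z by (simp add: algebra_simps)
  qed
qed

lemma powr_above_tangent:
  fixes p c t :: real
  assumes "1 \<le> p" "0 < c" "0 \<le> t"
  shows "c powr p + p * c powr (p - 1) * (t - c) \<le> t powr p"
  using powr_above_tangent_strict[of p c t] assms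
  by (cases "p = 1"; cases "t = c") (auto simp: less_imp_le)

lemma powr_convex_comb:
  fixes p a b s t :: real
  assumes "1 \<le> p" "0 \<le> a" "0 \<le> b" "0 \<le> s" "0 \<le> t" "s + t = 1"
  shows "(s * a + t * b) powr p \<le> s * a powr p + t * b powr p"
proof (cases "s * a + t * b = 0")
  case False
  define c where "c = s * a + t * b"
  have c: "c > 0" using False assms unfolding c_def by (simp add: less_le)
  have "s * (c powr p + p * c powr (p - 1) * (a - c)) + t * (c powr p + p * c powr (p - 1) * (b - c))
      \<le> s * a powr p + t * b powr p"
    using assms c by (intro add_mono mult_left_mono powr_above_tangent) auto
  moreover have "s * (c powr p + p * c powr (p - 1) * (a - c)) + t * (c powr p + p * c powr (p - 1) * (b - c))
     = (s + t) * c powr p + p * c powr (p - 1) * (s * a + t * b - (s + t) * c)"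
    by (simp add: algebra_simps)
  ultimately show ?thesis using assms by (simp add: c_def)
qed (use assms in auto)

lemma powr_midpoint:
  fixes p a b :: real
  assumes "1 \<le> p" "0 \<le> a" "0 \<le> b"
  shows "((a + b) / 2) powr p \<le> (a powr p + b powr p) / 2"
  using powr_convex_comb[of p a b "1/2" "1/2"] assms by (simp add: field_simps)

lemma powr_add_le:
  fixes p a b :: real
  assumes "1 \<le> p" "0 \<le> a" "0 \<le> b"
  shows "(a + b) powr p \<le> 2 powr p * (a powr p + b powr p)"
proof -
  have "(a + b) powr p = 2 powr p * ((a + b) / 2) powr p"
    using assms by (simp add: powr_divide)
  also have "\<dots> \<le> 2 powr p * ((a powr p + b powr p) / 2)"
    using powr_midpoint[OF assms] by (intro mult_left_mono) auto
  also have "\<dots> \<le> 2 powr p * (a powr p + b powr p)" by (intro mult_left_mono) auto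
  finally show ?thesis .
qed

text \<open>
  The right hand side is an extended real so that the estimate covers powers with infinite integral, and if
  \<open>f\<close> itself is not integrable, its Bochner integral is \<open>0\<close>. Otherwise one integrates the tangent line
  at the mean value.
\<close>

lemma jensen_powr:
  fixes f :: "'a \<Rightarrow> real"
  assumes fin: "finite_measure N" and p: "1 \<le> p" and f: "f \<in> borel_measurable N" "\<And>x. 0 \<le> f x"
  shows "ennreal ((\<integral>x. f x \<partial>N) powr p)
           \<le> ennreal (measure N (space N) powr (p - 1)) * (\<integral>\<^sup>+x. ennreal (f x powr p) \<partial>N)"
proof (cases "(\<integral>x. f x \<partial>N) = 0")
  case False
  interpret finite_measure N by fact
  define I where "I = (\<integral>x. f x \<partial>N)"
  define m where "m = measure N (space N)"
  have intf: "integrable N f" using False not_integrable_integral_eq by blast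
  have I: "I > 0" using False f unfolding I_def by (simp add: less_le)
  have m: "m > 0"
  proof (rule ccontr)
    assume "\<not> m > 0"
    then have "m = 0" unfolding m_def by (simp add: less_le)
    then have "emeasure N (space N) = 0" by (simp add: m_def emeasure_eq_measure)
    then have "AE x in N. f x = 0" by (intro AE_I[where N="space N"]) auto
    then have "I = 0" unfolding I_def by (simp add: integral_eq_zero_AE)
    with I show False by simp
  qed
  show ?thesis
  proof (cases "integrable N (\<lambda>x. f x powr p)")
    case True
    define c where "c = I / m"
    have c: "c > 0" using I m by (simp add: c_def)
    have mc: "m * c = I" using m by (simp add: c_def)
    \<comment> \<open>The tangent at the mean value c integrates to its value at c.\<close>
    have "(\<integral>x. c powr p + p * c powr (p - 1) * (f x - c) \<partial>N) \<le> (\<integral>x. f x powr p \<partial>N)"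
      using True intf by (intro integral_mono powr_above_tangent p c f) auto
    moreover have "(\<integral>x. c powr p + p * c powr (p - 1) * (f x - c) \<partial>N) = m * c powr p"
      using intf mc by (simp add: I_def[symmetric] m_def[symmetric])
    moreover have "m powr (p - 1) * (m * c powr p) = I powr p"
    proof -
      have "m powr (p - 1) * (m * c powr p) = (m powr (p - 1) * m) * c powr p" by simp
      also have "\<dots> = (m * c) powr p" using m c by (simp add: powr_minus_one_mult powr_mult)
      finally show ?thesis by (simp add: mc)
    qed
    ultimately have "I powr p \<le> m powr (p - 1) * (\<integral>x. f x powr p \<partial>N)"
      using mult_left_mono[of "m * c powr p" "\<integral>x. f x powr p \<partial>N" "m powr (p - 1)"] by simp
    moreover have "(\<integral>\<^sup>+x. ennreal (f x powr p) \<partial>N) = ennreal (\<integral>x. f x powr p \<partial>N)"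
      using True by (intro nn_integral_eq_integral) auto
    ultimately show ?thesis
      by (simp add: I_def m_def ennreal_mult[symmetric])
  next
    case False
    then have "(\<integral>\<^sup>+x. ennreal (f x powr p) \<partial>N) = \<infinity>"
      using f by (subst (asm) integrable_iff_bounded) (auto simp: less_top[symmetric])
    then show ?thesis using m by (simp add: m_def ennreal_mult_top)
  qed
qed simp

section \<open>The spaces $L^p$\<close>

text \<open>
  Norms are finite real numbers here, for functions with values in any Euclidean space, so that scalar
  functions and gradients are treated alike. Since the Bochner integral of a non-integrable function is
  \<open>0\<close>, \<open>lpn\<close> is meaningful only together with \<open>in_Lp\<close>.
\<close>

definition in_Lp :: "real \<Rightarrow> 'a measure \<Rightarrow> ('a \<Rightarrow> 'b::euclidean_space) \<Rightarrow> bool" where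
  "in_Lp p M f \<longleftrightarrow> f \<in> borel_measurable M \<and> integrable M (\<lambda>x. norm (f x) powr p)"

definition lpn :: "real \<Rightarrow> 'a measure \<Rightarrow> ('a \<Rightarrow> 'b::euclidean_space) \<Rightarrow> real" where
  "lpn p M f = (\<integral>x. norm (f x) powr p \<partial>M) powr (1 / p)"

lemma lpn_nonneg [simp]: "0 \<le> lpn p M f"
  by (simp add: lpn_def)

lemma lpn_powr: "0 < p \<Longrightarrow> lpn p M f powr p = (\<integral>x. norm (f x) powr p \<partial>M)"
  by (simp add: lpn_def powr_powr)

lemma lpn_le_iff:
  assumes "0 < p" "0 \<le> c"
  shows "lpn p M f \<le> c \<longleftrightarrow> (\<integral>x. norm (f x) powr p \<partial>M) \<le> c powr p"
proof
  assume "lpn p M f \<le> c"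
  then have "lpn p M f powr p \<le> c powr p" using assms by (intro powr_mono2) auto
  then show "(\<integral>x. norm (f x) powr p \<partial>M) \<le> c powr p" using assms by (simp add: lpn_powr)
next
  assume "(\<integral>x. norm (f x) powr p \<partial>M) \<le> c powr p"
  then have "lpn p M f \<le> (c powr p) powr (1 / p)"
    unfolding lpn_def using assms by (intro powr_mono2) auto
  then show "lpn p M f \<le> c" using assms by (simp add: powr_powr)
qed

lemma in_LpD: "in_Lp p M f \<Longrightarrow> f \<in> borel_measurable M" "in_Lp p M f \<Longrightarrow> integrable M (\<lambda>x. norm (f x) powr p)"
  by (auto simp: in_Lp_def)

lemma nn_integral_in_Lp:
  "in_Lp p M f \<Longrightarrow> 0 < p \<Longrightarrow> (\<integral>\<^sup>+x. ennreal (norm (f x) powr p) \<partial>M) = ennreal (lpn p M f powr p)"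
  by (simp add: lpn_powr nn_integral_eq_integral in_Lp_def)

lemma in_LpI_nn:
  assumes "f \<in> borel_measurable M" "(\<integral>\<^sup>+x. ennreal (norm (f x) powr p) \<partial>M) < \<infinity>"
  shows "in_Lp p M f"
  unfolding in_Lp_def using assms by (auto intro!: integrableI_bounded)

lemma in_LpI_bound:
  assumes "f \<in> borel_measurable M" "(\<integral>\<^sup>+x. ennreal (norm (f x) powr p) \<partial>M) \<le> ennreal (c powr p)" "0 < p" "0 \<le> c"
  shows "in_Lp p M f" "lpn p M f \<le> c"
proof -
  show 1: "in_Lp p M f" using assms by (intro in_LpI_nn) (auto intro: le_less_trans)
  show "lpn p M f \<le> c"
    using assms nn_integral_in_Lp[OF 1] by (simp add: lpn_le_iff lpn_powr)
qed

lemma in_Lp_cong: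
  assumes "in_Lp p M f" "g \<in> borel_measurable M" "AE x in M. norm (f x) = norm (g x)"
  shows "in_Lp p M g" "lpn p M g = lpn p M f"
proof -
  have ae: "AE x in M. norm (f x) powr p = norm (g x) powr p" using assms(3) by auto
  note [measurable] = in_LpD(1)[OF assms(1)] assms(2)
  have "integrable M (\<lambda>x. norm (f x) powr p) = integrable M (\<lambda>x. norm (g x) powr p)"
    using ae by (intro integrable_cong_AE) auto
  then show "in_Lp p M g" using assms by (simp add: in_Lp_def)
  have "(\<integral>x. norm (f x) powr p \<partial>M) = (\<integral>x. norm (g x) powr p \<partial>M)"
    using ae by (intro integral_cong_AE) auto
  then show "lpn p M g = lpn p M f" by (simp add: lpn_def)
qed

lemma in_Lp_mono:
  assumes f: "in_Lp p M f" and g: "g \<in> borel_measurable M" and le: "AE x in M. norm (g x) \<le> norm (f x)" and p: "0 < p"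
  shows "in_Lp p M g" "lpn p M g \<le> lpn p M f"
proof -
  have ae: "AE x in M. norm (g x) powr p \<le> norm (f x) powr p" 
    using le by eventually_elim (use p in \<open>auto intro!: powr_mono2\<close>)
  show 1: "in_Lp p M g" unfolding in_Lp_def
    using g in_LpD(2)[OF f] ae by (auto intro!: Bochner_Integration.integrable_bound[of M "\<lambda>x. norm (f x) powr p"])
  have "(\<integral>x. norm (g x) powr p \<partial>M) \<le> (\<integral>x. norm (f x) powr p \<partial>M)"
    using ae 1 f by (intro integral_mono_AE) (auto simp: in_Lp_def)
  then show "lpn p M g \<le> lpn p M f" using p by (simp add: lpn_le_iff lpn_powr)
qed

lemma in_Lp_zero: "in_Lp p M (\<lambda>x. 0)" "lpn p M (\<lambda>x. 0) = 0"
  by (auto simp: in_Lp_def lpn_def)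

lemma in_Lp_scaleR:
  assumes "in_Lp p M f" "0 < p"
  shows "in_Lp p M (\<lambda>x. c *\<^sub>R f x)" "lpn p M (\<lambda>x. c *\<^sub>R f x) = \<bar>c\<bar> * lpn p M f"
  using assms by (auto simp: in_Lp_def lpn_def powr_mult powr_powr)

lemma in_Lp_minus:
  assumes "in_Lp p M f" 
  shows "in_Lp p M (\<lambda>x. - f x)" "lpn p M (\<lambda>x. - f x) = lpn p M f"
  using assms by (auto simp: in_Lp_def lpn_def)

text \<open>
  Convexity of the power at the weights \<open>a / (a + b)\<close> and \<open>b / (a + b)\<close>, where \<open>a\<close> and \<open>b\<close> are
  slightly larger than the two norms.
\<close>

lemma minkowski:
  assumes f: "in_Lp p M f" and g: "in_Lp p M g" and p: "1 \<le> p"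
  shows "in_Lp p M (\<lambda>x. f x + g x)" "lpn p M (\<lambda>x. f x + g x) \<le> lpn p M f + lpn p M g"
proof -
  note [measurable] = in_LpD(1)[OF f] in_LpD(1)[OF g]
  note int = in_LpD(2)[OF f] in_LpD(2)[OF g]
  show in_Lp: "in_Lp p M (\<lambda>x. f x + g x)"
    unfolding in_Lp_def
  proof
    show "integrable M (\<lambda>x. norm (f x + g x) powr p)"
    proof (rule Bochner_Integration.integrable_bound[of M "\<lambda>x. 2 powr p * (norm (f x) powr p + norm (g x) powr p)"])
      have "norm (f x + g x) powr p \<le> 2 powr p * (norm (f x) powr p + norm (g x) powr p)" for x
      proof -
        have "norm (f x + g x) powr p \<le> (norm (f x) + norm (g x)) powr p"
          using p by (intro powr_mono2 norm_triangle_ineq) auto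
        also have "\<dots> \<le> 2 powr p * (norm (f x) powr p + norm (g x) powr p)"
          using p by (intro powr_add_le) auto
        finally show ?thesis .
      qed
      then show "AE x in M. norm (norm (f x + g x) powr p) \<le> norm (2 powr p * (norm (f x) powr p + norm (g x) powr p))"
        by simp
    qed (use int in auto)
  qed simp
  show "lpn p M (\<lambda>x. f x + g x) \<le> lpn p M f + lpn p M g"
  proof (rule field_le_epsilon)
    fix e :: real assume e: "0 < e"
    \<comment> \<open>The summand e / 2 keeps a and b positive when a norm vanishes.\<close>
    define a b where "a = lpn p M f + e / 2" and "b = lpn p M g + e / 2"
    have ab: "a > 0" "b > 0" unfolding a_def b_def by (smt (verit, ccfv_SIG) e half_gt_zero lpn_nonneg)+
    define s t where "s = a / (a + b)" and "t = b / (a + b)"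
    have st: "0 \<le> s" "0 \<le> t" "s + t = 1" using ab by (auto simp: s_def t_def add_divide_distrib[symmetric])
    have sa: "s * (X / a) = X / (a + b)" "t * (X / b) = X / (a + b)" for X using ab by (auto simp: s_def t_def)
    have pt: "norm (f x + g x) powr p \<le> (a + b) powr p * (s * (norm (f x) powr p / a powr p) + t * (norm (g x) powr p / b powr p))" for x
    proof -
      have "norm (f x + g x) powr p \<le> (norm (f x) + norm (g x)) powr p"
        using p by (intro powr_mono2 norm_triangle_ineq) auto
      also have "norm (f x) + norm (g x) = (a + b) * (s * (norm (f x) / a) + t * (norm (g x) / b))"
        unfolding sa using ab by (simp add: add_divide_distrib[symmetric])
      also have "\<dots> powr p = (a + b) powr p * (s * (norm (f x) / a) + t * (norm (g x) / b)) powr p"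
        using ab st by (simp add: powr_mult)
      also have "\<dots> \<le> (a + b) powr p * (s * (norm (f x) / a) powr p + t * (norm (g x) / b) powr p)"
        using ab st p by (intro mult_left_mono powr_convex_comb) auto
      finally show ?thesis using ab by (simp add: powr_divide)
    qed
    have "(\<integral>x. norm (f x + g x) powr p \<partial>M) 
       \<le> (\<integral>x. (a + b) powr p * (s * (norm (f x) powr p / a powr p) + t * (norm (g x) powr p / b powr p)) \<partial>M)"
      using in_LpD(2)[OF in_Lp] int by (intro integral_mono pt) auto
    also have "\<dots> = (a + b) powr p * (s * ((\<integral>x. norm (f x) powr p \<partial>M) / a powr p) + t * ((\<integral>x. norm (g x) powr p \<partial>M) / b powr p))"
      using int by simp
    also have "\<dots> \<le> (a + b) powr p * (s * 1 + t * 1)"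
    proof -
      have "(\<integral>x. norm (f x) powr p \<partial>M) \<le> a powr p" "(\<integral>x. norm (g x) powr p \<partial>M) \<le> b powr p"
        using p e ab by (subst lpn_le_iff[symmetric]; simp add: a_def b_def)+
      then show ?thesis using st ab by (intro mult_left_mono add_mono) auto
    qed
    also have "\<dots> = (a + b) powr p" using st by simp
    finally have "lpn p M (\<lambda>x. f x + g x) \<le> a + b"
      using p ab by (subst lpn_le_iff) auto
    then show "lpn p M (\<lambda>x. f x + g x) \<le> lpn p M f + lpn p M g + e"
      by (simp add: a_def b_def)
  qed
qed

lemma minkowski_diff:
  assumes f: "in_Lp p M f" and g: "in_Lp p M g" and p: "1 \<le> p"
  shows "in_Lp p M (\<lambda>x. f x - g x)" "lpn p M (\<lambda>x. f x - g x) \<le> lpn p M f + lpn p M g"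
    "\<bar>lpn p M f - lpn p M g\<bar> \<le> lpn p M (\<lambda>x. f x - g x)"
proof -
  show d: "in_Lp p M (\<lambda>x. f x - g x)" 
    using minkowski(1)[OF f in_Lp_minus(1)[OF g] p] by simp
  show "lpn p M (\<lambda>x. f x - g x) \<le> lpn p M f + lpn p M g"
    using minkowski(2)[OF f in_Lp_minus(1)[OF g] p] in_Lp_minus(2)[OF g] by simp
  have "lpn p M f \<le> lpn p M (\<lambda>x. f x - g x) + lpn p M g"
    using minkowski(2)[OF d g p] by simp
  moreover have "lpn p M g \<le> lpn p M (\<lambda>x. f x - g x) + lpn p M f"
    using minkowski(2)[OF in_Lp_minus(1)[OF d] f p] in_Lp_minus(2)[OF d] by simp
  ultimately show "\<bar>lpn p M f - lpn p M g\<bar> \<le> lpn p M (\<lambda>x. f x - g x)" by linarith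
qed

lemma lpn_eq_0_iff:
  assumes "in_Lp p M f" "0 < p"
  shows "lpn p M f = 0 \<longleftrightarrow> (AE x in M. f x = 0)"
proof -
  have "lpn p M f = 0 \<longleftrightarrow> (\<integral>x. norm (f x) powr p \<partial>M) = 0"
    by (simp add: lpn_def)
  also have "\<dots> \<longleftrightarrow> (AE x in M. norm (f x) powr p = 0)"
    using assms by (intro integral_nonneg_eq_0_iff_AE) (auto simp: in_Lp_def)
  finally show ?thesis by simp
qed

lemma Lp_Fatou:
  assumes f: "\<And>k. in_Lp p M (f k)" and C: "\<And>k. lpn p M (f k) \<le> C" and p: "0 < p" and C0: "0 \<le> C"
    and lim: "AE x in M. (\<lambda>k. f k x) \<longlonglongrightarrow> g x" and g: "g \<in> borel_measurable M"
  shows "in_Lp p M g" "lpn p M g \<le> C"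
proof -
  note [measurable] = in_LpD(1)[OF f] g
  have "(\<integral>\<^sup>+x. ennreal (norm (g x) powr p) \<partial>M) \<le> (\<integral>\<^sup>+x. liminf (\<lambda>k. ennreal (norm (f k x) powr p)) \<partial>M)"
  proof (rule nn_integral_mono_AE)
    show "AE x in M. ennreal (norm (g x) powr p) \<le> liminf (\<lambda>k. ennreal (norm (f k x) powr p))"
      using lim
    proof eventually_elim
      case (elim x)
      have "(\<lambda>k. ennreal (norm (f k x) powr p)) \<longlonglongrightarrow> ennreal (norm (g x) powr p)"
        using elim p by (intro tendsto_ennrealI tendsto_powr2 tendsto_norm tendsto_const) auto
      then show ?case using lim_imp_Liminf[of sequentially] by (metis order_refl sequentially_bot)
    qed
  qed
  also have "\<dots> \<le> liminf (\<lambda>k. \<integral>\<^sup>+x. ennreal (norm (f k x) powr p) \<partial>M)"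
    by (rule nn_integral_liminf) auto
  also have "\<dots> \<le> ennreal (C powr p)"
  proof (rule Liminf_le)
    show "\<forall>\<^sub>F k in sequentially. (\<integral>\<^sup>+x. ennreal (norm (f k x) powr p) \<partial>M) \<le> ennreal (C powr p)"
      using C p nn_integral_in_Lp[OF f p] by (auto intro!: always_eventually ennreal_leI powr_mono2)
  qed simp
  finally have "(\<integral>\<^sup>+x. ennreal (norm (g x) powr p) \<partial>M) \<le> ennreal (C powr p)" .
  from in_LpI_bound[OF g this p C0] show "in_Lp p M g" "lpn p M g \<le> C" by auto
qed

lemma Lp_AE_subseq:
  assumes f: "\<And>k. in_Lp p M (f k)" and g: "in_Lp p M g" and p: "1 \<le> p"
    and lim: "(\<lambda>k. lpn p M (\<lambda>x. f k x - g x)) \<longlonglongrightarrow> 0"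
  obtains r :: "nat \<Rightarrow> nat" where "strict_mono r" "AE x in M. (\<lambda>k. f (r k) x) \<longlonglongrightarrow> g x"
proof -
  have d: "in_Lp p M (\<lambda>x. f k x - g x)" for k using minkowski_diff(1)[OF f g p] .
  have "(\<lambda>k. lpn p M (\<lambda>x. f k x - g x) powr p) \<longlonglongrightarrow> 0 powr p"
    using p by (intro tendsto_powr2 lim tendsto_const) auto
  then have "(\<lambda>k. \<integral>x. norm (norm (f k x - g x) powr p) \<partial>M) \<longlonglongrightarrow> 0"
    using p by (simp add: lpn_powr)
  from tendsto_L1_AE_subseq[OF in_LpD(2)[OF d] this]
  obtain r :: "nat \<Rightarrow> nat" where r: "strict_mono r" "AE x in M. (\<lambda>k. norm (f (r k) x - g x) powr p) \<longlonglongrightarrow> 0" by auto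
  have "AE x in M. (\<lambda>k. f (r k) x) \<longlonglongrightarrow> g x"
    using r(2)
  proof eventually_elim
    case (elim x)
    then have "(\<lambda>k. (norm (f (r k) x - g x) powr p) powr (1 / p)) \<longlonglongrightarrow> 0 powr (1 / p)"
      using p by (intro tendsto_powr2 tendsto_const) auto
    then have "(\<lambda>k. norm (f (r k) x - g x)) \<longlonglongrightarrow> 0"
      using p by (simp add: powr_powr)
    then show ?case by (metis LIM_zero_cancel tendsto_norm_zero_cancel)
  qed
  with r(1) show ?thesis by (rule that)
qed

text \<open>
  A subsequence with summable increments converges almost everywhere by the Borel-Cantelli lemma, and
  Fatou's lemma turns the pointwise limit into a limit in norm of the entire sequence.
\<close>

lemma Lp_complete:
  fixes f :: "nat \<Rightarrow> 'a \<Rightarrow> 'b::euclidean_space"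
  assumes f: "\<And>k. in_Lp p M (f k)" and p: "1 \<le> p"
    and Cauchy: "\<And>e. e > 0 \<Longrightarrow> \<exists>K. \<forall>k\<ge>K. \<forall>l\<ge>K. lpn p M (\<lambda>x. f k x - f l x) < e"
  obtains g where "in_Lp p M g" "(\<lambda>k. lpn p M (\<lambda>x. f k x - g x)) \<longlonglongrightarrow> 0"
proof -
  note [measurable] = in_LpD(1)[OF f]
  have d: "in_Lp p M (\<lambda>x. f k x - f l x)" for k l using minkowski_diff(1)[OF f f p] .
  have "\<exists>K. \<forall>k\<ge>K. \<forall>l\<ge>K. lpn p M (\<lambda>x. f k x - f l x) < (1 / 4) ^ j" for j
    by (rule Cauchy) simp
  then obtain K where K: "\<And>j k l. k \<ge> K j \<Longrightarrow> l \<ge> K j \<Longrightarrow> lpn p M (\<lambda>x. f k x - f l x) < (1 / 4) ^ j"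
    by metis
  define r where "r j = (\<Sum>i\<le>j. K i)" for j
  have rK: "r j \<ge> K j" for j unfolding r_def by (rule member_le_sum) auto
  have rmono: "r (Suc j) \<ge> r j" for j unfolding r_def by simp
  \<comment> \<open>Increments of norm below (1/4)^j exceed (1/2)^j only on a set of measure at most (1/2)^j.\<close>
  define A where "A j = {x \<in> space M. norm (f (r (Suc j)) x - f (r j) x) powr p \<ge> ((1 / 2) ^ j) powr p}" for j
  have A[measurable]: "A j \<in> sets M" for j unfolding A_def by measurable
  have half: "((1 / 2) ^ j) powr p \<le> (1 / 2) ^ j" for j :: nat
    using powr_mono_both'[of 1 p "(1/2)^j" "(1/2)^j"] p by (simp add: power_le_one)
  have Ab: "emeasure M (A j) \<le> ennreal ((1 / 2) ^ j)" for j
  proof -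
    have "emeasure M (A j) = emeasure M {x \<in> space M. 1 \<le> ennreal (1 / ((1 / 2) ^ j) powr p) * ennreal (norm (f (r (Suc j)) x - f (r j) x) powr p)}"
      unfolding A_def
      by (intro arg_cong[where f="emeasure M"]) (auto simp: ennreal_mult[symmetric] field_simps)
    also have "\<dots> \<le> ennreal (1 / ((1 / 2) ^ j) powr p) * (\<integral>\<^sup>+x. ennreal (norm (f (r (Suc j)) x - f (r j) x) powr p) * indicator (space M) x \<partial>M)"
      by (rule nn_integral_Markov_inequality) auto
    also have "(\<integral>\<^sup>+x. ennreal (norm (f (r (Suc j)) x - f (r j) x) powr p) * indicator (space M) x \<partial>M)
       = (\<integral>\<^sup>+x. ennreal (norm (f (r (Suc j)) x - f (r j) x) powr p) \<partial>M)"
      by (intro nn_integral_cong) auto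
    also have "\<dots> = ennreal (lpn p M (\<lambda>x. f (r (Suc j)) x - f (r j) x) powr p)"
      using p by (intro nn_integral_in_Lp d) auto
    also have "\<dots> \<le> ennreal (((1 / 4) ^ j) powr p)"
      using K[of j "r (Suc j)" "r j"] rK[of j] rmono[of j] p
      by (intro ennreal_leI powr_mono2) auto
    also have "ennreal (1 / ((1 / 2) ^ j) powr p) * ennreal (((1 / 4) ^ j) powr p) = ennreal (((1 / 2) ^ j) powr p)"
    proof -
      have "(1 / 4 :: real) ^ j = (1 / 2) ^ j * (1 / 2) ^ j" by (simp add: power_mult_distrib[symmetric])
      then show ?thesis by (simp add: ennreal_mult[symmetric] powr_mult)
    qed
    also have "\<dots> \<le> ennreal ((1 / 2) ^ j)" using half by (intro ennreal_leI)
    finally show ?thesis by (simp add: mult_left_mono)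
  qed
  have ae: "AE x in M. eventually (\<lambda>j. x \<in> space M - A j) sequentially"
  proof (rule borel_cantelli_AE1)
    show "emeasure M (A j) < \<infinity>" for j using Ab[of j] by (simp add: le_less_trans)
    show "summable (\<lambda>j. measure M (A j))"
    proof (rule summable_comparison_test'[of "\<lambda>j. (1/2)^j"])
      show "norm (measure M (A j)) \<le> (1 / 2) ^ j" for j
        using Ab[of j] by (simp add: measure_def enn2real_leI)
    qed simp
  qed simp
  define g where "g x = lim (\<lambda>j. f (r j) x)" for x
  have g[measurable]: "g \<in> borel_measurable M" unfolding g_def by (rule borel_measurable_lim_metric) simp
  have lim: "AE x in M. (\<lambda>j. f (r j) x) \<longlonglongrightarrow> g x"
    using ae
  proof eventually_elim
    case (elim x)
    then obtain J where J: "\<And>j. j \<ge> J \<Longrightarrow> x \<in> space M - A j" by (auto simp: eventually_sequentially)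
    have "norm (f (r (Suc j)) x - f (r j) x) \<le> (1 / 2) ^ j" if "j \<ge> J" for j
    proof (rule ccontr)
      assume "\<not> ?thesis"
      then have "((1 / 2) ^ j) powr p \<le> norm (f (r (Suc j)) x - f (r j) x) powr p"
        using p by (intro powr_mono2) auto
      then show False using J[OF that] by (auto simp: A_def)
    qed
    then have "\<And>j. j \<ge> J \<Longrightarrow> norm (f (r (Suc j)) x - f (r j) x) \<le> (1 / 2) ^ j" .
    moreover have "summable (\<lambda>j. (1 / 2 :: real) ^ j)" by (simp add: summable_geometric)
    ultimately have "summable (\<lambda>j. f (r (Suc j)) x - f (r j) x)"
      by (rule summable_comparison_test'[rotated])
    then have "convergent (\<lambda>n. \<Sum>j<n. f (r (Suc j)) x - f (r j) x)"
      by (simp add: summable_iff_convergent)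
    then have "convergent (\<lambda>n. f (r n) x - f (r 0) x)" using sum_lessThan_telescope[of "\<lambda>n. f (r n) x"] by simp
    then have "convergent (\<lambda>n. (f (r n) x - f (r 0) x) + f (r 0) x)" by (intro convergent_add convergent_const)
    then show ?case by (simp add: g_def convergent_LIMSEQ_iff)
  qed
  have key: "in_Lp p M (\<lambda>x. f k x - g x) \<and> lpn p M (\<lambda>x. f k x - g x) \<le> (1 / 4) ^ j" if "k \<ge> K j" for j k
  proof -
    have "in_Lp p M (\<lambda>x. f k x - f (r (i + j)) x)" for i by (rule d)
    moreover have "lpn p M (\<lambda>x. f k x - f (r (i + j)) x) \<le> (1 / 4) ^ j" for i
    proof -
      have "r (i + j) \<ge> r j" by (rule lift_Suc_mono_le[of r]) (use rmono in auto)
      then show ?thesis using K[OF that, of "r (i + j)"] rK[of j] by simp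
    qed
    moreover have "AE x in M. (\<lambda>i. f k x - f (r (i + j)) x) \<longlonglongrightarrow> f k x - g x"
      using lim by eventually_elim (intro tendsto_diff tendsto_const LIMSEQ_ignore_initial_segment)
    ultimately show ?thesis
      using Lp_Fatou[of p M "\<lambda>i x. f k x - f (r (i + j)) x" "(1/4)^j" "\<lambda>x. f k x - g x"] p by auto
  qed
  have "in_Lp p M (\<lambda>x. f (K 0) x - (f (K 0) x - g x))"
    using minkowski_diff(1)[OF f conjunct1[OF key[of 0]] p, of "K 0" "K 0"] by simp
  then have "in_Lp p M g" by simp
  moreover have "(\<lambda>k. lpn p M (\<lambda>x. f k x - g x)) \<longlonglongrightarrow> 0"
  proof (rule LIMSEQ_I)
    fix e :: real assume "0 < e"
    then obtain j where j: "(1 / 4 :: real) ^ j < e" using real_arch_pow_inv[of e "1/4"] by auto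
    show "\<exists>no. \<forall>n\<ge>no. norm (lpn p M (\<lambda>x. f n x - g x) - 0) < e"
      by (rule exI[of _ "K j"]) (use key[of j] j in force)
  qed
  ultimately show ?thesis by (rule that)
qed

lemma lpn_mono_exponent:
  assumes fin: "finite_measure M" and f: "in_Lp r M f" and q: "1 \<le> q" "q \<le> r"
  shows "in_Lp q M f" "lpn q M f \<le> measure M (space M) powr (1 / q - 1 / r) * lpn r M f"
proof -
  interpret finite_measure M by fact
  note [measurable] = in_LpD(1)[OF f]
  have le: "norm (f x) powr q \<le> 1 + norm (f x) powr r" for x
  proof (cases "norm (f x) \<le> 1")
    case True
    then have "norm (f x) powr q \<le> 1 powr q" using q by (intro powr_mono2) auto
    then show ?thesis by (simp add: add_increasing2)
  next
    case False
    then have "norm (f x) powr q \<le> norm (f x) powr r" using q by (intro powr_mono) auto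
    then show ?thesis by simp
  qed
  have int: "integrable M (\<lambda>x. norm (f x) powr q)"
  proof (rule Bochner_Integration.integrable_bound)
    show "integrable M (\<lambda>x. 1 + norm (f x) powr r)" using in_LpD(2)[OF f] by simp
    show "AE x in M. norm (norm (f x) powr q) \<le> norm (1 + norm (f x) powr r)"
      using le by (intro AE_I2) (simp add: order_trans[OF le])
  qed simp
  then show "in_Lp q M f" by (simp add: in_Lp_def)
  define m where "m = measure M (space M)"
  have "ennreal ((\<integral>x. norm (f x) powr q \<partial>M) powr (r / q)) \<le> ennreal (m powr (r / q - 1)) * (\<integral>\<^sup>+x. ennreal ((norm (f x) powr q) powr (r / q)) \<partial>M)"
    unfolding m_def using q by (intro jensen_powr fin) auto
  also have "(\<integral>\<^sup>+x. ennreal ((norm (f x) powr q) powr (r / q)) \<partial>M) = ennreal (lpn r M f powr r)"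
    using q nn_integral_in_Lp[OF f] by (simp add: powr_powr)
  finally have "(\<integral>x. norm (f x) powr q \<partial>M) powr (r / q) \<le> m powr (r / q - 1) * lpn r M f powr r"
    by (simp add: ennreal_mult[symmetric])
  then have "((\<integral>x. norm (f x) powr q \<partial>M) powr (r / q)) powr (1 / r) \<le> (m powr (r / q - 1) * lpn r M f powr r) powr (1 / r)"
    using q by (intro powr_mono2) auto
  moreover have "((\<integral>x. norm (f x) powr q \<partial>M) powr (r / q)) powr (1 / r) = lpn q M f"
    using q by (simp add: lpn_def powr_powr)
  moreover have "(m powr (r / q - 1) * lpn r M f powr r) powr (1 / r) = m powr (1 / q - 1 / r) * lpn r M f"
  proof -
    have "(r / q - 1) * (1 / r) = 1 / q - 1 / r" using q by (simp add: field_simps)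
    then have "(m powr (r / q - 1)) powr (1 / r) = m powr (1 / q - 1 / r)" by (simp only: powr_powr)
    moreover have "(lpn r M f powr r) powr (1 / r) = lpn r M f" using q by (simp add: powr_powr)
    ultimately show ?thesis by (subst powr_mult) simp
  qed
  ultimately show "lpn q M f \<le> measure M (space M) powr (1 / q - 1 / r) * lpn r M f" by (simp add: m_def)
qed

section \<open>Uniform convexity\<close>

text \<open>
  If the two norms differ, the power is strictly convex at their mean; if they agree, the triangle inequality
  is strict.
\<close>

lemma powr_deficit_pos:
  fixes a b :: "'b::euclidean_space"
  assumes p: "1 < p" and "a \<noteq> b"
  shows "norm ((a + b) /\<^sub>R 2) powr p < (norm a powr p + norm b powr p) / 2"
proof -
  define s t where "s = norm a" and "t = norm b"
  have st: "s \<ge> 0" "t \<ge> 0" by (auto simp: s_def t_def)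
  have half: "norm ((a + b) /\<^sub>R 2) = norm (a + b) / 2" by simp
  have le: "norm ((a + b) /\<^sub>R 2) \<le> (s + t) / 2" unfolding half s_def t_def using norm_triangle_ineq[of a b] by simp
  show ?thesis
  proof (cases "s = t")
    case True
    have ne: "norm (a + b) \<noteq> norm a + norm b"
    proof
      assume "norm (a + b) = norm a + norm b"
      then have "norm a *\<^sub>R b = norm b *\<^sub>R a" by (simp add: norm_triangle_eq)
      then show False using True \<open>a \<noteq> b\<close> by (auto simp: s_def t_def)
    qed
    have lt: "norm ((a + b) /\<^sub>R 2) < s" unfolding half using ne norm_triangle_ineq[of a b] True by (simp add: s_def t_def)
    then have "norm ((a + b) /\<^sub>R 2) powr p < s powr p" using p by (intro powr_less_mono2) auto
    then show ?thesis using True by (simp add: s_def t_def)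
  next
    case False
    define c where "c = (s + t) / 2"
    have c: "c > 0" using False st unfolding c_def by auto
    have "c powr p + p * c powr (p - 1) * (s - c) < s powr p" "c powr p + p * c powr (p - 1) * (t - c) < t powr p"
      using False p c st by (intro powr_above_tangent_strict; auto simp: c_def)+
    moreover have "p * c powr (p - 1) * (s - c) + p * c powr (p - 1) * (t - c) = 0"
      by (simp add: c_def field_simps)
    ultimately have "c powr p < (s powr p + t powr p) / 2" by argo
    moreover have "norm ((a + b) /\<^sub>R 2) powr p \<le> c powr p" using le p by (intro powr_mono2) (auto simp: c_def)
    ultimately show ?thesis by (simp add: s_def t_def)
  qed
qed

text \<open>
  Both sides are homogeneous of degree \<open>p\<close>, so it suffices to look at the unit sphere of pairs. The pairs at which the
  bound is violated, or just attained, without the deficit term form a compact set on which the deficit is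
  positive, hence bounded away from zero; a large \<open>c\<close> then compensates.
\<close>

lemma powr_uniform_convexity:
  assumes p: "1 < p" and d: "0 < d"
  shows "\<exists>c\<ge>0. \<forall>a b :: 'b::euclidean_space. norm (a - b) powr p \<le> d * (norm a powr p + norm b powr p)
            + c * ((norm a powr p + norm b powr p) / 2 - norm ((a + b) /\<^sub>R 2) powr p)"
proof -
  define D where "D z = (norm (fst z) powr p + norm (snd z) powr p) / 2 - norm ((fst z + snd z) /\<^sub>R 2) powr p" for z :: "'b \<times> 'b"
  \<comment> \<open>On S the bound fails, or is attained, without the deficit D.\<close>
  define S where "S = sphere (0 :: 'b \<times> 'b) 1 \<inter> {z. d * (norm (fst z) powr p + norm (snd z) powr p) \<le> norm (fst z - snd z) powr p}"
  have contpow: "continuous_on UNIV (\<lambda>x. f x powr p)" if "continuous_on UNIV f" "\<And>x. 0 \<le> f x" for f :: "'b \<times> 'b \<Rightarrow> real"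
    using that p by (intro continuous_on_powr') auto
  have contD: "continuous_on UNIV D" unfolding D_def
    by (intro continuous_intros contpow) auto
  have closed: "closed {z :: 'b \<times> 'b. d * (norm (fst z) powr p + norm (snd z) powr p) \<le> norm (fst z - snd z) powr p}"
    by (intro closed_Collect_le continuous_intros contpow) auto
  have S: "compact S" unfolding S_def by (intro compact_Int_closed closed) auto
  have Dnn: "D z \<ge> 0" for z
    using powr_deficit_pos[OF p, of "fst z" "snd z"] by (cases "fst z = snd z") (auto simp: D_def scaleR_2[symmetric])
  have "\<exists>d0>0. \<forall>z\<in>S. d0 \<le> D z"
  proof (cases "S = {}")
    case False
    from continuous_attains_inf[OF S False continuous_on_subset[OF contD]]
    obtain z where z: "z \<in> S" "\<And>y. y \<in> S \<Longrightarrow> D z \<le> D y" by auto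
    have "fst z \<noteq> snd z"
    proof
      assume eq: "fst z = snd z"
      have "d * (norm (fst z) powr p + norm (snd z) powr p) \<le> norm (fst z - snd z) powr p"
        using z(1) by (simp add: S_def)
      then have "norm (fst z) powr p + norm (snd z) powr p \<le> 0" using eq p d by (simp add: mult_le_0_iff)
      then have "fst z = 0" using eq by simp
      then have "z = 0" using eq by (simp add: prod_eq_iff)
      then show False using z(1) by (simp add: S_def)
    qed
    then have "D z > 0" using powr_deficit_pos[OF p] by (simp add: D_def)
    then show ?thesis using z by auto
  qed (auto intro: exI[of _ 1])
  then obtain d0 where d0: "d0 > 0" "\<And>z. z \<in> S \<Longrightarrow> d0 \<le> D z" by auto
  define c where "c = 2 powr p / d0"
  have unit: "norm (a - b) powr p \<le> d * (norm a powr p + norm b powr p) + c * D (a, b)" if "norm (a, b) = 1" for a b :: 'b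
  proof (cases "(a, b) \<in> S")
    case True
    have "norm a \<le> 1" "norm b \<le> 1" using that norm_fst_le[of a b] norm_snd_le[of b a] by auto
    then have "norm (a - b) \<le> 2" using norm_triangle_ineq4[of a b] by linarith
    then have "norm (a - b) powr p \<le> 2 powr p" using p by (intro powr_mono2) auto
    also have "\<dots> \<le> c * D (a, b)" using d0(1) d0(2)[OF True] by (simp add: c_def field_simps)
    finally show ?thesis using d by (simp add: add_increasing)
  next
    case False
    then have "norm (a - b) powr p \<le> d * (norm a powr p + norm b powr p)" using that by (auto simp: S_def)
    then show ?thesis using Dnn[of "(a,b)"] d0(1) by (simp add: c_def add_increasing2)
  qed
  have "norm (a - b) powr p \<le> d * (norm a powr p + norm b powr p) + c * D (a, b)" for a b :: 'b
  proof (cases "(a, b) = 0")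
    case True
    then have "a = 0" "b = 0" by (auto simp: zero_prod_def)
    then show ?thesis using p by (simp add: D_def)
  next
    case False
    define r where "r = norm (a, b)"
    have r: "r > 0" using False by (simp add: r_def)
    have "norm (inverse r *\<^sub>R a, inverse r *\<^sub>R b) = 1"
      unfolding scaleR_Pair[symmetric] norm_scaleR r_def[symmetric] using r by simp
    from unit[OF this] have *: "norm (inverse r *\<^sub>R a - inverse r *\<^sub>R b) powr p
       \<le> d * (norm (inverse r *\<^sub>R a) powr p + norm (inverse r *\<^sub>R b) powr p) + c * D (inverse r *\<^sub>R a, inverse r *\<^sub>R b)" .
    have sc: "norm (inverse r *\<^sub>R x) powr p = inverse r powr p * norm x powr p" for x :: 'b
      using r by (simp add: powr_mult)
    have "D (inverse r *\<^sub>R a, inverse r *\<^sub>R b) = inverse r powr p * D (a, b)"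
    proof -
      have "(inverse r *\<^sub>R a + inverse r *\<^sub>R b) /\<^sub>R 2 = inverse r *\<^sub>R ((a + b) /\<^sub>R 2)" by (simp add: scaleR_add_right)
      then show ?thesis unfolding D_def by (simp only: fst_conv snd_conv sc) (simp add: algebra_simps)
    qed
    then have "inverse r powr p * norm (a - b) powr p \<le> inverse r powr p * (d * (norm a powr p + norm b powr p) + c * D (a, b))"
      using * unfolding scaleR_diff_right[symmetric] sc by (simp add: algebra_simps)
    moreover have "inverse r powr p > 0" using r by simp
    ultimately show ?thesis by (simp only: mult_le_cancel_left_pos)
  qed
  then show ?thesis using d0(1) by (intro exI[of _ c]) (auto simp: D_def c_def)
qed

text \<open>
  In this form uniform convexity makes minimizing sequences in convex sets Cauchy, and it comes from
  integrating the pointwise estimate.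
\<close>

lemma Lp_uniform_convexity:
  assumes p: "1 < p" and e: "0 < e" and B: "0 \<le> B"
  shows "\<exists>h>0. \<forall>f g :: 'a \<Rightarrow> 'b::euclidean_space. in_Lp p M f \<longrightarrow> in_Lp p M g \<longrightarrow>
      lpn p M f powr p \<le> B \<longrightarrow> lpn p M g powr p \<le> B \<longrightarrow>
      (lpn p M f powr p + lpn p M g powr p) / 2 - h \<le> lpn p M (\<lambda>x. (f x + g x) /\<^sub>R 2) powr p \<longrightarrow>
      lpn p M (\<lambda>x. f x - g x) powr p \<le> e"
proof -
  define d where "d = e / (4 * (B + 1))"
  have d: "d > 0" using e B by (simp add: d_def)
  from powr_uniform_convexity[OF p d, where 'b='b] obtain c where c: "c \<ge> 0"
    "\<And>a b :: 'b. norm (a - b) powr p \<le> d * (norm a powr p + norm b powr p)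
            + c * ((norm a powr p + norm b powr p) / 2 - norm ((a + b) /\<^sub>R 2) powr p)" by blast
  define h where "h = e / (2 * (c + 1))"
  have h: "h > 0" using e c by (simp add: h_def)
  have ch: "c * h \<le> e / 2" using e c by (simp add: h_def field_simps)
  have db: "d * (2 * B) \<le> e / 2" using e B by (simp add: d_def field_simps)
  show ?thesis
  proof (intro exI[of _ h] conjI h allI impI)
    fix f g :: "'a \<Rightarrow> 'b"
    assume f: "in_Lp p M f" and g: "in_Lp p M g" and Bf: "lpn p M f powr p \<le> B" and Bg: "lpn p M g powr p \<le> B"
      and def: "(lpn p M f powr p + lpn p M g powr p) / 2 - h \<le> lpn p M (\<lambda>x. (f x + g x) /\<^sub>R 2) powr p"
    have m: "in_Lp p M (\<lambda>x. (f x + g x) /\<^sub>R 2)" "in_Lp p M (\<lambda>x. f x - g x)"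
      using f g p by (auto intro!: in_Lp_scaleR minkowski(1) minkowski_diff(1))
    note int = in_LpD(2)[OF f] in_LpD(2)[OF g] in_LpD(2)[OF m(1)] in_LpD(2)[OF m(2)]
    have "(\<integral>x. norm (f x - g x) powr p \<partial>M) \<le> (\<integral>x. d * (norm (f x) powr p + norm (g x) powr p)
            + c * ((norm (f x) powr p + norm (g x) powr p) / 2 - norm ((f x + g x) /\<^sub>R 2) powr p) \<partial>M)"
      using int by (intro integral_mono c) auto
    also have "\<dots> = d * (lpn p M f powr p + lpn p M g powr p) + c * ((lpn p M f powr p + lpn p M g powr p) / 2 - lpn p M (\<lambda>x. (f x + g x) /\<^sub>R 2) powr p)"
      using int p by (simp add: lpn_powr)
    also have "\<dots> \<le> d * (2 * B) + c * h"
      using Bf Bg def c d by (intro add_mono mult_left_mono) auto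
    also have "\<dots> \<le> e" using ch db by linarith
    finally show "lpn p M (\<lambda>x. f x - g x) powr p \<le> e" using p by (simp add: lpn_powr)
  qed
qed

section \<open>Calculus of smooth functions\<close>

lemma partial_derivI: "(f has_derivative f') (at x) \<Longrightarrow> partial_deriv i f x = f' (axis i 1)"
  unfolding partial_deriv_def using frechet_derivative_at by metis

lemma partial_deriv_component: "partial_deriv i f x = gradient f x $ i"
  by (simp add: gradient_def)

lemma inner_linear_sum_axis:
  fixes L :: "real^'n \<Rightarrow> real"
  assumes "linear L"
  shows "L h = (\<chi> i. L (axis i 1)) \<bullet> h"
proof -
  have "L h = L (\<Sum>i\<in>UNIV. h $ i *\<^sub>R axis i 1)"
    using basis_expansion[of h] by (simp add: scalar_mult_eq_scaleR)
  also have "\<dots> = (\<Sum>i\<in>UNIV. h $ i * L (axis i 1))"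
    using assms by (simp add: linear_sum linear_cmul)
  also have "\<dots> = (\<chi> i. L (axis i 1)) \<bullet> h" by (simp add: inner_vec_def mult.commute)
  finally show ?thesis .
qed

lemma has_derivative_gradient:
  assumes "f differentiable (at x)"
  shows "(f has_derivative (\<lambda>h. gradient f x \<bullet> h)) (at x)"
proof -
  have d: "(f has_derivative frechet_derivative f (at x)) (at x)"
    using assms frechet_derivative_works by blast
  have "frechet_derivative f (at x) = (\<lambda>h. gradient f x \<bullet> h)"
    unfolding gradient_def partial_deriv_def
    by (rule ext) (rule inner_linear_sum_axis[OF linear_frechet_derivative[OF assms]])
  then show ?thesis using d by simp
qed

lemma gradientI:
  assumes "(f has_derivative (\<lambda>h. g \<bullet> h)) (at x)"
  shows "gradient f x = g"
  using partial_derivI[OF assms] by (simp add: gradient_def inner_axis)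

lemma C_k_SucD: "C_k (Suc k) f \<Longrightarrow> C_k k f"
proof (induction k arbitrary: f)
  case 0
  then show ?case
    by (auto intro!: continuous_at_imp_continuous_on differentiable_imp_continuous_within)
next
  case (Suc k)
  then show ?case by simp
qed

lemma C_k_add: "C_k k f \<Longrightarrow> C_k k g \<Longrightarrow> C_k k (\<lambda>x. f x + g x)"
proof (induction k arbitrary: f g)
  case 0
  then show ?case by (auto intro: continuous_intros)
next
  case (Suc k)
  have d: "f differentiable (at x)" "g differentiable (at x)" for x using Suc by auto
  have "partial_deriv i (\<lambda>x. f x + g x) = (\<lambda>x. partial_deriv i f x + partial_deriv i g x)" for i
    using partial_derivI[OF has_derivative_add[OF has_derivative_gradient[OF d(1)] has_derivative_gradient[OF d(2)]]]
    by (auto simp: partial_deriv_component inner_axis)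
  then show ?case using Suc d by auto
qed

lemma C_k_const: "C_k k (\<lambda>x :: real^'n. c)"
proof (induction k arbitrary: c)
  case 0
  then show ?case by auto
next
  case (Suc k)
  have "partial_deriv i (\<lambda>x :: real^'n. c) = (\<lambda>x. 0)" for i
    by (rule ext) (simp add: partial_derivI[OF has_derivative_const])
  then show ?case using Suc by simp
qed

lemma C_k_mult: "C_k k f \<Longrightarrow> C_k k g \<Longrightarrow> C_k k (\<lambda>x. f x * g x)"
proof (induction k arbitrary: f g)
  case 0
  then show ?case by (auto intro: continuous_intros)
next
  case (Suc k)
  have d: "f differentiable (at x)" "g differentiable (at x)" for x using Suc by auto
  have "partial_deriv i (\<lambda>x. f x * g x) = (\<lambda>x. f x * partial_deriv i g x + partial_deriv i f x * g x)" for i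
    using partial_derivI[OF has_derivative_mult[OF has_derivative_gradient[OF d(1)] has_derivative_gradient[OF d(2)]]]
    by (auto simp: partial_deriv_component inner_axis)
  moreover have "C_k k (\<lambda>x. f x * partial_deriv i g x + partial_deriv i f x * g x)" for i
    using Suc.IH Suc.prems C_k_SucD[OF Suc.prems(1)] C_k_SucD[OF Suc.prems(2)] by (intro C_k_add) auto
  ultimately show ?case using d by auto
qed

lemma C_k_sum: "finite I \<Longrightarrow> (\<And>i. i \<in> I \<Longrightarrow> C_k k (f i)) \<Longrightarrow> C_k k (\<lambda>x. \<Sum>i\<in>I. f i x)"
  by (induction I rule: finite_induct) (auto intro: C_k_add C_k_const)

lemma C_k_prod: "finite I \<Longrightarrow> (\<And>i. i \<in> I \<Longrightarrow> C_k k (f i)) \<Longrightarrow> C_k k (\<lambda>x. \<Prod>i\<in>I. f i x)"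
  by (induction I rule: finite_induct) (auto intro: C_k_mult C_k_const)

lemma C_k_component: "C_k k (\<lambda>x. x $ j)"
proof (cases k)
  case 0
  then show ?thesis by (auto intro: continuous_intros)
next
  case (Suc m)
  have "partial_deriv i (\<lambda>x. x $ j) = (\<lambda>x. axis i 1 $ j)" for i
    by (rule ext) (simp add: partial_derivI[OF bounded_linear.has_derivative[OF bounded_linear_vec_nth has_derivative_ident]])
  then show ?thesis using Suc
    by (auto simp: C_k_const intro!: bounded_linear_imp_differentiable bounded_linear_vec_nth)
qed

lemma C_k_minus: "C_k k f \<Longrightarrow> C_k k g \<Longrightarrow> C_k k (\<lambda>x. f x - g x)"
  using C_k_add[of k f "\<lambda>x. -1 * g x"] C_k_mult[OF C_k_const[of k "-1"], of g] by simp

lemma C_k_norm_sq: "C_k k (\<lambda>x :: real^'n. (norm x)\<^sup>2)"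
proof -
  have "C_k k (\<lambda>x :: real^'n. \<Sum>i\<in>UNIV. x $ i * x $ i)"
    by (intro C_k_sum C_k_mult C_k_component) auto
  moreover have "(\<lambda>x :: real^'n. \<Sum>i\<in>UNIV. x $ i * x $ i) = (\<lambda>x. (norm x)\<^sup>2)"
    by (simp add: power2_norm_eq_inner inner_vec_def)
  ultimately show ?thesis by simp
qed

text \<open>
  The chain rule feeds the induction on \<open>k\<close>: if all derivatives \<open>G m\<close> of a function of one
  variable are available, then the composite inherits the regularity of the inner function.
\<close>

lemma C_k_compose:
  assumes f: "C_k k f" and I: "\<And>x. f x \<in> I"
    and G: "\<And>m t. t \<in> I \<Longrightarrow> (G m has_real_derivative G (Suc m) t) (at t)"
  shows "C_k k (\<lambda>x. G m (f x))"
  using f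
proof (induction k arbitrary: m)
  case 0
  have "isCont (G m) t" if "t \<in> I" for t using DERIV_isCont[OF G[OF that]] .
  then have "continuous_on I (G m)" by (auto intro: continuous_at_imp_continuous_on)
  then show ?case using 0 I continuous_on_compose2[of I "G m" UNIV f] by auto
next
  case (Suc k)
  have d: "f differentiable (at x)" for x using Suc by auto
  have hd: "((\<lambda>x. G m (f x)) has_derivative (\<lambda>h. G (Suc m) (f x) * (gradient f x \<bullet> h))) (at x)" for x
    using has_derivative_compose[OF has_derivative_gradient[OF d, of x] G[OF I[of x], of m, unfolded has_field_derivative_def]] .
  have "partial_deriv i (\<lambda>x. G m (f x)) = (\<lambda>x. G (Suc m) (f x) * partial_deriv i f x)" for i
    using partial_derivI[OF hd] by (auto simp: partial_deriv_component inner_axis)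
  moreover have "C_k k (\<lambda>x. G (Suc m) (f x) * partial_deriv i f x)" for i
    using Suc.prems Suc.IH[OF C_k_SucD[OF Suc.prems]] by (intro C_k_mult) auto
  ultimately show ?case using hd by (auto simp: differentiable_def)
qed

lemma C_k_powr:
  assumes f: "C_k k f" and pos: "\<And>x. 0 < f x"
  shows "C_k k (\<lambda>x. f x powr a)"
proof -
  define G where "G m t = (\<Prod>j<m. a - real j) * t powr (a - real m)" for m and t :: real
  have "(G m has_real_derivative G (Suc m) t) (at t)" if "t \<in> {0<..}" for m t
    using that unfolding G_def by (auto intro!: derivative_eq_intros simp: algebra_simps)
  then show ?thesis using C_k_compose[of k f "{0<..}" G 0] f pos by (simp add: G_def)
qed

section \<open>Smooth cutoff functions\<close>

text \<open>
  The family is closed under differentiation up to linear combinations, so smoothness of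
  \<open>exp (-1/t)\<close> extended by zero is an induction over the order with \<open>m\<close> arbitrary.
\<close>

definition flat :: "nat \<Rightarrow> real \<Rightarrow> real" where
  "flat m t = (if t \<le> 0 then 0 else exp (- inverse t) * inverse t ^ m)"

lemma flat_tendsto_0: "(flat m \<longlongrightarrow> 0) (at_right 0)"
proof -
  have "((\<lambda>t :: real. inverse t ^ m / exp (inverse t)) \<longlongrightarrow> 0) (at_right 0)"
    by (rule filterlim_compose[OF tendsto_power_div_exp_0 filterlim_inverse_at_top_right])
  then show ?thesis
  proof (rule Lim_transform_eventually)
    show "\<forall>\<^sub>F t in at_right 0. inverse t ^ m / exp (inverse t) = flat m t"
      by (auto simp: eventually_at_right_less flat_def exp_minus field_simps eventually_at_filter)
  qed
qed

lemma flat_DERIV: "(flat m has_real_derivative (flat (m + 2) t - real m * flat (m + 1) t)) (at t)"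
proof -
  consider "t > 0" | "t < 0" | "t = 0" by linarith
  then show ?thesis
  proof cases
    case 1
    have "((\<lambda>t. exp (- inverse t) * inverse t ^ m) has_real_derivative (flat (m + 2) t - real m * flat (m + 1) t)) (at t)"
    proof -
      let ?s = "inverse t"
      have "((\<lambda>s. exp (- s) * s ^ m) has_real_derivative (exp (- ?s) * (real m * ?s ^ (m - 1)) - exp (- ?s) * ?s ^ m)) (at ?s)"
        by (auto intro!: derivative_eq_intros)
      moreover have "(inverse has_real_derivative - (?s\<^sup>2)) (at t)"
        using 1 DERIV_inverse[of t UNIV] by (simp add: numeral_2_eq_2)
      ultimately have "((\<lambda>t. exp (- inverse t) * inverse t ^ m) has_real_derivative
          (exp (- ?s) * (real m * ?s ^ (m - 1)) - exp (- ?s) * ?s ^ m) * - (?s\<^sup>2)) (at t)"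
        by (rule DERIV_chain2)
      moreover have "(exp (- ?s) * (real m * ?s ^ (m - 1)) - exp (- ?s) * ?s ^ m) * - (?s\<^sup>2) = flat (m + 2) t - real m * flat (m + 1) t"
        using 1 by (cases m) (simp_all add: flat_def power2_eq_square algebra_simps)
      ultimately show ?thesis by simp
    qed
    then show ?thesis
      by (rule has_field_derivative_transform_within_open[of _ _ _ "{0<..}"]) (use 1 in \<open>auto simp: flat_def\<close>)
  next
    case 2
    have "((\<lambda>t. 0) has_real_derivative (flat (m + 2) t - real m * flat (m + 1) t)) (at t)"
      using 2 by (auto simp: flat_def)
    then show ?thesis
      by (rule has_field_derivative_transform_within_open[of _ _ _ "{..<0}"]) (use 2 in \<open>auto simp: flat_def\<close>)
  next
    case 3
    have "((\<lambda>h. flat m h / h) \<longlongrightarrow> 0) (at_right 0)"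
    proof (rule Lim_transform_eventually[OF flat_tendsto_0[of "Suc m"]])
      show "\<forall>\<^sub>F h in at_right 0. flat (Suc m) h = flat m h / h"
        by (auto simp: eventually_at_filter flat_def field_simps)
    qed
    moreover have "((\<lambda>h. flat m h / h) \<longlongrightarrow> 0) (at_left 0)"
    proof (rule Lim_transform_eventually[OF tendsto_const])
      show "\<forall>\<^sub>F h in at_left 0. 0 = flat m h / h"
        by (auto simp: eventually_at_filter flat_def)
    qed
    ultimately have "((\<lambda>h. flat m h / h) \<longlongrightarrow> 0) (at 0)" by (rule filterlim_split_at[rotated])
    then show ?thesis using 3 by (simp add: DERIV_def flat_def)
  qed
qed

lemma C_k_flat:
  assumes "C_k k f"
  shows "C_k k (\<lambda>x. flat m (f x))"
  using assms
proof (induction k arbitrary: m)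
  case 0
  have "continuous_on UNIV (flat m)" by (intro continuous_at_imp_continuous_on) (auto intro: DERIV_isCont[OF flat_DERIV])
  then show ?case using 0 continuous_on_compose2[of UNIV "flat m" UNIV f] by auto
next
  case (Suc k)
  have d: "f differentiable (at x)" for x using Suc by auto
  have hd: "((\<lambda>x. flat m (f x)) has_derivative (\<lambda>h. (flat (m + 2) (f x) - real m * flat (m + 1) (f x)) * (gradient f x \<bullet> h))) (at x)" for x
    using has_derivative_compose[OF has_derivative_gradient[OF d, of x] flat_DERIV[of m "f x", unfolded has_field_derivative_def]] .
  have "partial_deriv i (\<lambda>x. flat m (f x)) = (\<lambda>x. (flat (m + 2) (f x) - real m * flat (m + 1) (f x)) * partial_deriv i f x)" for i
    using partial_derivI[OF hd] by (auto simp: partial_deriv_component inner_axis)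
  moreover have "C_k k (\<lambda>x. (flat (m + 2) (f x) - real m * flat (m + 1) (f x)) * partial_deriv i f x)" for i
    using Suc.prems Suc.IH[OF C_k_SucD[OF Suc.prems]] by (intro C_k_mult C_k_minus C_k_const) auto
  ultimately show ?case using hd by (auto simp: differentiable_def)
qed

lemma flat0_pos: "t > 0 \<Longrightarrow> flat 0 t > 0" and flat0_nonneg: "flat 0 t \<ge> 0" and flat0_le_1: "flat 0 t \<le> 1"
  by (auto simp: flat_def)

lemma C_k_affine:
  assumes "C_k k f"
  shows "C_k k (\<lambda>x. f (c *\<^sub>R x + b))"
  using assms
proof (induction k arbitrary: f)
  case 0
  then show ?case by (auto intro!: continuous_on_compose2[of UNIV f] continuous_intros)
next
  case (Suc k)
  have d: "f differentiable (at x)" for x using Suc by auto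
  have hd: "((\<lambda>x. f (c *\<^sub>R x + b)) has_derivative (\<lambda>h. gradient f (c *\<^sub>R x + b) \<bullet> (c *\<^sub>R h))) (at x)" for x
    by (rule has_derivative_compose[OF _ has_derivative_gradient[OF d]]) (auto intro!: derivative_eq_intros)
  have "partial_deriv i (\<lambda>x. f (c *\<^sub>R x + b)) = (\<lambda>x. c * partial_deriv i f (c *\<^sub>R x + b))" for i
    using partial_derivI[OF hd] by (auto simp: partial_deriv_component inner_axis)
  moreover have "C_k k (\<lambda>x. c * partial_deriv i f (c *\<^sub>R x + b))" for i
    using Suc.prems Suc.IH by (intro C_k_mult C_k_const) auto
  ultimately show ?case using hd by (auto simp: differentiable_def)
qed

lemma test_functionsI:
  assumes "\<And>k. C_k k f" "compact K" "K \<subseteq> \<Omega>" "\<And>x. x \<notin> K \<Longrightarrow> f x = 0"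
  shows "f \<in> test_functions \<Omega>"
proof -
  have "closure {x. f x \<noteq> 0} \<subseteq> K"
    using assms by (intro closure_minimal compact_imp_closed) auto
  then show ?thesis using assms closed_Int_compact[of "closure {x. f x \<noteq> 0}" K]
    by (auto simp: test_functions_def Int_absorb2)
qed

lemma test_support:
  assumes "f \<in> test_functions \<Omega>"
  shows "\<exists>K. compact K \<and> K \<subseteq> \<Omega> \<and> (\<forall>x. x \<notin> K \<longrightarrow> f x = 0 \<and> gradient f x = 0)"
proof (intro exI conjI allI impI)
  let ?K = "closure {x. f x \<noteq> 0}"
  show "compact ?K" "?K \<subseteq> \<Omega>" using assms by (auto simp: test_functions_def)
  fix x assume x: "x \<notin> ?K"
  show "f x = 0" using x closure_subset[of "{x. f x \<noteq> 0}"] by auto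
  show "gradient f x = 0"
  proof (rule gradientI)
    have "((\<lambda>x. 0) has_derivative (\<lambda>h. 0 \<bullet> h)) (at x)" by simp
    then show "(f has_derivative (\<lambda>h. 0 \<bullet> h)) (at x)"
    proof (rule has_derivative_transform_within_open)
      show "open (- ?K)" by (rule open_Compl) (rule closed_closure)
      show "x \<in> - ?K" using x by (simp only: Compl_iff not_False_eq_True)
      show "0 = f y" if "y \<in> - ?K" for y using that closure_subset[of "{x. f x \<noteq> 0}"] by auto
    qed
  qed
qed

lemma test_C_k: "f \<in> test_functions \<Omega> \<Longrightarrow> C_k k f"
  by (simp add: test_functions_def)

lemma test_differentiable: "f \<in> test_functions \<Omega> \<Longrightarrow> f differentiable (at x)"
  using test_C_k[of f \<Omega> "Suc 0"] by simp

lemma test_has_derivative: "f \<in> test_functions \<Omega> \<Longrightarrow> (f has_derivative (\<lambda>h. gradient f x \<bullet> h)) (at x)"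
  by (intro has_derivative_gradient test_differentiable)

lemma test_continuous: "f \<in> test_functions \<Omega> \<Longrightarrow> continuous_on S f"
  using test_C_k[of f \<Omega> 0] by (auto intro: continuous_on_subset)

lemma test_gradient_continuous: 
  assumes "f \<in> test_functions \<Omega>" 
  shows "continuous_on S (gradient f)"
proof -
  have "continuous_on UNIV (partial_deriv i f)" for i
    using test_C_k[OF assms, of "Suc 0"] by simp
  then have "continuous_on UNIV (\<lambda>x. \<chi> i. partial_deriv i f x)" by (intro continuous_on_vec_lambda) auto
  then show ?thesis by (auto simp: gradient_def[abs_def] intro: continuous_on_subset)
qed

lemma test_mono: "\<Omega> \<subseteq> \<Omega>' \<Longrightarrow> f \<in> test_functions \<Omega> \<Longrightarrow> f \<in> test_functions \<Omega>'"
  by (auto simp: test_functions_def)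

lemma test_outside:
  assumes f: "f \<in> test_functions \<Omega>" and x: "x \<notin> \<Omega>"
  shows "f x = 0" "gradient f x = 0"
proof -
  obtain K where K: "compact K" "K \<subseteq> \<Omega>" "\<And>x. x \<notin> K \<Longrightarrow> f x = 0" "\<And>x. x \<notin> K \<Longrightarrow> gradient f x = 0"
    using test_support[OF f] by blast
  show "f x = 0" "gradient f x = 0" using K(2-4) x by (meson subsetD)+
qed

lemma test_add:
  assumes f: "f \<in> test_functions \<Omega>" and g: "g \<in> test_functions \<Omega>"
  shows "(\<lambda>x. f x + g x) \<in> test_functions \<Omega>" "gradient (\<lambda>x. f x + g x) x = gradient f x + gradient g x"
proof -
  obtain K where K: "compact K" "K \<subseteq> \<Omega>" "\<And>x. x \<notin> K \<Longrightarrow> f x = 0" "\<And>x. x \<notin> K \<Longrightarrow> gradient f x = 0"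
    using test_support[OF f] by blast
  obtain L where L: "compact L" "L \<subseteq> \<Omega>" "\<And>x. x \<notin> L \<Longrightarrow> g x = 0" "\<And>x. x \<notin> L \<Longrightarrow> gradient g x = 0"
    using test_support[OF g] by blast
  show "(\<lambda>x. f x + g x) \<in> test_functions \<Omega>"
    by (rule test_functionsI[OF C_k_add[OF test_C_k[OF f] test_C_k[OF g]] compact_Un[OF K(1) L(1)]]) (use K L in simp_all)
  show "gradient (\<lambda>x. f x + g x) x = gradient f x + gradient g x"
    by (rule gradientI) (unfold inner_add_left, intro has_derivative_add test_has_derivative[OF f] test_has_derivative[OF g])
qed

lemma test_cmult:
  assumes f: "f \<in> test_functions \<Omega>"
  shows "(\<lambda>x. c * f x) \<in> test_functions \<Omega>" "gradient (\<lambda>x. c * f x) x = c *\<^sub>R gradient f x"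
proof -
  obtain K where K: "compact K" "K \<subseteq> \<Omega>" "\<And>x. x \<notin> K \<Longrightarrow> f x = 0" "\<And>x. x \<notin> K \<Longrightarrow> gradient f x = 0"
    using test_support[OF f] by blast
  show "(\<lambda>x. c * f x) \<in> test_functions \<Omega>"
    by (rule test_functionsI[OF C_k_mult[OF C_k_const test_C_k[OF f]] K(1)]) (use K in simp_all)
  show "gradient (\<lambda>x. c * f x) x = c *\<^sub>R gradient f x"
    by (rule gradientI) (unfold inner_scaleR_left, intro has_derivative_mult_right test_has_derivative[OF f])
qed

lemma test_diff:
  assumes f: "f \<in> test_functions \<Omega>" and g: "g \<in> test_functions \<Omega>"
  shows "(\<lambda>x. f x - g x) \<in> test_functions \<Omega>" "gradient (\<lambda>x. f x - g x) x = gradient f x - gradient g x"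
  using test_add[OF f test_cmult(1)[OF g, of "-1"]] test_cmult(2)[OF g, of "-1"] by auto

lemma test_mult:
  assumes f: "f \<in> test_functions \<Omega>" and g: "\<And>k. C_k k g"
  shows "(\<lambda>x. f x * g x) \<in> test_functions \<Omega>" 
    "gradient (\<lambda>x. f x * g x) x = f x *\<^sub>R gradient g x + g x *\<^sub>R gradient f x"
proof -
  obtain K where K: "compact K" "K \<subseteq> \<Omega>" "\<And>x. x \<notin> K \<Longrightarrow> f x = 0" "\<And>x. x \<notin> K \<Longrightarrow> gradient f x = 0"
    using test_support[OF f] by blast
  show "(\<lambda>x. f x * g x) \<in> test_functions \<Omega>"
    by (rule test_functionsI[OF C_k_mult[OF test_C_k[OF f] g] K(1)]) (use K in simp_all)
  have "g differentiable (at x)" using g[of "Suc 0"] by simp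
  from has_derivative_mult[OF test_has_derivative[OF f] has_derivative_gradient[OF this]]
  show "gradient (\<lambda>x. f x * g x) x = f x *\<^sub>R gradient g x + g x *\<^sub>R gradient f x"
    by (intro gradientI) (simp add: inner_add_left mult.commute)
qed

text \<open>
  The quotient \<open>F / (F + G)\<close> of two flat functions, where \<open>F\<close> vanishes outside the ball of radius \<open>2 R\<close>
  and \<open>G\<close> inside the ball of radius \<open>R\<close>, so that the denominator is positive everywhere.
\<close>

lemma exists_cutoff:
  assumes R: "0 < R"
  obtains \<eta> :: "real^'n \<Rightarrow> real" where "\<eta> \<in> test_functions UNIV" "\<And>x. norm x \<le> R \<Longrightarrow> \<eta> x = 1" "\<And>x. 0 \<le> \<eta> x"
proof
  define F G where "F x = flat 0 (4 * R\<^sup>2 - (norm x)\<^sup>2)" and "G x = flat 0 ((norm x)\<^sup>2 - R\<^sup>2)" for x :: "real^'n"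
  define \<eta> where "\<eta> x = F x * (F x + G x) powr (- 1)" for x
  have FG: "F x + G x > 0" for x
  proof (cases "(norm x)\<^sup>2 < 4 * R\<^sup>2")
    case True
    then have "F x > 0" by (simp add: F_def flat0_pos)
    moreover have "G x \<ge> 0" by (simp add: G_def flat0_nonneg)
    ultimately show ?thesis by linarith
  next
    case False
    have "R\<^sup>2 > 0" using R by simp
    then have "(norm x)\<^sup>2 > R\<^sup>2" using False by linarith
    then have "G x > 0" by (simp add: G_def flat0_pos)
    moreover have "F x \<ge> 0" by (simp add: F_def flat0_nonneg)
    ultimately show ?thesis by linarith
  qed
  have CF: "C_k k F" "C_k k G" for k
    unfolding F_def G_def by (intro C_k_flat C_k_minus C_k_const C_k_norm_sq)+
  show "\<eta> \<in> test_functions UNIV"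
  proof (rule test_functionsI)
    show "C_k k \<eta>" for k unfolding \<eta>_def by (intro C_k_mult C_k_powr C_k_add CF FG)
    show "compact (cball (0 :: real^'n) (2 * R))" by simp
    show "\<eta> x = 0" if "x \<notin> cball 0 (2 * R)" for x
    proof -
      have "(2 * R)\<^sup>2 \<le> (norm x)\<^sup>2" using that R by (intro power_mono) auto
      then show ?thesis by (simp add: \<eta>_def F_def flat_def)
    qed
  qed simp
  show "\<eta> x = 1" if "norm x \<le> R" for x
  proof -
    have "(norm x)\<^sup>2 \<le> R\<^sup>2" using that by (intro power_mono) auto
    then have "G x = 0" by (simp add: G_def flat_def)
    then show ?thesis using FG[of x] by (simp add: \<eta>_def powr_minus)
  qed
  show "0 \<le> \<eta> x" for x by (simp add: \<eta>_def F_def flat0_nonneg)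
qed

lemma integrable_continuous_compact_support:
  fixes f :: "'a::euclidean_space \<Rightarrow> 'b::{banach, second_countable_topology}"
  assumes "continuous_on UNIV f" "compact K" "\<And>x. x \<notin> K \<Longrightarrow> f x = 0"
  shows "integrable lborel f"
proof -
  have "integrable lborel (\<lambda>x. indicator K x *\<^sub>R f x)"
    using assms by (intro borel_integrable_compact) (auto intro: continuous_on_subset)
  moreover have "(\<lambda>x. indicator K x *\<^sub>R f x) = f" using assms(3) by (auto simp: indicator_def)
  ultimately show ?thesis by simp
qed

lemma in_Lp_continuous_compact_support:
  assumes "continuous_on UNIV f" "compact K" "\<And>x. x \<notin> K \<Longrightarrow> f x = 0" "0 < p"
  shows "in_Lp p lborel f"
  unfolding in_Lp_def
proof
  show "f \<in> borel_measurable lborel" using assms by (simp add: borel_measurable_continuous_onI)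
  show "integrable lborel (\<lambda>x. norm (f x) powr p)"
    by (rule integrable_continuous_compact_support[of _ K])
       (use assms in \<open>auto intro!: continuous_on_powr' continuous_on_norm continuous_on_const\<close>)
qed

lemma test_in_Lp:
  assumes "f \<in> test_functions \<Omega>" "0 < p"
  shows "in_Lp p lborel f" "in_Lp p lborel (gradient f)" "in_Lp p lborel (\<lambda>x. gradient f x \<bullet> \<xi>)"
proof -
  obtain K where K: "compact K" "K \<subseteq> \<Omega>" "\<And>x. x \<notin> K \<Longrightarrow> f x = 0" "\<And>x. x \<notin> K \<Longrightarrow> gradient f x = 0"
    using test_support[OF assms(1)] by blast
  show "in_Lp p lborel f" "in_Lp p lborel (gradient f)" "in_Lp p lborel (\<lambda>x. gradient f x \<bullet> \<xi>)"
    using K assms test_continuous[OF assms(1)] test_gradient_continuous[OF assms(1)]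
    by (auto intro!: in_Lp_continuous_compact_support[where K=K] continuous_intros)
qed

lemma test_borel [measurable_dest]: "f \<in> test_functions \<Omega> \<Longrightarrow> f \<in> borel_measurable borel"
  by (intro borel_measurable_continuous_onI test_continuous)

lemma gradient_borel: "f \<in> test_functions \<Omega> \<Longrightarrow> gradient f \<in> borel_measurable borel"
  by (intro borel_measurable_continuous_onI test_gradient_continuous)

lemma nn_integral_lborel_translate:
  fixes f :: "'a::euclidean_space \<Rightarrow> ennreal"
  assumes "f \<in> borel_measurable borel"
  shows "(\<integral>\<^sup>+x. f (x + z) \<partial>lborel) = (\<integral>\<^sup>+x. f x \<partial>lborel)"
proof -
  have "(\<integral>\<^sup>+x. f x \<partial>lborel) = (\<integral>\<^sup>+x. f x \<partial>distr lborel borel ((+) z))" by (simp add: lborel_distr_plus)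
  also have "\<dots> = (\<integral>\<^sup>+x. f (z + x) \<partial>lborel)" using assms by (intro nn_integral_distr) auto
  finally show ?thesis by (simp add: add.commute)
qed

lemma nn_integral_lborel_scale:
  fixes f :: "'a::euclidean_space \<Rightarrow> ennreal"
  assumes [measurable]: "f \<in> borel_measurable borel" and c: "c > 0"
  shows "(\<integral>\<^sup>+x. f x \<partial>lborel) = ennreal (c ^ DIM('a)) * (\<integral>\<^sup>+x. f (c *\<^sub>R x + t) \<partial>lborel)"
  using c by (subst lborel_affine[of c t]) (auto simp: nn_integral_density nn_integral_distr nn_integral_cmult add.commute)

lemma integral_lborel_translate:
  fixes f :: "'a::euclidean_space \<Rightarrow> real"
  assumes "f \<in> borel_measurable borel"
  shows "(\<integral>x. f (x + z) \<partial>lborel) = (\<integral>x. f x \<partial>lborel)"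
proof -
  have "(\<integral>x. f x \<partial>lborel) = (\<integral>x. f x \<partial>distr lborel borel ((+) z))" by (simp add: lborel_distr_plus)
  also have "\<dots> = (\<integral>x. f (z + x) \<partial>lborel)" using assms by (intro integral_distr) auto
  finally show ?thesis by (simp add: add.commute)
qed

lemma test_gradient_bounded:
  assumes f: "f \<in> test_functions \<Omega>"
  obtains B where "0 \<le> B" "\<And>x. norm (gradient f x) \<le> B" "\<And>x. norm (f x) \<le> B"
proof -
  obtain K where K: "compact K" "K \<subseteq> \<Omega>" "\<And>x. x \<notin> K \<Longrightarrow> f x = 0" "\<And>x. x \<notin> K \<Longrightarrow> gradient f x = 0"
    using test_support[OF f] by blast
  have "bounded (gradient f ` K)" "bounded (f ` K)"
    using K f by (auto intro!: compact_imp_bounded compact_continuous_image test_continuous test_gradient_continuous)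
  then obtain A B where AB: "\<And>x. x \<in> K \<Longrightarrow> norm (gradient f x) \<le> A" "\<And>x. x \<in> K \<Longrightarrow> norm (f x) \<le> B"
    unfolding bounded_iff by auto
  have "norm (gradient f x) \<le> max 0 (max A B)" "norm (f x) \<le> max 0 (max A B)" for x
    using AB[of x] K(3,4)[of x] by (cases "x \<in> K"; auto simp: max_def)+
  then show ?thesis by (intro that[of "max 0 (max A B)"]) auto
qed

section \<open>Weak gradients\<close>

text \<open>
  Integration by parts reduces to the vanishing of the integral of a derivative, which is the limit
  of difference quotients whose integrals vanish by translation invariance.
\<close>

lemma integral_partial_deriv_eq_0:
  fixes f :: "real^'n \<Rightarrow> real"
  assumes f: "f \<in> test_functions \<Omega>"
  shows "(\<integral>x. partial_deriv i f x \<partial>lborel) = 0"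
proof -
  obtain B where B: "0 \<le> B" "\<And>x. norm (gradient f x) \<le> B" using test_gradient_bounded[OF f] by metis
  obtain K where K: "compact K" "K \<subseteq> \<Omega>" "\<And>x. x \<notin> K \<Longrightarrow> f x = 0" "\<And>x. x \<notin> K \<Longrightarrow> gradient f x = 0"
    using test_support[OF f] by blast
  obtain r where r: "\<And>x. x \<in> K \<Longrightarrow> norm x \<le> r" using compact_imp_bounded[OF K(1)] unfolding bounded_iff by auto
  have fm[measurable]: "f \<in> borel_measurable borel" using test_borel[OF f] .
  have fi: "integrable lborel f" using integrable_continuous_compact_support[OF test_continuous[OF f] K(1,3)] .
  define h where "h n = inverse (real (Suc n))" for n
  have h: "0 < h n" "h n \<le> 1" for n by (auto simp: h_def field_simps)
  define D where "D n x = (f (x + h n *\<^sub>R axis i 1) - f x) / h n" for n x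
  have lip: "\<bar>f y - f x\<bar> \<le> B * norm (y - x)" for x y
  proof -
    have "norm (f y - f x) \<le> B * norm (y - x)"
    proof (rule differentiable_bound[of UNIV f "\<lambda>x h. gradient f x \<bullet> h"])
      show "onorm (\<lambda>h. gradient f z \<bullet> h) \<le> B" for z
        using B by (intro onorm_bound) (auto intro!: order_trans[OF Cauchy_Schwarz_ineq2] mult_right_mono)
    qed (use test_has_derivative[OF f] in auto)
    then show ?thesis by simp
  qed
  have "(\<lambda>n. \<integral>x. D n x \<partial>lborel) \<longlonglongrightarrow> (\<integral>x. partial_deriv i f x \<partial>lborel)"
  proof (rule integral_dominated_convergence)
    show "integrable lborel (\<lambda>x. B * indicator (cball (0 :: real^'n) (r + 1)) x)"
      using emeasure_bounded_finite[OF bounded_cball, of "0 :: real^'n" "r + 1"]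
      by (intro integrable_mult_right integrable_real_indicator) auto
    show "AE x in lborel. (\<lambda>n. D n x) \<longlonglongrightarrow> partial_deriv i f x"
    proof (rule AE_I2)
      fix x
      have "((\<lambda>t. f (x + t *\<^sub>R axis i 1)) has_derivative (\<lambda>t. gradient f (x + 0 *\<^sub>R axis i 1) \<bullet> (t *\<^sub>R axis i 1))) (at 0)"
        by (rule has_derivative_compose[OF _ test_has_derivative[OF f]]) (auto intro!: derivative_eq_intros)
      then have "((\<lambda>t. f (x + t *\<^sub>R axis i 1)) has_real_derivative partial_deriv i f x) (at 0)"
        by (simp add: has_field_derivative_def partial_deriv_component inner_axis mult_commute_abs)
      then have "((\<lambda>t. (f (x + t *\<^sub>R axis i 1) - f x) / t) \<longlongrightarrow> partial_deriv i f x) (at 0)"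
        by (simp add: has_field_derivative_iff)
      moreover have "filterlim h (at 0) sequentially"
        unfolding filterlim_at using LIMSEQ_inverse_real_of_nat by (auto simp: h_def[abs_def])
      ultimately show "(\<lambda>n. D n x) \<longlonglongrightarrow> partial_deriv i f x"
        unfolding D_def by (rule filterlim_compose)
    qed
    show "AE x in lborel. norm (D n x) \<le> B * indicator (cball 0 (r + 1)) x" for n
    proof (rule AE_I2)
      fix x :: "real^'n"
      show "norm (D n x) \<le> B * indicator (cball 0 (r + 1)) x"
      proof (cases "x \<in> cball 0 (r + 1)")
        case True
        have "\<bar>f (x + h n *\<^sub>R axis i 1) - f x\<bar> \<le> B * h n" using lip[of "x + h n *\<^sub>R axis i 1" x] h[of n] by simp
        then show ?thesis using True h[of n] by (simp add: D_def field_simps)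
      next
        case False
        have "norm x \<le> norm (x + h n *\<^sub>R axis i 1) + norm (h n *\<^sub>R axis i 1 :: real^'n)"
          using norm_triangle_ineq4[of "x + h n *\<^sub>R axis i 1" "h n *\<^sub>R axis i 1"] by simp
        moreover have "norm (h n *\<^sub>R axis i 1 :: real^'n) \<le> 1" using h[of n] by simp
        ultimately have "x \<notin> K" "x + h n *\<^sub>R axis i 1 \<notin> K" using False r[of x] r[of "x + h n *\<^sub>R axis i 1"] by auto
        then show ?thesis using False K(3) by (simp add: D_def)
      qed
    qed
    show "partial_deriv i f \<in> borel_measurable lborel"
      unfolding partial_deriv_component[abs_def]
      by (simp, intro borel_measurable_continuous_onI continuous_on_component test_gradient_continuous[OF f])
  qed (auto simp: D_def)
  moreover have "(\<integral>x. D n x \<partial>lborel) = 0" for n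
  proof -
    have "integrable lborel (\<lambda>x. f (x + h n *\<^sub>R axis i 1))"
    proof (rule integrable_continuous_compact_support)
      show "continuous_on UNIV (\<lambda>x. f (x + h n *\<^sub>R axis i 1))"
        by (rule continuous_on_compose2[OF test_continuous[OF f, of UNIV]]) (auto intro!: continuous_intros)
      show "compact (cball (0 :: real^'n) (r + 1))" by simp
      show "f (x + h n *\<^sub>R axis i 1) = 0" if "x \<notin> cball 0 (r + 1)" for x
      proof -
        have "norm x \<le> norm (x + h n *\<^sub>R axis i 1) + norm (h n *\<^sub>R axis i 1 :: real^'n)"
          using norm_triangle_ineq4[of "x + h n *\<^sub>R axis i 1" "h n *\<^sub>R axis i 1"] by simp
        moreover have "norm (h n *\<^sub>R axis i 1 :: real^'n) \<le> 1" using h[of n] by simp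
        ultimately have "x + h n *\<^sub>R axis i 1 \<notin> K" using that r[of "x + h n *\<^sub>R axis i 1"] by auto
        then show ?thesis using K(3) by simp
      qed
    qed
    then show ?thesis using fi integral_lborel_translate[OF fm, of "h n *\<^sub>R axis i 1"] by (simp add: D_def)
  qed
  ultimately show ?thesis by (simp add: LIMSEQ_const_iff)
qed

lemma continuous_locally_integrable:
  assumes f: "continuous_on UNIV f"
  shows "locally_integrable_on f \<Omega>"
  unfolding locally_integrable_on_def set_integrable_def
proof (intro allI impI)
  fix K assume "compact K \<and> K \<subseteq> \<Omega>"
  then have "integrable lborel (\<lambda>x. indicator K x *\<^sub>R f x)"
    using f by (intro borel_integrable_compact) (auto intro: continuous_on_subset)
  then show "integrable lebesgue (\<lambda>x. indicator K x *\<^sub>R f x)"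
    by (subst integrable_completion) auto
qed

lemma test_has_weak_gradient:
  fixes f :: "real^'n \<Rightarrow> real"
  assumes f: "f \<in> test_functions \<Omega>" and \<Omega>: "open \<Omega>"
  shows "has_weak_gradient \<Omega> f (gradient f)"
  unfolding has_weak_gradient_def
proof (intro conjI ballI allI)
  show "locally_integrable_on f \<Omega>" "locally_integrable_on (gradient f) \<Omega>"
    by (intro continuous_locally_integrable test_continuous[OF f] test_gradient_continuous[OF f])+
  fix \<phi> i assume \<phi>: "\<phi> \<in> test_functions \<Omega>"
  have cont: "continuous_on UNIV (\<lambda>x. f x * partial_deriv i \<phi> x)" "continuous_on UNIV (\<lambda>x. gradient f x $ i * \<phi> x)"
    unfolding partial_deriv_component
    by (intro continuous_intros test_continuous[OF f] test_continuous[OF \<phi>] test_gradient_continuous[OF f] test_gradient_continuous[OF \<phi>])+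
  obtain K where K: "compact K" "K \<subseteq> \<Omega>" "\<And>x. x \<notin> K \<Longrightarrow> f x = 0" "\<And>x. x \<notin> K \<Longrightarrow> gradient f x = 0"
    using test_support[OF f] by blast
  have int: "integrable lborel (\<lambda>x. f x * partial_deriv i \<phi> x)" "integrable lborel (\<lambda>x. gradient f x $ i * \<phi> x)"
    using K by (auto intro!: integrable_continuous_compact_support[OF _ K(1)] cont)
  have pd: "partial_deriv i (\<lambda>x. f x * \<phi> x) x = f x * partial_deriv i \<phi> x + gradient f x $ i * \<phi> x" for x
    using test_mult(2)[OF f test_C_k[OF \<phi>], of x] by (simp add: partial_deriv_component)
  have "(\<integral>x. f x * partial_deriv i \<phi> x \<partial>lborel) + (\<integral>x. gradient f x $ i * \<phi> x \<partial>lborel) = 0"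
    using integral_partial_deriv_eq_0[OF test_mult(1)[OF f test_C_k[OF \<phi>]], of i] int by (simp add: pd)
  moreover have "(LINT x:\<Omega>|lebesgue. F x) = (\<integral>x. F x \<partial>lborel)" if "continuous_on UNIV F" "\<And>x. x \<notin> \<Omega> \<Longrightarrow> F x = 0" for F :: "real^'n \<Rightarrow> real"
  proof -
    have "(LINT x:\<Omega>|lebesgue. F x) = (\<integral>x. F x \<partial>lebesgue)"
      unfolding set_lebesgue_integral_def using that(2) by (intro Bochner_Integration.integral_cong) (auto simp: indicator_def)
    also have "\<dots> = (\<integral>x. F x \<partial>lborel)"
      using that(1) by (intro integral_completion) (auto intro: borel_measurable_continuous_onI)
    finally show ?thesis .
  qed
  ultimately show "(LINT x:\<Omega>|lebesgue. f x * partial_deriv i \<phi> x) = - (LINT x:\<Omega>|lebesgue. gradient f x $ i * \<phi> x)"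
    using cont test_outside[OF f] by simp
qed

text \<open>
  For large \<open>c\<close> these test functions increase to the indicator of the open box, so testing
  against them tests against boxes.
\<close>

definition box_bump :: "real^'n \<Rightarrow> real^'n \<Rightarrow> real \<Rightarrow> real^'n \<Rightarrow> real" where
  "box_bump a b c x = (\<Prod>i\<in>UNIV. flat 0 (c * (x $ i - a $ i)) * flat 0 (c * (b $ i - x $ i)))"

lemma box_bump_outside:
  assumes "x \<notin> cbox a b" "c > 0"
  shows "box_bump a b c x = 0"
proof -
  obtain i where "x $ i < a $ i \<or> b $ i < x $ i" using assms by (auto simp: mem_box_cart not_le)
  then have "flat 0 (c * (x $ i - a $ i)) * flat 0 (c * (b $ i - x $ i)) = 0"
    using assms(2) by (auto simp: flat_def mult_le_0_iff)
  then show ?thesis unfolding box_bump_def by (intro prod_zero) auto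
qed

lemma box_bump_test:
  assumes "cbox a b \<subseteq> \<Omega>" "c > 0"
  shows "box_bump a b c \<in> test_functions \<Omega>"
proof (rule test_functionsI)
  show "C_k k (box_bump a b c)" for k
    unfolding box_bump_def
    by (intro C_k_prod C_k_mult C_k_flat C_k_const C_k_minus C_k_component) auto
qed (use assms box_bump_outside in auto)

lemma box_bump_bounds: "0 \<le> box_bump a b c x" "box_bump a b c x \<le> 1"
  unfolding box_bump_def
  by (auto intro!: prod_nonneg prod_le_1 mult_le_one simp: flat0_nonneg flat0_le_1)

lemma flat0_limit: "(\<lambda>j. flat 0 (real (Suc j) * s)) \<longlonglongrightarrow> (if s > 0 then 1 else 0)"
proof (cases "s > 0")
  case True
  have "(\<lambda>j. exp (- (inverse (real (Suc j)) * inverse s))) \<longlonglongrightarrow> exp (- (0 * inverse s))"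
    by (intro tendsto_intros LIMSEQ_inverse_real_of_nat)
  moreover have "\<not> real (Suc j) * s \<le> 0" for j
    using True by (simp add: mult_le_0_iff not_le)
  ultimately show ?thesis using True
    by (simp add: flat_def inverse_mult_distrib del: of_nat_Suc)
next
  case False
  then have "real (Suc j) * s \<le> 0" for j by (simp add: mult_le_0_iff)
  then show ?thesis using False by (simp add: flat_def del: of_nat_Suc)
qed

lemma box_bump_limit: "(\<lambda>j. box_bump a b (real (Suc j)) x) \<longlonglongrightarrow> indicator (box a b) x"
proof -
  have "(\<lambda>j. box_bump a b (real (Suc j)) x) \<longlonglongrightarrow>
     (\<Prod>i\<in>UNIV. (if x $ i - a $ i > 0 then 1 else 0) * (if b $ i - x $ i > 0 then 1 else 0))"
    unfolding box_bump_def by (intro tendsto_prod tendsto_mult flat0_limit)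
  also have "(\<Prod>i\<in>UNIV. (if x $ i - a $ i > 0 then 1 else 0) * (if b $ i - x $ i > 0 then 1 else 0)) = (indicator (box a b) x :: real)"
  proof (cases "x \<in> box a b")
    case True
    then show ?thesis by (simp add: mem_box_cart)
  next
    case False
    then obtain i where "\<not> (a $ i < x $ i \<and> x $ i < b $ i)" by (auto simp: mem_box_cart)
    then have "(\<Prod>i\<in>UNIV. (if x $ i - a $ i > 0 then 1 else 0) * (if b $ i - x $ i > 0 then 1 else 0)) = (0 :: real)"
      by (intro prod_zero) auto
    then show ?thesis using False by simp
  qed
  finally show ?thesis .
qed

lemma integral_box_eq_0:
  fixes w :: "real^'n \<Rightarrow> real"
  assumes w: "locally_integrable_on w \<Omega>"
    and test: "\<And>\<phi>. \<phi> \<in> test_functions \<Omega> \<Longrightarrow> (LINT x:\<Omega>|lebesgue. w x * \<phi> x) = 0"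
    and sub: "cbox a b \<subseteq> \<Omega>"
  shows "(LINT x:box a b|lebesgue. w x) = 0"
proof -
  have int: "integrable lebesgue (\<lambda>x. indicator (cbox a b) x *\<^sub>R w x)"
    using w sub unfolding locally_integrable_on_def set_integrable_def by auto
  define \<phi> where "\<phi> j = box_bump a b (real (Suc j))" for j
  have \<phi>: "\<phi> j \<in> test_functions \<Omega>" for j unfolding \<phi>_def by (intro box_bump_test sub) simp
  have [measurable]: "\<phi> j \<in> borel_measurable lebesgue" for j
    using test_borel[OF \<phi>[of j]] by (simp add: measurable_completion)
  have "(\<lambda>j. \<integral>x. (indicator (cbox a b) x *\<^sub>R w x) * \<phi> j x \<partial>lebesgue) \<longlonglongrightarrow> (\<integral>x. indicator (box a b) x *\<^sub>R w x \<partial>lebesgue)"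
  proof (rule integral_dominated_convergence)
    show "integrable lebesgue (\<lambda>x. norm (indicator (cbox a b) x *\<^sub>R w x))" using int by (rule integrable_norm)
    have "box a b \<subseteq> cbox a b" by (rule box_subset_cbox)
    then have eq: "indicator (box a b) x *\<^sub>R w x = (indicator (cbox a b) x *\<^sub>R w x) * indicator (box a b) x" for x
      by (auto simp: indicator_def)
    show "AE x in lebesgue. (\<lambda>j. (indicator (cbox a b) x *\<^sub>R w x) * \<phi> j x) \<longlonglongrightarrow> indicator (box a b) x *\<^sub>R w x"
      unfolding eq \<phi>_def by (intro AE_I2 tendsto_mult tendsto_const box_bump_limit)
    show "AE x in lebesgue. norm ((indicator (cbox a b) x *\<^sub>R w x) * \<phi> j x) \<le> norm (indicator (cbox a b) x *\<^sub>R w x)" for j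
      using box_bump_bounds[of a b "real (Suc j)"] by (intro AE_I2) (auto simp: \<phi>_def abs_mult intro: mult_left_le)
    show "(\<lambda>x. indicator (box a b) x *\<^sub>R w x) \<in> borel_measurable lebesgue"
      unfolding eq using borel_measurable_integrable[OF int]
      by (intro borel_measurable_times borel_measurable_indicator fmeasurableD[OF lmeasurable_box])
    show "(\<lambda>x. (indicator (cbox a b) x *\<^sub>R w x) * \<phi> j x) \<in> borel_measurable lebesgue" for j
      using borel_measurable_integrable[OF int] by (intro borel_measurable_times) auto
  qed
  moreover have "(\<integral>x. (indicator (cbox a b) x *\<^sub>R w x) * \<phi> j x \<partial>lebesgue) = 0" for j
  proof -
    have "(\<integral>x. (indicator (cbox a b) x *\<^sub>R w x) * \<phi> j x \<partial>lebesgue) = (LINT x:\<Omega>|lebesgue. w x * \<phi> j x)"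
      unfolding set_lebesgue_integral_def
    proof (rule Bochner_Integration.integral_cong)
      fix x show "(indicator (cbox a b) x *\<^sub>R w x) * \<phi> j x = indicator \<Omega> x *\<^sub>R (w x * \<phi> j x)"
        using sub box_bump_outside[of x a b "real (Suc j)"] by (auto simp: \<phi>_def indicator_def)
    qed simp
    then show ?thesis using test[OF \<phi>] by simp
  qed
  ultimately show ?thesis unfolding set_lebesgue_integral_def by (simp add: LIMSEQ_const_iff)
qed

text \<open>
  All integrals of \<open>w\<close> over boxes vanish, so its positive and negative parts are the densities of two
  finite measures that agree on an intersection-stable generator of the Borel sets.
\<close>

lemma AE_eq_0_on_box:
  fixes w :: "real^'n \<Rightarrow> real"
  assumes w: "locally_integrable_on w \<Omega>"
    and test: "\<And>\<phi>. \<phi> \<in> test_functions \<Omega> \<Longrightarrow> (LINT x:\<Omega>|lebesgue. w x * \<phi> x) = 0"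
    and sub: "cbox c d \<subseteq> \<Omega>"
  shows "AE x in lebesgue. x \<in> box c d \<longrightarrow> w x = 0"
proof -
  have int: "integrable lebesgue (\<lambda>x. indicator (box c d) x *\<^sub>R w x)"
  proof -
    have "w absolutely_integrable_on box c d"
      by (rule set_integrable_subset[of _ "cbox c d"]) (use w sub in \<open>auto simp: locally_integrable_on_def intro: subsetD[OF box_subset_cbox]\<close>)
    then show ?thesis by (simp add: set_integrable_def)
  qed
  obtain v where v[measurable]: "v \<in> borel_measurable lborel" and ae: "AE x in lborel. indicator (box c d) x *\<^sub>R w x = v x"
    using completion_ex_borel_measurable_real[OF borel_measurable_integrable[OF int]] by auto
  have ae': "AE x in lebesgue. indicator (box c d) x *\<^sub>R w x = v x" using ae by (rule AE_completion)
  have vint: "integrable lborel v"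
  proof -
    have vl: "v \<in> borel_measurable lebesgue" using v by (rule measurable_completion)
    have "integrable lebesgue v"
      using int ae' borel_measurable_integrable[OF int] vl by (subst integrable_cong_AE[symmetric]) auto
    then show ?thesis by (simp add: integrable_completion)
  qed
  have bint: "(\<integral>x. indicator (box a b) x * v x \<partial>lborel) = 0" for a b
  proof -
    have "(\<integral>x. indicator (box a b) x * v x \<partial>lborel) = (\<integral>x. indicator (box a b) x * v x \<partial>lebesgue)"
      by (rule integral_completion[symmetric]) auto
    also have "\<dots> = (\<integral>x. indicator (box a b) x * (indicator (box c d) x *\<^sub>R w x) \<partial>lebesgue)"
    proof (rule integral_cong_AE)
      show "AE x in lebesgue. indicator (box a b) x * v x = indicator (box a b) x * (indicator (box c d) x *\<^sub>R w x)"
        using ae' by eventually_elim simp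
      show "(\<lambda>x. indicator (box a b) x * v x) \<in> borel_measurable lebesgue"
        using measurable_completion[OF v] by (intro borel_measurable_times borel_measurable_indicator fmeasurableD[OF lmeasurable_box])
      show "(\<lambda>x. indicator (box a b) x * (indicator (box c d) x *\<^sub>R w x)) \<in> borel_measurable lebesgue"
        using borel_measurable_integrable[OF int] by (intro borel_measurable_times borel_measurable_indicator fmeasurableD[OF lmeasurable_box])
    qed
    also have "\<dots> = (LINT x:box a b \<inter> box c d|lebesgue. w x)"
      unfolding set_lebesgue_integral_def by (intro Bochner_Integration.integral_cong) (auto simp: indicator_def)
    also have "\<dots> = 0"
    proof -
      obtain e f where ef: "box a b \<inter> box c d = box e f" using box_Int_box by blast
      show ?thesis
      proof (cases "box e f = {}")
        case True
        then show ?thesis by (simp add: ef set_lebesgue_integral_def)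
      next
        case False
        have "closure (box e f) \<subseteq> closure (box c d)" using ef by (intro closure_mono) auto
        moreover have "box c d \<noteq> {}" using ef False by auto
        ultimately have sub': "cbox e f \<subseteq> \<Omega>" using False sub by (simp add: closure_box)
        show ?thesis unfolding ef by (rule integral_box_eq_0[OF w]) fact+
      qed
    qed
    finally show ?thesis .
  qed
  let ?P = "\<lambda>x. ennreal (max 0 (v x))" and ?N = "\<lambda>x. ennreal (max 0 (- v x))"
  have fin: "(\<integral>\<^sup>+x. ?P x \<partial>lborel) \<noteq> \<infinity>" "(\<integral>\<^sup>+x. ?N x \<partial>lborel) \<noteq> \<infinity>"
  proof -
    have "ennreal (max 0 y) = ennreal y" for y by (simp add: max_def ennreal_neg)
    then show "(\<integral>\<^sup>+x. ?P x \<partial>lborel) \<noteq> \<infinity>" "(\<integral>\<^sup>+x. ?N x \<partial>lborel) \<noteq> \<infinity>"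
      using vint by (simp_all add: real_integrable_def)
  qed
  have "density lborel ?P = density lborel ?N"
  proof (rule measure_eqI_generator_eq[where \<Omega>=UNIV and E="range (\<lambda>(a, b). box a b)" and A="\<lambda>i::nat. box (- real i *\<^sub>R One) (real i *\<^sub>R One)"])
    show "Int_stable (range (\<lambda>(a, b). box a b :: (real^'n) set))"
      unfolding Int_stable_def using box_Int_box by auto blast
    show "sets (density lborel ?P) = sigma_sets UNIV (range (\<lambda>(a, b). box a b))"
      "sets (density lborel ?N) = sigma_sets UNIV (range (\<lambda>(a, b). box a b))"
      by (simp_all add: borel_eq_box)
    show "(\<Union>i::nat. box (- real i *\<^sub>R One) (real i *\<^sub>R One)) = (UNIV :: (real^'n) set)"
      using UN_box_eq_UNIV by auto
    show "emeasure (density lborel ?P) (box (- real i *\<^sub>R One) (real i *\<^sub>R One)) \<noteq> \<infinity>" for i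
    proof -
      have "emeasure (density lborel ?P) (box (- real i *\<^sub>R One) (real i *\<^sub>R One)) \<le> (\<integral>\<^sup>+x. ?P x \<partial>lborel)"
        by (subst emeasure_density) (auto intro!: nn_integral_mono simp: indicator_def)
      then show ?thesis using fin by (auto simp: top_unique)
    qed
    fix X :: "(real^'n) set" assume "X \<in> range (\<lambda>(a, b). box a b)"
    then obtain a b where X: "X = box a b" by auto
    have i1: "integrable lborel (\<lambda>x. max 0 (v x) * indicator X x)" "integrable lborel (\<lambda>x. max 0 (- v x) * indicator X x)"
      using vint X by (auto intro!: integrable_real_mult_indicator integrable_max)
    have "(\<integral>x. max 0 (v x) * indicator X x \<partial>lborel) - (\<integral>x. max 0 (- v x) * indicator X x \<partial>lborel)
      = (\<integral>x. max 0 (v x) * indicator X x - max 0 (- v x) * indicator X x \<partial>lborel)"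
      using i1 by simp
    also have "\<dots> = (\<integral>x. indicator X x * v x \<partial>lborel)"
      by (intro Bochner_Integration.integral_cong) (auto simp: indicator_def max_def)
    also have "\<dots> = 0" using bint X by simp
    finally have eq: "(\<integral>x. max 0 (v x) * indicator X x \<partial>lborel) = (\<integral>x. max 0 (- v x) * indicator X x \<partial>lborel)" by simp
    have "(\<integral>\<^sup>+x. ?P x * indicator X x \<partial>lborel) = ennreal (\<integral>x. max 0 (v x) * indicator X x \<partial>lborel)"
      using i1(1) by (subst nn_integral_eq_integral[symmetric]) (auto intro!: nn_integral_cong simp: indicator_def)
    moreover have "(\<integral>\<^sup>+x. ?N x * indicator X x \<partial>lborel) = ennreal (\<integral>x. max 0 (- v x) * indicator X x \<partial>lborel)"
      using i1(2) by (subst nn_integral_eq_integral[symmetric]) (auto intro!: nn_integral_cong simp: indicator_def)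
    ultimately show "emeasure (density lborel ?P) X = emeasure (density lborel ?N) X"
      using X eq by (simp add: emeasure_density)
  qed auto
  then have "AE x in lborel. ?P x = ?N x"
    using fin by (subst (asm) finite_density_unique) auto
  then have "AE x in lborel. v x = 0"
    by eventually_elim (auto simp: max_def split: if_splits)
  then have "AE x in lebesgue. v x = 0" by (rule AE_completion)
  with ae' show ?thesis by eventually_elim auto
qed

text \<open>
  An open set is a countable union of closed boxes, and the boundary of a box is negligible.
\<close>

lemma fundamental_lemma:
  fixes w :: "real^'n \<Rightarrow> real"
  assumes \<Omega>: "open \<Omega>" and w: "locally_integrable_on w \<Omega>"
    and test: "\<And>\<phi>. \<phi> \<in> test_functions \<Omega> \<Longrightarrow> (LINT x:\<Omega>|lebesgue. w x * \<phi> x) = 0"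
  shows "AE x in lebesgue. x \<in> \<Omega> \<longrightarrow> w x = 0"
proof -
  obtain \<D> where D: "countable \<D>" "\<D> \<subseteq> Pow \<Omega>" "\<And>X. X \<in> \<D> \<Longrightarrow> \<exists>a b. X = cbox a b" "\<Union>\<D> = \<Omega>"
    using open_countable_Union_open_cbox[OF \<Omega>] by metis
  have "AE x in lebesgue. x \<in> X \<longrightarrow> w x = 0" if XD: "X \<in> \<D>" for X
  proof -
    obtain a b where X: "X = cbox a b" using D(3)[OF XD] by blast
    have "AE x in lebesgue. x \<in> box a b \<longrightarrow> w x = 0"
      by (rule AE_eq_0_on_box[OF w test]) (use D(2) XD X in auto)
    moreover have "AE x in lebesgue. x \<notin> cbox a b - box a b"
      using negligible_frontier_interval[of a b] by (intro AE_not_in) (simp add: negligible_iff_null_sets)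
    ultimately show ?thesis unfolding X by eventually_elim auto
  qed
  then have "AE x in lebesgue. \<forall>X\<in>\<D>. x \<in> X \<longrightarrow> w x = 0"
    by (subst AE_ball_countable[OF D(1)]) blast
  then show ?thesis by eventually_elim (use D(4) in auto)
qed

lemma locally_integrable_component:
  assumes "locally_integrable_on (g :: real^'n \<Rightarrow> real^'n) \<Omega>"
  shows "locally_integrable_on (\<lambda>x. g x $ i) \<Omega>"
proof -
  have "integrable lebesgue (\<lambda>x. indicator K x *\<^sub>R g x $ i)" if "integrable lebesgue (\<lambda>x. indicator K x *\<^sub>R g x)" for K
    using integrable_bounded_linear[OF bounded_linear_vec_nth[of i] that] by simp
  then show ?thesis using assms unfolding locally_integrable_on_def set_integrable_def by auto
qed

lemma set_integrable_locally_times_test: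
  fixes w :: "real^'n \<Rightarrow> real"
  assumes w: "locally_integrable_on w \<Omega>" and \<phi>: "\<phi> \<in> test_functions \<Omega>"
  shows "set_integrable lebesgue \<Omega> (\<lambda>x. w x * \<phi> x)"
proof -
  obtain K where K: "compact K" "K \<subseteq> \<Omega>" "\<And>x. x \<notin> K \<Longrightarrow> \<phi> x = 0" using test_support[OF \<phi>] by blast
  obtain B where B: "0 \<le> B" "\<And>x. norm (\<phi> x) \<le> B" using test_gradient_bounded[OF \<phi>] by metis
  have int: "integrable lebesgue (\<lambda>x. indicator K x *\<^sub>R w x)"
    using w K unfolding locally_integrable_on_def set_integrable_def by auto
  have [measurable]: "\<phi> \<in> borel_measurable lebesgue"
    using test_borel[OF \<phi>] by (simp add: measurable_completion)
  have "integrable lebesgue (\<lambda>x. (indicator K x *\<^sub>R w x) * \<phi> x)"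
  proof (rule Bochner_Integration.integrable_bound)
    show "integrable lebesgue (\<lambda>x. B * (indicator K x *\<^sub>R w x))" using int by (rule integrable_mult_right)
    show "(\<lambda>x. (indicator K x *\<^sub>R w x) * \<phi> x) \<in> borel_measurable lebesgue"
      using borel_measurable_integrable[OF int] by (intro borel_measurable_times) auto
    show "AE x in lebesgue. norm ((indicator K x *\<^sub>R w x) * \<phi> x) \<le> norm (B * (indicator K x *\<^sub>R w x))"
      using B by (intro AE_I2) (auto simp: abs_mult indicator_def mult.commute intro!: mult_right_mono)
  qed
  moreover have "(\<lambda>x. (indicator K x *\<^sub>R w x) * \<phi> x) = (\<lambda>x. indicator \<Omega> x *\<^sub>R (w x * \<phi> x))"
  proof (rule ext)
    show "(indicator K x *\<^sub>R w x) * \<phi> x = indicator \<Omega> x *\<^sub>R (w x * \<phi> x)" for x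
      using K(2) K(3)[of x] by (cases "x \<in> K") (auto simp: indicator_def)
  qed
  ultimately show ?thesis by (simp add: set_integrable_def)
qed

text \<open>
  This makes the representative chosen in the definition of the affine energy irrelevant.
\<close>

lemma weak_gradient_unique:
  fixes u :: "real^'n \<Rightarrow> real"
  assumes \<Omega>: "open \<Omega>" and g: "has_weak_gradient \<Omega> u g" and h: "has_weak_gradient \<Omega> u h"
  shows "AE x in lebesgue_on \<Omega>. g x = h x"
proof -
  have "AE x in lebesgue. x \<in> \<Omega> \<longrightarrow> g x $ i - h x $ i = 0" for i
  proof (rule fundamental_lemma[OF \<Omega>])
    have gi: "locally_integrable_on (\<lambda>x. g x $ i) \<Omega>" and hi: "locally_integrable_on (\<lambda>x. h x $ i) \<Omega>"
      using g h by (auto simp: has_weak_gradient_def intro: locally_integrable_component)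
    then show "locally_integrable_on (\<lambda>x. g x $ i - h x $ i) \<Omega>"
      unfolding locally_integrable_on_def by auto
    fix \<phi> assume \<phi>: "\<phi> \<in> test_functions \<Omega>"
    have "(LINT x:\<Omega>|lebesgue. g x $ i * \<phi> x) = (LINT x:\<Omega>|lebesgue. h x $ i * \<phi> x)"
    proof -
      have "(LINT x:\<Omega>|lebesgue. u x * partial_deriv i \<phi> x) = - (LINT x:\<Omega>|lebesgue. g x $ i * \<phi> x)"
        using g \<phi> by (simp add: has_weak_gradient_def)
      moreover have "(LINT x:\<Omega>|lebesgue. u x * partial_deriv i \<phi> x) = - (LINT x:\<Omega>|lebesgue. h x $ i * \<phi> x)"
        using h \<phi> by (simp add: has_weak_gradient_def)
      ultimately show ?thesis by linarith
    qed
    then show "(LINT x:\<Omega>|lebesgue. (g x $ i - h x $ i) * \<phi> x) = 0"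
      using set_integral_diff(2)[OF set_integrable_locally_times_test[OF gi \<phi>] set_integrable_locally_times_test[OF hi \<phi>]]
      by (simp add: left_diff_distrib)
  qed
  then have "AE x in lebesgue. \<forall>i\<in>UNIV. x \<in> \<Omega> \<longrightarrow> g x $ i - h x $ i = 0"
    by (subst AE_ball_countable) auto
  then have "AE x in lebesgue. x \<in> \<Omega> \<longrightarrow> g x = h x"
    by eventually_elim (auto simp: vec_eq_iff)
  then show ?thesis using \<Omega> by (subst AE_restrict_space_iff) auto
qed

section \<open>Volume of the unit ball of a seminorm\<close>

lemma surface_measure_nn_integral:
  fixes f :: "real^'n \<Rightarrow> ennreal"
  assumes [measurable]: "f \<in> borel_measurable borel"
  shows "(\<integral>\<^sup>+\<xi>. f \<xi> \<partial>surface_measure) = of_nat CARD('n) * (\<integral>\<^sup>+x. f (x /\<^sub>R norm x) * indicator (ball 0 1 - {0}) x \<partial>lborel)"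
proof -
  have m: "(\<lambda>x. x /\<^sub>R norm x) \<in> restrict_space lborel (ball 0 1 - {0 :: real^'n}) \<rightarrow>\<^sub>M restrict_space borel (sphere 0 1)"
    by (intro measurable_restrict_space2 measurable_restrict_space1) (auto simp: space_restrict_space)
  have f': "f \<in> borel_measurable (restrict_space borel (sphere 0 1))"
    by (intro measurable_restrict_space1) simp
  have "(\<integral>\<^sup>+\<xi>. f \<xi> \<partial>surface_measure) = of_nat CARD('n) * (\<integral>\<^sup>+x. f (x /\<^sub>R norm x) \<partial>restrict_space lborel (ball 0 1 - {0}))"
    unfolding surface_measure_def using f' m by (simp add: nn_integral_scale_measure nn_integral_distr)
  also have "(\<integral>\<^sup>+x. f (x /\<^sub>R norm x) \<partial>restrict_space lborel (ball 0 1 - {0})) = (\<integral>\<^sup>+x. f (x /\<^sub>R norm x) * indicator (ball 0 1 - {0}) x \<partial>lborel)"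
    by (rule nn_integral_restrict_space) auto
  finally show ?thesis .
qed

lemma nn_integral_tail:
  fixes n :: nat and c :: real
  assumes "0 < c" "0 < n"
  shows "(\<integral>\<^sup>+s. ennreal (real n * s powr (- real n - 1)) * indicator {c..} s \<partial>lborel) = ennreal (c powr (- real n))"
proof -
  have "(\<integral>\<^sup>+s. ennreal (real n * s powr (- real n - 1)) * indicator {c..} s \<partial>lborel) = ennreal (0 - (- (c powr (- real n))))"
  proof (rule nn_integral_FTC_atLeast)
    show "((\<lambda>s. - (s powr (- real n))) has_real_derivative real n * s powr (- real n - 1)) (at s)" if "c \<le> s" for s
      using that assms by (auto intro!: derivative_eq_intros)
    have "((\<lambda>s. s powr (- real n)) \<longlongrightarrow> 0) at_top"
      using assms by (intro tendsto_neg_powr filterlim_ident) auto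
    then show "((\<lambda>s. - (s powr (- real n))) \<longlongrightarrow> 0) at_top" using tendsto_minus by fastforce
  qed auto
  then show ?thesis by simp
qed

lemma nn_integral_head:
  fixes n :: nat and b :: real
  assumes "0 < b" "0 < n"
  shows "(\<integral>\<^sup>+s. ennreal (real n * s ^ (n - 1)) * indicator {0<..<b} s \<partial>lborel) = ennreal (b ^ n)"
proof -
  have "(\<integral>\<^sup>+s. ennreal (real n * s ^ (n - 1)) * indicator {0<..<b} s \<partial>lborel) = (\<integral>\<^sup>+s. ennreal (real n * s ^ (n - 1)) * indicator {0..b} s \<partial>lborel)"
  proof (rule nn_integral_cong_AE)
    have "AE s in lborel. s \<noteq> 0" "AE s in lborel. s \<noteq> b" by (rule AE_lborel_singleton)+
    then show "AE s in lborel. ennreal (real n * s ^ (n - 1)) * indicator {0<..<b} s = ennreal (real n * s ^ (n - 1)) * indicator {0..b} s"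
      by eventually_elim (auto simp: indicator_def)
  qed
  also have "\<dots> = ennreal (b ^ n - 0 ^ n)"
    using assms by (intro nn_integral_FTC_Icc[where F="\<lambda>s. s ^ n"]) (auto intro!: derivative_eq_intros)
  finally show ?thesis using assms by simp
qed

text \<open>
  The identity behind integration in polar coordinates: inserting the integral of
  \<open>n s\<^sup>n\<^sup>-\<^sup>1 |y|\<^sup>n\<close> over \<open>0 < s < 1/|y|\<close>, which is one, and substituting \<open>x = s y\<close> turns
  the volume of the ball of \<open>h\<close> into an integral of a function of degree zero over the Euclidean ball.
\<close>

lemma polar_volume:
  fixes h :: "real^'n \<Rightarrow> real"
  assumes h[measurable]: "h \<in> borel_measurable borel"
    and hom: "\<And>c x. 0 < c \<Longrightarrow> h (c *\<^sub>R x) = c * h x" and pos: "\<And>x. x \<noteq> 0 \<Longrightarrow> 0 < h x"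
  shows "(\<integral>\<^sup>+\<xi>. ennreal (h \<xi> powr (- real CARD('n))) \<partial>surface_measure) = of_nat CARD('n) * emeasure lborel {x. h x \<le> 1}"
proof -
  define n where "n = CARD('n)"
  have n: "0 < n" by (simp add: n_def)
  have h0: "h 0 \<le> 0" using hom[of 2 0] by simp
  let ?B = "ball 0 1 - {0 :: real^'n}"
  define k where "k x s = ennreal (norm x ^ n * (real n * s powr (- real n - 1))) * (if h x \<le> s \<and> norm x < 1 \<and> x \<noteq> 0 then 1 else 0)" for x :: "real^'n" and s :: real
  define m where "m y s = ennreal (norm y ^ n) * (if h y \<le> 1 \<and> y \<noteq> 0 then 1 else 0) * (ennreal (real n * s ^ (n - 1)) * indicator {0<..<1 / norm y} s)" for y :: "real^'n" and s :: real
  have km[measurable]: "case_prod k \<in> borel_measurable (lborel \<Otimes>\<^sub>M lborel)"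
    unfolding k_def by simp
  have mm[measurable]: "case_prod m \<in> borel_measurable (lborel \<Otimes>\<^sub>M lborel)"
  proof -
    have "case_prod m = (\<lambda>(y, s). ennreal (norm y ^ n) * (if h y \<le> 1 \<and> y \<noteq> 0 then 1 else 0) * (ennreal (real n * s ^ (n - 1)) * (if 0 < s \<and> s < 1 / norm y then 1 else 0)))"
      by (auto simp: m_def fun_eq_iff indicator_def)
    then show ?thesis by simp
  qed
  have k1: "(\<integral>\<^sup>+s. k x s \<partial>lborel) = ennreal (h (x /\<^sub>R norm x) powr (- real n)) * indicator ?B x" for x
  proof (cases "x \<in> ?B")
    case True
    then have x: "x \<noteq> 0" by auto
    have "(\<integral>\<^sup>+s. k x s \<partial>lborel) = (\<integral>\<^sup>+s. ennreal (norm x ^ n) * (ennreal (real n * s powr (- real n - 1)) * indicator {h x..} s) \<partial>lborel)"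
      using True by (intro nn_integral_cong) (auto simp: k_def ennreal_mult indicator_def)
    also have "\<dots> = ennreal (norm x ^ n) * ennreal (h x powr (- real n))"
      using nn_integral_tail[OF pos[OF x] n] by (simp add: nn_integral_cmult)
    also have "\<dots> = ennreal (h (x /\<^sub>R norm x) powr (- real n))"
    proof -
      have "h (x /\<^sub>R norm x) = inverse (norm x) * h x" using x by (intro hom) simp
      then have "h (x /\<^sub>R norm x) powr (- real n) = inverse (norm x) powr (- real n) * h x powr (- real n)"
        using pos[OF x] by (simp add: powr_mult)
      also have "inverse (norm x) powr (- real n) = norm x ^ n"
        using x by (simp add: powr_minus inverse_powr powr_realpow)
      finally show ?thesis by (simp add: ennreal_mult)
    qed
    finally show ?thesis using True by simp
  next
    case False
    then have "k x s = 0" for s by (auto simp: k_def)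
    then show ?thesis using False by simp
  qed
  have m1: "(\<integral>\<^sup>+s. m y s \<partial>lborel) = indicator ({x. h x \<le> 1} - {0}) y" for y
  proof (cases "h y \<le> 1 \<and> y \<noteq> 0")
    case True
    then have "(\<integral>\<^sup>+s. m y s \<partial>lborel) = (\<integral>\<^sup>+s. ennreal (norm y ^ n) * (ennreal (real n * s ^ (n - 1)) * indicator {0<..<1 / norm y} s) \<partial>lborel)"
      by (intro nn_integral_cong) (auto simp: m_def)
    also have "\<dots> = ennreal (norm y ^ n) * ennreal ((1 / norm y) ^ n)"
      using nn_integral_head[of "1 / norm y" n] True n by (simp add: nn_integral_cmult)
    also have "\<dots> = 1" using True by (simp add: ennreal_mult[symmetric] power_mult_distrib[symmetric])
    finally show ?thesis using True by simp
  qed (auto simp: m_def)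
  have km_eq: "(\<integral>\<^sup>+x. k x s \<partial>lborel) = (\<integral>\<^sup>+y. m y s \<partial>lborel)" for s
  proof (cases "s > 0")
    case True
    have "(\<lambda>x. k x s) \<in> borel_measurable borel" using km by simp
    then have "(\<integral>\<^sup>+x. k x s \<partial>lborel) = ennreal (s ^ n) * (\<integral>\<^sup>+y. k (s *\<^sub>R y + 0) s \<partial>lborel)"
      using nn_integral_lborel_scale[of "\<lambda>x. k x s" s 0] True by (simp add: n_def)
    also have "\<dots> = (\<integral>\<^sup>+y. ennreal (s ^ n) * k (s *\<^sub>R y) s \<partial>lborel)"
    proof -
      have "(\<lambda>y. k (s *\<^sub>R y) s) \<in> borel_measurable lborel" unfolding k_def by measurable
      then show ?thesis by (simp add: nn_integral_cmult)
    qed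
    also have "\<dots> = (\<integral>\<^sup>+y. m y s \<partial>lborel)"
    proof (rule nn_integral_cong)
      fix y :: "real^'n"
      show "ennreal (s ^ n) * k (s *\<^sub>R y) s = m y s"
      proof (cases "y \<noteq> 0 \<and> h y \<le> 1 \<and> s < 1 / norm y")
        case True': True
        have "s ^ n * (norm (s *\<^sub>R y) ^ n * (real n * s powr (- real n - 1))) = norm y ^ n * (real n * (s powr real n * s powr real n * s powr (- real n - 1)))"
          using True by (simp add: power_mult_distrib powr_realpow)
        also have "s powr real n * s powr real n * s powr (- real n - 1) = s powr real (n - 1)"
          using n by (simp add: powr_add[symmetric] of_nat_diff)
        also have "\<dots> = s ^ (n - 1)" using True by (simp add: powr_realpow)
        finally have eq: "s ^ n * (norm (s *\<^sub>R y) ^ n * (real n * s powr (- real n - 1))) = norm y ^ n * (real n * s ^ (n - 1))" .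
        have "s *\<^sub>R y \<in> ?B" "h (s *\<^sub>R y) \<le> s" using True True' hom[of s y] by (auto simp: field_simps)
        then have "ennreal (s ^ n) * k (s *\<^sub>R y) s = ennreal (s ^ n * (norm (s *\<^sub>R y) ^ n * (real n * s powr (- real n - 1))))"
          using True by (simp add: k_def ennreal_mult)
        also have "\<dots> = m y s" unfolding eq using True True' by (simp add: m_def ennreal_mult)
        finally show ?thesis .
      next
        case False
        have "\<not> (s *\<^sub>R y \<in> ?B \<and> h (s *\<^sub>R y) \<le> s)"
          using True False hom[of s y] by (auto simp: field_simps)
        then have "k (s *\<^sub>R y) s = 0" by (auto simp: k_def)
        moreover have "m y s = 0" using False by (auto simp: m_def indicator_def)
        ultimately show ?thesis by simp
      qed
    qed
    finally show ?thesis .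
  next
    case False
    have "k x s = 0" for x using pos[of x] False by (auto simp: k_def indicator_def)
    moreover have "m y s = 0" for y using False by (auto simp: m_def)
    ultimately show ?thesis by simp
  qed
  have "(\<integral>\<^sup>+\<xi>. ennreal (h \<xi> powr (- real n)) \<partial>surface_measure)
      = of_nat n * (\<integral>\<^sup>+x. ennreal (h (x /\<^sub>R norm x) powr (- real n)) * indicator ?B x \<partial>lborel)"
    unfolding n_def by (rule surface_measure_nn_integral) simp
  also have "(\<integral>\<^sup>+x. ennreal (h (x /\<^sub>R norm x) powr (- real n)) * indicator ?B x \<partial>lborel) = (\<integral>\<^sup>+x. \<integral>\<^sup>+s. k x s \<partial>lborel \<partial>lborel)"
    by (simp add: k1)
  also have "\<dots> = (\<integral>\<^sup>+s. \<integral>\<^sup>+x. k x s \<partial>lborel \<partial>lborel)"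
    by (rule lborel_pair.Fubini'[symmetric]) (rule km)
  also have "\<dots> = (\<integral>\<^sup>+s. \<integral>\<^sup>+y. m y s \<partial>lborel \<partial>lborel)" by (simp add: km_eq)
  also have "\<dots> = (\<integral>\<^sup>+y. \<integral>\<^sup>+s. m y s \<partial>lborel \<partial>lborel)"
    by (rule lborel_pair.Fubini') (rule mm)
  also have "\<dots> = emeasure lborel ({x. h x \<le> 1} - {0})" unfolding m1 by (subst nn_integral_indicator) auto
  also have "\<dots> = emeasure lborel {x. h x \<le> 1}" by (intro emeasure_Diff_null_set) (auto simp: null_sets_def)
  finally show ?thesis by (simp add: n_def)
qed

text \<open>
  A unit vector on which the seminorm is large is a direction in which its unit ball is thin: a line in
  this direction meets the ball in a segment of length at most \<open>2 / h e\<close>. Averaging over translations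
  along \<open>e\<close> turns this into a bound on the volume.
\<close>

lemma seminorm_times_volume_le:
  fixes h :: "real^'n \<Rightarrow> real"
  assumes h[measurable]: "h \<in> borel_measurable borel" and tri: "\<And>x y. h (x + y) \<le> h x + h y"
    and hom: "\<And>c x. h (c *\<^sub>R x) = \<bar>c\<bar> * h x"
    and R: "0 < R" "\<And>x. h x \<le> 1 \<Longrightarrow> norm x \<le> R" and e: "norm e = 1"
  shows "ennreal (h e) * emeasure lborel {x. h x \<le> 1} \<le> ennreal (4 * measure lborel (cball (0 :: real^'n) (2 * R)) / R)"
proof (cases "h e > 0")
  case True
  let ?K = "{x. h x \<le> 1}"
  have K[measurable]: "?K \<in> sets borel" by measurable
  have inner: "(\<integral>\<^sup>+s. indicator ?K (x + s *\<^sub>R e) * indicator {0..R} s \<partial>lborel) \<le> ennreal (4 / h e) * indicator (cball 0 (2 * R)) x" for x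
  proof (cases "\<exists>s\<in>{0..R}. x + s *\<^sub>R e \<in> ?K")
    case True': True
    then obtain t where t: "t \<in> {0..R}" "h (x + t *\<^sub>R e) \<le> 1" by auto
    have sub: "\<bar>s - t\<bar> \<le> 2 / h e" if "h (x + s *\<^sub>R e) \<le> 1" for s
    proof -
      have "h ((x + s *\<^sub>R e) + (-1) *\<^sub>R (x + t *\<^sub>R e)) \<le> h (x + s *\<^sub>R e) + h ((-1) *\<^sub>R (x + t *\<^sub>R e))" by (rule tri)
      also have "(x + s *\<^sub>R e) + (-1) *\<^sub>R (x + t *\<^sub>R e) = (s - t) *\<^sub>R e" by (simp add: algebra_simps)
      finally have "\<bar>s - t\<bar> * h e \<le> 2" using that t hom[of "-1" "x + t *\<^sub>R e"] by (simp add: hom)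
      then show ?thesis using True by (simp add: field_simps)
    qed
    have "(\<integral>\<^sup>+s. indicator ?K (x + s *\<^sub>R e) * indicator {0..R} s \<partial>lborel) \<le> (\<integral>\<^sup>+s. indicator {t - 2 / h e..t + 2 / h e} s \<partial>lborel)"
    proof (intro nn_integral_mono)
      fix s show "indicator ?K (x + s *\<^sub>R e) * indicator {0..R} s \<le> (indicator {t - 2 / h e..t + 2 / h e} s :: ennreal)"
        using sub[of s] by (cases "h (x + s *\<^sub>R e) \<le> 1") (auto simp: indicator_def abs_le_iff)
    qed
    also have "\<dots> = ennreal (4 / h e)" using True by (simp add: field_simps)
    also have "norm x \<le> 2 * R"
    proof -
      have "norm x \<le> norm (x + t *\<^sub>R e) + norm (t *\<^sub>R e)"
        using norm_triangle_ineq4[of "x + t *\<^sub>R e" "t *\<^sub>R e"] by simp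
      also have "\<dots> \<le> R + R" using R(2)[OF t(2)] t(1) e by (intro add_mono) auto
      finally show ?thesis by simp
    qed
    then have "ennreal (4 / h e) = ennreal (4 / h e) * indicator (cball 0 (2 * R)) x" by simp
    finally show ?thesis .
  next
    case False
    then have z: "indicator ?K (x + s *\<^sub>R e) * indicator {0..R} s = (0 :: ennreal)" for s by (auto simp: indicator_def)
    show ?thesis unfolding z by simp
  qed
  have "ennreal R * emeasure lborel ?K = (\<integral>\<^sup>+s. emeasure lborel ?K * indicator {0..R} s \<partial>lborel)"
    using R by (subst nn_integral_cmult_indicator) (auto simp: mult.commute)
  also have "\<dots> = (\<integral>\<^sup>+s. \<integral>\<^sup>+x. indicator ?K (x + s *\<^sub>R e) * indicator {0..R} s \<partial>lborel \<partial>lborel)"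
  proof (rule nn_integral_cong)
    fix s
    have "(\<integral>\<^sup>+x. indicator ?K (x + s *\<^sub>R e) \<partial>lborel) = emeasure lborel ?K"
      using nn_integral_lborel_translate[of "indicator ?K" "s *\<^sub>R e"] by simp
    then show "emeasure lborel ?K * indicator {0..R} s = (\<integral>\<^sup>+x. indicator ?K (x + s *\<^sub>R e) * indicator {0..R} s \<partial>lborel)"
      by (subst nn_integral_multc) auto
  qed
  also have "\<dots> = (\<integral>\<^sup>+x. \<integral>\<^sup>+s. indicator ?K (x + s *\<^sub>R e) * indicator {0..R} s \<partial>lborel \<partial>lborel)"
    by (rule lborel_pair.Fubini') measurable
  also have "\<dots> \<le> (\<integral>\<^sup>+x. ennreal (4 / h e) * indicator (cball (0 :: real^'n) (2 * R)) x \<partial>lborel)"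
    by (intro nn_integral_mono inner)
  also have "\<dots> = ennreal (4 / h e) * ennreal (measure lborel (cball (0 :: real^'n) (2 * R)))"
    using emeasure_bounded_finite[OF bounded_cball, of "0 :: real^'n" "2 * R"]
    by (subst nn_integral_cmult_indicator) (auto simp: emeasure_eq_ennreal_measure)
  finally have "ennreal (h e / R) * (ennreal R * emeasure lborel ?K) \<le> ennreal (h e / R) * (ennreal (4 / h e) * ennreal (measure lborel (cball (0 :: real^'n) (2 * R))))"
    by (rule mult_left_mono) simp
  moreover have "ennreal (h e / R) * (ennreal R * emeasure lborel ?K) = ennreal (h e) * emeasure lborel ?K"
    using True R by (simp add: mult.assoc[symmetric] ennreal_mult[symmetric])
  moreover have "ennreal (h e / R) * (ennreal (4 / h e) * ennreal (measure lborel (cball (0 :: real^'n) (2 * R)))) = ennreal (4 * measure lborel (cball (0 :: real^'n) (2 * R)) / R)"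
    using True R by (simp add: ennreal_mult[symmetric])
  ultimately show ?thesis by simp
next
  case False
  then have "ennreal (h e) = 0" by (simp add: ennreal_neg)
  then show ?thesis by simp
qed

lemma continuous_on_det:
  "continuous_on UNIV (det :: real^'n^'n \<Rightarrow> real)"
  unfolding det_def by (intro continuous_intros)

text \<open>
  An Auerbach basis: points of \<open>K\<close> that maximize the determinant. By Cramer's rule the
  coordinates of a point of \<open>K\<close> are quotients of determinants, with the maximal one in the denominator.
\<close>

lemma max_det_basis:
  fixes K :: "(real^'n) set"
  assumes K: "compact K" and r: "r > 0" "ball 0 r \<subseteq> K"
  shows "\<exists>A :: real^'n^'n. (\<forall>i. A $ i \<in> K) \<and> (\<forall>z\<in>K. \<exists>t. (\<forall>i. \<bar>t i\<bar> \<le> 1) \<and> z = (\<Sum>i\<in>UNIV. t i *\<^sub>R A $ i))"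
proof -
  define S where "S = {A :: real^'n^'n. \<forall>i. A $ i \<in> K}"
  have "closed S"
  proof -
    have "S = (\<Inter>i. (\<lambda>A. A $ i) -` K)" by (auto simp: S_def)
    moreover have "closed ((\<lambda>A :: real^'n^'n. A $ i) -` K)" for i
      by (intro continuous_closed_vimage compact_imp_closed[OF K]) (auto intro!: continuous_intros)
    ultimately show ?thesis by auto
  qed
  moreover have "bounded S"
  proof -
    obtain B where B: "\<And>x. x \<in> K \<Longrightarrow> norm x \<le> B" using compact_imp_bounded[OF K] by (auto simp: bounded_iff)
    have "norm A \<le> (\<Sum>i\<in>(UNIV :: 'n set). B)" if "A \<in> S" for A
    proof -
      have "norm A \<le> (\<Sum>i\<in>UNIV. norm (A $ i))" unfolding norm_vec_def by (rule L2_set_le_sum) auto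
      also have "\<dots> \<le> (\<Sum>i\<in>(UNIV :: 'n set). B)" using that B by (intro sum_mono) (auto simp: S_def)
      finally show ?thesis .
    qed
    then show ?thesis by (auto simp: bounded_iff)
  qed
  ultimately have "compact S" by (simp add: compact_eq_bounded_closed)
  have rI: "(\<chi> i j. if i = j then r / 2 else 0) \<in> S"
  proof -
    have "(\<chi> j. if i = j then r / 2 else 0) = (r / 2) *\<^sub>R axis i 1" for i :: 'n
      by (auto simp: axis_def vec_eq_iff)
    moreover have "(r / 2) *\<^sub>R axis i 1 \<in> K" for i :: 'n using r by (intro subsetD[OF r(2)]) simp
    ultimately show ?thesis by (auto simp: S_def)
  qed
  obtain A where A: "A \<in> S" "\<And>B. B \<in> S \<Longrightarrow> \<bar>det B\<bar> \<le> \<bar>det A\<bar>"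
  proof -
    have "\<exists>A\<in>S. \<forall>B\<in>S. \<bar>det B\<bar> \<le> \<bar>det A\<bar>"
      using rI by (intro continuous_attains_sup \<open>compact S\<close> continuous_intros continuous_on_subset[OF continuous_on_det]) auto
    then show ?thesis using that by auto
  qed
  have "\<bar>det (\<chi> i j. if i = j then r / 2 else 0 :: real^'n^'n)\<bar> > 0"
  proof -
    have "det (\<chi> i j. if i = j then r / 2 else 0 :: real^'n^'n) = (\<Prod>i\<in>(UNIV :: 'n set). r / 2)"
      by (subst det_diagonal) auto
    then show ?thesis using r by simp
  qed
  then have dA: "det A \<noteq> 0" using A(2)[OF rI] by auto
  show ?thesis
  proof (intro exI[of _ A] conjI ballI)
    show "\<forall>i. A $ i \<in> K" using A by (simp add: S_def)
    fix z assume z: "z \<in> K"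
    define t where "t = (\<chi> k. det (\<chi> i j. if j = k then z $ i else transpose A $ i $ j) / det (transpose A))"
    have "transpose A *v t = z" using cramer[of "transpose A" t z] dA by (simp add: t_def det_transpose)
    then have zt: "z = (\<Sum>i\<in>UNIV. t $ i *\<^sub>R A $ i)"
      by (auto simp: vec_eq_iff matrix_vector_mult_def transpose_def mult.commute)
    have "\<bar>t $ k\<bar> \<le> 1" for k
    proof -
      define B where "B = (\<chi> j. if j = k then z else A $ j)"
      have "(\<chi> i j. if j = k then z $ i else transpose A $ i $ j) = transpose B"
        by (auto simp: B_def transpose_def vec_eq_iff)
      then have "t $ k = det B / det A" by (simp add: t_def det_transpose)
      moreover have "B \<in> S" using A z by (auto simp: S_def B_def)
      ultimately show ?thesis using A(2)[of B] dA by (simp add: abs_divide divide_le_eq_1)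
    qed
    then show "\<exists>t. (\<forall>i. \<bar>t i\<bar> \<le> 1) \<and> z = (\<Sum>i\<in>UNIV. t i *\<^sub>R A $ i)"
      using zt by (intro exI[of _ "\<lambda>i. t $ i"]) auto
  qed
qed

section \<open>Directional derivatives and translations\<close>

definition dnorm :: "real \<Rightarrow> (real^'n \<Rightarrow> real) \<Rightarrow> real^'n \<Rightarrow> real" where
  "dnorm p f \<xi> = lpn p lborel (\<lambda>x. gradient f x \<bullet> \<xi>)"

lemma dnorm_nonneg [simp]: "0 \<le> dnorm p f \<xi>"
  by (simp add: dnorm_def)

lemma dnorm_triangle:
  assumes "f \<in> test_functions \<Omega>" "1 \<le> p"
  shows "dnorm p f (x + y) \<le> dnorm p f x + dnorm p f y"
  unfolding dnorm_def inner_add_right using assms by (intro minkowski test_in_Lp) auto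

lemma dnorm_scaleR:
  assumes "f \<in> test_functions \<Omega>" "1 \<le> p"
  shows "dnorm p f (c *\<^sub>R x) = \<bar>c\<bar> * dnorm p f x"
  using in_Lp_scaleR(2)[OF test_in_Lp(3)[OF assms(1)], of p c x] assms by (simp add: dnorm_def)

lemma dnorm_le:
  assumes "f \<in> test_functions \<Omega>" "1 \<le> p"
  shows "dnorm p f \<xi> \<le> lpn p lborel (gradient f) * norm \<xi>"
proof -
  have p: "0 < p" using assms by simp
  have "dnorm p f \<xi> \<le> lpn p lborel (\<lambda>x. norm \<xi> *\<^sub>R gradient f x)"
    unfolding dnorm_def
  proof (rule in_Lp_mono(2))
    show "in_Lp p lborel (\<lambda>x. norm \<xi> *\<^sub>R gradient f x)" by (intro in_Lp_scaleR(1) test_in_Lp(2)[OF assms(1)] p)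
    show "(\<lambda>x. gradient f x \<bullet> \<xi>) \<in> borel_measurable lborel" using in_LpD(1)[OF test_in_Lp(3)[OF assms(1) p]] .
    show "AE x in lborel. norm (gradient f x \<bullet> \<xi>) \<le> norm (norm \<xi> *\<^sub>R gradient f x)"
    proof (rule AE_I2)
      show "norm (gradient f x \<bullet> \<xi>) \<le> norm (norm \<xi> *\<^sub>R gradient f x)" for x
        using Cauchy_Schwarz_ineq2[of "gradient f x" \<xi>] by (simp add: mult.commute)
    qed
  qed (rule p)
  also have "\<dots> = lpn p lborel (gradient f) * norm \<xi>"
    using in_Lp_scaleR(2)[OF test_in_Lp(2)[OF assms(1) p] p] by simp
  finally show ?thesis .
qed

lemma dnorm_Lipschitz:
  assumes "f \<in> test_functions \<Omega>" "1 \<le> p"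
  shows "\<bar>dnorm p f x - dnorm p f y\<bar> \<le> dnorm p f (x - y)"
proof -
  have "dnorm p f x \<le> dnorm p f (x - y) + dnorm p f y" using dnorm_triangle[OF assms, of "x - y" y] by simp
  moreover have "dnorm p f y \<le> dnorm p f (y - x) + dnorm p f x" using dnorm_triangle[OF assms, of "y - x" x] by simp
  moreover have "dnorm p f (y - x) = dnorm p f (x - y)" using dnorm_scaleR[OF assms, of "-1" "x - y"] by simp
  ultimately show ?thesis by linarith
qed

lemma dnorm_continuous:
  assumes "f \<in> test_functions \<Omega>" "1 \<le> p"
  shows "continuous_on S (dnorm p f)"
proof -
  have "(lpn p lborel (gradient f))-lipschitz_on S (dnorm p f)"
    using dnorm_Lipschitz[OF assms] dnorm_le[OF assms]
    by (intro lipschitz_onI) (auto simp: dist_norm intro: order_trans)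
  then show ?thesis by (rule lipschitz_on_continuous_on)
qed

lemma dnorm_borel: "f \<in> test_functions \<Omega> \<Longrightarrow> 1 \<le> p \<Longrightarrow> dnorm p f \<in> borel_measurable borel"
  by (intro borel_measurable_continuous_onI dnorm_continuous)

lemma dnorm_add_fun:
  assumes "f \<in> test_functions \<Omega>" "g \<in> test_functions \<Omega>" "1 \<le> p"
  shows "dnorm p (\<lambda>x. f x + g x) \<xi> \<le> dnorm p f \<xi> + dnorm p g \<xi>"
  unfolding dnorm_def test_add(2)[OF assms(1,2)] inner_add_left using assms by (intro minkowski test_in_Lp) auto

lemma dnorm_cmult_fun:
  assumes "f \<in> test_functions \<Omega>" "1 \<le> p"
  shows "dnorm p (\<lambda>x. c * f x) \<xi> = \<bar>c\<bar> * dnorm p f \<xi>"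
  using in_Lp_scaleR(2)[OF test_in_Lp(3)[OF assms(1)], of p c \<xi>] assms by (simp add: dnorm_def test_cmult(2))

lemma dnorm_diff_fun:
  assumes "f \<in> test_functions \<Omega>" "g \<in> test_functions \<Omega>" "1 \<le> p"
  shows "dnorm p (\<lambda>x. f x - g x) \<xi> \<le> dnorm p f \<xi> + dnorm p g \<xi>"
  unfolding dnorm_def test_diff(2)[OF assms(1,2)] inner_diff_left using assms by (intro minkowski_diff test_in_Lp) auto

text \<open>
  Jensen's inequality followed by Tonelli's theorem.
\<close>

lemma Lp_of_average:
  fixes F :: "'a::euclidean_space \<Rightarrow> 'c::euclidean_space \<Rightarrow> real"
  assumes fin: "finite_measure N" and N: "sets N = sets borel"
    and F[measurable]: "case_prod F \<in> borel_measurable (borel \<Otimes>\<^sub>M borel)" and nn: "\<And>x y. 0 \<le> F x y" and p: "1 \<le> p"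
  shows "(\<integral>\<^sup>+x. ennreal ((\<integral>y. F x y \<partial>N) powr p) \<partial>lborel)
     \<le> ennreal (measure N (space N) powr (p - 1)) * (\<integral>\<^sup>+y. \<integral>\<^sup>+x. ennreal (F x y powr p) \<partial>lborel \<partial>N)"
proof -
  interpret N: finite_measure N by fact
  interpret pair_sigma_finite lborel N ..
  have [measurable_cong]: "sets N = sets borel" by (rule N)
  have "(\<integral>\<^sup>+x. ennreal ((\<integral>y. F x y \<partial>N) powr p) \<partial>lborel)
     \<le> (\<integral>\<^sup>+x. ennreal (measure N (space N) powr (p - 1)) * (\<integral>\<^sup>+y. ennreal (F x y powr p) \<partial>N) \<partial>lborel)"
    by (intro nn_integral_mono jensen_powr fin p nn) measurable
  also have "\<dots> = ennreal (measure N (space N) powr (p - 1)) * (\<integral>\<^sup>+x. (\<integral>\<^sup>+y. ennreal (F x y powr p) \<partial>N) \<partial>lborel)"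
    by (rule nn_integral_cmult) measurable
  also have "(\<integral>\<^sup>+x. (\<integral>\<^sup>+y. ennreal (F x y powr p) \<partial>N) \<partial>lborel) = (\<integral>\<^sup>+y. \<integral>\<^sup>+x. ennreal (F x y powr p) \<partial>lborel \<partial>N)"
    by (rule Fubini'[symmetric]) measurable
  finally show ?thesis .
qed

lemma test_FTC:
  assumes f: "f \<in> test_functions \<Omega>"
  shows "(\<integral>s. gradient f (x + s *\<^sub>R z) \<bullet> z \<partial>density lborel (indicator {0..1::real})) = f (x + z) - f x"
proof -
  have m: "(\<lambda>s. gradient f (x + s *\<^sub>R z) \<bullet> z) \<in> borel_measurable borel"
    by (intro borel_measurable_continuous_onI continuous_intros continuous_on_compose2[OF test_gradient_continuous[OF f, of UNIV]]) auto
  have "(\<integral>s. gradient f (x + s *\<^sub>R z) \<bullet> z \<partial>density lborel (indicator {0..1::real})) = (\<integral>s. indicator {0..1} s *\<^sub>R (gradient f (x + s *\<^sub>R z) \<bullet> z) \<partial>lborel)"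
    using m by (subst integral_density[symmetric]) (auto simp: ennreal_indicator)
  also have "\<dots> = f (x + 1 *\<^sub>R z) - f (x + 0 *\<^sub>R z)"
  proof (rule integral_FTC_Icc)
    fix s :: real
    have "((\<lambda>s. f (x + s *\<^sub>R z)) has_derivative (\<lambda>t. gradient f (x + s *\<^sub>R z) \<bullet> (t *\<^sub>R z))) (at s)"
      by (rule has_derivative_compose[OF _ test_has_derivative[OF f]]) (auto intro!: derivative_eq_intros)
    then show "((\<lambda>s. f (x + s *\<^sub>R z)) has_vector_derivative gradient f (x + s *\<^sub>R z) \<bullet> z) (at s within {0..1})"
      unfolding has_vector_derivative_def by (simp add: has_derivative_at_withinI)
  qed (auto intro!: continuous_intros continuous_on_compose2[OF test_gradient_continuous[OF f, of UNIV]])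
  finally show ?thesis by simp
qed

lemma finite_measure_density_indicator:
  assumes "bounded S" "S \<in> sets borel"
  shows "finite_measure (density lborel (indicator S))" "measure (density lborel (indicator S)) UNIV = measure lborel S"
proof -
  have "emeasure lborel S < \<infinity>" using assms(1) by (rule emeasure_bounded_finite)
  moreover have e: "emeasure (density lborel (indicator S)) UNIV = emeasure lborel S"
    using assms by (subst emeasure_density) auto
  ultimately show "finite_measure (density lborel (indicator S))" by (intro finite_measureI) auto
  show "measure (density lborel (indicator S)) UNIV = measure lborel S" using e by (simp add: measure_def)
qed

text \<open>
  The increment is the integral of the directional derivative along a segment, and Lebesgue measure is
  invariant under translation.
\<close>

lemma translation_estimate:
  fixes f :: "real^'n \<Rightarrow> real"
  assumes f: "f \<in> test_functions \<Omega>" and p: "1 \<le> p"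
  shows "in_Lp p lborel (\<lambda>x. f (x + z) - f x)" "lpn p lborel (\<lambda>x. f (x + z) - f x) \<le> dnorm p f z"
proof -
  let ?N = "density lborel (indicator {0..1::real})"
  have fm: "finite_measure ?N" "measure ?N UNIV = 1"
    using finite_measure_density_indicator[of "{0..1::real}"] by auto
  have [measurable]: "gradient f \<in> borel_measurable borel" "f \<in> borel_measurable borel"
    using gradient_borel[OF f] test_borel[OF f] by auto
  have pt: "\<bar>f (x + z) - f x\<bar> \<le> (\<integral>s. \<bar>gradient f (x + s *\<^sub>R z) \<bullet> z\<bar> \<partial>?N)" for x
    unfolding test_FTC[OF f, symmetric] using integral_norm_bound[of ?N "\<lambda>s. gradient f (x + s *\<^sub>R z) \<bullet> z"] by simp
  have "(\<integral>\<^sup>+x. ennreal (norm (f (x + z) - f x) powr p) \<partial>lborel) \<le> (\<integral>\<^sup>+x. ennreal ((\<integral>s. \<bar>gradient f (x + s *\<^sub>R z) \<bullet> z\<bar> \<partial>?N) powr p) \<partial>lborel)"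
    using pt p by (intro nn_integral_mono ennreal_leI powr_mono2) auto
  also have "\<dots> \<le> ennreal (measure ?N (space ?N) powr (p - 1)) * (\<integral>\<^sup>+s. \<integral>\<^sup>+x. ennreal (\<bar>gradient f (x + s *\<^sub>R z) \<bullet> z\<bar> powr p) \<partial>lborel \<partial>?N)"
    by (rule Lp_of_average[OF fm(1)]) (use p in \<open>auto\<close>)
  also have "(\<lambda>s. \<integral>\<^sup>+x. ennreal (\<bar>gradient f (x + s *\<^sub>R z) \<bullet> z\<bar> powr p) \<partial>lborel) = (\<lambda>s. ennreal (dnorm p f z powr p))"
  proof (rule ext)
    fix s
    have "(\<integral>\<^sup>+x. ennreal (\<bar>gradient f (x + s *\<^sub>R z) \<bullet> z\<bar> powr p) \<partial>lborel) = (\<integral>\<^sup>+x. ennreal (\<bar>gradient f x \<bullet> z\<bar> powr p) \<partial>lborel)"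
      by (rule nn_integral_lborel_translate[of "\<lambda>x. ennreal (\<bar>gradient f x \<bullet> z\<bar> powr p)"]) simp
    also have "\<dots> = ennreal (dnorm p f z powr p)"
      using nn_integral_in_Lp[OF test_in_Lp(3)[OF f], of p z] p by (simp add: dnorm_def)
    finally show "(\<integral>\<^sup>+x. ennreal (\<bar>gradient f (x + s *\<^sub>R z) \<bullet> z\<bar> powr p) \<partial>lborel) = ennreal (dnorm p f z powr p)" .
  qed
  also have "ennreal (measure ?N (space ?N) powr (p - 1)) * (\<integral>\<^sup>+s. ennreal (dnorm p f z powr p) \<partial>?N) = ennreal (dnorm p f z powr p)"
    using fm finite_measure.emeasure_eq_measure[OF fm(1), of UNIV] by simp
  finally have "(\<integral>\<^sup>+x. ennreal (norm (f (x + z) - f x) powr p) \<partial>lborel) \<le> ennreal (dnorm p f z powr p)" .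
  then show "in_Lp p lborel (\<lambda>x. f (x + z) - f x)" "lpn p lborel (\<lambda>x. f (x + z) - f x) \<le> dnorm p f z"
    using p by (auto intro!: in_LpI_bound)
qed

text \<open>
  A translation by a vector of length \<open>2 R\<close> moves \<open>\<Omega>\<close> off itself, so at each point at least one of \<open>f\<close> and its
  translate vanishes and \<open>f\<close> is bounded by the increment. Only one direction enters, which is
  what makes the estimate useful for an energy that averages over directions.
\<close>

lemma directional_Poincare:
  fixes f :: "real^'n \<Rightarrow> real"
  assumes f: "f \<in> test_functions \<Omega>" and p: "1 \<le> p" and \<Omega>: "\<Omega> \<subseteq> ball 0 R" and R: "0 < R"
  shows "lpn p lborel f * norm \<xi> \<le> 2 * R * dnorm p f \<xi>"
proof (cases "\<xi> = 0")
  case False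
  \<comment> \<open>A translation in direction \<open>\<xi>\<close> by the diameter of the ball.\<close>
  define z where "z = (2 * R / norm \<xi>) *\<^sub>R \<xi>"
  have nz: "norm z = 2 * R" using False R by (simp add: z_def)
  have "norm (f x) \<le> norm (f (x + z) - f x)" for x
  proof (cases "x \<in> \<Omega>")
    case True
    have "norm z \<le> norm (x + z) + norm x" using norm_triangle_ineq4[of "x + z" x] by simp
    moreover have "norm x < R" using True \<Omega> by auto
    ultimately have "x + z \<notin> \<Omega>" using nz \<Omega> by force
    then show ?thesis using test_outside(1)[OF f] by simp
  qed (use test_outside(1)[OF f] in auto)
  then have "lpn p lborel f \<le> lpn p lborel (\<lambda>x. f (x + z) - f x)"
    using in_Lp_mono(2)[OF translation_estimate(1)[OF f p], of f z] test_borel[OF f] p by auto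
  also have "\<dots> \<le> dnorm p f z" by (rule translation_estimate(2)[OF f p])
  also have "\<dots> = 2 * R / norm \<xi> * dnorm p f \<xi>" unfolding z_def using R by (simp add: dnorm_scaleR[OF f p])
  finally show ?thesis using False by (simp add: field_simps)
qed (use R in simp)

section \<open>The subcritical affine Sobolev inequality\<close>

text \<open>
  The interpolation \<open>F powr r = F powr p * (F powr p) powr (r / p - 1)\<close>.
\<close>

lemma Lr_from_Lp_and_sup:
  fixes F :: "'a \<Rightarrow> real"
  assumes [measurable]: "F \<in> borel_measurable M" and nn: "\<And>x. 0 \<le> F x" and p: "0 < p" "p \<le> r"
    and sup: "\<And>x. F x powr p \<le> S" and int: "(\<integral>\<^sup>+x. ennreal (F x powr p) \<partial>M) \<le> ennreal I" and I: "0 \<le> I"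
  shows "(\<integral>\<^sup>+x. ennreal (F x powr r) \<partial>M) \<le> ennreal (S powr (r / p - 1) * I)"
proof -
  have "(\<integral>\<^sup>+x. ennreal (F x powr r) \<partial>M) \<le> (\<integral>\<^sup>+x. ennreal (S powr (r / p - 1)) * ennreal (F x powr p) \<partial>M)"
  proof (rule nn_integral_mono)
    fix x
    have "F x powr r = (F x powr p) powr (r / p - 1) * F x powr p"
    proof -
      have "p * (r / p - 1) = r - p" using p by (simp add: field_simps)
      then have "(F x powr p) powr (r / p - 1) = F x powr (r - p)" by (simp add: powr_powr)
      then show ?thesis by (simp add: powr_add[symmetric])
    qed
    also have "\<dots> \<le> S powr (r / p - 1) * F x powr p"
      using p by (intro mult_right_mono powr_mono2 sup) (auto simp: field_simps)
    finally show "ennreal (F x powr r) \<le> ennreal (S powr (r / p - 1)) * ennreal (F x powr p)"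
      by (simp add: ennreal_mult[symmetric] ennreal_leI)
  qed
  also have "\<dots> = ennreal (S powr (r / p - 1)) * (\<integral>\<^sup>+x. ennreal (F x powr p) \<partial>M)" by (rule nn_integral_cmult) simp
  also have "\<dots> \<le> ennreal (S powr (r / p - 1)) * ennreal I" by (intro mult_left_mono int) simp
  finally show ?thesis using I by (simp add: ennreal_mult)
qed

text \<open>
  Averaging improves integrability: Jensen's inequality bounds the \<open>p\<close>-th power of the average both pointwise
  and in the mean, and interpolation gives the \<open>r\<close>-th power.
\<close>

lemma Lr_of_average:
  fixes F :: "'a::euclidean_space \<Rightarrow> 'c::euclidean_space \<Rightarrow> real"
  assumes fin: "finite_measure N" and N: "sets N = sets borel" and V: "measure N (space N) = V"
    and F[measurable]: "case_prod F \<in> borel_measurable (borel \<Otimes>\<^sub>M borel)" and nn: "\<And>x y. 0 \<le> F x y"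
    and p: "1 \<le> p" "p \<le> r" and S: "0 \<le> S" and I: "0 \<le> I"
    and sup: "\<And>x. (\<integral>\<^sup>+y. ennreal (F x y powr p) \<partial>N) \<le> ennreal S"
    and int: "(\<integral>\<^sup>+y. \<integral>\<^sup>+x. ennreal (F x y powr p) \<partial>lborel \<partial>N) \<le> ennreal I"
  shows "(\<integral>\<^sup>+x. ennreal ((\<integral>y. F x y \<partial>N) powr r) \<partial>lborel) \<le> ennreal ((V powr (p - 1) * S) powr (r / p - 1) * (V powr (p - 1) * I))"
proof (rule Lr_from_Lp_and_sup)
  interpret N: finite_measure N by fact
  have [measurable_cong]: "sets N = sets borel" by (rule N)
  show "(\<lambda>x. \<integral>y. F x y \<partial>N) \<in> borel_measurable lborel" by measurable
  show "0 \<le> (\<integral>y. F x y \<partial>N)" for x using nn by (simp add: integral_nonneg_AE)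
  show "(\<integral>y. F x y \<partial>N) powr p \<le> V powr (p - 1) * S" for x
  proof -
    have "ennreal ((\<integral>y. F x y \<partial>N) powr p) \<le> ennreal (V powr (p - 1)) * (\<integral>\<^sup>+y. ennreal (F x y powr p) \<partial>N)"
      unfolding V[symmetric] by (intro jensen_powr fin p nn) measurable
    also have "\<dots> \<le> ennreal (V powr (p - 1)) * ennreal S" by (intro mult_left_mono sup) simp
    finally show ?thesis using S by (simp add: ennreal_mult[symmetric])
  qed
  have "(\<integral>\<^sup>+x. ennreal ((\<integral>y. F x y \<partial>N) powr p) \<partial>lborel) \<le> ennreal (V powr (p - 1)) * (\<integral>\<^sup>+y. \<integral>\<^sup>+x. ennreal (F x y powr p) \<partial>lborel \<partial>N)"
    unfolding V[symmetric] by (rule Lp_of_average[OF fin N F nn p(1)])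
  also have "\<dots> \<le> ennreal (V powr (p - 1)) * ennreal I" by (intro mult_left_mono int) simp
  finally show "(\<integral>\<^sup>+x. ennreal ((\<integral>y. F x y \<partial>N) powr p) \<partial>lborel) \<le> ennreal (V powr (p - 1) * I)"
    using I by (simp add: ennreal_mult)
qed (use p I in auto)

text \<open>
  A variant for functions whose integral may be infinite.
\<close>

lemma jensen_powr_nn:
  fixes f :: "'a \<Rightarrow> real"
  assumes fin: "finite_measure N" and p: "1 \<le> p" and f[measurable]: "f \<in> borel_measurable N" and nn: "\<And>x. 0 \<le> f x"
    and c: "0 \<le> c" "ennreal c \<le> (\<integral>\<^sup>+x. ennreal (f x) \<partial>N)"
  shows "ennreal (c powr p) \<le> ennreal (measure N (space N) powr (p - 1)) * (\<integral>\<^sup>+x. ennreal (f x powr p) \<partial>N)"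
proof (cases "integrable N f")
  case True
  then have "ennreal c \<le> ennreal (\<integral>x. f x \<partial>N)" using c nn by (simp add: nn_integral_eq_integral)
  then have "c \<le> (\<integral>x. f x \<partial>N)" using nn by (subst (asm) ennreal_le_iff) (auto intro: integral_nonneg_AE)
  then have "ennreal (c powr p) \<le> ennreal ((\<integral>x. f x \<partial>N) powr p)"
    using c p by (intro ennreal_leI powr_mono2) auto
  also have "\<dots> \<le> ennreal (measure N (space N) powr (p - 1)) * (\<integral>\<^sup>+x. ennreal (f x powr p) \<partial>N)"
    by (rule jensen_powr[OF fin p f nn])
  finally show ?thesis .
next
  case False
  interpret finite_measure N by fact
  have inf: "(\<integral>\<^sup>+x. ennreal (f x) \<partial>N) = \<infinity>"
    using False nn by (subst (asm) integrable_iff_bounded) (auto simp: less_top[symmetric])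
  have m: "measure N (space N) > 0"
  proof (rule ccontr)
    assume "\<not> measure N (space N) > 0"
    then have "emeasure N (space N) = 0" by (simp add: less_le emeasure_eq_measure)
    then have "AE x in N. ennreal (f x) = 0" by (intro AE_I[where N="space N"]) auto
    then have "(\<integral>\<^sup>+x. ennreal (f x) \<partial>N) = (\<integral>\<^sup>+x. 0 \<partial>N)" by (rule nn_integral_cong_AE)
    with inf show False by simp
  qed
  have le: "f x \<le> 1 + f x powr p" for x
  proof (cases "f x \<le> 1")
    case False
    then have "f x powr 1 \<le> f x powr p" using p by (intro powr_mono) auto
    then show ?thesis using False by simp
  qed (simp add: add_increasing2)
  have "(\<integral>\<^sup>+x. ennreal (f x) \<partial>N) \<le> (\<integral>\<^sup>+x. 1 + ennreal (f x powr p) \<partial>N)"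
    using le by (intro nn_integral_mono) (metis ennreal_1 ennreal_leI ennreal_plus powr_ge_zero zero_le_one)
  also have "\<dots> = emeasure N (space N) + (\<integral>\<^sup>+x. ennreal (f x powr p) \<partial>N)" by (subst nn_integral_add) auto
  finally have "(\<integral>\<^sup>+x. ennreal (f x powr p) \<partial>N) = \<infinity>" using inf finite_emeasure_space by (auto simp: top_unique)
  then show ?thesis using m by (simp add: ennreal_mult_top)
qed

lemma nn_integral_powr_unit_interval:
  assumes "-1 < (a :: real)"
  shows "(\<integral>\<^sup>+s. ennreal (indicator {0..1} s * s powr a) \<partial>lborel) = ennreal (1 / (a + 1))"
  using nn_integral_has_integral_lebesgue[OF _ has_integral_powr_from_0[OF assms, of 1]] by simp

lemma lpn_sum_le:
  assumes "finite I" "1 \<le> p" "\<And>i. i \<in> I \<Longrightarrow> in_Lp p M (f i)"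
  shows "in_Lp p M (\<lambda>x. \<Sum>i\<in>I. f i x) \<and> lpn p M (\<lambda>x. \<Sum>i\<in>I. f i x) \<le> (\<Sum>i\<in>I. lpn p M (f i))"
  using assms(1,3)
proof (induction I rule: finite_induct)
  case empty
  then show ?case by (simp add: in_Lp_zero)
next
  case (insert i I)
  then show ?case using minkowski[of p M "f i" "\<lambda>x. \<Sum>i\<in>I. f i x"] assms(2) by force
qed

text \<open>
  The exponent \<open>\<alpha>\<close> is the weight in the one-dimensional Hoelder inequality along the rays; a suitable
  value exists exactly because \<open>r\<close> is below the critical exponent.
\<close>

lemma Sobolev_weight_exists:
  fixes n p r :: real
  assumes "1 < p" "p < n" "p < r" "r < critical_exponent n p"
  obtains \<alpha> where "\<alpha> < 1" "-1 < \<alpha> * (r - 1) - n * (r / p - 1)"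
proof -
  have "r * (n - p) < n * p" using assms by (simp add: critical_exponent_def field_simps)
  then have "n * (r / p - 1) < r" using assms by (simp add: field_simps)
  then have lt: "(n * (r / p - 1) - 1) / (r - 1) < 1" using assms by (simp add: field_simps)
  then obtain \<alpha> where a: "(n * (r / p - 1) - 1) / (r - 1) < \<alpha>" "\<alpha> < 1" using dense by blast
  have "n * (r / p - 1) - 1 < \<alpha> * (r - 1)" using a(1) assms by (simp add: pos_divide_less_eq)
  then show ?thesis using a by (intro that[of \<alpha>]) auto
qed

text \<open>
  Write \<open>f x\<close> as \<open>f (x + z)\<close> minus the integral of the derivative along the segment from \<open>x\<close> to
  \<open>x + z\<close>, and average over \<open>z\<close> in the unit ball \<open>K\<close> of \<open>dnorm p f\<close>. Both averages are estimated
  in \<open>L\<^sup>r\<close> by \<open>Lr_of_average\<close>. For the pointwise bound on the average of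
  \<open>gradient f (x + s *\<^sub>R z) \<bullet> z\<close> one needs a single function in \<open>L\<^sup>p\<close> that dominates the derivatives in all
  directions of \<open>K\<close> at once; an Auerbach basis provides it with a norm of at most \<open>n\<close>,
  whatever the shape of \<open>K\<close>. Hence only the volume of \<open>K\<close> enters the constant. The substitution
  \<open>s *\<^sub>R z\<close> costs a power of \<open>s\<close>, whose integrability at zero is the second condition on \<open>\<alpha>\<close>.
\<close>

lemma affine_Sobolev_normalized:
  fixes f :: "real^'n \<Rightarrow> real"
  assumes p: "1 < p" "p < real CARD('n)" "p < r" and \<alpha>: "\<alpha> < 1" "-1 < \<alpha> * (r - 1) - real CARD('n) * (r / p - 1)"
    and f: "f \<in> test_functions \<Omega>" and \<Omega>: "\<Omega> \<subseteq> ball 0 R" and R: "0 < R" and f1: "lpn p lborel f = 1"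
  defines "V \<equiv> measure lborel {z. dnorm p f z \<le> 1}"
  shows "lpn r lborel f powr r \<le> 2 powr r * (1 + (1 / (1 - \<alpha>)) powr (r - 1) * real CARD('n) powr (r - p) / (\<alpha> * (r - 1) - real CARD('n) * (r / p - 1) + 1)) * V powr (1 - r / p)"
proof -
  define n where "n = real CARD('n)"
  have n: "n \<ge> 1" unfolding n_def by (metis One_nat_def Suc_leI of_nat_1 of_nat_le_iff zero_less_card_finite)
  have p1: "1 \<le> p" "0 < p" "1 < r" "0 < r" using p by auto
  define K where "K = {z. dnorm p f z \<le> 1}"
  have gm[measurable]: "gradient f \<in> borel_measurable borel" "f \<in> borel_measurable borel"
    using gradient_borel[OF f] test_borel[OF f] by auto
  obtain B where B: "0 \<le> B" "\<And>x. norm (gradient f x) \<le> B" using test_gradient_bounded[OF f] by metis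
  have Kbd: "norm z \<le> 2 * R" if "z \<in> K" for z
  proof -
    have "norm z \<le> 2 * R * dnorm p f z" using directional_Poincare[OF f p1(1) \<Omega> R, of z] f1 by simp
    also have "\<dots> \<le> 2 * R * 1" using that R by (intro mult_left_mono) (auto simp: K_def)
    finally show ?thesis by simp
  qed
  have Kcl: "closed K" unfolding K_def by (intro closed_Collect_le dnorm_continuous[OF f p1(1)] continuous_on_const)
  have Kb: "bounded K" using Kbd by (auto simp: bounded_iff)
  have Kc: "compact K" using Kcl Kb by (simp add: compact_eq_bounded_closed)
  have Km[measurable]: "K \<in> sets borel" using Kcl by simp
  define G where "G = lpn p lborel (gradient f) + 1"
  have G: "G > 0" unfolding G_def by (smt (verit) lpn_nonneg)
  have Kball: "ball 0 (1 / G) \<subseteq> K"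
  proof
    fix z :: "real^'n" assume "z \<in> ball 0 (1 / G)"
    then have "norm z * G \<le> 1" using G by (simp add: field_simps)
    moreover have "dnorm p f z \<le> lpn p lborel (gradient f) * norm z" by (rule dnorm_le[OF f p1(1)])
    moreover have "lpn p lborel (gradient f) * norm z \<le> G * norm z" by (intro mult_right_mono) (auto simp: G_def)
    ultimately show "z \<in> K" by (simp add: K_def mult.commute)
  qed
  have V: "V > 0"
  proof -
    have "0 < measure lborel (ball (0 :: real^'n) (1 / G))" using G by (simp add: content_ball_pos)
    also have "\<dots> \<le> measure lborel K"
      using Kball emeasure_bounded_finite[OF Kb] by (intro measure_mono_fmeasurable) (auto simp: fmeasurable_def)
    finally show ?thesis by (simp add: V_def K_def)
  qed
  define N where "N = density lborel (indicator K)"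
  have N: "finite_measure N" "measure N UNIV = V" "sets N = sets borel" "space N = UNIV"
    using finite_measure_density_indicator[OF Kb Km] by (auto simp: N_def V_def K_def)
  note [measurable_cong] = N(3)
  interpret N: finite_measure N by (rule N)
  define N1 where "N1 = density lborel (indicator {0..1::real})"
  have N1: "finite_measure N1" "measure N1 UNIV = 1" "sets N1 = sets borel" "space N1 = UNIV"
    using finite_measure_density_indicator[of "{0..1::real}"] by (auto simp: N1_def)
  note [measurable_cong] = N1(3)
  interpret N1: finite_measure N1 by (rule N1)
  have nnN: "(\<integral>\<^sup>+z. F z \<partial>N) = (\<integral>\<^sup>+z. indicator K z * F z \<partial>lborel)" if "F \<in> borel_measurable borel" for F
    unfolding N_def using that by (subst nn_integral_density) auto
  have intN: "integrable N F" if "continuous_on UNIV F" for F :: "real^'n \<Rightarrow> real"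
  proof -
    have "integrable lborel (\<lambda>z. indicator K z *\<^sub>R F z)" using that Kc by (intro borel_integrable_compact) (auto intro: continuous_on_subset)
    then have "integrable (density lborel (\<lambda>z. ennreal (indicator K z))) F"
      using that by (subst integrable_density) (auto intro: borel_measurable_continuous_onI)
    then show ?thesis by (simp add: N_def ennreal_indicator)
  qed
  \<comment> \<open>The function W dominates the derivatives of f in all directions of K.\<close>
  obtain A :: "real^'n^'n" where A: "\<And>i. A $ i \<in> K" "\<And>z. z \<in> K \<Longrightarrow> \<exists>t. (\<forall>i. \<bar>t i\<bar> \<le> 1) \<and> z = (\<Sum>i\<in>UNIV. t i *\<^sub>R A $ i)"
    using max_det_basis[OF Kc _ Kball] G by auto
  define W where "W x = (\<Sum>i\<in>UNIV. \<bar>gradient f x \<bullet> A $ i\<bar>)" for x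
  have W0: "0 \<le> W x" for x unfolding W_def by (intro sum_nonneg) auto
  have Wm[measurable]: "W \<in> borel_measurable borel" unfolding W_def by measurable
  have Wbound: "\<bar>gradient f x \<bullet> z\<bar> \<le> W x" if zK: "z \<in> K" for x z
  proof -
    obtain t where t: "\<And>i. \<bar>t i\<bar> \<le> 1" "z = (\<Sum>i\<in>UNIV. t i *\<^sub>R A $ i)" using A(2)[OF zK] by auto
    have "\<bar>gradient f x \<bullet> z\<bar> = \<bar>\<Sum>i\<in>UNIV. t i * (gradient f x \<bullet> A $ i)\<bar>" by (simp add: t(2) inner_sum_right)
    also have "\<dots> \<le> (\<Sum>i\<in>UNIV. \<bar>t i * (gradient f x \<bullet> A $ i)\<bar>)" by (rule sum_abs)
    also have "\<dots> \<le> W x" unfolding W_def using t(1) by (intro sum_mono) (auto simp: abs_mult intro: mult_left_le_one_le)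
    finally show ?thesis .
  qed
  have WLp: "(\<integral>\<^sup>+x. ennreal (W x powr p) \<partial>lborel) \<le> ennreal (n powr p)"
  proof -
    have in1: "in_Lp p lborel (\<lambda>x. \<bar>gradient f x \<bullet> A $ i\<bar>)" for i
      using test_in_Lp(3)[OF f p1(2)] by (simp add: in_Lp_def)
    have "lpn p lborel (\<lambda>x. \<bar>gradient f x \<bullet> A $ i\<bar>) = dnorm p f (A $ i)" for i by (simp add: lpn_def dnorm_def)
    moreover have "dnorm p f (A $ i) \<le> 1" for i using A(1)[of i] by (simp add: K_def)
    ultimately have "(\<Sum>i\<in>UNIV. lpn p lborel (\<lambda>x. \<bar>gradient f x \<bullet> A $ i\<bar>)) \<le> (\<Sum>i\<in>(UNIV :: 'n set). 1)" by (intro sum_mono) simp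
    then have W: "in_Lp p lborel W" "lpn p lborel W \<le> n"
      using lpn_sum_le[of UNIV p lborel "\<lambda>i x. \<bar>gradient f x \<bullet> A $ i\<bar>"] in1 p1 by (auto simp: W_def[abs_def] n_def)
    then have "ennreal (lpn p lborel W powr p) \<le> ennreal (n powr p)" using p1 by (intro ennreal_leI powr_mono2) auto
    then show ?thesis using nn_integral_in_Lp[OF W(1) p1(2)] W0 by simp
  qed
  \<comment> \<open>The averages over K of the two terms of the representation of f x.\<close>
  define a where "a x = (\<integral>z. \<bar>f (x + z)\<bar> \<partial>N)" for x
  define g where "g s x = (\<integral>z. \<bar>gradient f (x + s *\<^sub>R z) \<bullet> z\<bar> \<partial>N)" for s x
  have g0: "0 \<le> g s x" for s x unfolding g_def by (intro integral_nonneg_AE) auto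
  have a0: "0 \<le> a x" for x unfolding a_def by (intro integral_nonneg_AE) auto
  have gmeas: "case_prod g \<in> borel_measurable (borel \<Otimes>\<^sub>M borel)" unfolding g_def by measurable
  have gmeas': "(\<lambda>x. g (snd x) (fst x)) \<in> borel_measurable (borel \<Otimes>\<^sub>M borel)" unfolding g_def by measurable
  have ameas[measurable]: "a \<in> borel_measurable borel" unfolding a_def by measurable
  have f_p: "(\<integral>\<^sup>+x. ennreal (\<bar>f x\<bar> powr p) \<partial>lborel) = 1"
    using nn_integral_in_Lp[OF test_in_Lp(1)[OF f p1(2)] p1(2)] f1 by simp
  have VE: "emeasure N UNIV = ennreal V" using N by (simp add: N.emeasure_eq_measure)
  have a_r: "(\<integral>\<^sup>+x. ennreal (a x powr r) \<partial>lborel) \<le> ennreal ((V powr (p - 1) * 1) powr (r / p - 1) * (V powr (p - 1) * V))"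
    unfolding a_def
  proof (rule Lr_of_average[OF N(1,3)])
    show "(\<integral>\<^sup>+y. ennreal (\<bar>f (x + y)\<bar> powr p) \<partial>N) \<le> ennreal 1" for x
    proof -
      have "(\<integral>\<^sup>+y. ennreal (\<bar>f (x + y)\<bar> powr p) \<partial>N) \<le> (\<integral>\<^sup>+y. ennreal (\<bar>f (x + y)\<bar> powr p) \<partial>lborel)"
        by (subst nnN) (auto intro!: nn_integral_mono simp: indicator_def)
      also have "\<dots> = 1" using nn_integral_lborel_translate[of "\<lambda>y. ennreal (\<bar>f y\<bar> powr p)" x] f_p by (simp add: add.commute)
      finally show ?thesis by simp
    qed
    have "(\<integral>\<^sup>+x. ennreal (\<bar>f (x + y)\<bar> powr p) \<partial>lborel) = 1" for y
      using nn_integral_lborel_translate[of "\<lambda>y. ennreal (\<bar>f y\<bar> powr p)" y] f_p by simp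
    then show "(\<integral>\<^sup>+y. \<integral>\<^sup>+x. ennreal (\<bar>f (x + y)\<bar> powr p) \<partial>lborel \<partial>N) \<le> ennreal V" using VE N by simp
  qed (use N p V in auto)
  have g_r: "(\<integral>\<^sup>+x. ennreal (g s x powr r) \<partial>lborel) \<le> ennreal ((V powr (p - 1) * (s powr (- n) * n powr p)) powr (r / p - 1) * (V powr (p - 1) * V))"
    if s: "0 < s" for s
    unfolding g_def
  proof (rule Lr_of_average[OF N(1,3)])
    show "(\<integral>\<^sup>+z. ennreal (\<bar>gradient f (x + s *\<^sub>R z) \<bullet> z\<bar> powr p) \<partial>N) \<le> ennreal (s powr (- n) * n powr p)" for x
    proof -
      have "(\<integral>\<^sup>+z. ennreal (\<bar>gradient f (x + s *\<^sub>R z) \<bullet> z\<bar> powr p) \<partial>N) \<le> (\<integral>\<^sup>+z. ennreal (W (s *\<^sub>R z + x) powr p) \<partial>lborel)"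
      proof (subst nnN)
        show "(\<integral>\<^sup>+z. indicator K z * ennreal (\<bar>gradient f (x + s *\<^sub>R z) \<bullet> z\<bar> powr p) \<partial>lborel) \<le> (\<integral>\<^sup>+z. ennreal (W (s *\<^sub>R z + x) powr p) \<partial>lborel)"
          using Wbound p1 by (intro nn_integral_mono) (auto simp: indicator_def add.commute intro!: ennreal_leI powr_mono2)
      qed measurable
      also have "\<dots> = ennreal (s powr (- n)) * (\<integral>\<^sup>+z. ennreal (W z powr p) \<partial>lborel)"
      proof -
        have "ennreal (s powr (- n)) * ennreal (s ^ CARD('n)) = 1"
          using s by (simp add: ennreal_mult[symmetric] n_def powr_realpow[symmetric] powr_add[symmetric] powr_minus)
        then show ?thesis
          using nn_integral_lborel_scale[of "\<lambda>z. ennreal (W z powr p)" s x] s by (simp add: mult.assoc[symmetric])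
      qed
      also have "\<dots> \<le> ennreal (s powr (- n)) * ennreal (n powr p)" by (intro mult_left_mono WLp) simp
      finally show ?thesis by (simp add: ennreal_mult)
    qed
    have "(\<integral>\<^sup>+x. ennreal (\<bar>gradient f (x + s *\<^sub>R z) \<bullet> z\<bar> powr p) \<partial>lborel) = ennreal (dnorm p f z powr p)" for z
      using nn_integral_lborel_translate[of "\<lambda>x. ennreal (\<bar>gradient f x \<bullet> z\<bar> powr p)" "s *\<^sub>R z"]
        nn_integral_in_Lp[OF test_in_Lp(3)[OF f p1(2)] p1(2), of z] by (simp add: dnorm_def)
    then have "(\<integral>\<^sup>+z. \<integral>\<^sup>+x. ennreal (\<bar>gradient f (x + s *\<^sub>R z) \<bullet> z\<bar> powr p) \<partial>lborel \<partial>N) = (\<integral>\<^sup>+z. indicator K z * ennreal (dnorm p f z powr p) \<partial>lborel)"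
      using dnorm_borel[OF f p1(1)] by (simp add: nnN)
    also have "\<dots> \<le> (\<integral>\<^sup>+z. indicator K z \<partial>lborel)"
    proof (rule nn_integral_mono)
      fix z
      have "dnorm p f z powr p \<le> 1" if "z \<in> K" using that p1 powr_mono2[of p "dnorm p f z" 1] by (simp add: K_def)
      then show "indicator K z * ennreal (dnorm p f z powr p) \<le> indicator K z" by (auto simp: indicator_def)
    qed
    also have "\<dots> = emeasure lborel K" by simp
    also have "\<dots> = ennreal V" using emeasure_bounded_finite[OF Kb] by (simp add: V_def K_def[symmetric] emeasure_eq_ennreal_measure)
    finally show "(\<integral>\<^sup>+z. \<integral>\<^sup>+x. ennreal (\<bar>gradient f (x + s *\<^sub>R z) \<bullet> z\<bar> powr p) \<partial>lborel \<partial>N) \<le> ennreal V" .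
  qed (use N p V in auto)
  have pointwise: "ennreal (V * \<bar>f x\<bar>) \<le> ennreal (a x) + (\<integral>\<^sup>+s. ennreal (g s x) \<partial>N1)" for x
  proof -
    have tri: "ennreal \<bar>f x\<bar> \<le> ennreal \<bar>f (x + z)\<bar> + (\<integral>\<^sup>+s. ennreal \<bar>gradient f (x + s *\<^sub>R z) \<bullet> z\<bar> \<partial>N1)" for z
    proof -
      have c: "continuous_on UNIV (\<lambda>s. gradient f (x + s *\<^sub>R z) \<bullet> z)"
        by (intro continuous_intros continuous_on_compose2[OF test_gradient_continuous[OF f, of UNIV]]) auto
      have "integrable lborel (\<lambda>s. indicator {0..1} s *\<^sub>R (gradient f (x + s *\<^sub>R z) \<bullet> z))"
        using c by (intro borel_integrable_compact) (auto intro: continuous_on_subset)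
      then have "integrable (density lborel (\<lambda>s. ennreal (indicator {0..1} s))) (\<lambda>s. gradient f (x + s *\<^sub>R z) \<bullet> z)"
        using c by (subst integrable_density) (auto intro: borel_measurable_continuous_onI)
      then have i: "integrable N1 (\<lambda>s. gradient f (x + s *\<^sub>R z) \<bullet> z)" by (simp add: N1_def ennreal_indicator)
      have "\<bar>f x\<bar> \<le> \<bar>f (x + z)\<bar> + \<bar>f (x + z) - f x\<bar>" by simp
      also have "f (x + z) - f x = (\<integral>s. gradient f (x + s *\<^sub>R z) \<bullet> z \<partial>N1)" unfolding N1_def by (rule test_FTC[OF f, symmetric])
      also have "\<bar>\<dots>\<bar> \<le> (\<integral>s. \<bar>gradient f (x + s *\<^sub>R z) \<bullet> z\<bar> \<partial>N1)" by (rule integral_abs_bound)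
      finally have "ennreal \<bar>f x\<bar> \<le> ennreal (\<bar>f (x + z)\<bar> + (\<integral>s. \<bar>gradient f (x + s *\<^sub>R z) \<bullet> z\<bar> \<partial>N1))" by (intro ennreal_leI) simp
      also have "\<dots> = ennreal \<bar>f (x + z)\<bar> + ennreal (\<integral>s. \<bar>gradient f (x + s *\<^sub>R z) \<bullet> z\<bar> \<partial>N1)"
        by (rule ennreal_plus) auto
      also have "ennreal (\<integral>s. \<bar>gradient f (x + s *\<^sub>R z) \<bullet> z\<bar> \<partial>N1) = (\<integral>\<^sup>+s. ennreal \<bar>gradient f (x + s *\<^sub>R z) \<bullet> z\<bar> \<partial>N1)"
        using i by (intro nn_integral_eq_integral[symmetric]) auto
      finally show ?thesis .
    qed
    have "ennreal (V * \<bar>f x\<bar>) = (\<integral>\<^sup>+z. ennreal \<bar>f x\<bar> \<partial>N)" using VE N V by (simp add: ennreal_mult mult.commute)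
    also have "\<dots> \<le> (\<integral>\<^sup>+z. ennreal \<bar>f (x + z)\<bar> + (\<integral>\<^sup>+s. ennreal \<bar>gradient f (x + s *\<^sub>R z) \<bullet> z\<bar> \<partial>N1) \<partial>N)"
      by (intro nn_integral_mono tri)
    also have "\<dots> = (\<integral>\<^sup>+z. ennreal \<bar>f (x + z)\<bar> \<partial>N) + (\<integral>\<^sup>+z. (\<integral>\<^sup>+s. ennreal \<bar>gradient f (x + s *\<^sub>R z) \<bullet> z\<bar> \<partial>N1) \<partial>N)"
      by (rule nn_integral_add) measurable
    also have "(\<integral>\<^sup>+z. ennreal \<bar>f (x + z)\<bar> \<partial>N) = ennreal (a x)"
      unfolding a_def
      by (intro nn_integral_eq_integral intN continuous_intros continuous_on_compose2[OF test_continuous[OF f, of UNIV]]) auto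
    also have "(\<integral>\<^sup>+z. (\<integral>\<^sup>+s. ennreal \<bar>gradient f (x + s *\<^sub>R z) \<bullet> z\<bar> \<partial>N1) \<partial>N) = (\<integral>\<^sup>+s. (\<integral>\<^sup>+z. ennreal \<bar>gradient f (x + s *\<^sub>R z) \<bullet> z\<bar> \<partial>N) \<partial>N1)"
    proof -
      interpret pair_sigma_finite N1 N ..
      show ?thesis by (rule Fubini') measurable
    qed
    also have "\<dots> = (\<integral>\<^sup>+s. ennreal (g s x) \<partial>N1)"
      unfolding g_def
      by (intro nn_integral_cong nn_integral_eq_integral intN continuous_intros continuous_on_compose2[OF test_gradient_continuous[OF f, of UNIV]]) auto
    finally show ?thesis .
  qed
  define b where "b x = enn2real (\<integral>\<^sup>+s. ennreal (g s x) \<partial>N1)" for x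
  have gle: "g s x \<le> V * (B * (2 * R))" for s x
  proof -
    have "ennreal (g s x) = (\<integral>\<^sup>+z. ennreal \<bar>gradient f (x + s *\<^sub>R z) \<bullet> z\<bar> \<partial>N)"
      unfolding g_def
      by (intro nn_integral_eq_integral[symmetric] intN continuous_intros continuous_on_compose2[OF test_gradient_continuous[OF f, of UNIV]]) auto
    also have "\<dots> = (\<integral>\<^sup>+z. indicator K z * ennreal \<bar>gradient f (x + s *\<^sub>R z) \<bullet> z\<bar> \<partial>lborel)" by (rule nnN) measurable
    also have "\<dots> \<le> (\<integral>\<^sup>+z. ennreal (B * (2 * R)) * indicator K z \<partial>lborel)"
    proof (rule nn_integral_mono)
      fix z
      have "\<bar>gradient f (x + s *\<^sub>R z) \<bullet> z\<bar> \<le> B * (2 * R)" if "z \<in> K"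
        using Cauchy_Schwarz_ineq2[of "gradient f (x + s *\<^sub>R z)" z] mult_mono[OF B(2)[of "x + s *\<^sub>R z"] Kbd[OF that] B(1)] by simp
      then show "indicator K z * ennreal \<bar>gradient f (x + s *\<^sub>R z) \<bullet> z\<bar> \<le> ennreal (B * (2 * R)) * indicator K z"
        by (auto simp: indicator_def intro: ennreal_leI)
    qed
    also have "\<dots> = ennreal (B * (2 * R)) * ennreal V"
      using emeasure_bounded_finite[OF Kb] by (subst nn_integral_cmult_indicator) (auto simp: V_def K_def[symmetric] emeasure_eq_ennreal_measure)
    finally have "ennreal (g s x) \<le> ennreal (V * (B * (2 * R)))" using V B R by (simp add: ennreal_mult[symmetric] mult.commute)
    then show ?thesis using V B R by (subst (asm) ennreal_le_iff) auto
  qed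
  have bfin: "(\<integral>\<^sup>+s. ennreal (g s x) \<partial>N1) = ennreal (b x)" for x
  proof -
    have "(\<integral>\<^sup>+s. ennreal (g s x) \<partial>N1) \<le> (\<integral>\<^sup>+s. ennreal (V * (B * (2 * R))) \<partial>N1)"
      using gle by (intro nn_integral_mono ennreal_leI)
    also have "\<dots> < \<infinity>" using N1 by (simp add: N1.emeasure_eq_measure)
    finally show ?thesis by (simp add: b_def)
  qed
  have b0: "0 \<le> b x" for x by (simp add: b_def)
  have bmeas[measurable]: "b \<in> borel_measurable borel" unfolding b_def using gmeas by measurable
  define \<kappa> where "\<kappa> = \<alpha> * (r - 1) - n * (r / p - 1)"
  have \<kappa>: "-1 < \<kappa>" using \<alpha> by (simp add: \<kappa>_def n_def)
  \<comment> \<open>The integral over s is split with the weight \<open>s powr \<alpha>\<close> by the inequality of Jensen for the finite measure \<open>s powr (- \<alpha>) ds\<close>.\<close>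
  define \<nu> where "\<nu> = density lborel (\<lambda>s :: real. ennreal (indicator {0..1} s * s powr (- \<alpha>)))"
  have \<nu>e: "emeasure \<nu> UNIV = ennreal (1 / (1 - \<alpha>))"
    unfolding \<nu>_def using nn_integral_powr_unit_interval[of "- \<alpha>"] \<alpha> by (subst emeasure_density) auto
  have \<nu>: "finite_measure \<nu>" "measure \<nu> (space \<nu>) = 1 / (1 - \<alpha>)" "sets \<nu> = sets borel" "space \<nu> = UNIV"
    using \<nu>e \<alpha> by (auto intro!: finite_measureI simp: \<nu>_def measure_def)
  have b_jensen: "ennreal (b x powr r) \<le> ennreal ((1 / (1 - \<alpha>)) powr (r - 1)) * (\<integral>\<^sup>+s. ennreal (indicator {0..1} s * s powr (\<alpha> * (r - 1)) * g s x powr r) \<partial>lborel)" for x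
  proof -
    have gx[measurable]: "(\<lambda>s. g s x) \<in> borel_measurable borel" using gmeas by measurable
    have "ennreal (b x powr r) \<le> ennreal ((1 / (1 - \<alpha>)) powr (r - 1)) * (\<integral>\<^sup>+s. ennreal ((g s x * s powr \<alpha>) powr r) \<partial>\<nu>)"
      unfolding \<nu>(2)[symmetric]
    proof (rule jensen_powr_nn[OF \<nu>(1)])
      have "ennreal (b x) = (\<integral>\<^sup>+s. indicator {0..1} s * ennreal (g s x) \<partial>lborel)"
        unfolding bfin[symmetric] N1_def by (subst nn_integral_density) auto
      also have "\<dots> = (\<integral>\<^sup>+s. ennreal (indicator {0..1} s * s powr (- \<alpha>)) * ennreal (g s x * s powr \<alpha>) \<partial>lborel)"
      proof (rule nn_integral_cong_AE)
        have "AE s in lborel. s \<noteq> (0 :: real)" by (rule AE_lborel_singleton)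
        then show "AE s in lborel. indicator {0..1} s * ennreal (g s x) = ennreal (indicator {0..1} s * s powr (- \<alpha>)) * ennreal (g s x * s powr \<alpha>)"
        proof eventually_elim
          case (elim s)
          have "s powr (- \<alpha>) * (g s x * s powr \<alpha>) = g s x" if "s > 0"
            using that by (simp add: powr_minus field_simps)
          then show ?case using elim g0[of s x] by (auto simp: indicator_def ennreal_mult[symmetric])
        qed
      qed
      also have "\<dots> = (\<integral>\<^sup>+s. ennreal (g s x * s powr \<alpha>) \<partial>\<nu>)" unfolding \<nu>_def by (subst nn_integral_density) auto
      finally show "ennreal (b x) \<le> (\<integral>\<^sup>+s. ennreal (g s x * s powr \<alpha>) \<partial>\<nu>)" by simp
    qed (use p1 b0 g0 \<nu>(3) in \<open>auto simp: measurable_cong_sets[OF \<nu>(3) refl]\<close>)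
    also have "(\<integral>\<^sup>+s. ennreal ((g s x * s powr \<alpha>) powr r) \<partial>\<nu>) = (\<integral>\<^sup>+s. ennreal (indicator {0..1} s * s powr (- \<alpha>)) * ennreal ((g s x * s powr \<alpha>) powr r) \<partial>lborel)"
      unfolding \<nu>_def by (subst nn_integral_density) auto
    also have "\<dots> = (\<integral>\<^sup>+s. ennreal (indicator {0..1} s * s powr (\<alpha> * (r - 1)) * g s x powr r) \<partial>lborel)"
    proof (rule nn_integral_cong)
      fix s
      have "s powr (- \<alpha>) * (g s x * s powr \<alpha>) powr r = s powr (\<alpha> * (r - 1)) * g s x powr r"
        using g0[of s x] by (simp add: powr_mult powr_powr powr_add[symmetric] algebra_simps)
      then show "ennreal (indicator {0..1} s * s powr (- \<alpha>)) * ennreal ((g s x * s powr \<alpha>) powr r) = ennreal (indicator {0..1} s * s powr (\<alpha> * (r - 1)) * g s x powr r)"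
        by (auto simp: indicator_def ennreal_mult[symmetric])
    qed
    finally show ?thesis .
  qed
  have Vpow: "(V powr (p - 1)) powr (r / p - 1) * (V powr (p - 1) * V) = V powr r * V powr (1 - r / p)"
  proof -
    have "(p - 1) * (r / p - 1) + ((p - 1) + 1) = r + (1 - r / p)" using p1 by (simp add: field_simps)
    then have "V powr ((p - 1) * (r / p - 1)) * (V powr (p - 1) * V powr 1) = V powr (r + (1 - r / p))"
      by (simp only: powr_add[symmetric])
    then show ?thesis using V by (simp add: powr_powr powr_add)
  qed
  define D where "D = V powr r * V powr (1 - r / p)"
  have D0: "0 \<le> D" by (simp add: D_def)
  have a_r': "(\<integral>\<^sup>+x. ennreal (a x powr r) \<partial>lborel) \<le> ennreal D"
    using a_r Vpow by (simp add: D_def)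
  have g_r': "(\<integral>\<^sup>+x. ennreal (g s x powr r) \<partial>lborel) \<le> ennreal (D * n powr (r - p) * s powr (- (n * (r / p - 1))))" if "0 < s" for s
  proof -
    have "(V powr (p - 1) * (s powr (- n) * n powr p)) powr (r / p - 1) * (V powr (p - 1) * V)
      = ((V powr (p - 1)) powr (r / p - 1) * (V powr (p - 1) * V)) * (s powr (- n)) powr (r / p - 1) * (n powr p) powr (r / p - 1)"
      by (simp add: powr_mult)
    also have "\<dots> = D * s powr (- (n * (r / p - 1))) * n powr (r - p)"
    proof -
      have "p * (r / p - 1) = r - p" using p1 by (simp add: field_simps)
      then have "(n powr p) powr (r / p - 1) = n powr (r - p)" by (simp add: powr_powr)
      moreover have "(s powr (- n)) powr (r / p - 1) = s powr (- (n * (r / p - 1)))" by (simp add: powr_powr)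
      ultimately show ?thesis unfolding Vpow D_def by simp
    qed
    finally show ?thesis using g_r[OF that] by (simp add: mult_ac)
  qed
  have gmeas_r: "(\<lambda>(x, s). ennreal (indicator {0..1} s * s powr (\<alpha> * (r - 1)) * g s x powr r)) \<in> borel_measurable (lborel \<Otimes>\<^sub>M lborel)"
  proof -
    have [measurable]: "(\<lambda>x. g (snd x) (fst x)) \<in> borel_measurable (lborel \<Otimes>\<^sub>M lborel)"
      using gmeas' by simp
    show ?thesis unfolding case_prod_beta by simp
  qed
  have b_r: "(\<integral>\<^sup>+x. ennreal (b x powr r) \<partial>lborel) \<le> ennreal ((1 / (1 - \<alpha>)) powr (r - 1) * (D * n powr (r - p) * (1 / (\<kappa> + 1))))"
  proof -
    have "(\<integral>\<^sup>+x. ennreal (b x powr r) \<partial>lborel) \<le> (\<integral>\<^sup>+x. ennreal ((1 / (1 - \<alpha>)) powr (r - 1)) * (\<integral>\<^sup>+s. ennreal (indicator {0..1} s * s powr (\<alpha> * (r - 1)) * g s x powr r) \<partial>lborel) \<partial>lborel)"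
      by (intro nn_integral_mono b_jensen)
    also have "\<dots> = ennreal ((1 / (1 - \<alpha>)) powr (r - 1)) * (\<integral>\<^sup>+x. (\<integral>\<^sup>+s. ennreal (indicator {0..1} s * s powr (\<alpha> * (r - 1)) * g s x powr r) \<partial>lborel) \<partial>lborel)"
      by (intro nn_integral_cmult lborel.borel_measurable_nn_integral gmeas_r)
    also have "(\<integral>\<^sup>+x. (\<integral>\<^sup>+s. ennreal (indicator {0..1} s * s powr (\<alpha> * (r - 1)) * g s x powr r) \<partial>lborel) \<partial>lborel)
        = (\<integral>\<^sup>+s. (\<integral>\<^sup>+x. ennreal (indicator {0..1} s * s powr (\<alpha> * (r - 1)) * g s x powr r) \<partial>lborel) \<partial>lborel)"
      by (rule lborel_pair.Fubini'[symmetric]) (rule gmeas_r)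
    also have "\<dots> \<le> (\<integral>\<^sup>+s. ennreal (D * n powr (r - p)) * ennreal (indicator {0..1} s * s powr \<kappa>) \<partial>lborel)"
    proof (rule nn_integral_mono_AE)
      have "AE s in lborel. s \<noteq> (0 :: real)" by (rule AE_lborel_singleton)
      then show "AE s in lborel. (\<integral>\<^sup>+x. ennreal (indicator {0..1} s * s powr (\<alpha> * (r - 1)) * g s x powr r) \<partial>lborel) \<le> ennreal (D * n powr (r - p)) * ennreal (indicator {0..1} s * s powr \<kappa>)"
      proof eventually_elim
        case (elim s)
        show ?case
        proof (cases "s \<in> {0..1}")
          case True
          then have s: "0 < s" using elim by auto
          have gs[measurable]: "g s \<in> borel_measurable borel" using gmeas by measurable
          have "(\<integral>\<^sup>+x. ennreal (indicator {0..1} s * s powr (\<alpha> * (r - 1)) * g s x powr r) \<partial>lborel) = (\<integral>\<^sup>+x. ennreal (s powr (\<alpha> * (r - 1))) * ennreal (g s x powr r) \<partial>lborel)"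
            using True by (simp add: ennreal_mult)
          also have "\<dots> = ennreal (s powr (\<alpha> * (r - 1))) * (\<integral>\<^sup>+x. ennreal (g s x powr r) \<partial>lborel)"
            by (rule nn_integral_cmult) simp
          also have "\<dots> \<le> ennreal (s powr (\<alpha> * (r - 1))) * ennreal (D * n powr (r - p) * s powr (- (n * (r / p - 1))))"
            by (intro mult_left_mono g_r' s) simp
          also have "\<dots> = ennreal (D * n powr (r - p) * s powr \<kappa>)"
            using D0 by (simp add: ennreal_mult[symmetric] \<kappa>_def powr_diff powr_minus divide_inverse mult_ac)
          finally show ?thesis using True D0 by (simp add: ennreal_mult)
        qed simp
      qed
    qed
    also have "\<dots> = ennreal (D * n powr (r - p)) * ennreal (1 / (\<kappa> + 1))"
      using nn_integral_powr_unit_interval[OF \<kappa>] by (subst nn_integral_cmult) auto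
    finally have "(\<integral>\<^sup>+x. ennreal (b x powr r) \<partial>lborel) \<le> ennreal ((1 / (1 - \<alpha>)) powr (r - 1)) * (ennreal (D * n powr (r - p)) * ennreal (1 / (\<kappa> + 1)))"
      by (simp add: mult_left_mono)
    then show ?thesis using D0 \<kappa> by (simp add: ennreal_mult[symmetric])
  qed
  have Vf: "V * \<bar>f x\<bar> \<le> a x + b x" for x
  proof -
    have "ennreal (V * \<bar>f x\<bar>) \<le> ennreal (a x + b x)" using pointwise[of x] a0 b0 by (simp add: bfin)
    then show ?thesis using a0[of x] b0[of x] by (subst (asm) ennreal_le_iff) auto
  qed
  have "ennreal (V powr r * lpn r lborel f powr r) = (\<integral>\<^sup>+x. ennreal ((V * \<bar>f x\<bar>) powr r) \<partial>lborel)"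
  proof -
    have "ennreal (V powr r) * (\<integral>\<^sup>+x. ennreal (\<bar>f x\<bar> powr r) \<partial>lborel) = (\<integral>\<^sup>+x. ennreal (V powr r) * ennreal (\<bar>f x\<bar> powr r) \<partial>lborel)"
      by (rule nn_integral_cmult[symmetric]) simp
    then show ?thesis using nn_integral_in_Lp[OF test_in_Lp(1)[OF f p1(4)] p1(4)] V
      by (simp add: ennreal_mult powr_mult)
  qed
  also have "\<dots> \<le> (\<integral>\<^sup>+x. ennreal (2 powr r) * (ennreal (a x powr r) + ennreal (b x powr r)) \<partial>lborel)"
  proof (rule nn_integral_mono)
    fix x
    have "(V * \<bar>f x\<bar>) powr r \<le> (a x + b x) powr r" using Vf[of x] V p1 by (intro powr_mono2) auto
    also have "\<dots> \<le> 2 powr r * (a x powr r + b x powr r)" using p1 a0 b0 by (intro powr_add_le) auto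
    finally show "ennreal ((V * \<bar>f x\<bar>) powr r) \<le> ennreal (2 powr r) * (ennreal (a x powr r) + ennreal (b x powr r))"
      by (simp add: ennreal_mult[symmetric] ennreal_plus[symmetric] ennreal_leI del: ennreal_plus)
  qed
  also have "\<dots> = ennreal (2 powr r) * ((\<integral>\<^sup>+x. ennreal (a x powr r) \<partial>lborel) + (\<integral>\<^sup>+x. ennreal (b x powr r) \<partial>lborel))"
    by (simp add: nn_integral_cmult nn_integral_add)
  also have "\<dots> \<le> ennreal (2 powr r) * (ennreal D + ennreal ((1 / (1 - \<alpha>)) powr (r - 1) * (D * n powr (r - p) * (1 / (\<kappa> + 1)))))"
    by (intro mult_left_mono add_mono a_r' b_r) simp
  also have "\<dots> = ennreal (2 powr r * (D + (1 / (1 - \<alpha>)) powr (r - 1) * (D * n powr (r - p) * (1 / (\<kappa> + 1)))))"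
    using D0 \<kappa> by (simp add: ennreal_mult[symmetric] ennreal_plus[symmetric] del: ennreal_plus)
  finally have "V powr r * lpn r lborel f powr r \<le> 2 powr r * (D + (1 / (1 - \<alpha>)) powr (r - 1) * (D * n powr (r - p) * (1 / (\<kappa> + 1))))"
    using D0 \<kappa> by (subst (asm) ennreal_le_iff) (auto intro!: mult_nonneg_nonneg add_nonneg_nonneg)
  also have "\<dots> = V powr r * (2 powr r * (1 + (1 / (1 - \<alpha>)) powr (r - 1) * n powr (r - p) / (\<kappa> + 1)) * V powr (1 - r / p))"
    by (simp add: D_def algebra_simps)
  finally show ?thesis using V by (simp add: n_def \<kappa>_def)
qed

text \<open>
  The normalized estimate, made homogeneous in \<open>f\<close>.
\<close>

lemma affine_Sobolev:
  assumes p: "1 < p" "p < real CARD('n)" and r: "p < r" "r < critical_exponent (real CARD('n)) p"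
  shows "\<exists>C>0. \<forall>\<Omega> R. \<forall>f :: real^'n \<Rightarrow> real. 0 < R \<longrightarrow> \<Omega> \<subseteq> ball 0 R \<longrightarrow> f \<in> test_functions \<Omega> \<longrightarrow> 0 < lpn p lborel f \<longrightarrow>
      lpn r lborel f powr r \<le> C * measure lborel {z. dnorm p f z \<le> lpn p lborel f} powr (1 - r / p) * lpn p lborel f powr r"
proof -
  obtain \<alpha> where \<alpha>: "\<alpha> < 1" "-1 < \<alpha> * (r - 1) - real CARD('n) * (r / p - 1)"
    using Sobolev_weight_exists[OF p r] by auto
  define C where "C = 2 powr r * (1 + (1 / (1 - \<alpha>)) powr (r - 1) * real CARD('n) powr (r - p) / (\<alpha> * (r - 1) - real CARD('n) * (r / p - 1) + 1))"
  have C: "C > 0" unfolding C_def using \<alpha> by (intro mult_pos_pos add_pos_nonneg) auto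
  show ?thesis
  proof (intro exI[of _ C] conjI C allI impI)
    fix \<Omega> R and f :: "real^'n \<Rightarrow> real"
    assume R: "0 < R" and \<Omega>: "\<Omega> \<subseteq> ball 0 R" and f: "f \<in> test_functions \<Omega>" and pos: "0 < lpn p lborel f"
    define t where "t = lpn p lborel f"
    have t: "t > 0" using pos by (simp add: t_def)
    define F where "F = (\<lambda>x. inverse t * f x)"
    have p1: "1 \<le> p" "0 < p" "0 < r" using p r by auto
    have F: "F \<in> test_functions \<Omega>" unfolding F_def by (rule test_cmult(1)[OF f])
    have sc: "lpn q lborel F = inverse t * lpn q lborel f" if "0 < q" for q
      using in_Lp_scaleR(2)[OF test_in_Lp(1)[OF f that] that, of "inverse t"] t by (simp add: F_def)
    have F1: "lpn p lborel F = 1" using sc[OF p1(2)] t by (simp add: t_def)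
    have set: "{z. dnorm p F z \<le> 1} = {z. dnorm p f z \<le> t}"
      unfolding F_def dnorm_cmult_fun[OF f p1(1)] using t by (auto simp: field_simps)
    have "lpn r lborel F powr r \<le> C * measure lborel {z. dnorm p F z \<le> 1} powr (1 - r / p)"
      unfolding C_def by (rule affine_Sobolev_normalized[OF p r(1) \<alpha> F \<Omega> R F1])
    then have "(inverse t * lpn r lborel f) powr r * t powr r \<le> C * measure lborel {z. dnorm p f z \<le> t} powr (1 - r / p) * t powr r"
      unfolding set sc[OF p1(3)] by (intro mult_right_mono) auto
    moreover have "(inverse t * lpn r lborel f) powr r * t powr r = lpn r lborel f powr r"
    proof -
      have "inverse t * lpn r lborel f * t = lpn r lborel f" using t by simp
      then show ?thesis by (simp only: powr_mult[symmetric])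
    qed
    ultimately show "lpn r lborel f powr r \<le> C * measure lborel {z. dnorm p f z \<le> lpn p lborel f} powr (1 - r / p) * lpn p lborel f powr r"
      by (simp add: t_def)
  qed
qed

section \<open>Compactness\<close>

text \<open>
  The translation estimate, averaged: means over small balls are equicontinuous, bounded, and close to \<open>f\<close>
  in norm, with constants that depend on \<open>f\<close> only through the bound \<open>C\<close>.
\<close>

lemma ball_average_estimates:
  fixes f :: "real^'n \<Rightarrow> real"
  assumes f: "f \<in> test_functions \<Omega>" and p: "1 \<le> p" and \<Omega>: "\<Omega> \<subseteq> ball 0 R" and R: "0 < R"
    and C: "\<And>\<xi>. dnorm p f \<xi> \<le> C * norm \<xi>" and e: "0 < e"
  defines "A \<equiv> \<lambda>x. (\<integral>z. f (x + z) \<partial>density lborel (indicator (cball 0 e))) / measure lborel (cball (0 :: real^'n) e)"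
  shows "\<bar>A x - A y\<bar> \<le> measure lborel (cball (0 :: real^'n) e) powr (- 1 / p) * (C * norm (x - y))"
    and "\<bar>A x\<bar> \<le> measure lborel (cball (0 :: real^'n) e) powr (- 1 / p) * (2 * R * C)"
    and "in_Lp p lborel (\<lambda>x. A x - f x)" "lpn p lborel (\<lambda>x. A x - f x) \<le> C * e"
proof -
  have p0: "0 < p" using p by simp
  have C0: "0 \<le> C" using C[of "axis undefined 1"] dnorm_nonneg[of p f "axis undefined 1"] by (smt (verit) mult_cancel_left1 norm_axis_1)
  let ?B = "cball (0 :: real^'n) e"
  have [measurable]: "?B \<in> sets borel" by simp
  define N where "N = density lborel (indicator ?B)"
  define v where "v = measure lborel ?B"
  have v: "v > 0" using e by (simp add: v_def content_cball_pos)
  have N: "finite_measure N" "measure N UNIV = v" "sets N = sets borel" "space N = UNIV"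
    using finite_measure_density_indicator[of ?B] by (auto simp: N_def v_def)
  note [measurable_cong] = N(3)
  interpret N: finite_measure N by (rule N)
  have [measurable]: "f \<in> borel_measurable borel" using test_borel[OF f] .
  have cont: "continuous_on UNIV (\<lambda>z. f (x + z))" for x
    by (intro continuous_on_compose2[OF test_continuous[OF f, of UNIV]] continuous_intros) auto
  have int: "integrable N (\<lambda>z. f (x + z))" for x
  proof -
    have "integrable lborel (\<lambda>z. indicator ?B z *\<^sub>R f (x + z))" by (intro borel_integrable_compact continuous_on_subset[OF cont]) auto
    then have "integrable (density lborel (\<lambda>z. ennreal (indicator ?B z))) (\<lambda>z. f (x + z))"
      by (subst integrable_density) auto
    then show ?thesis by (simp add: N_def ennreal_indicator)
  qed
  have nnN: "(\<integral>\<^sup>+z. F z \<partial>N) \<le> (\<integral>\<^sup>+z. F z \<partial>lborel)" if [measurable]: "F \<in> borel_measurable borel" for F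
    unfolding N_def by (subst nn_integral_density) (auto intro!: nn_integral_mono simp: indicator_def)
  have average_le: "\<bar>\<integral>z. F z \<partial>N\<bar> / v \<le> v powr (- 1 / p) * L"
    if F: "F \<in> borel_measurable borel" and L: "0 \<le> L" "(\<integral>\<^sup>+z. ennreal (\<bar>F z\<bar> powr p) \<partial>lborel) \<le> ennreal (L powr p)" for F :: "real^'n \<Rightarrow> real" and L
  proof -
    have [measurable]: "F \<in> borel_measurable N" using F by measurable
    have "ennreal ((\<integral>z. \<bar>F z\<bar> \<partial>N) powr p) \<le> ennreal (v powr (p - 1)) * (\<integral>\<^sup>+z. ennreal (\<bar>F z\<bar> powr p) \<partial>N)"
      using jensen_powr[OF N(1) p, of "\<lambda>z. \<bar>F z\<bar>"] N by simp
    also have "\<dots> \<le> ennreal (v powr (p - 1)) * ennreal (L powr p)"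
      using F by (intro mult_left_mono order_trans[OF nnN L(2)]) auto
    finally have "(\<integral>z. \<bar>F z\<bar> \<partial>N) powr p \<le> v powr (p - 1) * L powr p" by (simp add: ennreal_mult[symmetric])
    then have "((\<integral>z. \<bar>F z\<bar> \<partial>N) powr p) powr (1 / p) \<le> (v powr (p - 1) * L powr p) powr (1 / p)"
      using p by (intro powr_mono2) auto
    moreover have "((\<integral>z. \<bar>F z\<bar> \<partial>N) powr p) powr (1 / p) = (\<integral>z. \<bar>F z\<bar> \<partial>N)" using p by (simp add: powr_powr)
    moreover have "(v powr (p - 1) * L powr p) powr (1 / p) = v powr (1 + - 1 / p) * L"
    proof -
      have "(p - 1) * (1 / p) = 1 + - 1 / p" using p by (simp add: field_simps)
      then have "(v powr (p - 1)) powr (1 / p) = v powr (1 + - 1 / p)" by (simp only: powr_powr)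
      moreover have "(L powr p) powr (1 / p) = L" using p L by (simp add: powr_powr)
      ultimately show ?thesis by (subst powr_mult) simp
    qed
    moreover have "v powr (1 + - 1 / p) = v * v powr (- 1 / p)" using v by (simp only: powr_add powr_one)
    ultimately have "(\<integral>z. \<bar>F z\<bar> \<partial>N) \<le> v * (v powr (- 1 / p) * L)" by (simp only: mult.assoc)
    then have "\<bar>\<integral>z. F z \<partial>N\<bar> \<le> v * (v powr (- 1 / p) * L)" using integral_abs_bound[of N F] by linarith
    then show ?thesis using v by (simp add: divide_le_eq mult_ac)
  qed
  show "\<bar>A x - A y\<bar> \<le> measure lborel ?B powr (- 1 / p) * (C * norm (x - y))"
  proof -
    have "A x - A y = (\<integral>z. f (x + z) - f (y + z) \<partial>N) / v"
      using int by (simp add: A_def N_def[symmetric] v_def[symmetric] diff_divide_distrib)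
    moreover have "\<bar>\<integral>z. f (x + z) - f (y + z) \<partial>N\<bar> / v \<le> v powr (- 1 / p) * (C * norm (x - y))"
    proof (rule average_le)
      have "(\<integral>\<^sup>+z. ennreal (\<bar>f (x + z) - f (y + z)\<bar> powr p) \<partial>lborel) = (\<integral>\<^sup>+z. ennreal (\<bar>f (z + (x - y)) - f z\<bar> powr p) \<partial>lborel)"
        using nn_integral_lborel_translate[of "\<lambda>z. ennreal (\<bar>f (z + (x - y)) - f z\<bar> powr p)" y] by (simp add: algebra_simps)
      also have "\<dots> = ennreal (lpn p lborel (\<lambda>z. f (z + (x - y)) - f z) powr p)"
        using nn_integral_in_Lp[OF translation_estimate(1)[OF f p, of "x - y"] p0] by simp
      also have "\<dots> \<le> ennreal ((C * norm (x - y)) powr p)"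
        using p0 order_trans[OF translation_estimate(2)[OF f p] C] by (intro ennreal_leI powr_mono2) auto
      finally show "(\<integral>\<^sup>+z. ennreal (\<bar>f (x + z) - f (y + z)\<bar> powr p) \<partial>lborel) \<le> ennreal ((C * norm (x - y)) powr p)" .
    qed (use C0 in auto)
    ultimately show ?thesis by (simp add: v_def)
  qed
  have fle: "lpn p lborel f \<le> 2 * R * C"
  proof -
    have "lpn p lborel f * 1 \<le> 2 * R * dnorm p f (axis undefined 1)"
      using directional_Poincare[OF f p \<Omega> R, of "axis undefined 1"] by simp
    also have "\<dots> \<le> 2 * R * C" using C[of "axis undefined 1"] R by (intro mult_left_mono) auto
    finally show ?thesis by simp
  qed
  show "\<bar>A x\<bar> \<le> measure lborel ?B powr (- 1 / p) * (2 * R * C)"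
  proof -
    have "\<bar>\<integral>z. f (x + z) \<partial>N\<bar> / v \<le> v powr (- 1 / p) * (2 * R * C)"
    proof (rule average_le)
      have "(\<integral>\<^sup>+z. ennreal (\<bar>f (x + z)\<bar> powr p) \<partial>lborel) = (\<integral>\<^sup>+z. ennreal (\<bar>f z\<bar> powr p) \<partial>lborel)"
        using nn_integral_lborel_translate[of "\<lambda>z. ennreal (\<bar>f z\<bar> powr p)" x] by (simp add: add.commute)
      also have "\<dots> = ennreal (lpn p lborel f powr p)" using nn_integral_in_Lp[OF test_in_Lp(1)[OF f p0] p0] by simp
      also have "\<dots> \<le> ennreal ((2 * R * C) powr p)" using p0 fle by (intro ennreal_leI powr_mono2) auto
      finally show "(\<integral>\<^sup>+z. ennreal (\<bar>f (x + z)\<bar> powr p) \<partial>lborel) \<le> ennreal ((2 * R * C) powr p)" .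
    qed (use C0 R in auto)
    then show ?thesis using v by (simp add: A_def N_def[symmetric] v_def[symmetric])
  qed
  have Am[measurable]: "A \<in> borel_measurable borel"
    unfolding A_def N_def[symmetric] by measurable
  have "(\<integral>\<^sup>+x. ennreal (norm (A x - f x) powr p) \<partial>lborel) \<le> (\<integral>\<^sup>+x. ennreal (v powr (- p)) * ennreal ((\<integral>z. \<bar>f (x + z) - f x\<bar> \<partial>N) powr p) \<partial>lborel)"
  proof (rule nn_integral_mono)
    fix x
    have "A x - f x = (\<integral>z. f (x + z) - f x \<partial>N) / v"
      using int N v by (simp add: A_def N_def[symmetric] v_def[symmetric] diff_divide_distrib)
    then have "norm (A x - f x) \<le> inverse v * (\<integral>z. \<bar>f (x + z) - f x\<bar> \<partial>N)"
      using v integral_abs_bound[of N "\<lambda>z. f (x + z) - f x"] by (simp add: divide_inverse abs_mult mult.commute)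
    then have "norm (A x - f x) powr p \<le> (inverse v * (\<integral>z. \<bar>f (x + z) - f x\<bar> \<partial>N)) powr p"
      using p by (intro powr_mono2) auto
    also have "\<dots> = v powr (- p) * (\<integral>z. \<bar>f (x + z) - f x\<bar> \<partial>N) powr p"
      using v by (simp add: powr_mult powr_minus inverse_powr)
    finally show "ennreal (norm (A x - f x) powr p) \<le> ennreal (v powr (- p)) * ennreal ((\<integral>z. \<bar>f (x + z) - f x\<bar> \<partial>N) powr p)"
      by (simp add: ennreal_mult[symmetric] ennreal_leI)
  qed
  also have "\<dots> = ennreal (v powr (- p)) * (\<integral>\<^sup>+x. ennreal ((\<integral>z. \<bar>f (x + z) - f x\<bar> \<partial>N) powr p) \<partial>lborel)"
    by (rule nn_integral_cmult) measurable
  also have "\<dots> \<le> ennreal (v powr (- p)) * (ennreal (v powr (p - 1)) * (\<integral>\<^sup>+z. \<integral>\<^sup>+x. ennreal (\<bar>f (x + z) - f x\<bar> powr p) \<partial>lborel \<partial>N))"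
    using Lp_of_average[OF N(1,3), of "\<lambda>x z. \<bar>f (x + z) - f x\<bar>" p] p N by (intro mult_left_mono) auto
  also have "(\<integral>\<^sup>+z. \<integral>\<^sup>+x. ennreal (\<bar>f (x + z) - f x\<bar> powr p) \<partial>lborel \<partial>N) \<le> ennreal ((C * e) powr p * v)"
  proof -
    have "(\<integral>\<^sup>+z. \<integral>\<^sup>+x. ennreal (\<bar>f (x + z) - f x\<bar> powr p) \<partial>lborel \<partial>N) = (\<integral>\<^sup>+z. indicator ?B z * (\<integral>\<^sup>+x. ennreal (\<bar>f (x + z) - f x\<bar> powr p) \<partial>lborel) \<partial>lborel)"
      unfolding N_def by (subst nn_integral_density) auto
    also have "\<dots> \<le> (\<integral>\<^sup>+z. ennreal ((C * e) powr p) * indicator ?B z \<partial>lborel)"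
    proof (rule nn_integral_mono)
      fix z
      have "(\<integral>\<^sup>+x. ennreal (\<bar>f (x + z) - f x\<bar> powr p) \<partial>lborel) \<le> ennreal ((C * e) powr p)" if z: "z \<in> ?B"
      proof -
        have "(\<integral>\<^sup>+x. ennreal (\<bar>f (x + z) - f x\<bar> powr p) \<partial>lborel) = ennreal (lpn p lborel (\<lambda>x. f (x + z) - f x) powr p)"
          using nn_integral_in_Lp[OF translation_estimate(1)[OF f p, of z] p0] by simp
        also have "lpn p lborel (\<lambda>x. f (x + z) - f x) \<le> C * e"
          using order_trans[OF translation_estimate(2)[OF f p] C, of z] mult_left_mono[of "norm z" e C] z C0 by simp
        then have "ennreal (lpn p lborel (\<lambda>x. f (x + z) - f x) powr p) \<le> ennreal ((C * e) powr p)"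
          using p0 by (intro ennreal_leI powr_mono2) auto
        finally show ?thesis .
      qed
      then show "indicator ?B z * (\<integral>\<^sup>+x. ennreal (\<bar>f (x + z) - f x\<bar> powr p) \<partial>lborel) \<le> ennreal ((C * e) powr p) * indicator ?B z"
        by (auto simp: indicator_def)
    qed
    also have "\<dots> = ennreal ((C * e) powr p) * ennreal v"
      using emeasure_bounded_finite[OF bounded_cball, of "0 :: real^'n" e]
      by (subst nn_integral_cmult_indicator) (auto simp: v_def emeasure_eq_ennreal_measure)
    finally show ?thesis by (simp add: ennreal_mult v less_imp_le)
  qed
  finally have "(\<integral>\<^sup>+x. ennreal (norm (A x - f x) powr p) \<partial>lborel) \<le> ennreal (v powr (- p)) * (ennreal (v powr (p - 1)) * ennreal ((C * e) powr p * v))"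
    by (simp add: mult_left_mono)
  also have "\<dots> = ennreal (v powr (- p) * (v powr (p - 1) * ((C * e) powr p * v)))"
    using v by (simp add: ennreal_mult[symmetric])
  also have "v powr (- p) * (v powr (p - 1) * ((C * e) powr p * v)) = (C * e) powr p"
  proof -
    have "v powr (- p) * (v powr (p - 1) * v) = 1"
      using v by (simp add: powr_minus_one_mult powr_minus)
    then show ?thesis by (simp add: mult_ac)
  qed
  finally have "(\<integral>\<^sup>+x. ennreal (norm (A x - f x) powr p) \<partial>lborel) \<le> ennreal ((C * e) powr p)" .
  then show "in_Lp p lborel (\<lambda>x. A x - f x)" "lpn p lborel (\<lambda>x. A x - f x) \<le> C * e"
    using C0 e p0 by (auto intro!: in_LpI_bound)
qed

text \<open>
  Ascoli's theorem applies to the means over balls of a small radius \<open>e\<close>; the passage from \<open>f k\<close> to its means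
  costs \<open>C * e\<close>.
\<close>

lemma Rellich_step:
  fixes f :: "nat \<Rightarrow> real^'n \<Rightarrow> real"
  assumes f: "\<And>k. f k \<in> test_functions \<Omega>" and p: "1 \<le> p" and \<Omega>: "\<Omega> \<subseteq> ball 0 R" and R: "0 < R"
    and C: "\<And>k \<xi>. dnorm p (f k) \<xi> \<le> C * norm \<xi>" and d: "0 < d"
  shows "\<exists>s :: nat \<Rightarrow> nat. strict_mono s \<and> (\<forall>k l. lpn p lborel (\<lambda>x. f (s k) x - f (s l) x) < d)"
proof -
  have p0: "0 < p" using p by simp
  have C0: "0 \<le> C" using C[of 0 "axis undefined 1"] dnorm_nonneg[of p "f 0" "axis undefined 1"] by (smt (verit) mult_cancel_left1 norm_axis_1)
  let ?B = "cball (0 :: real^'n) R"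
  define m where "m = measure lborel ?B powr (1 / p)"
  have m: "0 \<le> m" by (simp add: m_def)
  define e where "e = d / (4 * (C + 1))"
  have e: "0 < e" using d C0 by (simp add: e_def)
  have Ce: "C * e \<le> d / 4" using d C0 by (simp add: e_def field_simps)
  define A where "A k x = (\<integral>z. f k (x + z) \<partial>density lborel (indicator (cball 0 e))) / measure lborel (cball (0 :: real^'n) e)" for k x
  note est = ball_average_estimates[OF f p \<Omega> R C e, folded A_def]
  define w where "w = measure lborel (cball (0 :: real^'n) e) powr (- 1 / p)"
  have w: "0 \<le> w" by (simp add: w_def)
  obtain g s where s: "strict_mono (s :: nat \<Rightarrow> nat)" "\<And>h. 0 < h \<Longrightarrow> \<exists>N. \<forall>n x. n \<ge> N \<and> x \<in> ?B \<longrightarrow> norm (A (s n) x - g x) < h"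
  proof (rule Arzela_Ascoli[of ?B A "w * (2 * R * C)"])
    show "norm (A n x) \<le> w * (2 * R * C)" for n x using est(2)[of n x] by (simp add: w_def)
    show "\<exists>d>0. \<forall>n y. y \<in> ?B \<and> norm (x - y) < d \<longrightarrow> norm (A n x - A n y) < h" if "0 < h" for x h
    proof (intro exI[of _ "h / (w * C + 1)"] conjI allI impI)
      have wC: "0 \<le> w * C" using w C0 by simp
      then show "0 < h / (w * C + 1)" using that by (simp add: add_nonneg_pos)
      fix n y assume "y \<in> ?B \<and> norm (x - y) < h / (w * C + 1)"
      then have lt: "(w * C + 1) * norm (x - y) < h" using wC by (simp add: field_simps)
      have "norm (A n x - A n y) \<le> w * C * norm (x - y)" using est(1)[of n x y] by (simp add: w_def)
      also have "\<dots> \<le> (w * C + 1) * norm (x - y)" by (intro mult_right_mono) auto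
      finally show "norm (A n x - A n y) < h" using lt by simp
    qed
  qed auto
  define h where "h = d / (8 * (m + 1))"
  have h: "0 < h" using d m by (simp add: h_def)
  have hm: "2 * h * m \<le> d / 4" using d m by (simp add: h_def field_simps)
  obtain N where N: "\<And>n x. n \<ge> N \<Longrightarrow> x \<in> ?B \<Longrightarrow> norm (A (s n) x - g x) < h" using s(2)[OF h] by auto
  define t where "t k = s (k + N)" for k
  have t: "strict_mono t" using s(1) unfolding t_def strict_mono_def by auto
  have bound: "lpn p lborel (\<lambda>x. f (t k) x - f (t l) x) \<le> 2 * (C * e) + 2 * h * m" for k l
  proof -
    let ?i = "\<lambda>x. indicator ?B x :: real"
    have iB[measurable]: "?i \<in> borel_measurable borel" by (intro borel_measurable_indicator) simp
    have mA: "(\<lambda>x. A j x) \<in> borel_measurable borel" for j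
    proof -
      have "(\<lambda>x. (A j x - f j x) + f j x) \<in> borel_measurable borel"
        using in_LpD(1)[OF est(3)[of j]] test_borel[OF f[of j]] by (intro borel_measurable_add) auto
      then show ?thesis by simp
    qed
    note mf = test_borel[OF f]
    have loc: "in_Lp p lborel (\<lambda>x. ?i x * (A j x - f j x))" "lpn p lborel (\<lambda>x. ?i x * (A j x - f j x)) \<le> C * e" for j
    proof -
      have "AE x in lborel. norm (?i x * (A j x - f j x)) \<le> norm (A j x - f j x)" by (auto simp: indicator_def)
      then show "in_Lp p lborel (\<lambda>x. ?i x * (A j x - f j x))" "lpn p lborel (\<lambda>x. ?i x * (A j x - f j x)) \<le> C * e"
        using in_Lp_mono[OF est(3)[of j] _ _ p0, of "\<lambda>x. ?i x * (A j x - f j x)"] est(4)[of j]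
          borel_measurable_times[OF iB borel_measurable_diff[OF mA[of j] mf[of j]]] by auto
    qed
    have mid: "in_Lp p lborel (\<lambda>x. ?i x * (A (t k) x - A (t l) x))" "lpn p lborel (\<lambda>x. ?i x * (A (t k) x - A (t l) x)) \<le> 2 * h * m"
    proof -
      have eq: "(\<lambda>x. norm (?i x) powr p) = ?i" by (auto simp: indicator_def)
      have i: "in_Lp p lborel ?i" unfolding in_Lp_def eq
        using emeasure_bounded_finite[OF bounded_cball, of "0 :: real^'n" R] by simp
      have 1: "in_Lp p lborel (\<lambda>x. (2 * h) *\<^sub>R ?i x)" by (rule in_Lp_scaleR(1)[OF i p0])
      have 2: "lpn p lborel ?i = m" unfolding lpn_def eq m_def by simp
      have 3: "AE x in lborel. norm (?i x * (A (t k) x - A (t l) x)) \<le> norm ((2 * h) *\<^sub>R ?i x)"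
      proof (rule AE_I2)
        fix x
        show "norm (?i x * (A (t k) x - A (t l) x)) \<le> norm ((2 * h) *\<^sub>R ?i x)"
        proof (cases "x \<in> ?B")
          case True
          have "norm (A (t k) x - g x) < h" "norm (A (t l) x - g x) < h" unfolding t_def by (rule N[OF _ True], simp)+
          then show ?thesis using True h by simp
        qed simp
      qed
      show "in_Lp p lborel (\<lambda>x. ?i x * (A (t k) x - A (t l) x))"
        using in_Lp_mono(1)[OF 1 _ 3 p0] borel_measurable_times[OF iB borel_measurable_diff[OF mA mA]] by auto
      have "lpn p lborel (\<lambda>x. ?i x * (A (t k) x - A (t l) x)) \<le> lpn p lborel (\<lambda>x. (2 * h) *\<^sub>R ?i x)"
        using in_Lp_mono(2)[OF 1 _ 3 p0] borel_measurable_times[OF iB borel_measurable_diff[OF mA mA]] by auto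
      then show "lpn p lborel (\<lambda>x. ?i x * (A (t k) x - A (t l) x)) \<le> 2 * h * m"
        using in_Lp_scaleR(2)[OF i p0, of "2 * h"] h 2 by simp
    qed
    have "f (t k) x - f (t l) x = (?i x * (A (t l) x - f (t l) x) + ?i x * (A (t k) x - A (t l) x)) - ?i x * (A (t k) x - f (t k) x)" for x
    proof (cases "x \<in> ?B")
      case False
      then have "x \<notin> \<Omega>" using \<Omega> by auto
      then show ?thesis using False test_outside(1)[OF f] by simp
    qed simp
    then have "lpn p lborel (\<lambda>x. f (t k) x - f (t l) x) \<le> (C * e + 2 * h * m) + C * e"
      using minkowski_diff(2)[OF minkowski(1)[OF loc(1)[of "t l"] mid(1) p] loc(1)[of "t k"] p]
        minkowski(2)[OF loc(1)[of "t l"] mid(1) p] loc(2)[of "t k"] loc(2)[of "t l"] mid(2) by simp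
    then show ?thesis by simp
  qed
  have "lpn p lborel (\<lambda>x. f (t k) x - f (t l) x) < d" for k l
    using bound[of k l] Ce hm d by linarith
  then show ?thesis using t by blast
qed

text \<open>
  A diagonal argument over the thresholds \<open>1 / (n + 1)\<close>.
\<close>

lemma Rellich:
  fixes f :: "nat \<Rightarrow> real^'n \<Rightarrow> real"
  assumes f: "\<And>k. f k \<in> test_functions \<Omega>" and p: "1 \<le> p" and \<Omega>: "\<Omega> \<subseteq> ball 0 R" and R: "0 < R"
    and C: "\<And>k \<xi>. dnorm p (f k) \<xi> \<le> C * norm \<xi>"
  shows "\<exists>s :: nat \<Rightarrow> nat. strict_mono s \<and> (\<forall>d>0. \<exists>K. \<forall>k\<ge>K. \<forall>l\<ge>K. lpn p lborel (\<lambda>x. f (s k) x - f (s l) x) < d)"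
proof -
  define P where "P n s \<longleftrightarrow> (\<forall>k l. lpn p lborel (\<lambda>x. f (s k) x - f (s l) x) < inverse (real (Suc n)))" for n and s :: "nat \<Rightarrow> nat"
  interpret subseqs P
  proof
    fix n and s :: "nat \<Rightarrow> nat"
    show "\<exists>r'. strict_mono r' \<and> P n (s \<circ> r')"
      using Rellich_step[of "\<lambda>k. f (s k)" \<Omega> p R C "inverse (real (Suc n))"] f p \<Omega> R C by (simp add: P_def)
  qed
  have P: "P n (diagseq \<circ> ((+) (Suc n)))" for n
    by (rule diagseq_holds) (auto simp: P_def)
  have "strict_mono diagseq \<and> (\<forall>d>0. \<exists>K. \<forall>k\<ge>K. \<forall>l\<ge>K. lpn p lborel (\<lambda>x. f (diagseq k) x - f (diagseq l) x) < d)"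
  proof (intro conjI subseq_diagseq allI impI)
    fix d :: real assume "0 < d"
    then obtain n where n: "inverse (real (Suc n)) < d" using reals_Archimedean by blast
    show "\<exists>K. \<forall>k\<ge>K. \<forall>l\<ge>K. lpn p lborel (\<lambda>x. f (diagseq k) x - f (diagseq l) x) < d"
    proof (intro exI[of _ "Suc n"] allI impI)
      fix k l assume kl: "Suc n \<le> k" "Suc n \<le> l"
      have "lpn p lborel (\<lambda>x. f (diagseq (Suc n + (k - Suc n))) x - f (diagseq (Suc n + (l - Suc n))) x) < inverse (real (Suc n))"
        using P[of n] unfolding P_def o_def by blast
      then show "lpn p lborel (\<lambda>x. f (diagseq k) x - f (diagseq l) x) < d" using n kl by simp
    qed
  qed
  then show ?thesis by blast
qed

section \<open>The affine energy as a functional of the directional norms\<close>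

text \<open>
  The affine energy with \<open>h \<xi>\<close> in place of the \<open>p\<close>-norm of the derivative in direction \<open>\<xi>\<close>. Seen as a
  functional of \<open>h\<close> it is defined for the directional norms of test functions and of Sobolev functions
  as well as for bounds on them.
\<close>

definition energy_of :: "real \<Rightarrow> (real^'n \<Rightarrow> real) \<Rightarrow> ennreal" where
  "energy_of p h = ennreal (affine_const (real CARD('n)) p) *
     ennreal_powr (\<integral>\<^sup>+\<xi>. ennreal (h \<xi> powr (- real CARD('n))) \<partial>surface_measure) (- 1 / real CARD('n))"

text \<open>
  The counterpart of \<open>dnorm\<close> for an arbitrary vector field on \<open>\<Omega>\<close>, used for weak gradients.
\<close>

definition dirn :: "real \<Rightarrow> (real^'n) set \<Rightarrow> (real^'n \<Rightarrow> real^'n) \<Rightarrow> real^'n \<Rightarrow> real" where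
  "dirn p \<Omega> g \<xi> = lpn p (lebesgue_on \<Omega>) (\<lambda>x. g x \<bullet> \<xi>)"

lemma space_surface_measure: "space surface_measure = sphere (0 :: real^'n) 1"
  by (simp add: surface_measure_def space_scale_measure space_restrict_space)

lemma sets_surface_measure: "sets surface_measure = sets (restrict_space borel (sphere (0 :: real^'n) 1))"
  by (simp add: surface_measure_def)

lemma ennreal_powr_neg_antimono:
  assumes "s < 0" "x \<le> y"
  shows "ennreal_powr y s \<le> ennreal_powr x s"
proof (cases "x = 0 \<or> y = \<infinity>")
  case True
  then show ?thesis using assms by (auto simp: ennreal_powr_def top_unique)
next
  case False
  then have "y \<noteq> 0" "x \<noteq> \<infinity>" using assms by (auto simp: top_unique)
  moreover have "0 < enn2real x" "enn2real x \<le> enn2real y"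
    using False calculation assms by (auto simp: enn2real_positive_iff less_top[symmetric] zero_less_iff_neq_zero intro!: enn2real_mono)
  ultimately show ?thesis using False assms
    by (auto simp: ennreal_powr_def intro!: ennreal_leI powr_mono2')
qed

lemma ennreal_powr_ennreal:
  assumes "0 < x" "s \<noteq> 0"
  shows "ennreal_powr (ennreal x) s = ennreal (x powr s)"
  using assms by (simp add: ennreal_powr_def)

lemma energy_of_mono:
  fixes h h' :: "real^'n \<Rightarrow> real"
  assumes "\<And>\<xi>. norm \<xi> = 1 \<Longrightarrow> 0 < h \<xi>" "\<And>\<xi>. norm \<xi> = 1 \<Longrightarrow> h \<xi> \<le> h' \<xi>"
  shows "energy_of p h \<le> energy_of p h'"
proof -
  have "(\<integral>\<^sup>+\<xi>. ennreal (h' \<xi> powr (- real CARD('n))) \<partial>surface_measure) \<le> (\<integral>\<^sup>+\<xi>. ennreal (h \<xi> powr (- real CARD('n))) \<partial>surface_measure)"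
    using assms by (intro nn_integral_mono ennreal_leI powr_mono2') (auto simp: space_surface_measure)
  then show ?thesis unfolding energy_of_def
    by (intro mult_left_mono ennreal_powr_neg_antimono) auto
qed

lemma affine_const_pos:
  assumes "1 < p" and n: "1 \<le> n"
  shows "0 < affine_const n p"
proof -
  have "unit_ball_vol (n + p - 2) > 0" "unit_ball_vol n > 0" "unit_ball_vol (p - 1) > 0"
    using n assms by (auto intro!: unit_ball_vol_pos)
  then have "unit_ball_vol (n + p - 2) \<noteq> 0" "unit_ball_vol n \<noteq> 0" "unit_ball_vol (p - 1) \<noteq> 0" "n \<noteq> 0"
    using n by linarith+
  then show ?thesis unfolding affine_const_def by (intro mult_pos_pos) auto
qed

text \<open>
  In these terms an upper bound on the energy is a lower bound on the volume of the unit ball of \<open>h\<close>.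
\<close>

lemma energy_of_volume:
  fixes h :: "real^'n \<Rightarrow> real"
  assumes h[measurable]: "h \<in> borel_measurable borel"
    and hom: "\<And>c x. 0 < c \<Longrightarrow> h (c *\<^sub>R x) = c * h x" and pos: "\<And>x. x \<noteq> 0 \<Longrightarrow> 0 < h x"
  shows "energy_of p h = ennreal (affine_const (real CARD('n)) p) * ennreal_powr (of_nat CARD('n) * emeasure lborel {x. h x \<le> 1}) (- 1 / real CARD('n))"
  unfolding energy_of_def using polar_volume[OF h hom pos] by simp

lemma energy_of_const:
  assumes p: "1 < p"
  shows "\<exists>e>0. \<forall>c>0. energy_of p (\<lambda>\<xi> :: real^'n. c) = ennreal (c * e)"
proof -
  define n where "n = real CARD('n)"
  have n: "1 \<le> n" unfolding n_def by (metis One_nat_def Suc_leI of_nat_1 of_nat_le_iff zero_less_card_finite)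
  define \<sigma> where "\<sigma> = n * measure lborel (ball (0 :: real^'n) 1 - {0})"
  have b0: "emeasure lborel (ball (0 :: real^'n) 1 - {0}) = emeasure lborel (ball (0 :: real^'n) 1)"
    by (intro emeasure_Diff_null_set) (auto simp: null_sets_def)
  have m0: "measure lborel (ball (0 :: real^'n) 1 - {0}) = measure lborel (ball (0 :: real^'n) 1)"
    using b0 by (simp add: measure_def)
  then have "\<sigma> = n * measure lborel (ball (0 :: real^'n) 1)" by (simp add: \<sigma>_def)
  then have \<sigma>: "\<sigma> > 0" using n content_ball_pos[of 1 "0 :: real^'n"] by simp
  have int: "(\<integral>\<^sup>+\<xi>. ennreal (c powr (- n)) \<partial>(surface_measure :: (real^'n) measure)) = ennreal (c powr (- n) * \<sigma>)" for c
  proof -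
    have "(\<integral>\<^sup>+\<xi>. ennreal (c powr (- n)) \<partial>(surface_measure :: (real^'n) measure)) = of_nat CARD('n) * (\<integral>\<^sup>+x. ennreal (c powr (- n)) * indicator (ball 0 1 - {0 :: real^'n}) x \<partial>lborel)"
      by (rule surface_measure_nn_integral) simp
    also have "\<dots> = of_nat CARD('n) * (ennreal (c powr (- n)) * ennreal (measure lborel (ball (0 :: real^'n) 1 - {0})))"
      using emeasure_bounded_finite[OF bounded_ball, of "0 :: real^'n" 1] b0
      by (subst nn_integral_cmult_indicator) (auto simp: emeasure_eq_ennreal_measure m0)
    also have "\<dots> = ennreal (c powr (- n) * \<sigma>)"
      by (simp add: \<sigma>_def n_def ennreal_mult[symmetric] ennreal_of_nat_eq_real_of_nat mult_ac)
    finally show ?thesis .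
  qed
  define e where "e = affine_const n p * \<sigma> powr (- 1 / n)"
  have a: "affine_const n p > 0" by (rule affine_const_pos[OF p n])
  have "energy_of p (\<lambda>\<xi> :: real^'n. c) = ennreal (c * e)" if "c > 0" for c
  proof -
    have "energy_of p (\<lambda>\<xi> :: real^'n. c) = ennreal (affine_const n p) * ennreal_powr (ennreal (c powr (- n) * \<sigma>)) (- 1 / n)"
      unfolding energy_of_def n_def[symmetric] int ..
    also have "\<dots> = ennreal (affine_const n p * (c powr (- n) * \<sigma>) powr (- 1 / n))"
    proof -
      have "ennreal_powr (ennreal (c powr (- n) * \<sigma>)) (- 1 / n) = ennreal ((c powr (- n) * \<sigma>) powr (- 1 / n))"
        by (rule ennreal_powr_ennreal) (use that \<sigma> n in auto)
      then show ?thesis using a by (simp add: ennreal_mult)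
    qed
    also have "(c powr (- n) * \<sigma>) powr (- 1 / n) = c * \<sigma> powr (- 1 / n)"
      using that n by (simp add: powr_mult powr_powr)
    finally show ?thesis by (simp add: e_def mult_ac)
  qed
  moreover have "e > 0" using a \<sigma> by (simp add: e_def)
  ultimately show ?thesis by blast
qed

lemma energy_of_cmult:
  fixes h :: "real^'n \<Rightarrow> real"
  assumes p: "1 < p" and c: "0 < c" and h: "h \<in> borel_measurable borel" "\<And>\<xi>. 0 \<le> h \<xi>"
  shows "energy_of p (\<lambda>\<xi>. c * h \<xi>) = ennreal c * energy_of p h"
proof -
  define n where "n = real CARD('n)"
  have n: "1 \<le> n" unfolding n_def by (metis One_nat_def Suc_leI of_nat_1 of_nat_le_iff zero_less_card_finite)
  have hm: "(\<lambda>\<xi>. ennreal (h \<xi> powr (- n))) \<in> borel_measurable surface_measure"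
    using h(1) by (simp add: measurable_cong_sets[OF sets_surface_measure refl] measurable_restrict_space1)
  define I where "I = (\<integral>\<^sup>+\<xi>. ennreal (h \<xi> powr (- n)) \<partial>surface_measure)"
  have "(\<integral>\<^sup>+\<xi>. ennreal ((c * h \<xi>) powr (- n)) \<partial>surface_measure) = (\<integral>\<^sup>+\<xi>. ennreal (c powr (- n)) * ennreal (h \<xi> powr (- n)) \<partial>surface_measure)"
    using c h by (simp add: powr_mult ennreal_mult)
  also have "\<dots> = ennreal (c powr (- n)) * I" unfolding I_def by (rule nn_integral_cmult[OF hm])
  finally have "energy_of p (\<lambda>\<xi>. c * h \<xi>) = ennreal (affine_const n p) * ennreal_powr (ennreal (c powr (- n)) * I) (- 1 / n)"
    by (simp add: energy_of_def n_def)
  also have "ennreal_powr (ennreal (c powr (- n)) * I) (- 1 / n) = ennreal c * ennreal_powr I (- 1 / n)"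
  proof (cases "I = 0 \<or> I = \<infinity>")
    case True
    then show ?thesis using n c by (auto simp: ennreal_powr_def ennreal_mult_top ennreal_top_mult)
  next
    case False
    then obtain i where i: "I = ennreal i" "0 < i" by (cases I) (auto simp: less_le)
    then show ?thesis using c n
      by (simp add: ennreal_mult[symmetric] ennreal_powr_ennreal powr_mult powr_powr)
  qed
  finally show ?thesis by (simp add: energy_of_def I_def n_def mult_ac)
qed

section \<open>Functions in the Sobolev space\<close>

lemma borel_measurable_lebesgue_on_locally_integrable:
  fixes f :: "real^'n \<Rightarrow> 'b::euclidean_space"
  assumes \<Omega>: "open \<Omega>" and f: "locally_integrable_on f \<Omega>"
  shows "f \<in> borel_measurable (lebesgue_on \<Omega>)"
proof -
  obtain \<D> where D: "countable \<D>" "\<D> \<subseteq> Pow \<Omega>" "\<And>X. X \<in> \<D> \<Longrightarrow> \<exists>a b. X = cbox a b" "\<Union>\<D> = \<Omega>"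
    using open_countable_Union_open_cbox[OF \<Omega>] by metis
  show ?thesis
  proof (rule measurable_piecewise_restrict[OF D(1)])
    show "space (lebesgue_on \<Omega>) \<subseteq> \<Union>\<D>" using D(4) by (simp add: space_restrict_space)
    fix X assume X: "X \<in> \<D>"
    obtain a b where ab: "X = cbox a b" using D(3)[OF X] by blast
    have sub: "X \<subseteq> \<Omega>" using D(2) X by auto
    have Xl: "X \<in> sets lebesgue" "\<Omega> \<in> sets lebesgue" using ab \<Omega> by auto
    show "X \<inter> space (lebesgue_on \<Omega>) \<in> sets (lebesgue_on \<Omega>)"
      using Xl sub by (auto simp: space_restrict_space sets_restrict_space_iff Int_absorb2)
    have "f absolutely_integrable_on X" using f sub ab by (auto simp: locally_integrable_on_def)
    then have "f \<in> borel_measurable (lebesgue_on X)"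
      using Xl by (intro absolutely_integrable_measurable[THEN iffD1, THEN conjunct1]) auto
    moreover have "restrict_space (lebesgue_on \<Omega>) X = lebesgue_on X"
      using Xl sub by (subst restrict_restrict_space) (auto simp: Int_absorb1)
    ultimately show "f \<in> borel_measurable (restrict_space (lebesgue_on \<Omega>) X)" by simp
  qed
qed

lemma Lp_norm_nn: "open \<Omega> \<Longrightarrow> Lp_norm p \<Omega> f = ennreal_powr (\<integral>\<^sup>+x. ennreal (norm (f x) powr p) \<partial>lebesgue_on \<Omega>) (1 / p)"
  unfolding Lp_norm_def by (subst nn_integral_restrict_space) auto

lemma Lp_norm_in_Lp:
  assumes "open \<Omega>" "0 < p" "in_Lp p (lebesgue_on \<Omega>) f"
  shows "Lp_norm p \<Omega> f = ennreal (lpn p (lebesgue_on \<Omega>) f)"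
proof -
  have "Lp_norm p \<Omega> f = ennreal_powr (ennreal (lpn p (lebesgue_on \<Omega>) f powr p)) (1 / p)"
    using assms by (simp add: Lp_norm_nn nn_integral_in_Lp)
  then show ?thesis using assms lpn_nonneg[of p "lebesgue_on \<Omega>" f]
    by (cases "lpn p (lebesgue_on \<Omega>) f = 0") (auto simp: ennreal_powr_def powr_powr)
qed

lemma in_Lp_Lp_norm:
  assumes "open \<Omega>" "0 < p" "f \<in> borel_measurable (lebesgue_on \<Omega>)" "Lp_norm p \<Omega> f < \<infinity>"
  shows "in_Lp p (lebesgue_on \<Omega>) f"
proof (rule in_LpI_nn[OF assms(3)])
  show "(\<integral>\<^sup>+x. ennreal (norm (f x) powr p) \<partial>lebesgue_on \<Omega>) < \<infinity>"
    using assms(4) assms(2) unfolding Lp_norm_nn[OF assms(1)]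
    by (auto simp: ennreal_powr_def less_top[symmetric] split: if_splits)
qed

lemma lebesgue_on_finite:
  assumes "open (\<Omega> :: (real^'n) set)" "bounded \<Omega>"
  shows "finite_measure (lebesgue_on \<Omega>)"
  using assms emeasure_bounded_finite[of \<Omega>]
  by (intro finite_measureI) (auto simp: space_restrict_space emeasure_restrict_space)

lemma in_Lp_lebesgue_on:
  fixes F :: "real^'n \<Rightarrow> 'b::euclidean_space"
  assumes \<Omega>: "open \<Omega>" and F: "in_Lp p lborel F" and z: "\<And>x. x \<notin> \<Omega> \<Longrightarrow> F x = 0"
  shows "in_Lp p (lebesgue_on \<Omega>) F" "lpn p (lebesgue_on \<Omega>) F = lpn p lborel F"
proof -
  have Fm: "F \<in> borel_measurable borel" using in_LpD(1)[OF F] by simp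
  have pm: "(\<lambda>x. norm (F x) powr p) \<in> borel_measurable borel" using Fm by measurable
  have eq: "(\<lambda>x. indicator \<Omega> x *\<^sub>R norm (F x) powr p) = (\<lambda>x. norm (F x) powr p)"
  proof (rule ext)
    show "indicator \<Omega> x *\<^sub>R norm (F x) powr p = norm (F x) powr p" for x
      using z[of x] by (auto simp: indicator_def)
  qed
  have \<Omega>l: "\<Omega> \<inter> space lebesgue \<in> sets lebesgue" using \<Omega> by simp
  have "integrable lebesgue (\<lambda>x. norm (F x) powr p)"
    using in_LpD(2)[OF F] pm by (subst integrable_completion) auto
  then have "integrable (lebesgue_on \<Omega>) (\<lambda>x. norm (F x) powr p)"
    by (subst integrable_restrict_space[OF \<Omega>l]) (simp only: eq)
  moreover have "F \<in> borel_measurable (lebesgue_on \<Omega>)"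
    using Fm by (intro measurable_restrict_space1 measurable_completion) simp
  ultimately show "in_Lp p (lebesgue_on \<Omega>) F" by (simp add: in_Lp_def)
  have "(\<integral>x. norm (F x) powr p \<partial>lebesgue_on \<Omega>) = (\<integral>x. norm (F x) powr p \<partial>lebesgue)"
    by (subst integral_restrict_space[OF \<Omega>l]) (simp only: eq)
  also have "\<dots> = (\<integral>x. norm (F x) powr p \<partial>lborel)" using pm by (intro integral_completion) simp
  finally show "lpn p (lebesgue_on \<Omega>) F = lpn p lborel F" by (simp add: lpn_def)
qed

lemma in_Lp_restrict:
  fixes F :: "real^'n \<Rightarrow> 'b::euclidean_space"
  assumes \<Omega>: "open \<Omega>" and F: "in_Lp p lborel F" and p: "0 < p"
  shows "in_Lp p (lebesgue_on \<Omega>) F" "lpn p (lebesgue_on \<Omega>) F \<le> lpn p lborel F"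
proof -
  let ?G = "\<lambda>x. indicator \<Omega> x *\<^sub>R F x"
  have Fm: "F \<in> borel_measurable borel" using in_LpD(1)[OF F] by simp
  have Gm: "?G \<in> borel_measurable lborel" using Fm \<Omega> by simp
  have G: "in_Lp p lborel ?G" "lpn p lborel ?G \<le> lpn p lborel F"
    using in_Lp_mono[OF F Gm _ p] by (auto simp: indicator_def)
  have G2: "in_Lp p (lebesgue_on \<Omega>) ?G" "lpn p (lebesgue_on \<Omega>) ?G = lpn p lborel ?G"
    using in_Lp_lebesgue_on[OF \<Omega> G(1)] by auto
  have Fm': "F \<in> borel_measurable (lebesgue_on \<Omega>)" using Fm by (intro measurable_restrict_space1 measurable_completion) simp
  have "AE x in lebesgue_on \<Omega>. norm (?G x) = norm (F x)" by (rule AE_I2) (simp add: space_restrict_space)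
  from in_Lp_cong[OF G2(1) Fm' this] show "in_Lp p (lebesgue_on \<Omega>) F" "lpn p (lebesgue_on \<Omega>) F \<le> lpn p lborel F"
    using G2(2) G(2) by auto
qed

lemma test_in_Lp_on:
  fixes f :: "real^'n \<Rightarrow> real"
  assumes \<Omega>: "open \<Omega>" and f: "f \<in> test_functions \<Omega>" and p: "0 < p"
  shows "in_Lp p (lebesgue_on \<Omega>) f" "lpn p (lebesgue_on \<Omega>) f = lpn p lborel f"
    "in_Lp p (lebesgue_on \<Omega>) (gradient f)" "lpn p (lebesgue_on \<Omega>) (gradient f) = lpn p lborel (gradient f)"
    "dirn p \<Omega> (gradient f) = dnorm p f"
  using in_Lp_lebesgue_on[OF \<Omega> test_in_Lp(1)[OF f p]] in_Lp_lebesgue_on[OF \<Omega> test_in_Lp(2)[OF f p]]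
    in_Lp_lebesgue_on(2)[OF \<Omega> test_in_Lp(3)[OF f p]] test_outside[OF f]
  by (auto simp: dirn_def dnorm_def fun_eq_iff)

lemma test_in_W01p:
  fixes f :: "real^'n \<Rightarrow> real"
  assumes \<Omega>: "open \<Omega>" and f: "f \<in> test_functions \<Omega>" and p: "0 < p"
  shows "f \<in> W01p p \<Omega>"
proof -
  have "Lp_norm p \<Omega> (\<lambda>x. f x - f x) = 0" "Lp_norm p \<Omega> (\<lambda>x. gradient f x - gradient f x) = 0"
    using p by (auto simp: Lp_norm_def ennreal_powr_def)
  then show ?thesis unfolding W01p_def
    using f test_has_weak_gradient[OF f \<Omega>]
    by (auto intro!: exI[of _ "gradient f"] exI[of _ "\<lambda>k. f"])
qed

lemma in_Lp_inner:
  fixes g :: "'a \<Rightarrow> real^'n"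
  assumes g: "in_Lp p M g" and p: "1 \<le> p"
  shows "in_Lp p M (\<lambda>x. g x \<bullet> \<xi>)" "lpn p M (\<lambda>x. g x \<bullet> \<xi>) \<le> lpn p M g * norm \<xi>"
proof -
  have p0: "0 < p" using p by simp
  have m: "(\<lambda>x. g x \<bullet> \<xi>) \<in> borel_measurable M" using in_LpD(1)[OF g] by measurable
  have ae: "AE x in M. norm (g x \<bullet> \<xi>) \<le> norm (norm \<xi> *\<^sub>R g x)"
  proof (rule AE_I2)
    show "norm (g x \<bullet> \<xi>) \<le> norm (norm \<xi> *\<^sub>R g x)" for x
      using Cauchy_Schwarz_ineq2[of "g x" \<xi>] by (simp add: mult.commute)
  qed
  show "in_Lp p M (\<lambda>x. g x \<bullet> \<xi>)" by (rule in_Lp_mono(1)[OF in_Lp_scaleR(1)[OF g p0] m ae p0])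
  show "lpn p M (\<lambda>x. g x \<bullet> \<xi>) \<le> lpn p M g * norm \<xi>"
    using in_Lp_mono(2)[OF in_Lp_scaleR(1)[OF g p0] m ae p0] in_Lp_scaleR(2)[OF g p0, of "norm \<xi>"] by (simp add: mult.commute)
qed

lemma W01p_approximation:
  fixes u :: "real^'n \<Rightarrow> real"
  assumes \<Omega>: "open \<Omega>" and p: "1 \<le> p" and u: "u \<in> W01p p \<Omega>"
  shows "\<exists>g \<phi>. has_weak_gradient \<Omega> u g \<and> in_Lp p (lebesgue_on \<Omega>) u \<and> in_Lp p (lebesgue_on \<Omega>) g \<and>
    (\<forall>k :: nat. \<phi> k \<in> test_functions \<Omega>) \<and> (\<lambda>k. lpn p (lebesgue_on \<Omega>) (\<lambda>x. \<phi> k x - u x)) \<longlonglongrightarrow> 0 \<and>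
    (\<lambda>k. lpn p (lebesgue_on \<Omega>) (\<lambda>x. gradient (\<phi> k) x - g x)) \<longlonglongrightarrow> 0"
proof -
  have p0: "0 < p" using p by simp
  from u obtain g \<phi> where g: "has_weak_gradient \<Omega> u g" and \<phi>: "\<And>k :: nat. \<phi> k \<in> test_functions \<Omega>"
    and lim: "(\<lambda>k. Lp_norm p \<Omega> (\<lambda>x. \<phi> k x - u x)) \<longlonglongrightarrow> 0" "(\<lambda>k. Lp_norm p \<Omega> (\<lambda>x. gradient (\<phi> k) x - g x)) \<longlonglongrightarrow> 0"
    unfolding W01p_def by blast
  have um: "u \<in> borel_measurable (lebesgue_on \<Omega>)" and gm: "g \<in> borel_measurable (lebesgue_on \<Omega>)"
    using g by (auto simp: has_weak_gradient_def intro!: borel_measurable_lebesgue_on_locally_integrable[OF \<Omega>])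
  note t = test_in_Lp_on[OF \<Omega> \<phi> p0]
  have "\<forall>\<^sub>F k in sequentially. Lp_norm p \<Omega> (\<lambda>x. \<phi> k x - u x) < \<infinity> \<and> Lp_norm p \<Omega> (\<lambda>x. gradient (\<phi> k) x - g x) < \<infinity>"
    using order_tendstoD(2)[OF lim(1), of \<infinity>] order_tendstoD(2)[OF lim(2), of \<infinity>] by (simp add: eventually_conj)
  from eventually_happens[OF this] obtain K
    where K: "Lp_norm p \<Omega> (\<lambda>x. \<phi> K x - u x) < \<infinity>" "Lp_norm p \<Omega> (\<lambda>x. gradient (\<phi> K) x - g x) < \<infinity>" by auto
  have "in_Lp p (lebesgue_on \<Omega>) (\<lambda>x. \<phi> K x - u x)"
    by (rule in_Lp_Lp_norm[OF \<Omega> p0 _ K(1)]) (intro borel_measurable_diff in_LpD(1)[OF t(1)] um)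
  from minkowski_diff(1)[OF t(1)[of K] this p] have uL: "in_Lp p (lebesgue_on \<Omega>) u" by simp
  have "in_Lp p (lebesgue_on \<Omega>) (\<lambda>x. gradient (\<phi> K) x - g x)"
    by (rule in_Lp_Lp_norm[OF \<Omega> p0 _ K(2)]) (intro borel_measurable_diff in_LpD(1)[OF t(3)] gm)
  from minkowski_diff(1)[OF t(3)[of K] this p] have gL: "in_Lp p (lebesgue_on \<Omega>) g" by simp
  have "(\<lambda>k. ennreal (lpn p (lebesgue_on \<Omega>) (\<lambda>x. \<phi> k x - u x))) \<longlonglongrightarrow> ennreal 0"
    using lim(1) by (simp add: Lp_norm_in_Lp[OF \<Omega> p0 minkowski_diff(1)[OF t(1) uL p]])
  then have 1: "(\<lambda>k. lpn p (lebesgue_on \<Omega>) (\<lambda>x. \<phi> k x - u x)) \<longlonglongrightarrow> 0" by (subst (asm) tendsto_ennreal_iff) auto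
  have "(\<lambda>k. ennreal (lpn p (lebesgue_on \<Omega>) (\<lambda>x. gradient (\<phi> k) x - g x))) \<longlonglongrightarrow> ennreal 0"
    using lim(2) by (simp add: Lp_norm_in_Lp[OF \<Omega> p0 minkowski_diff(1)[OF t(3) gL p]])
  then have 2: "(\<lambda>k. lpn p (lebesgue_on \<Omega>) (\<lambda>x. gradient (\<phi> k) x - g x)) \<longlonglongrightarrow> 0" by (subst (asm) tendsto_ennreal_iff) auto
  show ?thesis using g uL gL \<phi> 1 2 by blast
qed

text \<open>
  The estimate is uniform over unit vectors \<open>\<xi>\<close>; this uniformity is what transfers energies to limits.
\<close>

lemma dnorm_dirn_diff:
  fixes g :: "real^'n \<Rightarrow> real^'n"
  assumes \<Omega>: "open \<Omega>" and p: "1 \<le> p" and f: "f \<in> test_functions \<Omega>" and g: "in_Lp p (lebesgue_on \<Omega>) g"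
  shows "\<bar>dnorm p f \<xi> - dirn p \<Omega> g \<xi>\<bar> \<le> lpn p (lebesgue_on \<Omega>) (\<lambda>x. gradient f x - g x) * norm \<xi>"
proof -
  have p0: "0 < p" using p by simp
  note t = test_in_Lp_on[OF \<Omega> f p0]
  have "\<bar>dirn p \<Omega> (gradient f) \<xi> - dirn p \<Omega> g \<xi>\<bar> \<le> lpn p (lebesgue_on \<Omega>) (\<lambda>x. gradient f x \<bullet> \<xi> - g x \<bullet> \<xi>)"
    unfolding dirn_def by (rule minkowski_diff(3)[OF in_Lp_inner(1)[OF t(3) p] in_Lp_inner(1)[OF g p] p])
  also have "\<dots> \<le> lpn p (lebesgue_on \<Omega>) (\<lambda>x. gradient f x - g x) * norm \<xi>"
    using in_Lp_inner(2)[OF minkowski_diff(1)[OF t(3) g p] p, of \<xi>] by (simp add: inner_diff_left)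
  finally show ?thesis using t(5) by simp
qed

lemma dnorm_tendsto_dirn:
  assumes \<Omega>: "open \<Omega>" and p: "1 \<le> p" and f: "\<And>k. f k \<in> test_functions \<Omega>" and g: "in_Lp p (lebesgue_on \<Omega>) g"
    and lim: "(\<lambda>k. lpn p (lebesgue_on \<Omega>) (\<lambda>x. gradient (f k) x - g x)) \<longlonglongrightarrow> 0"
  shows "(\<lambda>k. dnorm p (f k) \<xi>) \<longlonglongrightarrow> dirn p \<Omega> g \<xi>"
proof (rule LIM_zero_cancel, rule Lim_null_comparison)
  show "\<forall>\<^sub>F k in sequentially. norm (dnorm p (f k) \<xi> - dirn p \<Omega> g \<xi>) \<le> lpn p (lebesgue_on \<Omega>) (\<lambda>x. gradient (f k) x - g x) * norm \<xi>"
    using dnorm_dirn_diff[OF \<Omega> p f g] by (intro always_eventually) auto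
  show "(\<lambda>k. lpn p (lebesgue_on \<Omega>) (\<lambda>x. gradient (f k) x - g x) * norm \<xi>) \<longlonglongrightarrow> 0"
    using tendsto_mult_left_zero[OF lim] .
qed

lemma lpn_tendsto:
  assumes "\<And>k. in_Lp p M (f k)" "in_Lp p M u" "1 \<le> p" "(\<lambda>k. lpn p M (\<lambda>x. f k x - u x)) \<longlonglongrightarrow> 0"
  shows "(\<lambda>k. lpn p M (f k)) \<longlonglongrightarrow> lpn p M u"
proof (rule LIM_zero_cancel, rule Lim_null_comparison[OF _ assms(4)])
  show "\<forall>\<^sub>F k in sequentially. norm (lpn p M (f k) - lpn p M u) \<le> lpn p M (\<lambda>x. f k x - u x)"
    using minkowski_diff(3)[OF assms(1,2,3)] by (intro always_eventually) auto
qed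

lemma W01p_Poincare:
  fixes u :: "real^'n \<Rightarrow> real"
  assumes \<Omega>: "open \<Omega>" and p: "1 \<le> p" and \<Omega>R: "\<Omega> \<subseteq> ball 0 R" and R: "0 < R"
    and \<phi>: "\<And>k. \<phi> k \<in> test_functions \<Omega>" and u: "in_Lp p (lebesgue_on \<Omega>) u" and g: "in_Lp p (lebesgue_on \<Omega>) g"
    and lim: "(\<lambda>k. lpn p (lebesgue_on \<Omega>) (\<lambda>x. \<phi> k x - u x)) \<longlonglongrightarrow> 0"
      "(\<lambda>k. lpn p (lebesgue_on \<Omega>) (\<lambda>x. gradient (\<phi> k) x - g x)) \<longlonglongrightarrow> 0"
  shows "lpn p (lebesgue_on \<Omega>) u * norm \<xi> \<le> 2 * R * dirn p \<Omega> g \<xi>"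
proof (rule LIMSEQ_le)
  have p0: "0 < p" using p by simp
  note t = test_in_Lp_on[OF \<Omega> \<phi> p0]
  show "(\<lambda>k. lpn p (lebesgue_on \<Omega>) (\<phi> k) * norm \<xi>) \<longlonglongrightarrow> lpn p (lebesgue_on \<Omega>) u * norm \<xi>"
    by (intro tendsto_mult tendsto_const lpn_tendsto t(1) u p lim)
  show "(\<lambda>k. 2 * R * dnorm p (\<phi> k) \<xi>) \<longlonglongrightarrow> 2 * R * dirn p \<Omega> g \<xi>"
    by (intro tendsto_mult tendsto_const dnorm_tendsto_dirn[OF \<Omega> p \<phi> g lim(2)])
  show "\<exists>N. \<forall>k\<ge>N. lpn p (lebesgue_on \<Omega>) (\<phi> k) * norm \<xi> \<le> 2 * R * dnorm p (\<phi> k) \<xi>"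
    using directional_Poincare[OF \<phi> p \<Omega>R R] t(2) by auto
qed

lemma dirn_borel:
  fixes g :: "real^'n \<Rightarrow> real^'n"
  assumes p: "1 \<le> p" and g: "in_Lp p (lebesgue_on \<Omega>) g"
  shows "dirn p \<Omega> g \<in> borel_measurable borel"
proof -
  have "(lpn p (lebesgue_on \<Omega>) g)-lipschitz_on UNIV (dirn p \<Omega> g)"
  proof (rule lipschitz_onI)
    fix x y
    have "\<bar>dirn p \<Omega> g x - dirn p \<Omega> g y\<bar> \<le> lpn p (lebesgue_on \<Omega>) (\<lambda>z. g z \<bullet> x - g z \<bullet> y)"
      unfolding dirn_def by (rule minkowski_diff(3)[OF in_Lp_inner(1)[OF g p] in_Lp_inner(1)[OF g p] p])
    also have "\<dots> \<le> lpn p (lebesgue_on \<Omega>) g * norm (x - y)"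
      using in_Lp_inner(2)[OF g p, of "x - y"] by (simp add: inner_diff_right)
    finally show "dist (dirn p \<Omega> g x) (dirn p \<Omega> g y) \<le> lpn p (lebesgue_on \<Omega>) g * dist x y" by (simp add: dist_norm)
  qed simp
  then show ?thesis by (intro borel_measurable_continuous_onI lipschitz_on_continuous_on)
qed

text \<open>
  Positivity in every direction excludes the case \<open>0\<close> of \<open>ennreal_powr\<close>, and uniqueness of the weak gradient
  replaces the chosen representative by \<open>g\<close>.
\<close>

lemma affine_energy_eq:
  fixes u :: "real^'n \<Rightarrow> real"
  assumes \<Omega>: "open \<Omega>" and p: "1 < p" and u: "has_weak_gradient \<Omega> u g" and g: "in_Lp p (lebesgue_on \<Omega>) g"
    and pos: "\<And>\<xi>. norm \<xi> = 1 \<Longrightarrow> 0 < dirn p \<Omega> g \<xi>"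
  shows "affine_energy p \<Omega> u = energy_of p (dirn p \<Omega> g)"
proof -
  define w where "w = weak_gradient \<Omega> u"
  have "has_weak_gradient \<Omega> u w" unfolding w_def weak_gradient_def by (rule someI[of _ g]) (rule u)
  then have ae: "AE x in lebesgue_on \<Omega>. w x = g x" using weak_gradient_unique[OF \<Omega> _ u] by blast
  have n: "real CARD('n) > 0" by simp
  have "ennreal_powr (\<integral>\<^sup>+x\<in>\<Omega>. ennreal (\<bar>w x \<bullet> \<xi>\<bar> powr p) \<partial>lebesgue) (- real CARD('n) / p) = ennreal (dirn p \<Omega> g \<xi> powr (- real CARD('n)))"
    if \<xi>: "norm \<xi> = 1" for \<xi>
  proof -
    have "(\<integral>\<^sup>+x\<in>\<Omega>. ennreal (\<bar>w x \<bullet> \<xi>\<bar> powr p) \<partial>lebesgue) = (\<integral>\<^sup>+x. ennreal (\<bar>w x \<bullet> \<xi>\<bar> powr p) \<partial>lebesgue_on \<Omega>)"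
      using \<Omega> by (subst nn_integral_restrict_space) auto
    also have "\<dots> = (\<integral>\<^sup>+x. ennreal (norm (g x \<bullet> \<xi>) powr p) \<partial>lebesgue_on \<Omega>)"
      by (rule nn_integral_cong_AE) (use ae in \<open>eventually_elim, simp\<close>)
    also have "\<dots> = ennreal (dirn p \<Omega> g \<xi> powr p)"
      unfolding dirn_def using p by (intro nn_integral_in_Lp in_Lp_inner(1)[OF g]) auto
    finally have "(\<integral>\<^sup>+x\<in>\<Omega>. ennreal (\<bar>w x \<bullet> \<xi>\<bar> powr p) \<partial>lebesgue) = ennreal (dirn p \<Omega> g \<xi> powr p)" .
    then show ?thesis using pos[OF \<xi>] p by (simp add: ennreal_powr_ennreal powr_powr)
  qed
  then have "(\<integral>\<^sup>+\<xi>. ennreal_powr (\<integral>\<^sup>+x\<in>\<Omega>. ennreal (\<bar>w x \<bullet> \<xi>\<bar> powr p) \<partial>lebesgue) (- real CARD('n) / p) \<partial>surface_measure)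
    = (\<integral>\<^sup>+\<xi>. ennreal (dirn p \<Omega> g \<xi> powr (- real CARD('n))) \<partial>surface_measure)"
    by (intro nn_integral_cong) (auto simp: space_surface_measure)
  then show ?thesis by (simp add: affine_energy_def energy_of_def w_def)
qed

lemma affine_energy_test:
  fixes f :: "real^'n \<Rightarrow> real"
  assumes \<Omega>: "open \<Omega>" and p: "1 < p" and f: "f \<in> test_functions \<Omega>" and \<Omega>R: "\<Omega> \<subseteq> ball 0 R" "0 < R"
    and pos: "0 < lpn p lborel f"
  shows "affine_energy p \<Omega> f = energy_of p (dnorm p f)"
proof -
  have p0: "0 < p" "1 \<le> p" using p by auto
  note t = test_in_Lp_on[OF \<Omega> f p0(1)]
  have "0 < dnorm p f \<xi>" if "norm \<xi> = 1" for \<xi>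
  proof -
    have "0 < 2 * R * dnorm p f \<xi>" using directional_Poincare[OF f p0(2) \<Omega>R, of \<xi>] that pos by simp
    then show ?thesis using \<Omega>R(2) by (simp add: zero_less_mult_iff)
  qed
  then show ?thesis using affine_energy_eq[OF \<Omega> p test_has_weak_gradient[OF f \<Omega>] t(3)] t(5) by simp
qed

lemma affine_mu_le:
  assumes "u \<in> W01p p \<Omega>"
  shows "affine_mu p q \<Omega> * Lp_norm q \<Omega> u \<le> affine_energy p \<Omega> u"
proof -
  let ?S = "{\<mu>. \<forall>u\<in>W01p p \<Omega>. \<mu> * Lp_norm q \<Omega> u \<le> affine_energy p \<Omega> u}"
  have "affine_mu p q \<Omega> * Lp_norm q \<Omega> u = (SUP \<mu>\<in>?S. \<mu> * Lp_norm q \<Omega> u)"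
    unfolding affine_mu_def using SUP_mult_right_ennreal[of "\<lambda>x. x" ?S "Lp_norm q \<Omega> u"] by simp
  also have "\<dots> \<le> affine_energy p \<Omega> u" by (intro SUP_least) (use assms in auto)
  finally show ?thesis .
qed

lemma nonzero_lpn_pos:
  assumes "in_Lp p M u" "0 < p" "\<not> (AE x in M. u x = 0)"
  shows "0 < lpn p M u"
  using lpn_eq_0_iff[OF assms(1,2)] assms(3) lpn_nonneg[of p M u] by linarith

section \<open>No extremal function at the critical exponent\<close>

text \<open>
  Comparison with constant functions on the sphere.
\<close>

lemma energy_of_finite_pos:
  fixes h :: "real^'n \<Rightarrow> real"
  assumes p: "1 < p" and c: "0 < c" and h: "\<And>\<xi>. norm \<xi> = 1 \<Longrightarrow> c \<le> h \<xi>" "\<And>\<xi>. norm \<xi> = 1 \<Longrightarrow> h \<xi> \<le> C"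
  shows "\<exists>e>0. energy_of p h = ennreal e"
proof -
  obtain e0 where e0: "e0 > 0" "\<And>c. c > 0 \<Longrightarrow> energy_of p (\<lambda>\<xi> :: real^'n. c) = ennreal (c * e0)"
    using energy_of_const[OF p, where 'n='n] by blast
  have "norm (axis undefined 1 :: real^'n) = 1" by simp
  then have C: "C > 0" using h c by (meson less_le_trans)
  have 1: "ennreal (c * e0) \<le> energy_of p h"
    unfolding e0(2)[OF c, symmetric] by (rule energy_of_mono) (use c h in auto)
  have 2: "energy_of p h \<le> ennreal (C * e0)"
    unfolding e0(2)[OF C, symmetric] by (rule energy_of_mono) (use c h in \<open>auto intro: less_le_trans\<close>)
  define e where "e = enn2real (energy_of p h)"
  have "energy_of p h < \<infinity>" using 2 by (rule le_less_trans) simp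
  then have e: "energy_of p h = ennreal e" by (simp add: e_def)
  have "ennreal (c * e0) \<le> ennreal e" using 1 e by simp
  moreover have "0 < c * e0" using c e0 by simp
  ultimately have "0 < e" by (metis ennreal_le_iff2 less_le_trans not_le)
  then show ?thesis using e by blast
qed

lemma lpn_affine:
  fixes F :: "real^'n \<Rightarrow> 'b::euclidean_space"
  assumes F: "in_Lp q lborel F" and G: "in_Lp q lborel (\<lambda>x. F (c *\<^sub>R x + b))" and c: "0 < c" and q: "0 < q"
  shows "lpn q lborel (\<lambda>x. F (c *\<^sub>R x + b)) = c powr (- real CARD('n) / q) * lpn q lborel F"
proof -
  define n where "n = real CARD('n)"
  have Fm[measurable]: "F \<in> borel_measurable borel" using in_LpD(1)[OF F] by simp
  have "ennreal (lpn q lborel F powr q) = ennreal (c ^ CARD('n)) * ennreal (lpn q lborel (\<lambda>x. F (c *\<^sub>R x + b)) powr q)"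
    using nn_integral_lborel_scale[of "\<lambda>x. ennreal (norm (F x) powr q)" c b] c
    unfolding nn_integral_in_Lp[OF F q] nn_integral_in_Lp[OF G q] by simp
  then have "lpn q lborel F powr q = c powr n * lpn q lborel (\<lambda>x. F (c *\<^sub>R x + b)) powr q"
    using c by (simp add: ennreal_mult[symmetric] n_def powr_realpow)
  then have "(lpn q lborel F powr q) powr (1 / q) = (c powr n) powr (1 / q) * (lpn q lborel (\<lambda>x. F (c *\<^sub>R x + b)) powr q) powr (1 / q)"
    by (simp add: powr_mult)
  then have "lpn q lborel F = c powr (n / q) * lpn q lborel (\<lambda>x. F (c *\<^sub>R x + b))"
    using q by (simp add: powr_powr)
  then show ?thesis using c by (simp add: n_def powr_minus field_simps)
qed

text \<open>
  A dilation moves the support of \<open>\<psi>\<close> into a ball contained in \<open>\<Omega>\<close>. It multiplies the directional norms and the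
  norm at the critical exponent by the same power of the dilation factor, so the factor cancels.
\<close>

lemma critical_scaling:
  fixes \<psi> :: "real^'n \<Rightarrow> real" and \<Omega> :: "(real^'n) set"
  assumes \<Omega>: "open \<Omega>" "x0 \<in> \<Omega>" and p: "1 < p" "p < real CARD('n)"
    and ineq: "\<And>\<phi>. \<phi> \<in> test_functions \<Omega> \<Longrightarrow> 0 < lpn p lborel \<phi> \<Longrightarrow>
        ennreal (m * lpn (critical_exponent (real CARD('n)) p) lborel \<phi>) \<le> energy_of p (dnorm p \<phi>)"
    and \<psi>: "\<psi> \<in> test_functions UNIV" "0 < lpn p lborel \<psi>" and m: "0 \<le> m"
  shows "ennreal (m * lpn (critical_exponent (real CARD('n)) p) lborel \<psi>) \<le> energy_of p (dnorm p \<psi>)"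
proof -
  define n where "n = real CARD('n)"
  define q where "q = critical_exponent n p"
  have q: "0 < q" "n / q = n / p - 1" using p by (auto simp: q_def critical_exponent_def n_def field_simps)
  have p0: "0 < p" "1 \<le> p" using p by auto
  obtain K where K: "compact K" "\<And>x. x \<notin> K \<Longrightarrow> \<psi> x = 0" using test_support[OF \<psi>(1)] by blast
  obtain r where r: "0 < r" "\<And>x. x \<in> K \<Longrightarrow> norm x \<le> r"
    using compact_imp_bounded[OF K(1)] unfolding bounded_pos by auto
  obtain \<rho> where \<rho>: "0 < \<rho>" "cball x0 \<rho> \<subseteq> \<Omega>" using \<Omega> open_contains_cball by blast
  \<comment> \<open>The dilation maps the ball of radius \<open>\<rho>\<close> about x0 onto one that contains the support of \<open>\<psi>\<close>.\<close>
  define c where "c = r / \<rho>"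
  have c: "0 < c" using r \<rho> by (simp add: c_def)
  define b where "b = - c *\<^sub>R x0"
  define \<phi> where "\<phi> = (\<lambda>x. \<psi> (c *\<^sub>R x + b))"
  have \<phi>: "\<phi> \<in> test_functions \<Omega>"
  proof (rule test_functionsI[OF _ compact_cball \<rho>(2)])
    show "C_k k \<phi>" for k unfolding \<phi>_def by (intro C_k_affine test_C_k[OF \<psi>(1)])
    show "\<phi> x = 0" if "x \<notin> cball x0 \<rho>" for x
    proof -
      have "\<rho> < norm (x - x0)" using that by (simp add: dist_norm norm_minus_commute)
      then have "r < c * norm (x - x0)" using r \<rho> by (simp add: c_def field_simps)
      moreover have "c *\<^sub>R x + b = c *\<^sub>R (x - x0)" by (simp add: b_def scaleR_diff_right)
      ultimately have "c *\<^sub>R x + b \<notin> K" using r(2)[of "c *\<^sub>R x + b"] c by auto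
      then show ?thesis using K(2) by (simp add: \<phi>_def)
    qed
  qed
  have grad: "gradient \<phi> x = c *\<^sub>R gradient \<psi> (c *\<^sub>R x + b)" for x
  proof (rule gradientI)
    have "(\<phi> has_derivative (\<lambda>h. gradient \<psi> (c *\<^sub>R x + b) \<bullet> (c *\<^sub>R h))) (at x)"
      unfolding \<phi>_def by (rule has_derivative_compose[OF _ test_has_derivative[OF \<psi>(1)]]) (auto intro!: derivative_eq_intros)
    then show "(\<phi> has_derivative (\<lambda>h. c *\<^sub>R gradient \<psi> (c *\<^sub>R x + b) \<bullet> h)) (at x)" by simp
  qed
  have lq: "lpn s lborel \<phi> = c powr (- n / s) * lpn s lborel \<psi>" if "0 < s" for s
    using lpn_affine[OF test_in_Lp(1)[OF \<psi>(1) that] test_in_Lp(1)[OF \<phi> that, unfolded \<phi>_def] c that] by (simp add: \<phi>_def n_def)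
  have dn: "dnorm p \<phi> \<xi> = c powr (1 - n / p) * dnorm p \<psi> \<xi>" for \<xi>
  proof -
    have eq: "(\<lambda>x. gradient \<phi> x \<bullet> \<xi>) = (\<lambda>x. (c *\<^sub>R (gradient \<psi> (c *\<^sub>R x + b) \<bullet> \<xi>)))" by (simp add: grad)
    have G: "in_Lp p lborel (\<lambda>x. gradient \<psi> (c *\<^sub>R x + b) \<bullet> \<xi>)"
    proof -
      have "(\<lambda>x. inverse c *\<^sub>R (gradient \<phi> x \<bullet> \<xi>)) = (\<lambda>x. gradient \<psi> (c *\<^sub>R x + b) \<bullet> \<xi>)"
        using c by (simp add: grad mult.assoc[symmetric])
      then show ?thesis
        using in_Lp_scaleR(1)[OF test_in_Lp(3)[OF \<phi> p0(1), of \<xi>] p0(1), of "inverse c"] by simp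
    qed
    have "dnorm p \<phi> \<xi> = c * lpn p lborel (\<lambda>x. gradient \<psi> (c *\<^sub>R x + b) \<bullet> \<xi>)"
      unfolding dnorm_def eq using in_Lp_scaleR(2)[OF G p0(1), of c] c by simp
    also have "\<dots> = c * (c powr (- n / p) * dnorm p \<psi> \<xi>)"
      using lpn_affine[OF test_in_Lp(3)[OF \<psi>(1) p0(1), of \<xi>] G c p0(1)] by (simp add: dnorm_def n_def)
    also have "\<dots> = c powr (1 - n / p) * dnorm p \<psi> \<xi>" using c by (simp add: powr_diff powr_minus divide_inverse)
    finally show ?thesis .
  qed
  define k where "k = c powr (1 - n / p)"
  have k: "k > 0" using c by (simp add: k_def)
  have "0 < lpn p lborel \<phi>" using lq[OF p0(1)] \<psi>(2) c by simp
  from ineq[OF \<phi> this] have "ennreal (m * lpn q lborel \<phi>) \<le> energy_of p (dnorm p \<phi>)" by (simp add: q_def n_def)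
  moreover have "m * lpn q lborel \<phi> = k * (m * lpn q lborel \<psi>)" using lq[OF q(1)] q(2) by (simp add: k_def)
  moreover have "energy_of p (dnorm p \<phi>) = ennreal k * energy_of p (dnorm p \<psi>)"
  proof -
    have "dnorm p \<phi> = (\<lambda>\<xi>. k * dnorm p \<psi> \<xi>)" using dn by (auto simp: k_def)
    then show ?thesis using energy_of_cmult[OF p(1) k dnorm_borel[OF \<psi>(1) p0(2)]] by simp
  qed
  ultimately have "ennreal k * ennreal (m * lpn q lborel \<psi>) \<le> ennreal k * energy_of p (dnorm p \<psi>)"
    using k m by (simp add: ennreal_mult)
  then have "ennreal (m * lpn q lborel \<psi>) \<le> energy_of p (dnorm p \<psi>)"
    using k by (subst (asm) ennreal_mult_le_mult_iff) auto
  then show ?thesis by (simp add: q_def n_def)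
qed

text \<open>
  A smooth approximation of \<open>|f|\<close> whose gradient is \<open>gradient f\<close> times a factor of modulus at most one, so that
  no directional norm increases.
\<close>

lemma smooth_abs_test:
  fixes f :: "real^'n \<Rightarrow> real"
  assumes f: "f \<in> test_functions \<Omega>" and e: "0 < e"
  shows "(\<lambda>x. sqrt ((f x)\<^sup>2 + e\<^sup>2) - e) \<in> test_functions \<Omega>"
    "\<bar>gradient (\<lambda>x. sqrt ((f x)\<^sup>2 + e\<^sup>2) - e) x \<bullet> \<xi>\<bar> \<le> \<bar>gradient f x \<bullet> \<xi>\<bar>"
proof -
  have pos: "0 < f x * f x + e\<^sup>2" for x using e by (simp add: add_nonneg_pos)
  have eq: "sqrt ((f x)\<^sup>2 + e\<^sup>2) = (f x * f x + e\<^sup>2) powr (1 / 2)" for x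
    using pos[of x] by (simp add: powr_half_sqrt power2_eq_square)
  obtain K where K: "compact K" "K \<subseteq> \<Omega>" "\<And>x. x \<notin> K \<Longrightarrow> f x = 0" using test_support[OF f] by blast
  show "(\<lambda>x. sqrt ((f x)\<^sup>2 + e\<^sup>2) - e) \<in> test_functions \<Omega>"
  proof (rule test_functionsI[OF _ K(1,2)])
    show "C_k k (\<lambda>x. sqrt ((f x)\<^sup>2 + e\<^sup>2) - e)" for k
      unfolding eq using pos by (intro C_k_minus C_k_powr C_k_add C_k_mult C_k_const test_C_k[OF f]) auto
    show "sqrt ((f x)\<^sup>2 + e\<^sup>2) - e = 0" if "x \<notin> K" for x using K(3)[OF that] e by simp
  qed
  define s where "s = sqrt ((f x)\<^sup>2 + e\<^sup>2)"
  have s: "0 < s" "\<bar>f x\<bar> \<le> s" using pos[of x] by (auto simp: s_def power2_eq_square intro: real_le_rsqrt)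
  have "gradient (\<lambda>x. sqrt ((f x)\<^sup>2 + e\<^sup>2) - e) x = (f x / s) *\<^sub>R gradient f x"
  proof (rule gradientI)
    show "((\<lambda>x. sqrt ((f x)\<^sup>2 + e\<^sup>2) - e) has_derivative (\<lambda>h. (f x / s) *\<^sub>R gradient f x \<bullet> h)) (at x)"
      using s pos[of x] 
      by (auto intro!: derivative_eq_intros test_has_derivative[OF f] simp: s_def power2_eq_square field_simps)
  qed
  then have "\<bar>gradient (\<lambda>x. sqrt ((f x)\<^sup>2 + e\<^sup>2) - e) x \<bullet> \<xi>\<bar> = (\<bar>f x\<bar> / s) * \<bar>gradient f x \<bullet> \<xi>\<bar>"
    using s by (simp add: abs_mult)
  also have "\<dots> \<le> 1 * \<bar>gradient f x \<bullet> \<xi>\<bar>" using s by (intro mult_right_mono) auto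
  finally show "\<bar>gradient (\<lambda>x. sqrt ((f x)\<^sup>2 + e\<^sup>2) - e) x \<bullet> \<xi>\<bar> \<le> \<bar>gradient f x \<bullet> \<xi>\<bar>" by simp
qed

lemma powr_one_plus_le:
  fixes k s :: real
  assumes "1 \<le> k" "0 \<le> s" "s \<le> 1"
  shows "(1 + s) powr k \<le> 1 + k * 2 powr (k - 1) * s"
proof -
  have "(1 + s) powr k + k * (1 + s) powr (k - 1) * (1 - (1 + s)) \<le> 1 powr k"
    using assms by (intro powr_above_tangent) auto
  then have "(1 + s) powr k \<le> 1 + k * (1 + s) powr (k - 1) * s" by simp
  also have "\<dots> \<le> 1 + k * 2 powr (k - 1) * s"
    using assms by (intro add_left_mono mult_right_mono mult_left_mono powr_mono2) auto
  finally show ?thesis .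
qed

text \<open>
  As \<open>t\<close> tends to zero the right hand side is \<open>A\<close> plus a term of order \<open>t powr p\<close>, which is smaller than
  \<open>D * t\<close>.
\<close>

lemma no_linear_growth:
  fixes A D B p k :: real
  assumes p: "1 < p" and k: "1 \<le> k" and D: "0 < D" and B: "0 < B" and A: "0 < A"
    and le: "\<And>t. 0 < t \<Longrightarrow> t \<le> 1 \<Longrightarrow> A + D * t \<le> A * (1 + B * t powr p) powr k"
  shows False
proof -
  define M where "M = A * k * 2 powr (k - 1) * B"
  have M: "M > 0" using A k B by (simp add: M_def)
  have lim: "((\<lambda>t. t powr r) \<longlongrightarrow> 0) (at_right 0)" if "0 < r" for r :: real
  proof -
    have "((\<lambda>t. t powr r) \<longlongrightarrow> 0 powr r) (at_right 0)"
      using that by (intro tendsto_powr2 tendsto_const tendsto_ident_at) (auto simp: eventually_at_filter)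
    then show ?thesis by simp
  qed
  have "\<forall>\<^sub>F t in at_right 0. B * t powr p < 1"
    using tendsto_mult_right_zero[OF lim, of p B] p by (intro order_tendstoD(2)) auto
  moreover have "\<forall>\<^sub>F t in at_right 0. M * t powr (p - 1) < D"
    using tendsto_mult_right_zero[OF lim, of "p - 1" M] p D by (intro order_tendstoD(2)) auto
  moreover have "\<forall>\<^sub>F t in at_right (0 :: real). t < 1 \<and> 0 < t"
    by (rule eventually_at_rightI[of 0 1]) auto
  ultimately have "\<forall>\<^sub>F t in at_right 0. B * t powr p < 1 \<and> M * t powr (p - 1) < D \<and> t < 1 \<and> 0 < t"
    by eventually_elim auto
  from eventually_happens[OF this] obtain t where t: "B * t powr p < 1" "M * t powr (p - 1) < D" "t < 1" "0 < t"
    by (auto simp: trivial_limit_at_right_real)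
  have "A + D * t \<le> A * (1 + B * t powr p) powr k" using t by (intro le) auto
  also have "\<dots> \<le> A * (1 + k * 2 powr (k - 1) * (B * t powr p))"
    using A t B k by (intro mult_left_mono powr_one_plus_le) auto
  also have "\<dots> = A + M * t powr p" by (simp add: M_def algebra_simps)
  also have "t powr p = t powr (p - 1) * t" using t by (simp add: powr_minus_one_mult)
  finally have "D * t \<le> (M * t powr (p - 1)) * t" by simp
  then show False using t by simp
qed

text \<open>
  The cutoff is constant on the ball that contains the support of \<open>f\<close>, so at each point at most one of the two
  gradients is nonzero and \<open>p\<close>-th powers add, with no cross term linear in \<open>t\<close>.
\<close>

lemma cutoff_perturbation_dnorm:
  fixes f \<eta> :: "real^'n \<Rightarrow> real"
  assumes f: "f \<in> test_functions \<Omega>" and \<Omega>: "\<Omega> \<subseteq> ball 0 R" and e: "0 < e" and t: "0 \<le> t" and p: "1 \<le> p"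
    and \<eta>: "\<eta> \<in> test_functions UNIV" "\<And>x. norm x \<le> R \<Longrightarrow> \<eta> x = 1"
  defines "\<psi> \<equiv> \<lambda>x. (sqrt ((f x)\<^sup>2 + e\<^sup>2) - e) + t * \<eta> x"
  shows "\<psi> \<in> test_functions UNIV" "dnorm p \<psi> \<xi> powr p \<le> dnorm p f \<xi> powr p + (t * dnorm p \<eta> \<xi>) powr p"
proof -
  have p0: "0 < p" using p by simp
  let ?F = "\<lambda>x. sqrt ((f x)\<^sup>2 + e\<^sup>2) - e"
  have F: "?F \<in> test_functions \<Omega>" by (rule smooth_abs_test(1)[OF f e])
  have F': "?F \<in> test_functions UNIV" by (rule test_mono[OF _ F]) simp
  note t\<eta> = test_cmult[OF \<eta>(1), of t]
  show \<psi>: "\<psi> \<in> test_functions UNIV" unfolding \<psi>_def by (rule test_add(1)[OF F' t\<eta>(1)])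
  have grad: "gradient \<psi> x = gradient ?F x + t *\<^sub>R gradient \<eta> x" for x
    unfolding \<psi>_def using test_add(2)[OF F' t\<eta>(1)] t\<eta>(2) by simp
  have pt: "\<bar>gradient \<psi> x \<bullet> \<xi>\<bar> powr p \<le> \<bar>gradient f x \<bullet> \<xi>\<bar> powr p + \<bar>t *\<^sub>R (gradient \<eta> x \<bullet> \<xi>)\<bar> powr p" for x
  proof (cases "x \<in> \<Omega>")
    case True
    have "gradient \<eta> x = 0"
    proof (rule gradientI)
      have "((\<lambda>x. 1) has_derivative (\<lambda>h. 0 \<bullet> h)) (at x)" by simp
      then show "(\<eta> has_derivative (\<lambda>h. 0 \<bullet> h)) (at x)"
        by (rule has_derivative_transform_within_open[of _ _ _ _ "ball 0 R"]) (use True \<Omega> \<eta>(2) in auto)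
    qed
    then have "\<bar>gradient \<psi> x \<bullet> \<xi>\<bar> \<le> \<bar>gradient f x \<bullet> \<xi>\<bar>" using smooth_abs_test(2)[OF f e, of x \<xi>] by (simp add: grad)
    then have "\<bar>gradient \<psi> x \<bullet> \<xi>\<bar> powr p \<le> \<bar>gradient f x \<bullet> \<xi>\<bar> powr p" using p by (intro powr_mono2) auto
    then show ?thesis by (simp add: add_increasing2)
  next
    case False
    then have "gradient ?F x = 0" by (rule test_outside(2)[OF F])
    then show ?thesis by (simp add: grad)
  qed
  have i1: "integrable lborel (\<lambda>x. \<bar>gradient f x \<bullet> \<xi>\<bar> powr p)" using in_LpD(2)[OF test_in_Lp(3)[OF f p0, of \<xi>]] by simp
  have T: "in_Lp p lborel (\<lambda>x. t *\<^sub>R (gradient \<eta> x \<bullet> \<xi>))" by (rule in_Lp_scaleR(1)[OF test_in_Lp(3)[OF \<eta>(1) p0] p0])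
  have i2: "integrable lborel (\<lambda>x. \<bar>t *\<^sub>R (gradient \<eta> x \<bullet> \<xi>)\<bar> powr p)" using in_LpD(2)[OF T] by simp
  have "dnorm p \<psi> \<xi> powr p = (\<integral>x. \<bar>gradient \<psi> x \<bullet> \<xi>\<bar> powr p \<partial>lborel)" unfolding dnorm_def using p0 by (simp add: lpn_powr)
  also have "\<dots> \<le> (\<integral>x. \<bar>gradient f x \<bullet> \<xi>\<bar> powr p + \<bar>t *\<^sub>R (gradient \<eta> x \<bullet> \<xi>)\<bar> powr p \<partial>lborel)"
    using in_LpD(2)[OF test_in_Lp(3)[OF \<psi> p0, of \<xi>]] i1 i2 by (intro integral_mono pt) auto
  also have "\<dots> = lpn p lborel (\<lambda>x. gradient f x \<bullet> \<xi>) powr p + lpn p lborel (\<lambda>x. t *\<^sub>R (gradient \<eta> x \<bullet> \<xi>)) powr p"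
    using i1 i2 p0 by (simp add: lpn_powr)
  also have "lpn p lborel (\<lambda>x. t *\<^sub>R (gradient \<eta> x \<bullet> \<xi>)) = t * dnorm p \<eta> \<xi>"
    using in_Lp_scaleR(2)[OF test_in_Lp(3)[OF \<eta>(1) p0, of \<xi>] p0, of t] t by (simp add: dnorm_def)
  finally show "dnorm p \<psi> \<xi> powr p \<le> dnorm p f \<xi> powr p + (t * dnorm p \<eta> \<xi>) powr p" by (simp add: dnorm_def)
qed

lemma test_in_ball:
  assumes f: "f \<in> test_functions \<Omega>"
  shows "\<exists>R>0. f \<in> test_functions (ball 0 R)"
proof -
  obtain K where K: "compact K" "K \<subseteq> \<Omega>" "\<And>x. x \<notin> K \<Longrightarrow> f x = 0" using test_support[OF f] by blast
  obtain R where R: "0 < R" "K \<subseteq> ball 0 R" using bounded_subset_ballD[OF compact_imp_bounded[OF K(1)], of 0] by blast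
  have "f \<in> test_functions (ball 0 R)" by (rule test_functionsI[OF test_C_k[OF f] K(1) R(2) K(3)])
  then show ?thesis using R(1) by blast
qed

text \<open>
  The function \<open>\<bar>u\<bar> + t\<close> on \<open>\<Omega>\<close> is reached as a limit of the perturbed approximants
  \<open>sqrt ((\<phi> k)\<^sup>2 + \<epsilon>\<^sup>2) - \<epsilon> + t * \<eta>\<close>, to which the inequality on the whole space applies. Restricting
  their norms to \<open>\<Omega>\<close> loses only a nonnegative amount, and Fatou's lemma suffices for the passage to the limit.
\<close>

lemma no_critical_extremal:
  fixes \<Omega> :: "(real^'n) set"
  assumes p: "1 < p" "p < real CARD('n)" and \<Omega>: "open \<Omega>" "bounded \<Omega>"
    and ext: "affine_extremal p (critical_exponent (real CARD('n)) p) \<Omega> u"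
  shows False
proof -
  define n where "n = real CARD('n)"
  define q where "q = critical_exponent n p"
  let ?L = "lebesgue_on \<Omega>"
  have p0: "0 < p" "1 \<le> p" using p by auto
  have "0 < n - p" using p by (simp add: n_def)
  then have "p * (n - p) < n * p" using p by (simp add: algebra_simps)
  then have pq: "p < q" using \<open>0 < n - p\<close> by (simp add: q_def critical_exponent_def pos_less_divide_eq)
  have q: "1 < q" "0 < q" using p pq by auto
  have uW: "u \<in> W01p p \<Omega>" and unz: "\<not> (AE x in ?L. u x = 0)" and eqE: "affine_mu p q \<Omega> * Lp_norm q \<Omega> u = affine_energy p \<Omega> u"
    using ext by (auto simp: affine_extremal_def q_def n_def)
  obtain R where R: "0 < R" "\<Omega> \<subseteq> ball 0 R" using \<Omega>(2) bounded_subset_ballD[of \<Omega> 0] by blast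
  obtain x0 where x0: "x0 \<in> \<Omega>"
    using unz by (metis AE_I2 space_restrict_space Int_iff)
  obtain g \<phi> where g: "has_weak_gradient \<Omega> u g" and uL: "in_Lp p ?L u" and gL: "in_Lp p ?L g"
    and \<phi>: "\<And>k :: nat. \<phi> k \<in> test_functions \<Omega>" and lim: "(\<lambda>k. lpn p ?L (\<lambda>x. \<phi> k x - u x)) \<longlonglongrightarrow> 0"
    "(\<lambda>k. lpn p ?L (\<lambda>x. gradient (\<phi> k) x - g x)) \<longlonglongrightarrow> 0"
    using W01p_approximation[OF \<Omega>(1) p0(2) uW] by blast
  define h where "h = dirn p \<Omega> g"
  define c0 where "c0 = lpn p ?L u / (2 * R)"
  have c0: "0 < c0" using nonzero_lpn_pos[OF uL p0(1) unz] R by (simp add: c0_def)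
  have hlow: "c0 \<le> h \<xi>" if "norm \<xi> = 1" for \<xi>
    using W01p_Poincare[OF \<Omega>(1) p0(2) R(2,1) \<phi> uL gL lim, of \<xi>] that R by (simp add: c0_def h_def field_simps)
  have hup: "h \<xi> \<le> lpn p ?L g" if "norm \<xi> = 1" for \<xi>
    using in_Lp_inner(2)[OF gL p0(2), of \<xi>] that by (simp add: h_def dirn_def)
  obtain e where e: "0 < e" "energy_of p h = ennreal e"     using energy_of_finite_pos[OF p(1) c0, of h "lpn p ?L g"] hlow hup by blast
  have hpos: "0 < h \<xi>" if "norm \<xi> = 1" for \<xi> using hlow[OF that] c0 by linarith
  have Eu: "affine_energy p \<Omega> u = ennreal e"
    using affine_energy_eq[OF \<Omega>(1) p(1) g gL] hpos e(2) by (simp add: h_def)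
  have N0: "Lp_norm q \<Omega> u \<noteq> 0" using eqE Eu e(1) by auto
  have mu0: "affine_mu p q \<Omega> \<noteq> 0" using eqE Eu e(1) by auto
  have N1: "Lp_norm q \<Omega> u \<noteq> \<infinity>" using eqE Eu mu0 by (auto simp: ennreal_mult_eq_top_iff)
  have mu1: "affine_mu p q \<Omega> \<noteq> \<infinity>" using eqE Eu N0 by (auto simp: ennreal_mult_eq_top_iff)
  define m where "m = enn2real (affine_mu p q \<Omega>)"
  have m: "affine_mu p q \<Omega> = ennreal m" "0 < m"
    using mu0 mu1 by (auto simp: m_def enn2real_positive_iff less_top[symmetric] zero_less_iff_neq_zero)
  have uq: "in_Lp q ?L u" using in_Lp_Lp_norm[OF \<Omega>(1) q(2) in_LpD(1)[OF uL]] N1 by (simp add: less_top[symmetric])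
  define A where "A = lpn q ?L u"
  have NA: "Lp_norm q \<Omega> u = ennreal A" unfolding A_def by (rule Lp_norm_in_Lp[OF \<Omega>(1) q(2) uq])
  have A: "0 < A" using N0 NA by (auto simp: A_def less_le)
  have mA: "m * A = e" using eqE m(1) NA Eu m(2) A e(1) by (simp add: ennreal_mult[symmetric])
  have ineq: "ennreal (m * lpn q lborel f) \<le> energy_of p (dnorm p f)" if f: "f \<in> test_functions \<Omega>" "0 < lpn p lborel f" for f
  proof -
    have "ennreal m * Lp_norm q \<Omega> f \<le> affine_energy p \<Omega> f"
      using affine_mu_le[OF test_in_W01p[OF \<Omega>(1) f(1) p0(1)], of q] m(1) by simp
    then show ?thesis
      using affine_energy_test[OF \<Omega>(1) p(1) f(1) R(2,1) f(2)] Lp_norm_in_Lp[OF \<Omega>(1) q(2) test_in_Lp_on(1)[OF \<Omega>(1) f(1) q(2)]]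
        test_in_Lp_on(2)[OF \<Omega>(1) f(1) q(2)] m(2) by (simp add: ennreal_mult)
  qed
  have ineq': "ennreal (m * lpn q lborel f) \<le> energy_of p (dnorm p f)" if f: "f \<in> test_functions UNIV" "0 < lpn p lborel f" for f :: "real^'n \<Rightarrow> real"
    unfolding q_def n_def
  proof (rule critical_scaling[OF \<Omega>(1) x0 p])
    show "ennreal (m * lpn (critical_exponent (real CARD('n)) p) lborel \<phi>) \<le> energy_of p (dnorm p \<phi>)"
      if "\<phi> \<in> test_functions \<Omega>" "0 < lpn p lborel \<phi>" for \<phi>
      using ineq[OF that] by (simp add: q_def n_def)
  qed (use f m(2) in auto)
  obtain \<eta> :: "real^'n \<Rightarrow> real" where \<eta>: "\<eta> \<in> test_functions UNIV" "\<And>x. norm x \<le> R \<Longrightarrow> \<eta> x = 1" "\<And>x. 0 \<le> \<eta> x"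
    using exists_cutoff[OF R(1)] by metis
  define G where "G = lpn p lborel (gradient \<eta>)"
  have G0: "0 \<le> G" by (simp add: G_def)
  \<comment> \<open>One unit of B pays for replacing u by its approximants, the other summand for the gradient of the cutoff; c0 is the lower bound on the directional norms of u.\<close>
  define B where "B = 1 + (G / c0) powr p"
  have B: "0 < B" by (simp add: B_def add_pos_nonneg)
  obtain r where r: "strict_mono (r :: nat \<Rightarrow> nat)" "AE x in ?L. (\<lambda>k. \<phi> (r k) x) \<longlonglongrightarrow> u x"
    using Lp_AE_subseq[OF test_in_Lp_on(1)[OF \<Omega>(1) \<phi> p0(1)] uL p0(2) lim(1)] by blast
  define \<delta> where "\<delta> k = lpn p ?L (\<lambda>x. gradient (\<phi> k) x - g x)" for k
  have key: "in_Lp q ?L (\<lambda>x. \<bar>u x\<bar> + t) \<and> lpn q ?L (\<lambda>x. \<bar>u x\<bar> + t) \<le> A * (1 + B * t powr p) powr (1 / p)" if t: "0 < t" for t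
  proof -
    \<comment> \<open>Smooth approximants of \<open>\<bar>u\<bar> + t\<close> on \<open>\<Omega>\<close>.\<close>
    define \<psi> where "\<psi> k = (\<lambda>x. (sqrt ((\<phi> k x)\<^sup>2 + (inverse (real (Suc k)))\<^sup>2) - inverse (real (Suc k))) + t * \<eta> x)" for k
    have ik: "0 < inverse (real (Suc k))" for k by simp
    have \<psi>: "\<psi> k \<in> test_functions UNIV" for k
      unfolding \<psi>_def by (rule cutoff_perturbation_dnorm(1)[OF \<phi> R(2) ik less_imp_le[OF t] p0(2) \<eta>(1,2)])
    have pert: "dnorm p (\<psi> k) \<xi> powr p \<le> dnorm p (\<phi> k) \<xi> powr p + (t * dnorm p \<eta> \<xi>) powr p" for k \<xi>
      unfolding \<psi>_def by (rule cutoff_perturbation_dnorm(2)[OF \<phi> R(2) ik less_imp_le[OF t] p0(2) \<eta>(1,2)])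
    have \<psi>nn: "0 \<le> sqrt ((\<phi> k x)\<^sup>2 + (inverse (real (Suc k)))\<^sup>2) - inverse (real (Suc k))" for k x
      using real_sqrt_le_mono[of "(inverse (real (Suc k)))\<^sup>2" "(\<phi> k x)\<^sup>2 + (inverse (real (Suc k)))\<^sup>2"] by simp
    have "(\<lambda>k. (1 + \<delta> k / c0) powr p) \<longlonglongrightarrow> (1 + 0 / c0) powr p"
      using lim(2) by (intro tendsto_powr tendsto_add tendsto_const tendsto_divide) (use c0 in \<open>auto simp: \<delta>_def\<close>)
    then have "\<forall>\<^sub>F k in sequentially. (1 + \<delta> k / c0) powr p < 1 + t powr p"
      using t by (intro order_tendstoD(2)) auto
    then obtain N where N: "\<And>k. k \<ge> N \<Longrightarrow> (1 + \<delta> k / c0) powr p < 1 + t powr p" by (auto simp: eventually_sequentially)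
    define b where "b = (1 + B * t powr p) powr (1 / p)"
    have "0 < 1 + B * t powr p" using B by (intro add_pos_nonneg) auto
    then have b: "0 < b" by (simp add: b_def)
    have bound: "lpn q lborel (\<psi> k) \<le> A * b" if k: "k \<ge> N" for k
    proof -
      have dle: "dnorm p (\<psi> k) \<xi> \<le> b * h \<xi>" if \<xi>: "norm \<xi> = 1" for \<xi>
      proof -
        have h0: "0 < h \<xi>" by (rule hpos[OF \<xi>])
        have "dnorm p (\<phi> k) \<xi> \<le> h \<xi> + \<delta> k" using dnorm_dirn_diff[OF \<Omega>(1) p0(2) \<phi> gL, of k \<xi>] \<xi> by (simp add: h_def \<delta>_def)
        also have "\<dots> \<le> h \<xi> * (1 + \<delta> k / c0)"
        proof -
          have "\<delta> k * c0 \<le> \<delta> k * h \<xi>" by (intro mult_left_mono hlow[OF \<xi>]) (simp add: \<delta>_def)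
          then show ?thesis using c0 by (simp add: field_simps)
        qed
        finally have "dnorm p (\<phi> k) \<xi> powr p \<le> (h \<xi> * (1 + \<delta> k / c0)) powr p" using p0 by (intro powr_mono2) auto
        also have "\<dots> = h \<xi> powr p * (1 + \<delta> k / c0) powr p" by (simp add: powr_mult)
        also have "\<dots> \<le> h \<xi> powr p * (1 + t powr p)" using N[OF k] by (intro mult_left_mono) auto
        finally have 1: "dnorm p (\<phi> k) \<xi> powr p \<le> h \<xi> powr p * (1 + t powr p)" .
        have "t * dnorm p \<eta> \<xi> \<le> h \<xi> * (t * (G / c0))"
        proof -
          have "dnorm p \<eta> \<xi> \<le> G" using dnorm_le[OF \<eta>(1) p0(2), of \<xi>] \<xi> by (simp add: G_def)
          also have "\<dots> \<le> h \<xi> * (G / c0)" using mult_left_mono[OF hlow[OF \<xi>] G0] c0 by (simp add: field_simps)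
          finally have "t * dnorm p \<eta> \<xi> \<le> t * (h \<xi> * (G / c0))" using t by (intro mult_left_mono) auto
          then show ?thesis by (simp only: mult.left_commute)
        qed
        then have "(t * dnorm p \<eta> \<xi>) powr p \<le> (h \<xi> * (t * (G / c0))) powr p" using t p0 by (intro powr_mono2) auto
        also have "\<dots> = h \<xi> powr p * (t powr p * (G / c0) powr p)" by (simp only: powr_mult)
        finally have 2: "(t * dnorm p \<eta> \<xi>) powr p \<le> h \<xi> powr p * (t powr p * (G / c0) powr p)" .
        have "dnorm p (\<psi> k) \<xi> powr p \<le> h \<xi> powr p * (1 + B * t powr p)"
          using pert[of k \<xi>] 1 2 by (simp add: B_def algebra_simps)
        then have "(dnorm p (\<psi> k) \<xi> powr p) powr (1 / p) \<le> (h \<xi> powr p * (1 + B * t powr p)) powr (1 / p)"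
          using p0 by (intro powr_mono2) auto
        then show ?thesis using p0 h0 B t by (simp add: powr_powr powr_mult b_def mult.commute)
      qed
      show ?thesis
      proof (cases "0 < lpn p lborel (\<psi> k)")
        case True
        obtain R' where R': "0 < R'" "\<psi> k \<in> test_functions (ball 0 R')"
          using test_in_ball[OF \<psi>[of k]] by auto
        have dpos: "0 < dnorm p (\<psi> k) \<xi>" if "norm \<xi> = 1" for \<xi>
        proof -
          have "0 < 2 * R' * dnorm p (\<psi> k) \<xi>" using directional_Poincare[OF R'(2) p0(2) subset_refl R'(1), of \<xi>] that True by simp
          then show ?thesis using R'(1) by (simp add: zero_less_mult_iff)
        qed
        have "ennreal (m * lpn q lborel (\<psi> k)) \<le> energy_of p (dnorm p (\<psi> k))" by (rule ineq'[OF \<psi> True])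
        also have "\<dots> \<le> energy_of p (\<lambda>\<xi>. b * h \<xi>)" by (rule energy_of_mono[OF dpos dle])
        also have "\<dots> = ennreal b * ennreal e"
          using energy_of_cmult[OF p(1) b dirn_borel[OF p0(2) gL]] e(2) by (simp add: h_def dirn_def)
        also have "\<dots> = ennreal (m * (A * b))" using b e(1) by (simp add: ennreal_mult[symmetric] mA[symmetric] mult_ac)
        finally have "m * lpn q lborel (\<psi> k) \<le> m * (A * b)" using b A m(2) by (subst (asm) ennreal_le_iff) auto
        then show ?thesis using m(2) by simp
      next
        case False
        then have "lpn p lborel (\<psi> k) = 0" using lpn_nonneg[of p lborel "\<psi> k"] by linarith
        then have "AE x in lborel. \<psi> k x = 0" using lpn_eq_0_iff[OF test_in_Lp(1)[OF \<psi> p0(1)] p0(1)] by simp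
        then have "lpn q lborel (\<psi> k) = 0" using lpn_eq_0_iff[OF test_in_Lp(1)[OF \<psi> q(2)] q(2)] by simp
        then show ?thesis using A b by simp
      qed
    qed
    have in_k: "in_Lp q ?L (\<psi> (r (k + N)))" and bd_k: "lpn q ?L (\<psi> (r (k + N))) \<le> A * b" for k
    proof -
      have "r (k + N) \<ge> N" using seq_suble[OF r(1), of "k + N"] by linarith
      then show "in_Lp q ?L (\<psi> (r (k + N)))" "lpn q ?L (\<psi> (r (k + N))) \<le> A * b"
        using in_Lp_restrict[OF \<Omega>(1) test_in_Lp(1)[OF \<psi> q(2)] q(2)] bound by (auto intro: order_trans)
    qed
    have ae: "AE x in ?L. (\<lambda>k. \<psi> (r (k + N)) x) \<longlonglongrightarrow> \<bar>u x\<bar> + t"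
      using r(2) AE_space
    proof eventually_elim
      case (elim x)
      then have x: "x \<in> \<Omega>" by (simp add: space_restrict_space)
      then have \<eta>1: "\<eta> x = 1" using R(2) by (intro \<eta>(2)) auto
      have rs: "filterlim (\<lambda>k. r (k + N)) sequentially sequentially"
        using filterlim_compose[OF filterlim_subseq[OF r(1)] filterlim_add_const_nat_at_top[of N]] .
      have z: "(\<lambda>k. inverse (real (Suc (r (k + N))))) \<longlonglongrightarrow> 0"
        by (rule filterlim_compose[OF LIMSEQ_inverse_real_of_nat rs])
      have "(\<lambda>k. (sqrt ((\<phi> (r (k + N)) x)\<^sup>2 + (inverse (real (Suc (r (k + N)))))\<^sup>2) - inverse (real (Suc (r (k + N))))) + t * \<eta> x)
          \<longlonglongrightarrow> (sqrt ((u x)\<^sup>2 + 0\<^sup>2) - 0) + t * \<eta> x"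
        by (intro tendsto_intros z LIMSEQ_ignore_initial_segment[OF elim(1)])
      then show ?case by (simp add: \<psi>_def \<eta>1)
    qed
    have um: "(\<lambda>x. \<bar>u x\<bar> + t) \<in> borel_measurable ?L" using in_LpD(1)[OF uL] by measurable
    show ?thesis
      using Lp_Fatou[of q ?L "\<lambda>k. \<psi> (r (k + N))" "A * b", OF in_k bd_k q(2) _ ae um] A b by (simp add: b_def)
  qed
  interpret finite_measure ?L by (rule lebesgue_on_finite[OF \<Omega>])
  note [measurable] = in_LpD(1)[OF uL]
  \<comment> \<open>By convexity of the power, q D is a lower bound for the slope of the q-th power of the norm of \<open>\<bar>u\<bar> + t\<close>.\<close>
  define D where "D = (\<integral>x. \<bar>u x\<bar> powr (q - 1) \<partial>?L)"
  have Dint: "integrable ?L (\<lambda>x. \<bar>u x\<bar> powr (q - 1))"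
  proof (rule Bochner_Integration.integrable_bound)
    show "integrable ?L (\<lambda>x. 1 + \<bar>u x\<bar> powr q)" using in_LpD(2)[OF uq] by simp
    show "AE x in ?L. norm (\<bar>u x\<bar> powr (q - 1)) \<le> norm (1 + \<bar>u x\<bar> powr q)"
    proof (rule AE_I2)
      fix x
      have "\<bar>u x\<bar> powr (q - 1) \<le> 1 + \<bar>u x\<bar> powr q"
      proof (cases "\<bar>u x\<bar> \<le> 1")
        case True
        then have "\<bar>u x\<bar> powr (q - 1) \<le> 1 powr (q - 1)" using q by (intro powr_mono2) auto
        then show ?thesis by (simp add: add_increasing2)
      next
        case False
        then have "\<bar>u x\<bar> powr (q - 1) \<le> \<bar>u x\<bar> powr q" by (intro powr_mono) auto
        then show ?thesis by simp
      qed
      then show "norm (\<bar>u x\<bar> powr (q - 1)) \<le> norm (1 + \<bar>u x\<bar> powr q)" by simp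
    qed
  qed measurable
  have D: "D > 0"
  proof -
    have "D \<noteq> 0"
    proof
      assume "D = 0"
      then have "AE x in ?L. \<bar>u x\<bar> powr (q - 1) = 0"
        using Dint unfolding D_def by (subst (asm) integral_nonneg_eq_0_iff_AE) auto
      then show False using unz by simp
    qed
    moreover have "D \<ge> 0" unfolding D_def by (intro integral_nonneg_AE) auto
    ultimately show ?thesis by simp
  qed
  show False
  proof (rule no_linear_growth)
    show "1 < p" by (rule p(1))
    show "1 \<le> q / p" using pq p0 by simp
    show "0 < q * D" using q D by simp
    show "0 < B" by (rule B)
    show "0 < A powr q" using A by simp
    fix t :: real assume t: "0 < t" "t \<le> 1"
    from key[OF t(1)] have kin: "in_Lp q ?L (\<lambda>x. \<bar>u x\<bar> + t)" and kle: "lpn q ?L (\<lambda>x. \<bar>u x\<bar> + t) \<le> A * (1 + B * t powr p) powr (1 / p)" by auto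
    have iu: "integrable ?L (\<lambda>x. \<bar>u x\<bar> powr q)" using in_LpD(2)[OF uq] by simp
    have it: "integrable ?L (\<lambda>x. (\<bar>u x\<bar> + t) powr q)" using in_LpD(2)[OF kin] t by simp
    have pt: "\<bar>u x\<bar> powr q + q * t * \<bar>u x\<bar> powr (q - 1) \<le> (\<bar>u x\<bar> + t) powr q" for x
    proof (cases "u x = 0")
      case False
      then show ?thesis using powr_above_tangent[of q "\<bar>u x\<bar>" "\<bar>u x\<bar> + t"] q t by (simp add: mult_ac)
    qed (use q in simp)
    have "A powr q + q * D * t = (\<integral>x. \<bar>u x\<bar> powr q + q * t * \<bar>u x\<bar> powr (q - 1) \<partial>?L)"
      using iu Dint q(2) by (simp add: A_def D_def lpn_powr)
    also have "\<dots> \<le> (\<integral>x. (\<bar>u x\<bar> + t) powr q \<partial>?L)"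
      using iu Dint it by (intro integral_mono pt) auto
    also have "\<dots> = lpn q ?L (\<lambda>x. \<bar>u x\<bar> + t) powr q" using q(2) t by (simp add: lpn_powr)
    also have "\<dots> \<le> (A * (1 + B * t powr p) powr (1 / p)) powr q" using q kle by (intro powr_mono2) auto
    also have "\<dots> = A powr q * (1 + B * t powr p) powr (q / p)" by (simp add: powr_mult powr_powr)
    finally show "A powr q + q * D * t \<le> A powr q * (1 + B * t powr p) powr (q / p)" .
  qed
qed

section \<open>Extremal functions below the critical exponent\<close>

lemma Lp_integral_tendsto:
  fixes f :: "nat \<Rightarrow> 'a \<Rightarrow> real"
  assumes fin: "finite_measure M" and p: "1 \<le> p" and f: "\<And>k. in_Lp p M (f k)" and u: "in_Lp p M u"
    and lim: "(\<lambda>k. lpn p M (\<lambda>x. f k x - u x)) \<longlonglongrightarrow> 0"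
    and b[measurable]: "b \<in> borel_measurable M" and B: "\<And>x. \<bar>b x\<bar> \<le> B"
  shows "(\<lambda>k. \<integral>x. f k x * b x \<partial>M) \<longlonglongrightarrow> (\<integral>x. u x * b x \<partial>M)"
proof -
  have B0: "0 \<le> B" using B[of undefined] by (smt (verit) abs_ge_zero)
  have int: "integrable M (\<lambda>x. v x * b x)" if "in_Lp p M v" for v
  proof (rule Bochner_Integration.integrable_bound)
    have "in_Lp 1 M v" by (rule lpn_mono_exponent(1)[OF fin that]) (use p in auto)
    then have "integrable M (\<lambda>x. norm (v x))" by (simp add: in_Lp_def)
    then show "integrable M (\<lambda>x. B * norm (v x))" by (rule integrable_mult_right)
    show "(\<lambda>x. v x * b x) \<in> borel_measurable M" using in_LpD(1)[OF that] by measurable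
    show "AE x in M. norm (v x * b x) \<le> norm (B * norm (v x))"
      using B B0 by (intro AE_I2) (simp add: abs_mult mult.commute mult_right_mono)
  qed
  define V where "V = measure M (space M) powr (1 / 1 - 1 / p)"
  have est: "\<bar>(\<integral>x. f k x * b x \<partial>M) - (\<integral>x. u x * b x \<partial>M)\<bar> \<le> B * (V * lpn p M (\<lambda>x. f k x - u x))" for k
  proof -
    have d: "in_Lp p M (\<lambda>x. f k x - u x)" by (rule minkowski_diff(1)[OF f u p])
    have d1: "in_Lp 1 M (\<lambda>x. f k x - u x)" "lpn 1 M (\<lambda>x. f k x - u x) \<le> V * lpn p M (\<lambda>x. f k x - u x)"
      unfolding V_def by (rule lpn_mono_exponent[OF fin d]; use p in simp)+
    have "(\<integral>x. f k x * b x \<partial>M) - (\<integral>x. u x * b x \<partial>M) = (\<integral>x. (f k x - u x) * b x \<partial>M)"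
      using int[OF f[of k]] int[OF u] by (simp add: left_diff_distrib)
    also have "\<bar>\<dots>\<bar> \<le> (\<integral>x. \<bar>(f k x - u x) * b x\<bar> \<partial>M)" by (rule integral_abs_bound)
    also have "\<dots> \<le> (\<integral>x. B * norm (f k x - u x) \<partial>M)"
    proof (rule integral_mono)
      show "integrable M (\<lambda>x. \<bar>(f k x - u x) * b x\<bar>)" using int[OF d] by (rule integrable_abs)
      show "integrable M (\<lambda>x. B * norm (f k x - u x))" using d1(1) by (intro integrable_mult_right) (simp add: in_Lp_def)
      show "\<bar>(f k x - u x) * b x\<bar> \<le> B * norm (f k x - u x)" for x
        using mult_right_mono[OF B[of x], of "\<bar>f k x - u x\<bar>"] by (simp add: abs_mult mult.commute)
    qed
    also have "\<dots> = B * lpn 1 M (\<lambda>x. f k x - u x)" by (simp add: lpn_def)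
    also have "\<dots> \<le> B * (V * lpn p M (\<lambda>x. f k x - u x))" by (intro mult_left_mono d1(2) B0)
    finally show ?thesis .
  qed
  show ?thesis
  proof (rule LIM_zero_cancel, rule Lim_null_comparison)
    show "\<forall>\<^sub>F k in sequentially. norm ((\<integral>x. f k x * b x \<partial>M) - (\<integral>x. u x * b x \<partial>M)) \<le> B * (V * lpn p M (\<lambda>x. f k x - u x))"
      using est by (intro always_eventually) simp
    show "(\<lambda>k. B * (V * lpn p M (\<lambda>x. f k x - u x))) \<longlonglongrightarrow> 0"
      by (intro tendsto_mult_right_zero lim)
  qed
qed

lemma in_Lp_locally_integrable:
  fixes u :: "real^'n \<Rightarrow> 'b::euclidean_space"
  assumes \<Omega>: "open \<Omega>" "bounded \<Omega>" and p: "1 \<le> p" and u: "in_Lp p (lebesgue_on \<Omega>) u"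
  shows "locally_integrable_on u \<Omega>"
  unfolding locally_integrable_on_def
proof (intro allI impI)
  fix K assume K: "compact K \<and> K \<subseteq> \<Omega>"
  have "in_Lp 1 (lebesgue_on \<Omega>) u" by (rule lpn_mono_exponent(1)[OF lebesgue_on_finite[OF \<Omega>] u]) (use p in auto)
  then have "integrable (lebesgue_on \<Omega>) u" using integrable_norm_iff[of u "lebesgue_on \<Omega>"] by (simp add: in_Lp_def)
  then have "set_integrable lebesgue \<Omega> u" unfolding set_integrable_def using \<Omega> by (subst (asm) integrable_restrict_space) auto
  then show "set_integrable lebesgue K u" by (rule set_integrable_subset) (use K in \<open>auto simp: compact_imp_closed\<close>)
qed

text \<open>
  The identity that defines weak gradients is linear in the function and its gradient, hence
  stable under convergence in \<open>L\<^sup>p\<close>.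
\<close>

lemma W01p_limit:
  fixes u :: "real^'n \<Rightarrow> real"
  assumes \<Omega>: "open \<Omega>" "bounded \<Omega>" and p: "1 \<le> p" and w: "\<And>k. w k \<in> test_functions \<Omega>"
    and u: "in_Lp p (lebesgue_on \<Omega>) u" and g: "in_Lp p (lebesgue_on \<Omega>) g"
    and lim: "(\<lambda>k. lpn p (lebesgue_on \<Omega>) (\<lambda>x. w k x - u x)) \<longlonglongrightarrow> 0"
      "(\<lambda>k. lpn p (lebesgue_on \<Omega>) (\<lambda>x. gradient (w k) x - g x)) \<longlonglongrightarrow> 0"
  shows "has_weak_gradient \<Omega> u g" "u \<in> W01p p \<Omega>"
proof -
  have p0: "0 < p" using p by simp
  let ?L = "lebesgue_on \<Omega>"
  note t = test_in_Lp_on[OF \<Omega>(1) w p0]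
  note fin = lebesgue_on_finite[OF \<Omega>]
  have LI: "(LINT x:\<Omega>|lebesgue. F x) = (\<integral>x. F x \<partial>?L)" for F :: "real^'n \<Rightarrow> real"
    unfolding set_lebesgue_integral_def using \<Omega> by (subst integral_restrict_space) auto
  show wg: "has_weak_gradient \<Omega> u g"
    unfolding has_weak_gradient_def
  proof (intro conjI ballI allI in_Lp_locally_integrable[OF \<Omega> p u] in_Lp_locally_integrable[OF \<Omega> p g])
    fix \<phi> i assume \<phi>: "\<phi> \<in> test_functions \<Omega>"
    obtain B where B: "0 \<le> B" "\<And>x. norm (gradient \<phi> x) \<le> B" "\<And>x. norm (\<phi> x) \<le> B" using test_gradient_bounded[OF \<phi>] by metis
    have m1: "\<phi> \<in> borel_measurable ?L" using test_borel[OF \<phi>] by (intro measurable_restrict_space1 measurable_completion) simp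
    have "partial_deriv i \<phi> \<in> borel_measurable borel"
      unfolding partial_deriv_component[abs_def]
      by (intro borel_measurable_continuous_onI continuous_on_component test_gradient_continuous[OF \<phi>])
    then have m2: "partial_deriv i \<phi> \<in> borel_measurable ?L" by (intro measurable_restrict_space1 measurable_completion) simp
    have b2: "\<bar>partial_deriv i \<phi> x\<bar> \<le> B" for x
      using component_le_norm_cart[of "gradient \<phi> x" i] B(2)[of x] by (simp add: partial_deriv_component)
    have lhs: "(\<lambda>k. \<integral>x. w k x * partial_deriv i \<phi> x \<partial>?L) \<longlonglongrightarrow> (\<integral>x. u x * partial_deriv i \<phi> x \<partial>?L)"
      by (rule Lp_integral_tendsto[OF fin p t(1) u lim(1) m2 b2])
    have gi: "in_Lp p ?L (\<lambda>x. gradient (w k) x \<bullet> axis i 1)" "in_Lp p ?L (\<lambda>x. g x \<bullet> axis i 1)" for k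
      by (rule in_Lp_inner(1)[OF t(3) p]) (rule in_Lp_inner(1)[OF g p])
    have "(\<lambda>k. lpn p ?L (\<lambda>x. gradient (w k) x \<bullet> axis i 1 - g x \<bullet> axis i 1)) \<longlonglongrightarrow> 0"
    proof (rule Lim_null_comparison[OF _ lim(2)])
      show "\<forall>\<^sub>F k in sequentially. norm (lpn p ?L (\<lambda>x. gradient (w k) x \<bullet> axis i 1 - g x \<bullet> axis i 1)) \<le> lpn p ?L (\<lambda>x. gradient (w k) x - g x)"
        using in_Lp_inner(2)[OF minkowski_diff(1)[OF t(3) g p] p, of _ "axis i 1"] by (intro always_eventually) (simp add: inner_diff_left)
    qed
    from Lp_integral_tendsto[OF fin p gi this m1 B(3)[unfolded real_norm_def]]
    have rhs: "(\<lambda>k. \<integral>x. gradient (w k) x $ i * \<phi> x \<partial>?L) \<longlonglongrightarrow> (\<integral>x. g x $ i * \<phi> x \<partial>?L)"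
      by (simp add: inner_axis)
    have "(\<integral>x. w k x * partial_deriv i \<phi> x \<partial>?L) = - (\<integral>x. gradient (w k) x $ i * \<phi> x \<partial>?L)" for k
      using test_has_weak_gradient[OF w[of k] \<Omega>(1)] \<phi> by (simp add: has_weak_gradient_def LI)
    then have "(\<lambda>k. - (\<integral>x. gradient (w k) x $ i * \<phi> x \<partial>?L)) \<longlonglongrightarrow> (\<integral>x. u x * partial_deriv i \<phi> x \<partial>?L)" using lhs by simp
    moreover have "(\<lambda>k. - (\<integral>x. gradient (w k) x $ i * \<phi> x \<partial>?L)) \<longlonglongrightarrow> - (\<integral>x. g x $ i * \<phi> x \<partial>?L)"
      by (rule tendsto_minus[OF rhs])
    ultimately have "(\<integral>x. u x * partial_deriv i \<phi> x \<partial>?L) = - (\<integral>x. g x $ i * \<phi> x \<partial>?L)" by (rule LIMSEQ_unique)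
    then show "(LINT x:\<Omega>|lebesgue. u x * partial_deriv i \<phi> x) = - (LINT x:\<Omega>|lebesgue. g x $ i * \<phi> x)" by (simp add: LI)
  qed
  have "(\<lambda>k. Lp_norm p \<Omega> (\<lambda>x. w k x - u x)) \<longlonglongrightarrow> ennreal 0"
    unfolding Lp_norm_in_Lp[OF \<Omega>(1) p0 minkowski_diff(1)[OF t(1) u p]] by (rule tendsto_ennrealI[OF lim(1)])
  moreover have "(\<lambda>k. Lp_norm p \<Omega> (\<lambda>x. gradient (w k) x - g x)) \<longlonglongrightarrow> ennreal 0"
    unfolding Lp_norm_in_Lp[OF \<Omega>(1) p0 minkowski_diff(1)[OF t(3) g p]] by (rule tendsto_ennrealI[OF lim(2)])
  ultimately show "u \<in> W01p p \<Omega>" unfolding W01p_def using wg w by auto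
qed

text \<open>
  The directional norms of the approximants exceed those of \<open>v\<close> by a factor that tends to one, because the latter
  are bounded below; the left hand side passes to the limit by Fatou's lemma, which also shows that \<open>v\<close> has a
  finite \<open>q\<close>-norm.
\<close>

lemma test_inequality_extends:
  fixes \<Omega> :: "(real^'n) set"
  assumes \<Omega>: "open \<Omega>" "bounded \<Omega>" and p: "1 < p" and q: "1 \<le> q" and m: "0 \<le> m"
    and ineq: "\<And>\<phi>. \<phi> \<in> test_functions \<Omega> \<Longrightarrow> 0 < lpn p lborel \<phi> \<Longrightarrow> ennreal (m * lpn q lborel \<phi>) \<le> energy_of p (dnorm p \<phi>)"
    and v: "v \<in> W01p p \<Omega>"
  shows "ennreal m * Lp_norm q \<Omega> v \<le> affine_energy p \<Omega> v"
proof -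
  let ?L = "lebesgue_on \<Omega>"
  have p0: "0 < p" "1 \<le> p" "0 < q" using p q by auto
  obtain g \<phi> where g: "has_weak_gradient \<Omega> v g" and vL: "in_Lp p ?L v" and gL: "in_Lp p ?L g"
    and \<phi>: "\<And>k :: nat. \<phi> k \<in> test_functions \<Omega>" and lim: "(\<lambda>k. lpn p ?L (\<lambda>x. \<phi> k x - v x)) \<longlonglongrightarrow> 0"
    "(\<lambda>k. lpn p ?L (\<lambda>x. gradient (\<phi> k) x - g x)) \<longlonglongrightarrow> 0"
    using W01p_approximation[OF \<Omega>(1) p0(2) v] by blast
  show ?thesis
  proof (cases "m = 0 \<or> (AE x in ?L. v x = 0)")
    case True
    then show ?thesis
    proof
      assume ae: "AE x in ?L. v x = 0"
      have z: "in_Lp q ?L v" "lpn q ?L v = lpn q ?L (\<lambda>x. 0 :: real)"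
        using in_Lp_cong[OF in_Lp_zero(1)[of q ?L] in_LpD(1)[OF vL]] ae by auto
      then have "Lp_norm q \<Omega> v = 0" using Lp_norm_in_Lp[OF \<Omega>(1) p0(3) z(1)] by (simp add: in_Lp_zero)
      then show ?thesis by simp
    qed simp
  next
    case False
    then have m0: "0 < m" and vnz: "\<not> (AE x in ?L. v x = 0)" using m by auto
    obtain R where R: "0 < R" "\<Omega> \<subseteq> ball 0 R" using \<Omega>(2) bounded_subset_ballD[of \<Omega> 0] by blast
    define h where "h = dirn p \<Omega> g"
    have vpos: "0 < lpn p ?L v" by (rule nonzero_lpn_pos[OF vL p0(1) vnz])
    define c0 where "c0 = lpn p ?L v / (2 * R)"
    have c0: "0 < c0" using vpos R by (simp add: c0_def)
    have hlow: "c0 \<le> h \<xi>" if "norm \<xi> = 1" for \<xi>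
      using W01p_Poincare[OF \<Omega>(1) p0(2) R(2,1) \<phi> vL gL lim, of \<xi>] that R by (simp add: c0_def h_def field_simps)
    have hup: "h \<xi> \<le> lpn p ?L g" if "norm \<xi> = 1" for \<xi>
      using in_Lp_inner(2)[OF gL p0(2), of \<xi>] that by (simp add: h_def dirn_def)
    obtain e where e: "0 < e" "energy_of p h = ennreal e"
      using energy_of_finite_pos[OF p c0, of h "lpn p ?L g"] hlow hup by blast
    have hpos: "0 < h \<xi>" if "norm \<xi> = 1" for \<xi> using hlow[OF that] c0 by linarith
    have Ev: "affine_energy p \<Omega> v = ennreal e"
      using affine_energy_eq[OF \<Omega>(1) p g gL] hpos e(2) by (simp add: h_def)
    obtain r where r: "strict_mono (r :: nat \<Rightarrow> nat)" "AE x in ?L. (\<lambda>k. \<phi> (r k) x) \<longlonglongrightarrow> v x"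
      using Lp_AE_subseq[OF test_in_Lp_on(1)[OF \<Omega>(1) \<phi> p0(1)] vL p0(2) lim(1)] by blast
    have bound: "in_Lp q ?L v \<and> lpn q ?L v \<le> (1 + d) * e / m" if d: "0 < d" for d
    proof -
      have "\<forall>\<^sub>F k in sequentially. lpn p ?L (\<lambda>x. gradient (\<phi> k) x - g x) < d * c0"
        by (rule order_tendstoD(2)[OF lim(2)]) (use d c0 in simp)
      moreover have "\<forall>\<^sub>F k in sequentially. 0 < lpn p ?L (\<phi> k)"
        by (rule order_tendstoD(1)[OF lpn_tendsto[OF test_in_Lp_on(1)[OF \<Omega>(1) \<phi> p0(1)] vL p0(2) lim(1)] vpos])
      ultimately have "\<forall>\<^sub>F k in sequentially. lpn p ?L (\<lambda>x. gradient (\<phi> k) x - g x) < d * c0 \<and> 0 < lpn p ?L (\<phi> k)"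
        by eventually_elim auto
      then obtain N where N: "\<And>k. k \<ge> N \<Longrightarrow> lpn p ?L (\<lambda>x. gradient (\<phi> k) x - g x) < d * c0" "\<And>k. k \<ge> N \<Longrightarrow> 0 < lpn p ?L (\<phi> k)"
        by (auto simp: eventually_sequentially)
      have le: "lpn q ?L (\<phi> k) \<le> (1 + d) * e / m" if k: "k \<ge> N" for k
      proof -
        have pos: "0 < lpn p lborel (\<phi> k)" using N(2)[OF k] test_in_Lp_on(2)[OF \<Omega>(1) \<phi> p0(1)] by simp
        have dpos: "0 < dnorm p (\<phi> k) \<xi>" if "norm \<xi> = 1" for \<xi>
        proof -
          have "0 < 2 * R * dnorm p (\<phi> k) \<xi>" using directional_Poincare[OF \<phi> p0(2) R(2,1), of k \<xi>] that pos by simp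
          then show ?thesis using R(1) by (simp add: zero_less_mult_iff)
        qed
        have dle: "dnorm p (\<phi> k) \<xi> \<le> (1 + d) * h \<xi>" if \<xi>: "norm \<xi> = 1" for \<xi>
        proof -
          have "dnorm p (\<phi> k) \<xi> \<le> h \<xi> + d * c0"
            using dnorm_dirn_diff[OF \<Omega>(1) p0(2) \<phi> gL, of k \<xi>] \<xi> N(1)[OF k] by (simp add: h_def)
          also have "\<dots> \<le> h \<xi> + d * h \<xi>" using hlow[OF \<xi>] d by simp
          finally show ?thesis by (simp add: algebra_simps)
        qed
        have "ennreal (m * lpn q lborel (\<phi> k)) \<le> energy_of p (dnorm p (\<phi> k))" by (rule ineq[OF \<phi> pos])
        also have "\<dots> \<le> energy_of p (\<lambda>\<xi>. (1 + d) * h \<xi>)" by (rule energy_of_mono[OF dpos dle])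
        also have "\<dots> = ennreal ((1 + d) * e)"
          using energy_of_cmult[OF p _ dirn_borel[OF p0(2) gL], of "1 + d"] e d by (simp add: h_def dirn_def ennreal_mult del: ennreal_plus)
        finally have "m * lpn q lborel (\<phi> k) \<le> (1 + d) * e" using e d by (subst (asm) ennreal_le_iff) auto
        then show ?thesis using m0 test_in_Lp_on(2)[OF \<Omega>(1) \<phi> p0(3)] by (simp add: field_simps)
      qed
      have ge: "r (k + N) \<ge> N" for k using seq_suble[OF r(1), of "k + N"] by linarith
      have ae: "AE x in ?L. (\<lambda>k. \<phi> (r (k + N)) x) \<longlonglongrightarrow> v x"
        using r(2) by eventually_elim (rule LIMSEQ_ignore_initial_segment)
      show ?thesis
        using Lp_Fatou[of q ?L "\<lambda>k. \<phi> (r (k + N))" "(1 + d) * e / m", OF test_in_Lp_on(1)[OF \<Omega>(1) \<phi> p0(3)] le[OF ge] p0(3) _ ae in_LpD(1)[OF vL]]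
          e d m0 by simp
    qed
    have vq: "in_Lp q ?L v" using bound[of 1] by simp
    have "m * lpn q ?L v \<le> e"
    proof (rule field_le_epsilon)
      fix \<epsilon> :: real assume "0 < \<epsilon>"
      then have "0 < \<epsilon> / e" using e by simp
      from conjunct2[OF bound[OF this]] have "lpn q ?L v \<le> (1 + \<epsilon> / e) * e / m" .
      moreover have "(1 + \<epsilon> / e) * e = e + \<epsilon>" using e by (simp add: field_simps)
      ultimately show "m * lpn q ?L v \<le> e + \<epsilon>" using m0 by (simp add: pos_le_divide_eq mult.commute)
    qed
    then show ?thesis using Ev Lp_norm_in_Lp[OF \<Omega>(1) p0(3) vq] m0 by (simp add: ennreal_mult[symmetric] ennreal_leI)
  qed
qed

lemma sublevel_scale:
  fixes h :: "real^'n \<Rightarrow> real"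
  assumes h[measurable]: "h \<in> borel_measurable borel" and hom: "\<And>c x. 0 < c \<Longrightarrow> h (c *\<^sub>R x) = c * h x" and t: "0 < t"
  shows "emeasure lborel {x. h x \<le> t} = ennreal (t ^ CARD('n)) * emeasure lborel {x. h x \<le> 1}"
proof -
  have "emeasure lborel {x. h x \<le> t} = (\<integral>\<^sup>+x. indicator {x. h x \<le> t} x \<partial>lborel)" by simp
  also have "\<dots> = ennreal (t ^ CARD('n)) * (\<integral>\<^sup>+x. indicator {x. h x \<le> t} (t *\<^sub>R x + 0) \<partial>lborel)"
    using nn_integral_lborel_scale[of "indicator {x. h x \<le> t} :: real^'n \<Rightarrow> ennreal" t 0] t by simp
  also have "(\<lambda>x. indicator {x. h x \<le> t} (t *\<^sub>R x + 0)) = (indicator {x. h x \<le> 1} :: real^'n \<Rightarrow> ennreal)"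
    using t by (auto simp: fun_eq_iff indicator_def hom)
  finally show ?thesis by simp
qed

lemma volume_lower_bound:
  fixes h :: "real^'n \<Rightarrow> real"
  assumes p: "1 < p" and h: "h \<in> borel_measurable borel" and hom: "\<And>c x. 0 < c \<Longrightarrow> h (c *\<^sub>R x) = c * h x"
    and pos: "\<And>x. x \<noteq> 0 \<Longrightarrow> 0 < h x" and M: "0 < M" "energy_of p h \<le> ennreal M"
  shows "ennreal ((affine_const (real CARD('n)) p / M) powr real CARD('n) / real CARD('n)) \<le> emeasure lborel {x. h x \<le> 1}"
proof (cases "emeasure lborel {x. h x \<le> 1}")
  case top
  then show ?thesis by simp
next
  case (real V)
  define n where "n = real CARD('n)"
  have n: "1 \<le> n" unfolding n_def by (metis One_nat_def Suc_leI of_nat_1 of_nat_le_iff zero_less_card_finite)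
  define a where "a = affine_const n p"
  have a: "0 < a" unfolding a_def by (rule affine_const_pos[OF p n])
  have E: "energy_of p h = ennreal a * ennreal_powr (ennreal (n * V)) (- 1 / n)"
    using energy_of_volume[OF h hom pos, of p] real by (simp add: n_def a_def ennreal_mult ennreal_of_nat_eq_real_of_nat)
  have V: "V > 0"
  proof (rule ccontr)
    assume "\<not> V > 0"
    then have "V = 0" using real(1) by simp
    then have "energy_of p h = \<infinity>" unfolding E using n a by (simp add: ennreal_powr_def ennreal_mult_top)
    then show False using M(2) by (simp add: top_unique)
  qed
  have "energy_of p h = ennreal (a * (n * V) powr (- 1 / n))"
    unfolding E using V n a by (subst ennreal_powr_ennreal) (auto simp: ennreal_mult)
  then have "a * (n * V) powr (- 1 / n) \<le> M" using M a by simp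
  then have "a / M \<le> (n * V) powr (1 / n)" using M V n by (simp add: powr_minus field_simps)
  then have "(a / M) powr n \<le> ((n * V) powr (1 / n)) powr n" using a M n by (intro powr_mono2) auto
  also have "\<dots> = n * V" using n V by (simp add: powr_powr)
  finally have "(a / M) powr n / n \<le> V" using n by (simp add: field_simps)
  then show ?thesis using real by (simp add: a_def n_def ennreal_leI)
qed

text \<open>
  As \<open>r > p\<close>, the volume carries a negative exponent, and a lower bound on it gives an upper bound. The
  remaining exponent of \<open>\<tau>\<close> is positive exactly below the critical exponent.
\<close>

lemma Sobolev_volume:
  fixes f :: "real^'n \<Rightarrow> real"
  assumes p: "1 < p" and r: "p < r" and C: "0 < C"
    and S: "lpn r lborel f powr r \<le> C * measure lborel {z. dnorm p f z \<le> \<tau>} powr (1 - r / p) * \<tau> powr r"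
    and \<tau>: "0 < \<tau>" and v: "0 < v" "\<tau> ^ CARD('n) * v \<le> measure lborel {z. dnorm p f z \<le> \<tau>}"
  shows "lpn r lborel f powr r \<le> C * v powr (1 - r / p) * \<tau> powr (r - real CARD('n) * (r / p - 1))"
proof -
  have "measure lborel {z. dnorm p f z \<le> \<tau>} powr (1 - r / p) \<le> (\<tau> ^ CARD('n) * v) powr (1 - r / p)"
    using p r \<tau> v by (intro powr_mono2') (auto simp: field_simps)
  also have "\<dots> = \<tau> powr (real CARD('n) * (1 - r / p)) * v powr (1 - r / p)"
    using \<tau> by (simp add: powr_mult powr_realpow[symmetric] powr_powr)
  finally have "lpn r lborel f powr r \<le> C * (\<tau> powr (real CARD('n) * (1 - r / p)) * v powr (1 - r / p)) * \<tau> powr r"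
    using S C by (meson mult_left_mono mult_right_mono less_imp_le order_trans powr_ge_zero)
  also have "\<dots> = C * v powr (1 - r / p) * (\<tau> powr (real CARD('n) * (1 - r / p)) * \<tau> powr r)" by simp
  also have "\<tau> powr (real CARD('n) * (1 - r / p)) * \<tau> powr r = \<tau> powr (r - real CARD('n) * (r / p - 1))"
    by (simp add: powr_add[symmetric] algebra_simps)
  finally show ?thesis .
qed

lemma gradient_lpn_le:
  fixes f :: "real^'n \<Rightarrow> real"
  assumes f: "f \<in> test_functions \<Omega>" and p: "1 \<le> p" and C: "\<And>\<xi>. norm \<xi> = 1 \<Longrightarrow> dnorm p f \<xi> \<le> C"
  shows "lpn p lborel (gradient f) \<le> real CARD('n) * C"
proof -
  have p0: "0 < p" using p by simp
  let ?G = "\<lambda>i x. \<bar>gradient f x \<bullet> axis i 1\<bar>"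
  have G: "in_Lp p lborel (?G i)" for i
    using in_LpD(1)[OF test_in_Lp(3)[OF f p0, of "axis i 1"]]
    by (intro in_Lp_cong(1)[OF test_in_Lp(3)[OF f p0, of "axis i 1"]] borel_measurable_abs) auto
  have Gd: "lpn p lborel (?G i) = dnorm p f (axis i 1)" for i by (simp add: lpn_def dnorm_def)
  have s: "in_Lp p lborel (\<lambda>x. \<Sum>i\<in>UNIV. ?G i x)" "lpn p lborel (\<lambda>x. \<Sum>i\<in>UNIV. ?G i x) \<le> (\<Sum>i\<in>UNIV. lpn p lborel (?G i))"
    using lpn_sum_le[of UNIV p lborel ?G] G p by auto
  have "norm (gradient f x) \<le> norm (\<Sum>i\<in>UNIV. ?G i x)" for x
    using norm_le_l1_cart[of "gradient f x"] by (simp add: inner_axis)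
  then have "lpn p lborel (gradient f) \<le> lpn p lborel (\<lambda>x. \<Sum>i\<in>UNIV. ?G i x)"
    using in_LpD(1)[OF test_in_Lp(2)[OF f p0]] by (intro in_Lp_mono(2)[OF s(1) _ _ p0]) auto
  also have "\<dots> \<le> (\<Sum>i\<in>(UNIV :: 'n set). C)" by (rule order_trans[OF s(2)]) (unfold Gd, intro sum_mono C, simp)
  finally show ?thesis by simp
qed

lemma dnorm_unit_bound:
  fixes f :: "real^'n \<Rightarrow> real"
  assumes f: "f \<in> test_functions \<Omega>" and p: "1 \<le> p" and C: "\<And>\<xi>. norm \<xi> = 1 \<Longrightarrow> dnorm p f \<xi> \<le> C"
  shows "dnorm p f \<xi> \<le> C * norm \<xi>"
proof (cases "\<xi> = 0")
  case True
  then show ?thesis using dnorm_scaleR[OF f p, of 0 0] by simp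
next
  case False
  then have "dnorm p f \<xi> = norm \<xi> * dnorm p f (\<xi> /\<^sub>R norm \<xi>)" using dnorm_scaleR[OF f p, of "norm \<xi>" "\<xi> /\<^sub>R norm \<xi>"] by simp
  also have "\<dots> \<le> norm \<xi> * C" by (intro mult_left_mono C) (use False in auto)
  finally show ?thesis by (simp add: mult.commute)
qed

text \<open>
  The energy bounds the volume of the unit ball \<open>K\<close> of \<open>dnorm p f\<close> from below by \<open>v\<close>. The affine Sobolev inequality then
  controls the \<open>r\<close>-norm, hence the normalized \<open>q\<close>-norm, by a positive power of the \<open>p\<close>-norm, so the
  latter is at least some \<open>t0\<close>; with the directional Poincare inequality this is the lower bound, and it
  confines \<open>K\<close> to the ball of radius \<open>1 / c\<close>. By \<open>seminorm_times_volume_le\<close>, \<open>dnorm p f\<close> cannot be large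
  on a unit vector without making the volume of \<open>K\<close> smaller than \<open>v\<close>.
\<close>

lemma bounded_energy_imp_dnorm_bounds:
  fixes \<Omega> :: "(real^'n) set"
  assumes p: "1 < p" "p < real CARD('n)" and r: "p < r" "r < critical_exponent (real CARD('n)) p" and q: "1 \<le> q" "q \<le> r"
    and \<Omega>: "open \<Omega>" "\<Omega> \<subseteq> ball 0 R" and R: "0 < R" and M: "0 < M"
  shows "\<exists>c>0. \<exists>C>0. \<forall>f\<in>test_functions \<Omega>. lpn q lborel f = 1 \<longrightarrow> energy_of p (dnorm p f) \<le> ennreal M \<longrightarrow>
      (\<forall>\<xi>. c * norm \<xi> \<le> dnorm p f \<xi> \<and> dnorm p f \<xi> \<le> C * norm \<xi>)"
proof -
  define n where "n = real CARD('n)"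
  have n: "1 \<le> n" unfolding n_def by (metis One_nat_def Suc_leI of_nat_1 of_nat_le_iff zero_less_card_finite)
  have p0: "0 < p" "1 \<le> p" "0 < q" "0 < r" using p q r by auto
  have b\<Omega>: "bounded \<Omega>" using \<Omega>(2) bounded_ball bounded_subset by blast
  let ?L = "lebesgue_on \<Omega>"
  obtain C where C: "0 < C" and S: "\<And>\<Omega> R. \<And>f :: real^'n \<Rightarrow> real. 0 < R \<Longrightarrow> \<Omega> \<subseteq> ball 0 R \<Longrightarrow> f \<in> test_functions \<Omega> \<Longrightarrow> 0 < lpn p lborel f \<Longrightarrow>
      lpn r lborel f powr r \<le> C * measure lborel {z. dnorm p f z \<le> lpn p lborel f} powr (1 - r / p) * lpn p lborel f powr r"
    using affine_Sobolev[OF p r] by blast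
  define v where "v = (affine_const n p / M) powr n / n"
  have v: "0 < v" using affine_const_pos[OF p(1) n] M n by (simp add: v_def)
  define \<gamma> where "\<gamma> = r - n * (r / p - 1)"
  have \<gamma>: "0 < \<gamma>"
  proof -
    have "r * (n - p) < n * p" using r p by (simp add: critical_exponent_def n_def field_simps)
    then show ?thesis using p0 by (simp add: \<gamma>_def field_simps)
  qed
  define W where "W = measure ?L (space ?L) powr (1 / q - 1 / r)"
  \<comment> \<open>The summand 1 only ensures positivity.\<close>
  define Q where "Q = W powr r * (C * v powr (1 - r / p)) + 1"
  have Q: "0 < Q" using C by (simp add: Q_def add_nonneg_pos)
  define t0 where "t0 = (1 / Q) powr (1 / \<gamma>)"
  have t0: "0 < t0" using Q by (simp add: t0_def)
  define c where "c = t0 / (2 * R)"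
  have c: "0 < c" using t0 R by (simp add: c_def)
  define X where "X = 4 * measure lborel (cball (0 :: real^'n) (2 * (1 / c))) / (1 / c)"
  have X: "0 < X" using c content_ball_pos[of "2 / c" "0 :: real^'n"] by (simp add: X_def content_cball_pos)
  have main: "c * norm \<xi> \<le> dnorm p f \<xi> \<and> dnorm p f \<xi> \<le> X / v * norm \<xi>"
    if f: "f \<in> test_functions \<Omega>" and f1: "lpn q lborel f = 1" and E: "energy_of p (dnorm p f) \<le> ennreal M" for f \<xi>
  proof -
    define \<tau> where "\<tau> = lpn p lborel f"
    have \<tau>: "0 < \<tau>"
    proof (rule ccontr)
      assume "\<not> 0 < \<tau>"
      then have "lpn p lborel f = 0" using lpn_nonneg[of p lborel f] by (simp add: \<tau>_def)
      then have "AE x in lborel. f x = 0" using lpn_eq_0_iff[OF test_in_Lp(1)[OF f p0(1)] p0(1)] by simp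
      then have "lpn q lborel f = 0" using lpn_eq_0_iff[OF test_in_Lp(1)[OF f p0(3)] p0(3)] by simp
      then show False using f1 by simp
    qed
    have Poin: "\<tau> * norm \<xi> \<le> 2 * R * dnorm p f \<xi>" for \<xi> unfolding \<tau>_def by (rule directional_Poincare[OF f p0(2) \<Omega>(2) R])
    have hom: "dnorm p f (c *\<^sub>R x) = c * dnorm p f x" if "0 < c" for c x using dnorm_scaleR[OF f p0(2), of c x] that by simp
    have pos: "0 < dnorm p f x" if "x \<noteq> 0" for x
    proof -
      have "0 < \<tau> * norm x" using \<tau> that by simp
      also have "\<dots> \<le> 2 * R * dnorm p f x" by (rule Poin)
      finally show ?thesis using R by (simp add: zero_less_mult_iff)
    qed
    have vol: "ennreal v \<le> emeasure lborel {x. dnorm p f x \<le> 1}"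
      using volume_lower_bound[OF p(1) dnorm_borel[OF f p0(2)] hom pos M E] by (simp add: v_def n_def)
    have "emeasure lborel {z. dnorm p f z \<le> \<tau>} = ennreal (\<tau> ^ CARD('n)) * emeasure lborel {x. dnorm p f x \<le> 1}"
      by (rule sublevel_scale[OF dnorm_borel[OF f p0(2)] hom \<tau>])
    then have "ennreal (\<tau> ^ CARD('n) * v) \<le> emeasure lborel {z. dnorm p f z \<le> \<tau>}"
      using mult_left_mono[OF vol, of "ennreal (\<tau> ^ CARD('n))"] \<tau> v by (simp add: ennreal_mult)
    moreover have "bounded {z. dnorm p f z \<le> \<tau>}"
    proof -
      have "norm z \<le> 2 * R" if "dnorm p f z \<le> \<tau>" for z
      proof -
        have "\<tau> * norm z \<le> \<tau> * (2 * R)" using order_trans[OF Poin mult_left_mono[OF that, of "2 * R"]] R by (simp add: mult.commute)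
        then show ?thesis using \<tau> by simp
      qed
      then show ?thesis by (auto simp: bounded_iff)
    qed
    ultimately have volm: "\<tau> ^ CARD('n) * v \<le> measure lborel {z. dnorm p f z \<le> \<tau>}"
      using emeasure_bounded_finite[of "{z. dnorm p f z \<le> \<tau>}"] by (simp add: emeasure_eq_ennreal_measure)
    have Sv: "lpn r lborel f powr r \<le> C * v powr (1 - r / p) * \<tau> powr \<gamma>"
      unfolding \<gamma>_def n_def
      by (rule Sobolev_volume[OF p(1) r(1) C _ \<tau> v volm]) (use S[OF R \<Omega>(2) f] \<tau> in \<open>simp add: \<tau>_def\<close>)
    have "1 \<le> W * lpn r lborel f"
      using lpn_mono_exponent(2)[OF lebesgue_on_finite[OF \<Omega>(1) b\<Omega>] test_in_Lp_on(1)[OF \<Omega>(1) f p0(4)] q]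
        test_in_Lp_on(2)[OF \<Omega>(1) f p0(3)] test_in_Lp_on(2)[OF \<Omega>(1) f p0(4)] f1 by (simp add: W_def)
    then have "1 powr r \<le> (W * lpn r lborel f) powr r" using p0 by (intro powr_mono2) auto
    also have "\<dots> = W powr r * lpn r lborel f powr r" by (simp add: powr_mult)
    also have "\<dots> \<le> W powr r * (C * v powr (1 - r / p) * \<tau> powr \<gamma>)" by (intro mult_left_mono Sv) simp
    also have "\<dots> \<le> Q * \<tau> powr \<gamma>" by (simp add: Q_def algebra_simps)
    finally have "1 / Q \<le> \<tau> powr \<gamma>" using Q by (simp add: field_simps)
    then have "t0 \<le> (\<tau> powr \<gamma>) powr (1 / \<gamma>)" unfolding t0_def using Q \<gamma> by (intro powr_mono2) auto
    then have t0\<tau>: "t0 \<le> \<tau>" using \<gamma> \<tau> by (simp add: powr_powr)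
    have low: "c * norm x \<le> dnorm p f x" for x
    proof -
      have "t0 * norm x \<le> 2 * R * dnorm p f x" using order_trans[OF mult_right_mono[OF t0\<tau>, of "norm x"] Poin] by simp
      then show ?thesis using R by (simp add: c_def field_simps)
    qed
    have "dnorm p f e \<le> X / v" if e: "norm e = 1" for e
    proof -
      have rad: "norm x \<le> 1 / c" if "dnorm p f x \<le> 1" for x using low[of x] that c by (simp add: field_simps)
      have "ennreal (dnorm p f e) * emeasure lborel {x. dnorm p f x \<le> 1} \<le> ennreal X"
        unfolding X_def using c
        by (intro seminorm_times_volume_le[OF dnorm_borel[OF f p0(2)] dnorm_triangle[OF f p0(2)] dnorm_scaleR[OF f p0(2)] _ rad e]) auto
      then have "ennreal (dnorm p f e) * ennreal v \<le> ennreal X" using mult_left_mono[OF vol, of "ennreal (dnorm p f e)"] by (meson order_trans zero_le)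
      then have "dnorm p f e * v \<le> X" using X v by (simp add: ennreal_mult[symmetric])
      then show ?thesis using v by (simp add: field_simps)
    qed
    then show ?thesis using low dnorm_unit_bound[OF f p0(2)] by blast
  qed
  have Xv: "0 < X / v" using X v by simp
  show ?thesis using c Xv main by blast
qed

text \<open>
  Ascoli's theorem on the sphere for the norms \<open>dnorm p (f k)\<close>, which share a Lipschitz constant, followed by
  Rellich's theorem in \<open>L\<^sup>p\<close>. The affine Sobolev inequality, applied to differences, improves convergence
  from \<open>p\<close> to \<open>r\<close>.
\<close>

lemma extract_subsequence:
  fixes \<Omega> :: "(real^'n) set"
  assumes p: "1 < p" "p < real CARD('n)" and r: "p < r" "r < critical_exponent (real CARD('n)) p"
    and \<Omega>: "open \<Omega>" "\<Omega> \<subseteq> ball 0 R" and R: "0 < R" and C: "0 < C"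
    and f: "\<And>k. f k \<in> test_functions \<Omega>" and up: "\<And>k \<xi>. dnorm p (f k) \<xi> \<le> C * norm \<xi>"
  shows "\<exists>(s :: nat \<Rightarrow> nat) h. strict_mono s \<and> (\<forall>e>0. \<exists>K. \<forall>k\<ge>K. \<forall>\<xi>. norm \<xi> = 1 \<longrightarrow> \<bar>dnorm p (f (s k)) \<xi> - h \<xi>\<bar> < e) \<and>
     (\<forall>d>0. \<exists>K. \<forall>k\<ge>K. \<forall>l\<ge>K. lpn r lborel (\<lambda>x. f (s k) x - f (s l) x) < d)"
proof -
  define n where "n = real CARD('n)"
  have p0: "0 < p" "1 \<le> p" "0 < r" using p r by auto
  obtain h s1 where s1: "strict_mono (s1 :: nat \<Rightarrow> nat)"
    "\<And>e. 0 < e \<Longrightarrow> \<exists>N. \<forall>k \<xi>. k \<ge> N \<and> \<xi> \<in> sphere 0 1 \<longrightarrow> norm (dnorm p (f (s1 k)) \<xi> - h \<xi>) < e"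
  proof (rule Arzela_Ascoli[of "sphere (0 :: real^'n) 1" "\<lambda>k. dnorm p (f k)" C])
    show "norm (dnorm p (f k) \<xi>) \<le> C" if "\<xi> \<in> sphere 0 1" for k \<xi> using up[of k \<xi>] that by simp
    show "\<exists>d>0. \<forall>k y. y \<in> sphere 0 1 \<and> norm (x - y) < d \<longrightarrow> norm (dnorm p (f k) x - dnorm p (f k) y) < e" if "0 < e" for x e
    proof (intro exI[of _ "e / C"] conjI allI impI)
      show "0 < e / C" using that C by simp
      fix k y assume y: "y \<in> sphere 0 1 \<and> norm (x - y) < e / C"
      have "norm (dnorm p (f k) x - dnorm p (f k) y) \<le> C * norm (x - y)"
        using order_trans[OF dnorm_Lipschitz[OF f p0(2)] up] by simp
      also have "\<dots> < e" using y C by (simp add: field_simps)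
      finally show "norm (dnorm p (f k) x - dnorm p (f k) y) < e" .
    qed
  qed auto
  obtain s2 where s2: "strict_mono (s2 :: nat \<Rightarrow> nat)"
    "\<And>d. 0 < d \<Longrightarrow> \<exists>K. \<forall>k\<ge>K. \<forall>l\<ge>K. lpn p lborel (\<lambda>x. f (s1 (s2 k)) x - f (s1 (s2 l)) x) < d"
    using Rellich[of "\<lambda>k. f (s1 k)" \<Omega> p R C, OF f p0(2) \<Omega>(2) R up] by blast
  define s where "s = s1 \<circ> s2"
  have s: "strict_mono s" unfolding s_def using s1(1) s2(1) by (rule strict_mono_o)
  have unif: "\<exists>K. \<forall>k\<ge>K. \<forall>\<xi>. norm \<xi> = 1 \<longrightarrow> \<bar>dnorm p (f (s k)) \<xi> - h \<xi>\<bar> < e" if e: "0 < e" for e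
  proof -
    obtain K where K: "\<And>k \<xi>. k \<ge> K \<Longrightarrow> norm \<xi> = 1 \<Longrightarrow> \<bar>dnorm p (f (s1 k)) \<xi> - h \<xi>\<bar> < e" using s1(2)[OF e] by auto
    have "s2 k \<ge> K" if "k \<ge> K" for k using seq_suble[OF s2(1), of k] that by linarith
    then show ?thesis using K by (intro exI[of _ K]) (auto simp: s_def)
  qed
  obtain C0 where C0: "0 < C0" and S: "\<And>\<Omega> R. \<And>f :: real^'n \<Rightarrow> real. 0 < R \<Longrightarrow> \<Omega> \<subseteq> ball 0 R \<Longrightarrow> f \<in> test_functions \<Omega> \<Longrightarrow> 0 < lpn p lborel f \<Longrightarrow>
      lpn r lborel f powr r \<le> C0 * measure lborel {z. dnorm p f z \<le> lpn p lborel f} powr (1 - r / p) * lpn p lborel f powr r"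
    using affine_Sobolev[OF p r] by blast
  define \<gamma> where "\<gamma> = r - n * (r / p - 1)"
  have \<gamma>: "0 < \<gamma>"
  proof -
    have "r * (n - p) < n * p" using r p by (simp add: critical_exponent_def n_def field_simps)
    then show ?thesis using p0 by (simp add: \<gamma>_def field_simps)
  qed
  \<comment> \<open>The directional norms of a difference are at most 2 C, so its unit ball contains the ball of radius 1 / (2 C).\<close>
  define v where "v = (1 / (2 * C)) ^ CARD('n) * measure lborel (ball (0 :: real^'n) 1)"
  have v: "0 < v" using C by (simp add: v_def content_ball_pos)
  define B where "B = C0 * v powr (1 - r / p)"
  have B: "0 < B" using C0 v by (simp add: B_def)
  have diff: "lpn r lborel (\<lambda>x. f k x - f l x) powr r \<le> B * lpn p lborel (\<lambda>x. f k x - f l x) powr \<gamma>" for k l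
  proof -
    let ?w = "\<lambda>x. f k x - f l x"
    have w: "?w \<in> test_functions \<Omega>" by (rule test_diff(1)[OF f f])
    define \<tau> where "\<tau> = lpn p lborel ?w"
    show ?thesis
    proof (cases "0 < \<tau>")
      case False
      then have "lpn p lborel ?w = 0" using lpn_nonneg[of p lborel ?w] by (simp add: \<tau>_def)
      then have "AE x in lborel. ?w x = 0" using lpn_eq_0_iff[OF test_in_Lp(1)[OF w p0(1)] p0(1)] by simp
      then have "lpn r lborel ?w = 0" using lpn_eq_0_iff[OF test_in_Lp(1)[OF w p0(3)] p0(3)] by simp
      then show ?thesis using B by simp
    next
      case True
      have up2: "dnorm p ?w \<xi> \<le> 2 * C * norm \<xi>" for \<xi>
        using dnorm_diff_fun[OF f f p0(2), of k l \<xi>] up[of k \<xi>] up[of l \<xi>] by simp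
      have sub: "ball 0 (\<tau> / (2 * C)) \<subseteq> {z. dnorm p ?w z \<le> \<tau>}"
      proof
        fix z :: "real^'n" assume "z \<in> ball 0 (\<tau> / (2 * C))"
        then have "2 * C * norm z \<le> \<tau>" using C by (simp add: field_simps)
        then show "z \<in> {z. dnorm p ?w z \<le> \<tau>}" using up2[of z] by simp
      qed
      have bd: "bounded {z. dnorm p ?w z \<le> \<tau>}"
      proof -
        have "norm z \<le> 2 * R" if "dnorm p ?w z \<le> \<tau>" for z
        proof -
          have "\<tau> * norm z \<le> 2 * R * dnorm p ?w z" unfolding \<tau>_def by (rule directional_Poincare[OF w p0(2) \<Omega>(2) R])
          also have "\<dots> \<le> 2 * R * \<tau>" using that R by (intro mult_left_mono) auto
          finally show ?thesis using True by simp
        qed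
        then show ?thesis by (auto simp: bounded_iff)
      qed
      have "\<tau> ^ CARD('n) * v = (\<tau> / (2 * C)) ^ CARD('n) * measure lborel (ball (0 :: real^'n) 1)"
        by (simp add: v_def power_divide power_mult_distrib)
      also have "\<dots> = measure lborel (ball (0 :: real^'n) (\<tau> / (2 * C)))"
        using content_ball_conv_unit_ball[of "\<tau> / (2 * C)" "0 :: real^'n"] True C by simp
      also have "\<dots> \<le> measure lborel {z. dnorm p ?w z \<le> \<tau>}"
      proof (rule measure_mono_fmeasurable[OF sub])
        have "{z. dnorm p ?w z \<le> \<tau>} \<in> sets borel" using dnorm_borel[OF w p0(2)] by measurable
        then show "{z. dnorm p ?w z \<le> \<tau>} \<in> fmeasurable lborel" using emeasure_bounded_finite[OF bd] by (simp add: fmeasurable_def)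
      qed simp
      finally have vm: "\<tau> ^ CARD('n) * v \<le> measure lborel {z. dnorm p ?w z \<le> \<tau>}" .
      have "lpn r lborel ?w powr r \<le> C0 * v powr (1 - r / p) * \<tau> powr \<gamma>"
        unfolding \<gamma>_def n_def
        by (rule Sobolev_volume[OF p(1) r(1) C0 _ True v vm]) (use S[OF R \<Omega>(2) w] True in \<open>simp add: \<tau>_def\<close>)
      then show ?thesis by (simp add: B_def \<tau>_def)
    qed
  qed
  have cau: "\<exists>K. \<forall>k\<ge>K. \<forall>l\<ge>K. lpn r lborel (\<lambda>x. f (s k) x - f (s l) x) < d" if d: "0 < d" for d
  proof -
    define \<epsilon> where "\<epsilon> = (d powr r / (2 * B)) powr (1 / \<gamma>)"
    have \<epsilon>: "0 < \<epsilon>" using d B by (simp add: \<epsilon>_def)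
    obtain K where K: "\<And>k l. k \<ge> K \<Longrightarrow> l \<ge> K \<Longrightarrow> lpn p lborel (\<lambda>x. f (s1 (s2 k)) x - f (s1 (s2 l)) x) < \<epsilon>"
      using s2(2)[OF \<epsilon>] by blast
    have "lpn r lborel (\<lambda>x. f (s k) x - f (s l) x) < d" if kl: "k \<ge> K" "l \<ge> K" for k l
    proof -
      have "lpn r lborel (\<lambda>x. f (s k) x - f (s l) x) powr r \<le> B * lpn p lborel (\<lambda>x. f (s k) x - f (s l) x) powr \<gamma>" by (rule diff)
      also have "\<dots> \<le> B * \<epsilon> powr \<gamma>"
        using K[OF kl] B \<gamma> by (intro mult_left_mono powr_mono2) (auto simp: s_def)
      also have "\<dots> = d powr r / 2" using \<gamma> B d by (simp add: \<epsilon>_def powr_powr)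
      also have "\<dots> < d powr r" using d by simp
      finally show ?thesis using p0 d by (meson linorder_not_less powr_mono2 less_imp_le)
    qed
    then show ?thesis by blast
  qed
  show ?thesis using s unif cau by blast
qed

lemma midpoint_test:
  assumes f: "f \<in> test_functions \<Omega>" and g: "g \<in> test_functions \<Omega>"
  defines "w \<equiv> \<lambda>x. (1 / 2) * (f x + g x)"
  shows "w \<in> test_functions \<Omega>" "gradient w x = (gradient f x + gradient g x) /\<^sub>R 2"
    "1 \<le> p \<Longrightarrow> dnorm p w \<xi> \<le> (dnorm p f \<xi> + dnorm p g \<xi>) / 2"
proof -
  note fg = test_add[OF f g]
  show "w \<in> test_functions \<Omega>" "gradient w x = (gradient f x + gradient g x) /\<^sub>R 2"
    unfolding w_def using test_cmult[OF fg(1), of "1 / 2"] fg(2) by (simp_all add: inverse_eq_divide)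
  show "dnorm p w \<xi> \<le> (dnorm p f \<xi> + dnorm p g \<xi>) / 2" if "1 \<le> p"
    unfolding w_def dnorm_cmult_fun[OF fg(1) that] using dnorm_add_fun[OF f g that, of \<xi>] by simp
qed

text \<open>
  This takes the place of weak compactness and Mazur's lemma. The set \<open>A e\<close> of test functions whose directional norms
  exceed \<open>h\<close> by at most \<open>e\<close> and which are within \<open>e\<close> of \<open>u\<close> is closed under midpoints and contains some \<open>f k\<close>. As
  \<open>e\<close> decreases, the infimum over \<open>A e\<close> of the \<open>p\<close>-th power of the gradient norm increases to a finite
  limit. Almost minimizers \<open>w j\<close> then have midpoints of almost the same gradient norm, so uniform
  convexity makes their gradients a Cauchy sequence.
\<close>

lemma convex_minimizing_sequence:
  fixes \<Omega> :: "(real^'n) set" and u :: "real^'n \<Rightarrow> real"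
  assumes p: "1 < p" and r: "1 \<le> r" and \<Omega>: "open \<Omega>" and C: "0 \<le> C"
    and f: "\<And>k. f k \<in> test_functions \<Omega>" and up: "\<And>k \<xi>. norm \<xi> = 1 \<Longrightarrow> dnorm p (f k) \<xi> \<le> C"
    and h: "\<And>e. e > 0 \<Longrightarrow> \<exists>K. \<forall>k\<ge>K. \<forall>\<xi>. norm \<xi> = 1 \<longrightarrow> \<bar>dnorm p (f k) \<xi> - h \<xi>\<bar> < e"
    and u: "in_Lp r (lebesgue_on \<Omega>) u" and lim: "(\<lambda>k. lpn r (lebesgue_on \<Omega>) (\<lambda>x. f k x - u x)) \<longlonglongrightarrow> 0"
  shows "\<exists>w g. (\<forall>j. w j \<in> test_functions \<Omega>) \<and> in_Lp p (lebesgue_on \<Omega>) g \<and>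
     (\<lambda>j. lpn p (lebesgue_on \<Omega>) (\<lambda>x. gradient (w j) x - g x)) \<longlonglongrightarrow> 0 \<and>
     (\<forall>j \<xi>. norm \<xi> = 1 \<longrightarrow> dnorm p (w j) \<xi> \<le> h \<xi> + inverse (real (Suc j))) \<and>
     (\<forall>j. lpn r (lebesgue_on \<Omega>) (\<lambda>x. w j x - u x) \<le> inverse (real (Suc j)))"
proof -
  let ?L = "lebesgue_on \<Omega>"
  have p0: "0 < p" "1 \<le> p" "0 < r" using p r by auto
  define A where "A e = {w \<in> test_functions \<Omega>. (\<forall>\<xi>. norm \<xi> = 1 \<longrightarrow> dnorm p w \<xi> \<le> h \<xi> + e) \<and> lpn r ?L (\<lambda>x. w x - u x) \<le> e}" for e
  have A_mono: "A e \<subseteq> A e'" if "e \<le> e'" for e e' unfolding A_def using that by force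
  have A_mid: "(\<lambda>x. (1 / 2) * (v x + w x)) \<in> A e" if vw: "v \<in> A e" "w \<in> A e" for v w e
  proof -
    have vt: "v \<in> test_functions \<Omega>" and wt: "w \<in> test_functions \<Omega>" using vw by (auto simp: A_def)
    note m = midpoint_test[OF vt wt]
    have "dnorm p (\<lambda>x. (1 / 2) * (v x + w x)) \<xi> \<le> h \<xi> + e" if \<xi>: "norm \<xi> = 1" for \<xi>
    proof -
      have "dnorm p v \<xi> \<le> h \<xi> + e" "dnorm p w \<xi> \<le> h \<xi> + e" using vw \<xi> by (auto simp: A_def)
      then have "(dnorm p v \<xi> + dnorm p w \<xi>) / 2 \<le> h \<xi> + e" by simp
      then show ?thesis by (rule order_trans[OF m(3)[OF p0(2)]])
    qed
    moreover have "lpn r ?L (\<lambda>x. (1 / 2) * (v x + w x) - u x) \<le> e"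
    proof -
      have iv: "in_Lp r ?L (\<lambda>x. v x - u x)" "in_Lp r ?L (\<lambda>x. w x - u x)"
        using test_in_Lp_on(1)[OF \<Omega> vt p0(3)] test_in_Lp_on(1)[OF \<Omega> wt p0(3)] u r by (auto intro: minkowski_diff(1))
      have "(\<lambda>x. (1 / 2) * (v x + w x) - u x) = (\<lambda>x. (1 / 2) *\<^sub>R ((v x - u x) + (w x - u x)))" by (auto simp: field_simps)
      then have "lpn r ?L (\<lambda>x. (1 / 2) * (v x + w x) - u x) = (1 / 2) * lpn r ?L (\<lambda>x. (v x - u x) + (w x - u x))"
        using in_Lp_scaleR(2)[OF minkowski(1)[OF iv r] p0(3), of "1 / 2"] by simp
      also have "\<dots> \<le> (1 / 2) * (lpn r ?L (\<lambda>x. v x - u x) + lpn r ?L (\<lambda>x. w x - u x))"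
        by (intro mult_left_mono minkowski(2)[OF iv r]) simp
      also have "\<dots> \<le> e" using vw by (simp add: A_def)
      finally show ?thesis .
    qed
    ultimately show ?thesis using m(1) by (auto simp: A_def)
  qed
  define G where "G w = lpn p lborel (gradient w) powr p" for w :: "real^'n \<Rightarrow> real"
  define Bd where "Bd = (real CARD('n) * C) powr p"
  have fA: "\<exists>k. f k \<in> A e \<and> G (f k) \<le> Bd" if e: "0 < e" for e
  proof -
    obtain K where K: "\<And>k \<xi>. k \<ge> K \<Longrightarrow> norm \<xi> = 1 \<Longrightarrow> \<bar>dnorm p (f k) \<xi> - h \<xi>\<bar> < e" using h[OF e] by blast
    have "\<forall>\<^sub>F k in sequentially. lpn r ?L (\<lambda>x. f k x - u x) < e" using e by (intro order_tendstoD(2)[OF lim])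
    then obtain K' where K': "\<And>k. k \<ge> K' \<Longrightarrow> lpn r ?L (\<lambda>x. f k x - u x) < e" by (auto simp: eventually_sequentially)
    let ?k = "max K K'"
    have "dnorm p (f ?k) \<xi> \<le> h \<xi> + e" if "norm \<xi> = 1" for \<xi> using K[OF _ that, of ?k] by simp
    then have "f ?k \<in> A e" using f K'[of ?k] by (auto simp: A_def less_imp_le)
    moreover have "lpn p lborel (gradient (f ?k)) \<le> real CARD('n) * C" by (rule gradient_lpn_le[OF f p0(2) up])
    then have "G (f ?k) \<le> Bd" unfolding G_def Bd_def using p0 by (intro powr_mono2) auto
    ultimately show ?thesis by blast
  qed
  define \<epsilon> where "\<epsilon> j = inverse (real (Suc j))" for j
  have \<epsilon>: "0 < \<epsilon> j" "\<epsilon> (Suc j) \<le> \<epsilon> j" for j by (auto simp: \<epsilon>_def field_simps)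
  have \<epsilon>mono: "\<epsilon> j \<le> \<epsilon> i" if "i \<le> j" for i j using that by (simp add: \<epsilon>_def field_simps)
  \<comment> \<open>The functional G is the p-th power of the norm of the gradient.\<close>
  define J where "J j = Inf (G ` A (\<epsilon> j))" for j
  have bdd: "bdd_below (G ` A e)" for e by (rule bdd_belowI[of _ 0]) (auto simp: G_def)
  have J_le: "J j \<le> G w" if "w \<in> A (\<epsilon> j)" for j w unfolding J_def using that by (intro cInf_lower bdd) auto
  have J_Bd: "J j \<le> Bd" for j using fA[OF \<epsilon>(1)[of j]] J_le order_trans by blast
  have ne: "A (\<epsilon> j) \<noteq> {}" for j using fA[OF \<epsilon>(1)[of j]] by blast
  have "incseq J"
  proof (rule incseq_SucI)
    fix j
    have "A (\<epsilon> (Suc j)) \<subseteq> A (\<epsilon> j)" by (rule A_mono[OF \<epsilon>(2)])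
    then show "J j \<le> J (Suc j)" unfolding J_def using ne[of "Suc j"] by (intro cInf_superset_mono bdd image_mono) auto
  qed
  then have Jmono: "J i \<le> J j" if "i \<le> j" for i j using that by (simp add: incseq_def)
  obtain a where a: "J \<longlonglongrightarrow> a" "\<And>j. J j \<le> a"
    using incseq_convergent[OF \<open>incseq J\<close>, of Bd] J_Bd by blast
  have "\<exists>w\<in>A (\<epsilon> j). G w < J j + \<epsilon> j" for j
  proof -
    have "Inf (G ` A (\<epsilon> j)) < J j + \<epsilon> j" using \<epsilon>(1)[of j] by (simp add: J_def)
    then show ?thesis using ne[of j] bdd by (subst (asm) cInf_less_iff) auto
  qed
  then obtain w where w: "\<And>j. w j \<in> A (\<epsilon> j)" "\<And>j. G (w j) < J j + \<epsilon> j" by metis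
  have wt: "w j \<in> test_functions \<Omega>" for j using w(1)[of j] by (simp add: A_def)
  have Gb: "G (w j) \<le> a + 1" for j
  proof -
    have "\<epsilon> j \<le> 1" by (simp add: \<epsilon>_def field_simps)
    then show ?thesis using w(2)[of j] a(2)[of j] by linarith
  qed
  have a0: "0 \<le> a + 1" using Gb[of 0] by (smt (verit) G_def powr_ge_zero)
  note t = test_in_Lp_on[OF \<Omega> wt p0(1)]
  have Cauchy: "\<exists>N. \<forall>i\<ge>N. \<forall>j\<ge>N. lpn p ?L (\<lambda>x. gradient (w i) x - gradient (w j) x) < e" if e: "0 < e" for e
  proof -
    have e2: "0 < (e / 2) powr p" using e by simp
    obtain \<eta> where \<eta>: "0 < \<eta>" and uc: "\<And>F H :: real^'n \<Rightarrow> real^'n. in_Lp p lborel F \<Longrightarrow> in_Lp p lborel H \<Longrightarrow>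
      lpn p lborel F powr p \<le> a + 1 \<Longrightarrow> lpn p lborel H powr p \<le> a + 1 \<Longrightarrow>
      (lpn p lborel F powr p + lpn p lborel H powr p) / 2 - \<eta> \<le> lpn p lborel (\<lambda>x. (F x + H x) /\<^sub>R 2) powr p \<Longrightarrow>
      lpn p lborel (\<lambda>x. F x - H x) powr p \<le> (e / 2) powr p"
      using Lp_uniform_convexity[OF p e2 a0, where M="lborel :: (real^'n) measure" and 'b="real^'n"] by blast
    have "\<forall>\<^sub>F j in sequentially. a - \<eta> / 2 < J j" using \<eta> by (intro order_tendstoD(1)[OF a(1)]) simp
    moreover have "\<forall>\<^sub>F j in sequentially. \<epsilon> j < \<eta> / 2"
      unfolding \<epsilon>_def using \<eta> by (intro order_tendstoD(2)[OF LIMSEQ_inverse_real_of_nat]) simp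
    ultimately have "\<forall>\<^sub>F j in sequentially. a - \<eta> / 2 < J j \<and> \<epsilon> j < \<eta> / 2" by eventually_elim auto
    then obtain N where N: "a - \<eta> / 2 < J N" "\<epsilon> N < \<eta> / 2" by (auto simp: eventually_sequentially)
    show ?thesis
    proof (intro exI[of _ N] allI impI)
      fix i j assume ij: "N \<le> i" "N \<le> j"
      have inA: "w i \<in> A (\<epsilon> N)" "w j \<in> A (\<epsilon> N)"
        using w(1)[of i] w(1)[of j] A_mono[OF \<epsilon>mono[OF ij(1)]] A_mono[OF \<epsilon>mono[OF ij(2)]] by auto
      have mid: "J N \<le> lpn p lborel (\<lambda>x. (gradient (w i) x + gradient (w j) x) /\<^sub>R 2) powr p"
      proof -
        have eq: "gradient (\<lambda>x. (1 / 2) * (w i x + w j x)) = (\<lambda>x. (gradient (w i) x + gradient (w j) x) /\<^sub>R 2)"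
          by (rule ext) (rule midpoint_test(2)[OF wt[of i] wt[of j]])
        show ?thesis using J_le[OF A_mid[OF inA]] unfolding G_def eq .
      qed
      have up: "G (w i) \<le> a + \<epsilon> N" "G (w j) \<le> a + \<epsilon> N"
        using w(2)[of i] w(2)[of j] a(2)[of i] a(2)[of j] \<epsilon>mono[OF ij(1)] \<epsilon>mono[OF ij(2)] by linarith+
      have "lpn p lborel (\<lambda>x. gradient (w i) x - gradient (w j) x) powr p \<le> (e / 2) powr p"
      proof (rule uc)
        show "in_Lp p lborel (gradient (w i))" "in_Lp p lborel (gradient (w j))" by (rule test_in_Lp(2)[OF wt p0(1)])+
        show "lpn p lborel (gradient (w i)) powr p \<le> a + 1" "lpn p lborel (gradient (w j)) powr p \<le> a + 1"
          using Gb[of i] Gb[of j] by (auto simp: G_def)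
        show "(lpn p lborel (gradient (w i)) powr p + lpn p lborel (gradient (w j)) powr p) / 2 - \<eta> \<le> lpn p lborel (\<lambda>x. (gradient (w i) x + gradient (w j) x) /\<^sub>R 2) powr p"
        proof -
          have lin: "(A + B) / 2 - \<eta> \<le> X" if "J N \<le> X" "A \<le> a + \<epsilon> N" "B \<le> a + \<epsilon> N" for A B X
            using that N by (simp add: field_simps)
          show ?thesis by (rule lin[OF mid up[unfolded G_def]])
        qed
      qed
      then have "lpn p lborel (\<lambda>x. gradient (w i) x - gradient (w j) x) \<le> e / 2"
        using powr_less_mono2[OF p0(1), of "e / 2" "lpn p lborel (\<lambda>x. gradient (w i) x - gradient (w j) x)"] e by (auto simp: not_less[symmetric])
      moreover have "lpn p ?L (\<lambda>x. gradient (w i) x - gradient (w j) x) = lpn p lborel (\<lambda>x. gradient (w i) x - gradient (w j) x)"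
      proof -
        have "gradient (\<lambda>x. w i x - w j x) = (\<lambda>x. gradient (w i) x - gradient (w j) x)"
          by (rule ext) (rule test_diff(2)[OF wt[of i] wt[of j]])
        then show ?thesis using test_in_Lp_on(4)[OF \<Omega> test_diff(1)[OF wt[of i] wt[of j]] p0(1)] by simp
      qed
      ultimately show "lpn p ?L (\<lambda>x. gradient (w i) x - gradient (w j) x) < e" using e by simp
    qed
  qed
  obtain g where g: "in_Lp p ?L g" "(\<lambda>j. lpn p ?L (\<lambda>x. gradient (w j) x - g x)) \<longlonglongrightarrow> 0"
    by (rule Lp_complete[where f = "\<lambda>j. gradient (w j)", OF t(3) p0(2) Cauchy])
  have "\<forall>j \<xi>. norm \<xi> = 1 \<longrightarrow> dnorm p (w j) \<xi> \<le> h \<xi> + inverse (real (Suc j))"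
    "\<forall>j. lpn r ?L (\<lambda>x. w j x - u x) \<le> inverse (real (Suc j))"
    using w(1) by (auto simp: A_def \<epsilon>_def)
  then show ?thesis using wt g by blast
qed

lemma nonzero_test_exists:
  fixes \<Omega> :: "(real^'n) set"
  assumes \<Omega>: "open \<Omega>" "\<Omega> \<noteq> {}" and p: "1 \<le> p"
  shows "\<exists>f\<in>test_functions \<Omega>. 0 < lpn p lborel f"
proof -
  have p0: "0 < p" using p by simp
  obtain x0 where x0: "x0 \<in> \<Omega>" using \<Omega> by blast
  obtain a b where ab: "x0 \<in> box a b" "cbox a b \<subseteq> \<Omega>"
    by (rule open_contains_cbox[OF \<Omega>(1) x0])
  define f where "f = box_bump a b 1"
  have f: "f \<in> test_functions \<Omega>" unfolding f_def by (rule box_bump_test[OF ab(2)]) simp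
  have fpos: "0 < f x" if "x \<in> box a b" for x
    unfolding f_def box_bump_def using that by (intro prod_pos mult_pos_pos flat0_pos) (auto simp: mem_box_cart)
  have "lpn p lborel f \<noteq> 0"
  proof
    assume "lpn p lborel f = 0"
    then have "AE x in lborel. f x = 0" using lpn_eq_0_iff[OF test_in_Lp(1)[OF f p0] p0] by simp
    then have "AE x in lborel. x \<notin> box a b" by eventually_elim (use fpos in force)
    then have "emeasure lborel (box a b) = 0" by (subst (asm) AE_iff_measurable[where N="box a b"]) auto
    moreover have "0 < emeasure lborel (box a b)"
    proof -
      have "(\<Prod>i\<in>Basis. (b - a) \<bullet> i) > 0" using ab(1) by (intro prod_pos) (auto simp: mem_box inner_diff_left)
      then show ?thesis using ab(1) by (auto simp: emeasure_lborel_box_eq mem_box less_imp_le)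
    qed
    ultimately show False by simp
  qed
  then show ?thesis using f lpn_nonneg[of p lborel f] by (intro bexI[of _ f]) (auto simp: less_le)
qed

text \<open>
  The infimum \<open>m\<close> of the quotient of energy and norm over test functions; both are homogeneous, so the minimizing
  sequence can be normalized.
\<close>

lemma minimizing_sequence:
  fixes \<Omega> :: "(real^'n) set"
  assumes p: "1 < p" and q: "1 \<le> q" and \<Omega>: "open \<Omega>" "\<Omega> \<noteq> {}" "\<Omega> \<subseteq> ball 0 R" and R: "0 < R"
  shows "\<exists>m\<ge>0. (\<forall>\<phi>\<in>test_functions \<Omega>. 0 < lpn p lborel \<phi> \<longrightarrow> ennreal (m * lpn q lborel \<phi>) \<le> energy_of p (dnorm p \<phi>)) \<and>
     (\<exists>f. \<forall>k. f k \<in> test_functions \<Omega> \<and> lpn q lborel (f k) = 1 \<and> energy_of p (dnorm p (f k)) \<le> ennreal (m + inverse (real (Suc k))))"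
proof -
  have p0: "0 < p" "1 \<le> p" "0 < q" using p q by auto
  define T where "T = {\<phi> \<in> test_functions \<Omega>. 0 < lpn p lborel \<phi>}"
  have E: "\<exists>e>0. energy_of p (dnorm p \<phi>) = ennreal e" if "\<phi> \<in> T" for \<phi>
  proof -
    have \<phi>: "\<phi> \<in> test_functions \<Omega>" "0 < lpn p lborel \<phi>" using that by (auto simp: T_def)
    show ?thesis
    proof (rule energy_of_finite_pos[OF p])
      show "0 < lpn p lborel \<phi> / (2 * R)" using \<phi>(2) R by simp
      show "lpn p lborel \<phi> / (2 * R) \<le> dnorm p \<phi> \<xi>" if "norm \<xi> = 1" for \<xi>
        using directional_Poincare[OF \<phi>(1) p0(2) \<Omega>(3) R, of \<xi>] that R by (simp add: field_simps)
      show "dnorm p \<phi> \<xi> \<le> lpn p lborel (gradient \<phi>)" if "norm \<xi> = 1" for \<xi>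
        using dnorm_le[OF \<phi>(1) p0(2), of \<xi>] that by simp
    qed
  qed
  then obtain E where E: "\<And>\<phi>. \<phi> \<in> T \<Longrightarrow> 0 < E \<phi> \<and> energy_of p (dnorm p \<phi>) = ennreal (E \<phi>)" by metis
  have qpos: "0 < lpn q lborel \<phi>" if "\<phi> \<in> T" for \<phi>
  proof (rule ccontr)
    have \<phi>: "\<phi> \<in> test_functions \<Omega>" "0 < lpn p lborel \<phi>" using that by (auto simp: T_def)
    assume "\<not> 0 < lpn q lborel \<phi>"
    then have "lpn q lborel \<phi> = 0" using lpn_nonneg[of q lborel \<phi>] by linarith
    then have "AE x in lborel. \<phi> x = 0" using lpn_eq_0_iff[OF test_in_Lp(1)[OF \<phi>(1) p0(3)] p0(3)] by simp
    then have "lpn p lborel \<phi> = 0" using lpn_eq_0_iff[OF test_in_Lp(1)[OF \<phi>(1) p0(1)] p0(1)] by simp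
    then show False using \<phi>(2) by simp
  qed
  define F where "F \<phi> = E \<phi> / lpn q lborel \<phi>" for \<phi>
  have F0: "0 \<le> F \<phi>" if "\<phi> \<in> T" for \<phi> using E[OF that] by (simp add: F_def)
  define m where "m = Inf (F ` T)"
  have T: "T \<noteq> {}" using nonzero_test_exists[OF \<Omega>(1,2) p0(2)] by (auto simp: T_def)
  have bdd: "bdd_below (F ` T)" by (rule bdd_belowI[of _ 0]) (use F0 in auto)
  have m0: "0 \<le> m" unfolding m_def using T F0 by (intro cInf_greatest) auto
  have mle: "ennreal (m * lpn q lborel \<phi>) \<le> energy_of p (dnorm p \<phi>)" if "\<phi> \<in> T" for \<phi>
  proof -
    have "m \<le> F \<phi>" unfolding m_def using that by (intro cInf_lower bdd) auto
    then have "m * lpn q lborel \<phi> \<le> E \<phi>" using qpos[OF that] by (simp add: F_def field_simps)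
    then show ?thesis using E[OF that] by (simp add: ennreal_leI)
  qed
  have "\<exists>f. f \<in> test_functions \<Omega> \<and> lpn q lborel f = 1 \<and> energy_of p (dnorm p f) \<le> ennreal (m + inverse (real (Suc k)))" for k
  proof -
    have "Inf (F ` T) < m + inverse (real (Suc k))" by (simp add: m_def)
    then obtain \<phi> where \<phi>: "\<phi> \<in> T" "F \<phi> < m + inverse (real (Suc k))" using T bdd by (subst (asm) cInf_less_iff) auto
    have \<phi>t: "\<phi> \<in> test_functions \<Omega>" using \<phi>(1) by (simp add: T_def)
    define c where "c = 1 / lpn q lborel \<phi>"
    have c: "0 < c" using qpos[OF \<phi>(1)] by (simp add: c_def)
    have 1: "lpn q lborel (\<lambda>x. c * \<phi> x) = 1"
      using in_Lp_scaleR(2)[OF test_in_Lp(1)[OF \<phi>t p0(3)] p0(3), of c] c qpos[OF \<phi>(1)] by (simp add: c_def)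
    have "dnorm p (\<lambda>x. c * \<phi> x) = (\<lambda>\<xi>. c * dnorm p \<phi> \<xi>)" using dnorm_cmult_fun[OF \<phi>t p0(2), of c] c by auto
    then have "energy_of p (dnorm p (\<lambda>x. c * \<phi> x)) = ennreal c * ennreal (E \<phi>)"
      using energy_of_cmult[OF p c dnorm_borel[OF \<phi>t p0(2)]] E[OF \<phi>(1)] by simp
    also have "\<dots> = ennreal (F \<phi>)" using c E[OF \<phi>(1)] by (simp add: ennreal_mult[symmetric] F_def c_def)
    also have "\<dots> \<le> ennreal (m + inverse (real (Suc k)))" using \<phi>(2) by (intro ennreal_leI) simp
    finally show ?thesis using 1 test_cmult(1)[OF \<phi>t, of c] by blast
  qed
  then obtain f where "\<And>k. f k \<in> test_functions \<Omega> \<and> lpn q lborel (f k) = 1 \<and> energy_of p (dnorm p (f k)) \<le> ennreal (m + inverse (real (Suc k)))"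
    by metis
  then show ?thesis using m0 mle by (intro exI[of _ m]) (auto simp: T_def)
qed

text \<open>
  Along the minimizing sequence the directional norms converge uniformly to some \<open>h\<close> of energy at most \<open>m\<close>. The
  limit \<open>u\<close> is approximated by test functions whose directional norms are asymptotically at most
  \<open>h\<close> and whose gradients converge, so \<open>u\<close> has energy at most \<open>m\<close> and norm one, and \<open>m\<close> is a lower bound for the
  sharp constant.
\<close>

lemma subcritical_extremal:
  fixes \<Omega> :: "(real^'n) set"
  assumes p: "1 < p" "p < real CARD('n)" and \<Omega>: "open \<Omega>" "bounded \<Omega>" "\<Omega> \<noteq> {}"
    and q: "1 \<le> q" "q < critical_exponent (real CARD('n)) p"
  shows "\<exists>u. affine_extremal p q \<Omega> u"
proof -
  let ?L = "lebesgue_on \<Omega>"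
  have "0 < real CARD('n) - p" using p by simp
  moreover have "p * (real CARD('n) - p) < real CARD('n) * p" using p by (simp add: algebra_simps)
  ultimately have "p < critical_exponent (real CARD('n)) p" by (simp add: critical_exponent_def pos_less_divide_eq)
  then have "max p q < critical_exponent (real CARD('n)) p" using q by simp
  \<comment> \<open>The compactness is used in an exponent above both p and q.\<close>
  then obtain r where "max p q < r" "r < critical_exponent (real CARD('n)) p" using dense by blast
  then have r: "p < r" "r < critical_exponent (real CARD('n)) p" "q \<le> r" by auto
  have p0: "0 < p" "1 \<le> p" "0 < q" "0 < r" "1 \<le> r" "p \<le> r" using p q r by auto
  obtain R where R: "0 < R" "\<Omega> \<subseteq> ball 0 R" using \<Omega>(2) bounded_subset_ballD[of \<Omega> 0] by blast
  note fin = lebesgue_on_finite[OF \<Omega>(1,2)]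
  obtain m f0 where m: "0 \<le> m"
    and ineq: "\<And>\<phi>. \<phi> \<in> test_functions \<Omega> \<Longrightarrow> 0 < lpn p lborel \<phi> \<Longrightarrow> ennreal (m * lpn q lborel \<phi>) \<le> energy_of p (dnorm p \<phi>)"
    and f0: "\<And>k :: nat. f0 k \<in> test_functions \<Omega>" "\<And>k. lpn q lborel (f0 k) = 1" "\<And>k. energy_of p (dnorm p (f0 k)) \<le> ennreal (m + inverse (real (Suc k)))"
  proof -
    from minimizing_sequence[OF p(1) q(1) \<Omega>(1,3) R(2,1)]
    obtain m f where "0 \<le> m" and ineq: "\<forall>\<phi>\<in>test_functions \<Omega>. 0 < lpn p lborel \<phi> \<longrightarrow> ennreal (m * lpn q lborel \<phi>) \<le> energy_of p (dnorm p \<phi>)"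
      and "\<forall>k :: nat. f k \<in> test_functions \<Omega> \<and> lpn q lborel (f k) = 1 \<and> energy_of p (dnorm p (f k)) \<le> ennreal (m + inverse (real (Suc k)))"
      by (elim exE conjE)
    from this(3) show thesis by (intro that[OF \<open>0 \<le> m\<close> ineq[rule_format], of f]) simp_all
  qed
  have f0': "energy_of p (dnorm p (f0 k)) \<le> ennreal (m + 1)" for k
    by (rule order_trans[OF f0(3)]) (intro ennreal_leI, simp add: field_simps)
  obtain c C where c: "0 < c" and C: "0 < C"
    and bd: "\<And>f \<xi>. f \<in> test_functions \<Omega> \<Longrightarrow> lpn q lborel f = 1 \<Longrightarrow> energy_of p (dnorm p f) \<le> ennreal (m + 1) \<Longrightarrow>
        c * norm \<xi> \<le> dnorm p f \<xi> \<and> dnorm p f \<xi> \<le> C * norm \<xi>"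
  proof -
    have "0 < m + 1" using m by simp
    from bounded_energy_imp_dnorm_bounds[OF p r(1,2) q(1) r(3) \<Omega>(1) R(2,1) this]
    obtain c C where "0 < c" "0 < C" and bd: "\<forall>f\<in>test_functions \<Omega>. lpn q lborel f = 1 \<longrightarrow> energy_of p (dnorm p f) \<le> ennreal (m + 1) \<longrightarrow>
      (\<forall>\<xi>. c * norm \<xi> \<le> dnorm p f \<xi> \<and> dnorm p f \<xi> \<le> C * norm \<xi>)" by (elim exE conjE)
    show thesis by (rule that[OF \<open>0 < c\<close> \<open>0 < C\<close>]) (use bd in simp)
  qed
  have low: "c * norm \<xi> \<le> dnorm p (f0 k) \<xi>" and up: "dnorm p (f0 k) \<xi> \<le> C * norm \<xi>" for k \<xi>
    using bd[OF f0(1,2) f0'] by auto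
  from extract_subsequence[where f = f0, OF p r(1,2) \<Omega>(1) R(2,1) C f0(1) up]
  obtain s :: "nat \<Rightarrow> nat" and h where sh: "strict_mono s \<and>
      (\<forall>e>0. \<exists>K. \<forall>k\<ge>K. \<forall>\<xi>. norm \<xi> = 1 \<longrightarrow> \<bar>dnorm p (f0 (s k)) \<xi> - h \<xi>\<bar> < e) \<and>
      (\<forall>d>0. \<exists>K. \<forall>k\<ge>K. \<forall>l\<ge>K. lpn r lborel (\<lambda>x. f0 (s k) x - f0 (s l) x) < d)"
    by (elim exE)
  have s: "strict_mono s" using sh by (rule conjunct1)
  have h: "\<exists>K. \<forall>k\<ge>K. \<forall>\<xi>. norm \<xi> = 1 \<longrightarrow> \<bar>dnorm p (f0 (s k)) \<xi> - h \<xi>\<bar> < e" if "0 < e" for e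
    using sh[THEN conjunct2, THEN conjunct1, rule_format, OF that] by simp
  have cau: "\<exists>K. \<forall>k\<ge>K. \<forall>l\<ge>K. lpn r lborel (\<lambda>x. f0 (s k) x - f0 (s l) x) < d" if "0 < d" for d
    using sh[THEN conjunct2, THEN conjunct2, rule_format, OF that] by simp
  define f where "f k = f0 (s k)" for k
  have ft: "f k \<in> test_functions \<Omega>" for k by (simp add: f_def f0)
  have cauf: "\<exists>K. \<forall>k\<ge>K. \<forall>l\<ge>K. lpn r ?L (\<lambda>x. f k x - f l x) < d" if "0 < d" for d
    using cau[OF that] test_in_Lp_on(2)[OF \<Omega>(1) test_diff(1)[OF ft ft] p0(4)] by (simp add: f_def)
  obtain u where u: "in_Lp r ?L u" and flim: "(\<lambda>k. lpn r ?L (\<lambda>x. f k x - u x)) \<longlonglongrightarrow> 0"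
    by (rule Lp_complete[where f = f, OF test_in_Lp_on(1)[OF \<Omega>(1) ft p0(4)] p0(5) cauf])
  have to_lower: "(\<lambda>k. lpn t ?L (\<lambda>x. v k x - u x)) \<longlonglongrightarrow> 0"
    if v: "\<And>k. v k \<in> test_functions \<Omega>" "(\<lambda>k. lpn r ?L (\<lambda>x. v k x - u x)) \<longlonglongrightarrow> 0" and t: "1 \<le> t" "t \<le> r" for v t
  proof (rule Lim_null_comparison)
    show "\<forall>\<^sub>F k in sequentially. norm (lpn t ?L (\<lambda>x. v k x - u x)) \<le> measure ?L (space ?L) powr (1 / t - 1 / r) * lpn r ?L (\<lambda>x. v k x - u x)"
      using lpn_mono_exponent(2)[OF fin minkowski_diff(1)[OF test_in_Lp_on(1)[OF \<Omega>(1) v(1) p0(4)] u p0(5)] t]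
      by (intro always_eventually) simp
    show "(\<lambda>k. measure ?L (space ?L) powr (1 / t - 1 / r) * lpn r ?L (\<lambda>x. v k x - u x)) \<longlonglongrightarrow> 0"
      by (rule tendsto_mult_right_zero[OF v(2)])
  qed
  have uq: "in_Lp q ?L u" and up': "in_Lp p ?L u"
    by (rule lpn_mono_exponent(1)[OF fin u]; use q r p0 in simp)+
  have "(\<lambda>k. lpn q ?L (f k)) \<longlonglongrightarrow> lpn q ?L u"
    by (rule lpn_tendsto[OF test_in_Lp_on(1)[OF \<Omega>(1) ft p0(3)] uq q(1) to_lower[OF ft flim q(1) r(3)]])
  moreover have "lpn q ?L (f k) = 1" for k using test_in_Lp_on(2)[OF \<Omega>(1) ft p0(3)] f0(2) by (simp add: f_def)
  ultimately have u1: "lpn q ?L u = 1" by (simp add: LIMSEQ_const_iff)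
  have unz: "\<not> (AE x in ?L. u x = 0)" using lpn_eq_0_iff[OF uq p0(3)] u1 by simp
  have "\<exists>w g. (\<forall>j. w j \<in> test_functions \<Omega>) \<and> in_Lp p ?L g \<and>
     (\<lambda>j. lpn p ?L (\<lambda>x. gradient (w j) x - g x)) \<longlonglongrightarrow> 0 \<and>
     (\<forall>j \<xi>. norm \<xi> = 1 \<longrightarrow> dnorm p (w j) \<xi> \<le> h \<xi> + inverse (real (Suc j))) \<and>
     (\<forall>j. lpn r ?L (\<lambda>x. w j x - u x) \<le> inverse (real (Suc j)))"
  proof (rule convex_minimizing_sequence[OF p(1) p0(5) \<Omega>(1) less_imp_le[OF C] ft _ _ u flim])
    show "dnorm p (f k) \<xi> \<le> C" if "norm \<xi> = 1" for k \<xi> using up[of "s k" \<xi>] that by (simp add: f_def)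
    show "\<exists>K. \<forall>k\<ge>K. \<forall>\<xi>. norm \<xi> = 1 \<longrightarrow> \<bar>dnorm p (f k) \<xi> - h \<xi>\<bar> < e" if "0 < e" for e using h[OF that] by (simp add: f_def)
  qed
  then obtain w g where w: "\<And>j :: nat. w j \<in> test_functions \<Omega>" and g: "in_Lp p ?L g"
    and glim: "(\<lambda>j. lpn p ?L (\<lambda>x. gradient (w j) x - g x)) \<longlonglongrightarrow> 0"
    and wh: "\<And>j \<xi>. norm \<xi> = 1 \<Longrightarrow> dnorm p (w j) \<xi> \<le> h \<xi> + inverse (real (Suc j))"
    and wu: "\<And>j. lpn r ?L (\<lambda>x. w j x - u x) \<le> inverse (real (Suc j))" by blast
  have wlim: "(\<lambda>j. lpn r ?L (\<lambda>x. w j x - u x)) \<longlonglongrightarrow> 0"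
    by (rule Lim_null_comparison[OF _ LIMSEQ_inverse_real_of_nat]) (use wu in \<open>auto intro!: always_eventually\<close>)
  note wlimp = to_lower[OF w wlim p0(2,6)]
  note lim_u = W01p_limit[OF \<Omega>(1,2) p0(2) w up' g wlimp glim]
  have gh: "dirn p \<Omega> g \<xi> \<le> h \<xi>" if \<xi>: "norm \<xi> = 1" for \<xi>
  proof (rule LIMSEQ_le[OF dnorm_tendsto_dirn[OF \<Omega>(1) p0(2) w g glim]])
    have "(\<lambda>j. h \<xi> + inverse (real (Suc j))) \<longlonglongrightarrow> h \<xi> + 0" by (intro tendsto_add tendsto_const LIMSEQ_inverse_real_of_nat)
    then show "(\<lambda>j. h \<xi> + inverse (real (Suc j))) \<longlonglongrightarrow> h \<xi>" by simp
    show "\<exists>N. \<forall>j\<ge>N. dnorm p (w j) \<xi> \<le> h \<xi> + inverse (real (Suc j))" using wh[OF \<xi>] by blast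
  qed
  have gpos: "0 < dirn p \<Omega> g \<xi>" if \<xi>: "norm \<xi> = 1" for \<xi>
  proof -
    have "0 < lpn p ?L u * norm \<xi>" using nonzero_lpn_pos[OF up' p0(1) unz] \<xi> by simp
    also have "\<dots> \<le> 2 * R * dirn p \<Omega> g \<xi>" by (rule W01p_Poincare[OF \<Omega>(1) p0(2) R(2,1) w up' g wlimp glim])
    finally show ?thesis using R by (simp add: zero_less_mult_iff)
  qed
  have Eu: "affine_energy p \<Omega> u = energy_of p (dirn p \<Omega> g)"
    by (rule affine_energy_eq[OF \<Omega>(1) p(1) lim_u(1) g gpos])
  have "energy_of p (dirn p \<Omega> g) \<le> ennreal m"
  proof -
    \<comment> \<open>The additive error in the uniform convergence to h is absorbed by a factor 1 + d, using the lower bound c.\<close>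
    have bound: "energy_of p (dirn p \<Omega> g) \<le> ennreal ((1 + d) * (m + d))" if d: "0 < d" for d
    proof -
      obtain K where K: "\<And>k \<xi>. k \<ge> K \<Longrightarrow> norm \<xi> = 1 \<Longrightarrow> \<bar>dnorm p (f0 (s k)) \<xi> - h \<xi>\<bar> < d * c"
        using h[of "d * c"] d c by auto
      have "\<forall>\<^sub>F k in sequentially. inverse (real (Suc k)) < d" using d by (intro order_tendstoD(2)[OF LIMSEQ_inverse_real_of_nat])
      then obtain K' where K': "\<And>k. k \<ge> K' \<Longrightarrow> inverse (real (Suc k)) < d" by (auto simp: eventually_sequentially)
      define k where "k = max K K'"
      have sk: "s k \<ge> K'" using seq_suble[OF s, of k] by (simp add: k_def)
      have "dirn p \<Omega> g \<xi> \<le> (1 + d) * dnorm p (f0 (s k)) \<xi>" if \<xi>: "norm \<xi> = 1" for \<xi>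
      proof -
        have "dirn p \<Omega> g \<xi> \<le> dnorm p (f0 (s k)) \<xi> + d * c" using gh[OF \<xi>] K[OF _ \<xi>, of k] by (simp add: k_def)
        also have "d * c \<le> d * dnorm p (f0 (s k)) \<xi>" using low[where k="s k" and \<xi>=\<xi>] \<xi> d by simp
        finally show ?thesis by (simp add: algebra_simps)
      qed
      then have "energy_of p (dirn p \<Omega> g) \<le> energy_of p (\<lambda>\<xi>. (1 + d) * dnorm p (f0 (s k)) \<xi>)"
        by (intro energy_of_mono gpos)
      also have "\<dots> = ennreal (1 + d) * energy_of p (dnorm p (f0 (s k)))"
        using d by (intro energy_of_cmult[OF p(1) _ dnorm_borel[OF f0(1) p0(2)]]) auto
      also have "\<dots> \<le> ennreal (1 + d) * ennreal (m + d)"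
        using K'[OF sk] by (intro mult_left_mono order_trans[OF f0(3)] ennreal_leI) auto
      also have "\<dots> = ennreal ((1 + d) * (m + d))" using d m by (simp add: ennreal_mult del: ennreal_plus)
      finally show ?thesis .
    qed
    have "(\<lambda>k. ennreal ((1 + inverse (real (Suc k))) * (m + inverse (real (Suc k))))) \<longlonglongrightarrow> ennreal ((1 + 0) * (m + 0))"
      by (intro tendsto_ennrealI tendsto_mult tendsto_add tendsto_const LIMSEQ_inverse_real_of_nat)
    then have "energy_of p (dirn p \<Omega> g) \<le> ennreal ((1 + 0) * (m + 0))"
      by (rule LIMSEQ_le_const) (use bound in \<open>auto intro!: exI[of _ 0]\<close>)
    then show ?thesis by simp
  qed
  then have E_le: "affine_energy p \<Omega> u \<le> ennreal m" using Eu by simp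
  have "ennreal m \<le> affine_mu p q \<Omega>"
    unfolding affine_mu_def
    by (rule Sup_upper) (use test_inequality_extends[OF \<Omega>(1,2) p(1) q(1) m ineq] in auto)
  moreover have Nu: "Lp_norm q \<Omega> u = 1" using Lp_norm_in_Lp[OF \<Omega>(1) p0(3) uq] u1 by simp
  moreover have "affine_mu p q \<Omega> * Lp_norm q \<Omega> u \<le> affine_energy p \<Omega> u" by (rule affine_mu_le[OF lim_u(2)])
  ultimately have "affine_mu p q \<Omega> * Lp_norm q \<Omega> u = affine_energy p \<Omega> u" using E_le by simp
  then have "affine_extremal p q \<Omega> u" unfolding affine_extremal_def using lim_u(2) unz by simp
  then show ?thesis by blast
qed

theorem corollary1p1:
  fixes \<Omega> :: "(real^'n) set" and p q \<alpha> :: real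
  assumes "CARD('n) \<ge> 2"
    and "1 < p" and "p < real CARD('n)"
    and "open \<Omega>" and "bounded \<Omega>" and "\<Omega> \<noteq> {}"
    and "0 < \<alpha>" and "\<alpha> \<le> 1" and "C2_Holder_boundary \<alpha> \<Omega>"
    and "1 \<le> q" and "q \<le> critical_exponent (real CARD('n)) p"
  shows "(\<exists>u. affine_extremal p q \<Omega> u) \<longleftrightarrow> 1 \<le> q \<and> q < critical_exponent (real CARD('n)) p"
proof
  assume "\<exists>u. affine_extremal p q \<Omega> u"
  then obtain u where u: "affine_extremal p q \<Omega> u" ..
  have "q \<noteq> critical_exponent (real CARD('n)) p"
  proof
    assume "q = critical_exponent (real CARD('n)) p"
    then show False using no_critical_extremal[OF assms(2-5)] u by blast
  qed
  then show "1 \<le> q \<and> q < critical_exponent (real CARD('n)) p" using assms by simp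
next
  assume "1 \<le> q \<and> q < critical_exponent (real CARD('n)) p"
  then show "\<exists>u. affine_extremal p q \<Omega> u" using subcritical_extremal[OF assms(2-6)] by blast
qed

end
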